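(* Let $k$ be a commutative ring and let $\mathcal S,\mathcal T$ be $k$-linear triangulated categories with dg enhancements $\mathcal S_{dg}$ and $\mathcal T_{dg}$. Let $s:\mathcal S\to\mathcal T$ be a triangle functor induced by a dg functor $s_{dg}:\mathcal S_{dg}\to\mathcal T_{dg}$, and assume that $s$ admits a right adjoint $r:\mathcal T\to\mathcal S$. Let there be given a $t$-structure on $\mathcal S$ with truncation functor $\tau_{\le0}$. \begin{itemize} \item[a)] There is a triangle functor $t:\mathcal T\to\mathcal T$ admitting a dg enhancement and fitting into a functorial triangle $$sr\to\mathbf 1_{\mathcal T}\to t\to\Sigma sr.$$ \item[b)] There is a $k$-linear functor $t^0:\mathcal T\to\mathcal T$ fitting into a functorial triangle $$s\tau_{\le0}r\to\mathbf 1_{\mathcal T}\to t^0\to\Sigma s\tau_{\le0}r.$$ \end{itemize}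
   Context: $\Sigma$ denotes the suspension functor of a triangulated category and $\mathbf 1_{\mathcal T}$ the identity functor of $\mathcal T$. A dg enhancement of a triangulated category $\mathcal T$ is a pretriangulated dg category $\mathcal T_{dg}$ with a triangle equivalence $H^0(\mathcal T_{dg})\simeq\mathcal T$. A functorial triangle of functors $F\to G\to H\to\Sigma F$ consists of natural transformations which, evaluated at each object, form a distinguished triangle. For a $t$-structure with left aisle $\mathcal S_{\le0}$, $\tau_{\le0}$ is the right adjoint of the inclusion $\mathcal S_{\le0}\subset\mathcal S$, regarded as a functor $\mathcal S\to\mathcal S$ when composed with this inclusion. *)

theory Defs
  imports "HOL-Algebra.Module" "HOL-Algebra.AbelCoset"
begin

text \<open>
  The ground ring is a commutative ring of HOL-Algebra (possibly the zero ring), and modules over it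
  are modules of HOL-Algebra; the fields \<open>mult\<close> and \<open>one\<close>, which a module record inherits from the
  ring record, carry no meaning.  Categories are small: objects and morphisms are elements of
  arbitrary types.  Distinct Hom modules need not be disjoint, which is why composition takes the
  three objects as arguments.
\<close>

definition linear_map ::
  "'k ring \<Rightarrow> ('k, 'm) module \<Rightarrow> ('k, 'n) module \<Rightarrow> ('m \<Rightarrow> 'n) \<Rightarrow> bool" where
  "linear_map K M N f \<longleftrightarrow>
     f \<in> carrier M \<rightarrow> carrier N \<and>
     (\<forall>x\<in>carrier M. \<forall>y\<in>carrier M. f (x \<oplus>\<^bsub>M\<^esub> y) = f x \<oplus>\<^bsub>N\<^esub> f y) \<and>
     (\<forall>a\<in>carrier K. \<forall>x\<in>carrier M. f (a \<odot>\<^bsub>M\<^esub> x) = a \<odot>\<^bsub>N\<^esub> f x)"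


section \<open>Linear categories\<close>

record ('o, 'm, 'k) lin_cat =
  Obj :: "'o set"
  Hom :: "'o \<Rightarrow> 'o \<Rightarrow> ('k, 'm) module"
  Cmp :: "'o \<Rightarrow> 'o \<Rightarrow> 'o \<Rightarrow> 'm \<Rightarrow> 'm \<Rightarrow> 'm"  \<comment> \<open>\<open>Cmp C X Y Z g f\<close> is \<open>g \<circ> f\<close> for \<open>f : X \<rightarrow> Y\<close>, \<open>g : Y \<rightarrow> Z\<close>\<close>
  Idn :: "'o \<Rightarrow> 'm"

abbreviation mor :: "('o, 'm, 'k, 'z) lin_cat_scheme \<Rightarrow> 'o \<Rightarrow> 'o \<Rightarrow> 'm set" where
  "mor C X Y \<equiv> carrier (Hom C X Y)"

locale linear_category = cring K
  for K :: "'k ring" and C :: "('o, 'm, 'k, 'z) lin_cat_scheme" +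
  assumes Hom_module: "\<lbrakk>X \<in> Obj C; Y \<in> Obj C\<rbrakk> \<Longrightarrow> module K (Hom C X Y)"
    and Cmp_linear_right:
      "\<lbrakk>X \<in> Obj C; Y \<in> Obj C; Z \<in> Obj C; g \<in> mor C Y Z\<rbrakk>
        \<Longrightarrow> linear_map K (Hom C X Y) (Hom C X Z) (\<lambda>f. Cmp C X Y Z g f)"
    and Cmp_linear_left:
      "\<lbrakk>X \<in> Obj C; Y \<in> Obj C; Z \<in> Obj C; f \<in> mor C X Y\<rbrakk>
        \<Longrightarrow> linear_map K (Hom C Y Z) (Hom C X Z) (\<lambda>g. Cmp C X Y Z g f)"
    and Cmp_assoc:
      "\<lbrakk>W \<in> Obj C; X \<in> Obj C; Y \<in> Obj C; Z \<in> Obj C;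
        f \<in> mor C W X; g \<in> mor C X Y; h \<in> mor C Y Z\<rbrakk>
        \<Longrightarrow> Cmp C W Y Z h (Cmp C W X Y g f) = Cmp C W X Z (Cmp C X Y Z h g) f"
    and Idn_mor: "X \<in> Obj C \<Longrightarrow> Idn C X \<in> mor C X X"
    and Cmp_Idn_left: "\<lbrakk>X \<in> Obj C; Y \<in> Obj C; f \<in> mor C X Y\<rbrakk> \<Longrightarrow> Cmp C X Y Y (Idn C Y) f = f"
    and Cmp_Idn_right: "\<lbrakk>X \<in> Obj C; Y \<in> Obj C; f \<in> mor C X Y\<rbrakk> \<Longrightarrow> Cmp C X X Y f (Idn C X) = f"

definition is_iso :: "('o, 'm, 'k, 'z) lin_cat_scheme \<Rightarrow> 'o \<Rightarrow> 'o \<Rightarrow> 'm \<Rightarrow> bool" where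
  "is_iso C X Y f \<longleftrightarrow> f \<in> mor C X Y \<and>
     (\<exists>g\<in>mor C Y X. Cmp C X Y X g f = Idn C X \<and> Cmp C Y X Y f g = Idn C Y)"

definition is_zero_object :: "('o, 'm, 'k, 'z) lin_cat_scheme \<Rightarrow> 'o \<Rightarrow> bool" where
  "is_zero_object C Z \<longleftrightarrow> Z \<in> Obj C \<and>
     (\<forall>X\<in>Obj C. mor C X Z = {\<zero>\<^bsub>Hom C X Z\<^esub>} \<and> mor C Z X = {\<zero>\<^bsub>Hom C Z X\<^esub>})"

definition is_biproduct ::
  "('o, 'm, 'k, 'z) lin_cat_scheme \<Rightarrow> 'o \<Rightarrow> 'o \<Rightarrow> 'o \<Rightarrow> 'm \<Rightarrow> 'm \<Rightarrow> 'm \<Rightarrow> 'm \<Rightarrow> bool" where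
  "is_biproduct C X Y Z i j p q \<longleftrightarrow>
     Z \<in> Obj C \<and> i \<in> mor C X Z \<and> j \<in> mor C Y Z \<and> p \<in> mor C Z X \<and> q \<in> mor C Z Y \<and>
     Cmp C X Z X p i = Idn C X \<and> Cmp C Y Z Y q j = Idn C Y \<and>
     Cmp C Y Z X p j = \<zero>\<^bsub>Hom C Y X\<^esub> \<and> Cmp C X Z Y q i = \<zero>\<^bsub>Hom C X Y\<^esub> \<and>
     Cmp C Z X Z i p \<oplus>\<^bsub>Hom C Z Z\<^esub> Cmp C Z Y Z j q = Idn C Z"

definition full_subcat :: "('o, 'm, 'k, 'z) lin_cat_scheme \<Rightarrow> 'o set \<Rightarrow> ('o, 'm, 'k) lin_cat" where
  "full_subcat C L = \<lparr>Obj = L, Hom = Hom C, Cmp = Cmp C, Idn = Idn C\<rparr>"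


section \<open>Functors and natural transformations\<close>

record ('o, 'm, 'p, 'n) func =
  fobj :: "'o \<Rightarrow> 'p"
  fmap :: "'o \<Rightarrow> 'o \<Rightarrow> 'm \<Rightarrow> 'n"

definition is_functor ::
  "('o, 'm, 'k, 'y) lin_cat_scheme \<Rightarrow> ('p, 'n, 'k, 'z) lin_cat_scheme
    \<Rightarrow> ('o, 'm, 'p, 'n, 'x) func_scheme \<Rightarrow> bool" where
  "is_functor C D F \<longleftrightarrow>
     fobj F \<in> Obj C \<rightarrow> Obj D \<and>
     (\<forall>X\<in>Obj C. \<forall>Y\<in>Obj C. fmap F X Y \<in> mor C X Y \<rightarrow> mor D (fobj F X) (fobj F Y)) \<and>
     (\<forall>X\<in>Obj C. fmap F X X (Idn C X) = Idn D (fobj F X)) \<and>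
     (\<forall>X\<in>Obj C. \<forall>Y\<in>Obj C. \<forall>Z\<in>Obj C. \<forall>f\<in>mor C X Y. \<forall>g\<in>mor C Y Z.
        fmap F X Z (Cmp C X Y Z g f)
          = Cmp D (fobj F X) (fobj F Y) (fobj F Z) (fmap F Y Z g) (fmap F X Y f))"

definition linear_functor ::
  "'k ring \<Rightarrow> ('o, 'm, 'k, 'y) lin_cat_scheme \<Rightarrow> ('p, 'n, 'k, 'z) lin_cat_scheme
    \<Rightarrow> ('o, 'm, 'p, 'n, 'x) func_scheme \<Rightarrow> bool" where
  "linear_functor K C D F \<longleftrightarrow> is_functor C D F \<and>
     (\<forall>X\<in>Obj C. \<forall>Y\<in>Obj C.
        linear_map K (Hom C X Y) (Hom D (fobj F X) (fobj F Y)) (fmap F X Y))"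

text \<open>The identity functor; it also serves as the inclusion of a full subcategory.\<close>

definition idf :: "('o, 'm, 'o, 'm) func" where
  "idf = \<lparr>fobj = (\<lambda>X. X), fmap = (\<lambda>X Y f. f)\<rparr>"

definition func_comp ::
  "('p, 'n, 'q, 'l, 'x) func_scheme \<Rightarrow> ('o, 'm, 'p, 'n, 'y) func_scheme
    \<Rightarrow> ('o, 'm, 'q, 'l) func" where
  "func_comp G F = \<lparr>fobj = (\<lambda>X. fobj G (fobj F X)),
                fmap = (\<lambda>X Y f. fmap G (fobj F X) (fobj F Y) (fmap F X Y f))\<rparr>"

definition nat_trans ::
  "('o, 'm, 'k, 'y) lin_cat_scheme \<Rightarrow> ('p, 'n, 'k, 'z) lin_cat_scheme
    \<Rightarrow> ('o, 'm, 'p, 'n, 'x) func_scheme \<Rightarrow> ('o, 'm, 'p, 'n, 'w) func_scheme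
    \<Rightarrow> ('o \<Rightarrow> 'n) \<Rightarrow> bool" where
  "nat_trans C D F G \<alpha> \<longleftrightarrow>
     (\<forall>X\<in>Obj C. \<alpha> X \<in> mor D (fobj F X) (fobj G X)) \<and>
     (\<forall>X\<in>Obj C. \<forall>Y\<in>Obj C. \<forall>f\<in>mor C X Y.
        Cmp D (fobj F X) (fobj F Y) (fobj G Y) (\<alpha> Y) (fmap F X Y f)
          = Cmp D (fobj F X) (fobj G X) (fobj G Y) (fmap G X Y f) (\<alpha> X))"

definition nat_iso ::
  "('o, 'm, 'k, 'y) lin_cat_scheme \<Rightarrow> ('p, 'n, 'k, 'z) lin_cat_scheme
    \<Rightarrow> ('o, 'm, 'p, 'n, 'x) func_scheme \<Rightarrow> ('o, 'm, 'p, 'n, 'w) func_scheme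
    \<Rightarrow> ('o \<Rightarrow> 'n) \<Rightarrow> bool" where
  "nat_iso C D F G \<alpha> \<longleftrightarrow> nat_trans C D F G \<alpha> \<and>
     (\<forall>X\<in>Obj C. is_iso D (fobj F X) (fobj G X) (\<alpha> X))"

definition is_equivalence ::
  "('o, 'm, 'k, 'y) lin_cat_scheme \<Rightarrow> ('p, 'n, 'k, 'z) lin_cat_scheme
    \<Rightarrow> ('o, 'm, 'p, 'n, 'x) func_scheme \<Rightarrow> bool" where
  "is_equivalence C D F \<longleftrightarrow> is_functor C D F \<and>
     (\<exists>G :: ('p, 'n, 'o, 'm) func. is_functor D C G \<and>
        (\<exists>\<alpha>. nat_iso C C idf (func_comp G F) \<alpha>) \<and> (\<exists>\<beta>. nat_iso D D (func_comp F G) idf \<beta>))"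

text \<open>\<open>F : C \<rightarrow> D\<close> is left adjoint to \<open>G : D \<rightarrow> C\<close> with unit \<open>\<eta>\<close> and counit \<open>\<epsilon>\<close>.\<close>

definition adjunction ::
  "('o, 'm, 'k, 'y) lin_cat_scheme \<Rightarrow> ('p, 'n, 'k, 'z) lin_cat_scheme
    \<Rightarrow> ('o, 'm, 'p, 'n, 'x) func_scheme \<Rightarrow> ('p, 'n, 'o, 'm, 'w) func_scheme
    \<Rightarrow> ('o \<Rightarrow> 'm) \<Rightarrow> ('p \<Rightarrow> 'n) \<Rightarrow> bool" where
  "adjunction C D F G \<eta> \<epsilon> \<longleftrightarrow>
     is_functor C D F \<and> is_functor D C G \<and>
     nat_trans C C idf (func_comp G F) \<eta> \<and> nat_trans D D (func_comp F G) idf \<epsilon> \<and>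
     (\<forall>X\<in>Obj C. let FX = fobj F X; GFX = fobj G FX; FGFX = fobj F GFX in
        Cmp D FX FGFX FX (\<epsilon> FX) (fmap F X GFX (\<eta> X)) = Idn D FX) \<and>
     (\<forall>Y\<in>Obj D. let GY = fobj G Y; FGY = fobj F GY; GFGY = fobj G FGY in
        Cmp C GY GFGY GY (fmap G FGY Y (\<epsilon> Y)) (\<eta> GY) = Idn C GY)"


section \<open>Triangulated categories\<close>

text \<open>\<open>(X, Y, Z, f, g, h)\<close> stands for the triangle \<open>X \<rightarrow> Y \<rightarrow> Z \<rightarrow> \<Sigma>X\<close> with morphisms \<open>f\<close>, \<open>g\<close>, \<open>h\<close>.\<close>

record ('o, 'm, 'k) tri_cat = "('o, 'm, 'k) lin_cat" +
  Sus :: "('o, 'm, 'o, 'm) func"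
  Tri :: "('o \<times> 'o \<times> 'o \<times> 'm \<times> 'm \<times> 'm) set"

abbreviation sob :: "('o, 'm, 'k, 'z) tri_cat_scheme \<Rightarrow> 'o \<Rightarrow> 'o" where
  "sob T \<equiv> fobj (Sus T)"

abbreviation smap :: "('o, 'm, 'k, 'z) tri_cat_scheme \<Rightarrow> 'o \<Rightarrow> 'o \<Rightarrow> 'm \<Rightarrow> 'm" where
  "smap T \<equiv> fmap (Sus T)"

text \<open>The suspension is only required to be an autoequivalence, not an automorphism.\<close>

locale triangulated_category = linear_category K T
  for K :: "'k ring" and T :: "('o, 'm, 'k, 'z) tri_cat_scheme" +
  assumes zero_object: "\<exists>Z. is_zero_object T Z"
    and biproducts: "\<lbrakk>X \<in> Obj T; Y \<in> Obj T\<rbrakk> \<Longrightarrow> \<exists>Z i j p q. is_biproduct T X Y Z i j p q"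
    and Sus_linear: "linear_functor K T T (Sus T)"
    and Sus_equivalence: "is_equivalence T T (Sus T)"
    and Tri_mor:
      "(X, Y, Z, f, g, h) \<in> Tri T \<Longrightarrow>
        X \<in> Obj T \<and> Y \<in> Obj T \<and> Z \<in> Obj T \<and>
        f \<in> mor T X Y \<and> g \<in> mor T Y Z \<and> h \<in> mor T Z (sob T X)"
    and Tri_iso:
      "\<lbrakk>(X, Y, Z, f, g, h) \<in> Tri T; X' \<in> Obj T; Y' \<in> Obj T; Z' \<in> Obj T;
        f' \<in> mor T X' Y'; g' \<in> mor T Y' Z'; h' \<in> mor T Z' (sob T X');
        is_iso T X X' a; is_iso T Y Y' b; is_iso T Z Z' c;
        Cmp T X Y Y' b f = Cmp T X X' Y' f' a;
        Cmp T Y Z Z' c g = Cmp T Y Y' Z' g' b;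
        Cmp T Z (sob T X) (sob T X') (smap T X X' a) h = Cmp T Z Z' (sob T X') h' c\<rbrakk>
        \<Longrightarrow> (X', Y', Z', f', g', h') \<in> Tri T"
    and Tri_id:
      "\<lbrakk>X \<in> Obj T; is_zero_object T Z\<rbrakk>
        \<Longrightarrow> (X, X, Z, Idn T X, \<zero>\<^bsub>Hom T X Z\<^esub>, \<zero>\<^bsub>Hom T Z (sob T X)\<^esub>) \<in> Tri T"
    and Tri_cone:
      "\<lbrakk>X \<in> Obj T; Y \<in> Obj T; f \<in> mor T X Y\<rbrakk> \<Longrightarrow> \<exists>Z g h. (X, Y, Z, f, g, h) \<in> Tri T"
    and Tri_rotate:
      "\<lbrakk>X \<in> Obj T; Y \<in> Obj T; Z \<in> Obj T;
        f \<in> mor T X Y; g \<in> mor T Y Z; h \<in> mor T Z (sob T X)\<rbrakk>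
        \<Longrightarrow> (X, Y, Z, f, g, h) \<in> Tri T \<longleftrightarrow>
          (Y, Z, sob T X, g, h, \<ominus>\<^bsub>Hom T (sob T X) (sob T Y)\<^esub> (smap T X Y f)) \<in> Tri T"
    and Tri_fill:
      "\<lbrakk>(X, Y, Z, f, g, h) \<in> Tri T; (X', Y', Z', f', g', h') \<in> Tri T;
        a \<in> mor T X X'; b \<in> mor T Y Y'; Cmp T X Y Y' b f = Cmp T X X' Y' f' a\<rbrakk>
        \<Longrightarrow> \<exists>c\<in>mor T Z Z'.
          Cmp T Y Z Z' c g = Cmp T Y Y' Z' g' b \<and>
          Cmp T Z (sob T X) (sob T X') (smap T X X' a) h = Cmp T Z Z' (sob T X') h' c"
    and Tri_octahedral:
      "\<lbrakk>(X, Y, Z', f, a, b) \<in> Tri T; (Y, Z, X', g, c, e) \<in> Tri T;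
        (X, Z, Y', Cmp T X Y Z g f, p, q) \<in> Tri T\<rbrakk>
        \<Longrightarrow> \<exists>u v. (Z', Y', X', u, v, Cmp T X' (sob T Y) (sob T Z') (smap T Y Z' a) e) \<in> Tri T \<and>
          Cmp T Y Z' Y' u a = Cmp T Y Z Y' p g \<and> Cmp T Z' Y' (sob T X) q u = b \<and>
          Cmp T Z Y' X' v p = c \<and>
          Cmp T Y' (sob T X) (sob T Y) (smap T X Y f) q = Cmp T Y' X' (sob T Y) e v"

text \<open>A triangle functor is a functor \<open>F\<close> together with an isomorphism \<open>F \<Sigma> \<rightarrow> \<Sigma> F\<close>, the field \<open>Com\<close>.\<close>

record ('o, 'm, 'p, 'n) tri_func = "('o, 'm, 'p, 'n) func" +
  Com :: "'o \<Rightarrow> 'n"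

definition triangle_functor ::
  "'k ring \<Rightarrow> ('o, 'm, 'k, 'y) tri_cat_scheme \<Rightarrow> ('p, 'n, 'k, 'z) tri_cat_scheme
    \<Rightarrow> ('o, 'm, 'p, 'n) tri_func \<Rightarrow> bool" where
  "triangle_functor K C D F \<longleftrightarrow> linear_functor K C D F \<and>
     nat_iso C D (func_comp F (Sus C)) (func_comp (Sus D) F) (Com F) \<and>
     (\<forall>X Y Z f g h. (X, Y, Z, f, g, h) \<in> Tri C \<longrightarrow>
        (fobj F X, fobj F Y, fobj F Z, fmap F X Y f, fmap F Y Z g,
          Cmp D (fobj F Z) (fobj F (sob C X)) (sob D (fobj F X))
            (Com F X) (fmap F Z (sob C X) h)) \<in> Tri D)"

definition tcomp ::
  "('o, 'm, 'k, 'x) tri_cat_scheme \<Rightarrow> ('p, 'n, 'k, 'y) tri_cat_scheme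
    \<Rightarrow> ('q, 'l, 'k, 'z) tri_cat_scheme \<Rightarrow> ('p, 'n, 'q, 'l) tri_func
    \<Rightarrow> ('o, 'm, 'p, 'n) tri_func \<Rightarrow> ('o, 'm, 'q, 'l) tri_func" where
  "tcomp C D E G F =
     \<lparr>fobj = fobj (func_comp G F), fmap = fmap (func_comp G F),
      Com = (\<lambda>X. Cmp E (fobj G (fobj F (sob C X))) (fobj G (sob D (fobj F X)))
                       (sob E (fobj G (fobj F X)))
                   (Com G (fobj F X))
                   (fmap G (fobj F (sob C X)) (sob D (fobj F X)) (Com F X)))\<rparr>"

text \<open>Isomorphisms of triangle functors are compatible with the suspensions.\<close>

definition triangle_iso ::
  "('o, 'm, 'k, 'y) tri_cat_scheme \<Rightarrow> ('p, 'n, 'k, 'z) tri_cat_scheme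
    \<Rightarrow> ('o, 'm, 'p, 'n) tri_func \<Rightarrow> ('o, 'm, 'p, 'n) tri_func \<Rightarrow> ('o \<Rightarrow> 'n) \<Rightarrow> bool" where
  "triangle_iso C D F G \<alpha> \<longleftrightarrow> nat_iso C D F G \<alpha> \<and>
     (\<forall>X\<in>Obj C.
        Cmp D (fobj F (sob C X)) (sob D (fobj F X)) (sob D (fobj G X))
            (smap D (fobj F X) (fobj G X) (\<alpha> X)) (Com F X)
          = Cmp D (fobj F (sob C X)) (fobj G (sob C X)) (sob D (fobj G X))
            (Com G X) (\<alpha> (sob C X)))"

text \<open>A functorial triangle \<open>F \<rightarrow> G \<rightarrow> H \<rightarrow> \<Sigma> F\<close> of functors \<open>C \<rightarrow> T\<close>.\<close>

definition functorial_triangle ::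
  "('o, 'm, 'k, 'y) lin_cat_scheme \<Rightarrow> ('p, 'n, 'k, 'z) tri_cat_scheme
    \<Rightarrow> ('o, 'm, 'p, 'n, 'u) func_scheme \<Rightarrow> ('o, 'm, 'p, 'n, 'v) func_scheme
    \<Rightarrow> ('o, 'm, 'p, 'n, 'w) func_scheme
    \<Rightarrow> ('o \<Rightarrow> 'n) \<Rightarrow> ('o \<Rightarrow> 'n) \<Rightarrow> ('o \<Rightarrow> 'n) \<Rightarrow> bool" where
  "functorial_triangle C T F G H \<alpha> \<beta> \<gamma> \<longleftrightarrow>
     nat_trans C T F G \<alpha> \<and> nat_trans C T G H \<beta> \<and> nat_trans C T H (func_comp (Sus T) F) \<gamma> \<and>
     (\<forall>X\<in>Obj C. (fobj F X, fobj G X, fobj H X, \<alpha> X, \<beta> X, \<gamma> X) \<in> Tri T)"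

text \<open>
  A t-structure with left aisle \<open>L\<close> (objects of degrees \<open>\<le> 0\<close>) and right aisle \<open>R\<close> (objects of
  degrees \<open>\<ge> 0\<close>), both strictly full.  The objects of degrees \<open>\<ge> 1\<close> are the \<open>Y\<close> with \<open>\<Sigma>Y \<in> R\<close>.
\<close>

definition t_structure :: "('o, 'm, 'k, 'z) tri_cat_scheme \<Rightarrow> 'o set \<Rightarrow> 'o set \<Rightarrow> bool" where
  "t_structure T L R \<longleftrightarrow>
     L \<subseteq> Obj T \<and> R \<subseteq> Obj T \<and>
     (\<forall>X\<in>L. \<forall>Y\<in>Obj T. (\<exists>f. is_iso T X Y f) \<longrightarrow> Y \<in> L) \<and>
     (\<forall>X\<in>R. \<forall>Y\<in>Obj T. (\<exists>f. is_iso T X Y f) \<longrightarrow> Y \<in> R) \<and>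
     (\<forall>X\<in>L. sob T X \<in> L) \<and>
     (\<forall>Y\<in>Obj T. sob T Y \<in> R \<longrightarrow> Y \<in> R) \<and>
     (\<forall>X\<in>L. \<forall>Y\<in>Obj T. sob T Y \<in> R \<longrightarrow> mor T X Y = {\<zero>\<^bsub>Hom T X Y\<^esub>}) \<and>
     (\<forall>X\<in>Obj T. \<exists>A\<in>L. \<exists>B\<in>Obj T. sob T B \<in> R \<and> (\<exists>f g h. (A, X, B, f, g, h) \<in> Tri T))"


section \<open>Complexes\<close>

record ('k, 'm) cpx =
  Mdl :: "int \<Rightarrow> ('k, 'm) module"
  Dif :: "int \<Rightarrow> 'm \<Rightarrow> 'm"

definition is_complex :: "'k ring \<Rightarrow> ('k, 'm) cpx \<Rightarrow> bool" where
  "is_complex K M \<longleftrightarrow>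
     (\<forall>n. module K (Mdl M n)) \<and>
     (\<forall>n. linear_map K (Mdl M n) (Mdl M (n + 1)) (Dif M n)) \<and>
     (\<forall>n. \<forall>x\<in>carrier (Mdl M n). Dif M (n + 1) (Dif M n x) = \<zero>\<^bsub>Mdl M (n + 2)\<^esub>)"

definition cocycles :: "('k, 'm) cpx \<Rightarrow> int \<Rightarrow> 'm set" where
  "cocycles M n = {x \<in> carrier (Mdl M n). Dif M n x = \<zero>\<^bsub>Mdl M (n + 1)\<^esub>}"

definition coboundaries :: "('k, 'm) cpx \<Rightarrow> int \<Rightarrow> 'm set" where
  "coboundaries M n = Dif M (n - 1) ` carrier (Mdl M (n - 1))"

definition cclass :: "('k, 'm) cpx \<Rightarrow> int \<Rightarrow> 'm \<Rightarrow> 'm set" where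
  "cclass M n x = coboundaries M n +>\<^bsub>Mdl M n\<^esub> x"

text \<open>
  Operations on cohomology classes are given by the union, over all representatives, of the class of
  the result; if the operation is well defined then all classes in this union coincide.
\<close>

definition cohomology :: "('k, 'm) cpx \<Rightarrow> int \<Rightarrow> ('k, 'm set) module" where
  "cohomology M n =
     \<lparr>carrier = cclass M n ` cocycles M n,
      mult = undefined, one = undefined,
      zero = coboundaries M n,
      add = set_add (Mdl M n),
      smult = (\<lambda>a c. \<Union>x\<in>c. cclass M n (a \<odot>\<^bsub>Mdl M n\<^esub> x))\<rparr>"

definition chain_map ::
  "'k ring \<Rightarrow> ('k, 'm) cpx \<Rightarrow> ('k, 'n) cpx \<Rightarrow> (int \<Rightarrow> 'm \<Rightarrow> 'n) \<Rightarrow> bool" where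
  "chain_map K M N \<phi> \<longleftrightarrow>
     (\<forall>n. linear_map K (Mdl M n) (Mdl N n) (\<phi> n)) \<and>
     (\<forall>n. \<forall>x\<in>carrier (Mdl M n). \<phi> (n + 1) (Dif M n x) = Dif N n (\<phi> n x))"

definition quasi_iso ::
  "'k ring \<Rightarrow> ('k, 'm) cpx \<Rightarrow> ('k, 'n) cpx \<Rightarrow> (int \<Rightarrow> 'm \<Rightarrow> 'n) \<Rightarrow> bool" where
  "quasi_iso K M N \<phi> \<longleftrightarrow> chain_map K M N \<phi> \<and>
     (\<forall>n. bij_betw (\<lambda>c. \<Union>x\<in>c. cclass N n (\<phi> n x))
            (carrier (cohomology M n)) (carrier (cohomology N n)))"


section \<open>Dg categories\<close>

record ('o, 'm, 'k) dg_cat =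
  DObj :: "'o set"
  DHom :: "'o \<Rightarrow> 'o \<Rightarrow> ('k, 'm) cpx"
  DCmp :: "'o \<Rightarrow> 'o \<Rightarrow> 'o \<Rightarrow> int \<Rightarrow> int \<Rightarrow> 'm \<Rightarrow> 'm \<Rightarrow> 'm"
    \<comment> \<open>\<open>DCmp A X Y Z m n g f\<close> is \<open>g \<circ> f\<close> for \<open>f : X \<rightarrow> Y\<close> of degree \<open>n\<close> and \<open>g : Y \<rightarrow> Z\<close> of degree \<open>m\<close>\<close>
  DIdn :: "'o \<Rightarrow> 'm"

abbreviation dmor :: "('o, 'm, 'k) dg_cat \<Rightarrow> 'o \<Rightarrow> 'o \<Rightarrow> int \<Rightarrow> 'm set" where
  "dmor A X Y n \<equiv> carrier (Mdl (DHom A X Y) n)"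

abbreviation ddif :: "('o, 'm, 'k) dg_cat \<Rightarrow> 'o \<Rightarrow> 'o \<Rightarrow> int \<Rightarrow> 'm \<Rightarrow> 'm" where
  "ddif A X Y n \<equiv> Dif (DHom A X Y) n"

abbreviation dcocyc :: "('o, 'm, 'k) dg_cat \<Rightarrow> 'o \<Rightarrow> 'o \<Rightarrow> int \<Rightarrow> 'm set" where
  "dcocyc A X Y n \<equiv> cocycles (DHom A X Y) n"

abbreviation dcob :: "('o, 'm, 'k) dg_cat \<Rightarrow> 'o \<Rightarrow> 'o \<Rightarrow> int \<Rightarrow> 'm set" where
  "dcob A X Y n \<equiv> coboundaries (DHom A X Y) n"

abbreviation dcls :: "('o, 'm, 'k) dg_cat \<Rightarrow> 'o \<Rightarrow> 'o \<Rightarrow> 'm \<Rightarrow> 'm set" where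
  "dcls A X Y \<equiv> cclass (DHom A X Y) 0"

definition koszul :: "('k, 'm) module \<Rightarrow> int \<Rightarrow> 'm \<Rightarrow> 'm" where
  "koszul M n x = (if even n then x else \<ominus>\<^bsub>M\<^esub> x)"

locale dg_category = cring K
  for K :: "'k ring" and A :: "('o, 'm, 'k) dg_cat" +
  assumes DHom_complex: "\<lbrakk>X \<in> DObj A; Y \<in> DObj A\<rbrakk> \<Longrightarrow> is_complex K (DHom A X Y)"
    and DCmp_linear_right:
      "\<lbrakk>X \<in> DObj A; Y \<in> DObj A; Z \<in> DObj A; g \<in> dmor A Y Z m\<rbrakk>
        \<Longrightarrow> linear_map K (Mdl (DHom A X Y) n) (Mdl (DHom A X Z) (m + n))
              (\<lambda>f. DCmp A X Y Z m n g f)"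
    and DCmp_linear_left:
      "\<lbrakk>X \<in> DObj A; Y \<in> DObj A; Z \<in> DObj A; f \<in> dmor A X Y n\<rbrakk>
        \<Longrightarrow> linear_map K (Mdl (DHom A Y Z) m) (Mdl (DHom A X Z) (m + n))
              (\<lambda>g. DCmp A X Y Z m n g f)"
    and Leibniz:
      "\<lbrakk>X \<in> DObj A; Y \<in> DObj A; Z \<in> DObj A; f \<in> dmor A X Y n; g \<in> dmor A Y Z m\<rbrakk>
        \<Longrightarrow> ddif A X Z (m + n) (DCmp A X Y Z m n g f)
          = DCmp A X Y Z (m + 1) n (ddif A Y Z m g) f
            \<oplus>\<^bsub>Mdl (DHom A X Z) (m + n + 1)\<^esub>
            koszul (Mdl (DHom A X Z) (m + n + 1)) m (DCmp A X Y Z m (n + 1) g (ddif A X Y n f))"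
    and DCmp_assoc:
      "\<lbrakk>W \<in> DObj A; X \<in> DObj A; Y \<in> DObj A; Z \<in> DObj A;
        f \<in> dmor A W X n; g \<in> dmor A X Y m; h \<in> dmor A Y Z l\<rbrakk>
        \<Longrightarrow> DCmp A W Y Z l (m + n) h (DCmp A W X Y m n g f)
          = DCmp A W X Z (l + m) n (DCmp A X Y Z l m h g) f"
    and DIdn_mor: "X \<in> DObj A \<Longrightarrow> DIdn A X \<in> dmor A X X 0"
    and DCmp_DIdn_left:
      "\<lbrakk>X \<in> DObj A; Y \<in> DObj A; f \<in> dmor A X Y n\<rbrakk> \<Longrightarrow> DCmp A X Y Y 0 n (DIdn A Y) f = f"
    and DCmp_DIdn_right:
      "\<lbrakk>X \<in> DObj A; Y \<in> DObj A; f \<in> dmor A X Y n\<rbrakk> \<Longrightarrow> DCmp A X X Y n 0 f (DIdn A X) = f"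

record ('o, 'm, 'p, 'n) dg_func =
  dobj :: "'o \<Rightarrow> 'p"
  dmap :: "'o \<Rightarrow> 'o \<Rightarrow> int \<Rightarrow> 'm \<Rightarrow> 'n"

definition dg_functor ::
  "'k ring \<Rightarrow> ('o, 'm, 'k) dg_cat \<Rightarrow> ('p, 'n, 'k) dg_cat \<Rightarrow> ('o, 'm, 'p, 'n) dg_func \<Rightarrow> bool" where
  "dg_functor K A B F \<longleftrightarrow>
     dobj F \<in> DObj A \<rightarrow> DObj B \<and>
     (\<forall>X\<in>DObj A. \<forall>Y\<in>DObj A.
        chain_map K (DHom A X Y) (DHom B (dobj F X) (dobj F Y)) (dmap F X Y)) \<and>
     (\<forall>X\<in>DObj A. dmap F X X 0 (DIdn A X) = DIdn B (dobj F X)) \<and>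
     (\<forall>X\<in>DObj A. \<forall>Y\<in>DObj A. \<forall>Z\<in>DObj A. \<forall>m n. \<forall>f\<in>dmor A X Y n. \<forall>g\<in>dmor A Y Z m.
        dmap F X Z (m + n) (DCmp A X Y Z m n g f)
          = DCmp B (dobj F X) (dobj F Y) (dobj F Z) m n (dmap F Y Z m g) (dmap F X Y n f))"

definition H0cat :: "('o, 'm, 'k) dg_cat \<Rightarrow> ('o, 'm set, 'k) lin_cat" where
  "H0cat A =
     \<lparr>Obj = DObj A,
      Hom = (\<lambda>X Y. cohomology (DHom A X Y) 0),
      Cmp = (\<lambda>X Y Z d c. \<Union>g\<in>d. \<Union>f\<in>c. dcls A X Z (DCmp A X Y Z 0 0 g f)),
      Idn = (\<lambda>X. dcls A X X (DIdn A X))\<rparr>"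


section \<open>Pretriangulated dg categories\<close>

text \<open>
  \<open>Y\<close> represents the suspension of \<open>X\<close> up to homotopy: \<open>\<sigma> : X \<rightarrow> Y\<close> is closed of degree \<open>-1\<close> and
  \<open>\<sigma>' : Y \<rightarrow> X\<close> is closed of degree \<open>1\<close>, and they are inverse to each other up to homotopy.
  By the Yoneda lemma this says that the dg module represented by \<open>Y\<close> is homotopy equivalent, via
  \<open>a \<mapsto> \<sigma> a\<close>, to the shift \<open>M[1]\<close> (with differential \<open>-d\<close>) of the dg module \<open>M\<close> represented by \<open>X\<close>.
\<close>

definition is_suspension ::
  "('o, 'm, 'k) dg_cat \<Rightarrow> 'o \<Rightarrow> 'o \<Rightarrow> 'm \<Rightarrow> 'm \<Rightarrow> bool" where
  "is_suspension A X Y \<sigma> \<sigma>' \<longleftrightarrow>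
     X \<in> DObj A \<and> Y \<in> DObj A \<and> \<sigma> \<in> dcocyc A X Y (-1) \<and> \<sigma>' \<in> dcocyc A Y X 1 \<and>
     DCmp A X Y X 1 (-1) \<sigma>' \<sigma> \<ominus>\<^bsub>Mdl (DHom A X X) 0\<^esub> DIdn A X \<in> dcob A X X 0 \<and>
     DCmp A Y X Y (-1) 1 \<sigma> \<sigma>' \<ominus>\<^bsub>Mdl (DHom A Y Y) 0\<^esub> DIdn A Y \<in> dcob A Y Y 0"

text \<open>
  The complex of morphisms from \<open>W\<close> to the cone of \<open>f : X \<rightarrow> Y\<close>: in degree \<open>n\<close> it consists of the
  pairs \<open>(a, b)\<close> with \<open>a : W \<rightarrow> X\<close> of degree \<open>n + 1\<close> and \<open>b : W \<rightarrow> Y\<close> of degree \<open>n\<close>, with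
  differential \<open>(a, b) \<mapsto> (- d a, f a + d b)\<close>.
\<close>

definition direct_sum :: "('k, 'm) module \<Rightarrow> ('k, 'n) module \<Rightarrow> ('k, 'm \<times> 'n) module" where
  "direct_sum M N =
     \<lparr>carrier = carrier M \<times> carrier N,
      mult = undefined, one = undefined,
      zero = (\<zero>\<^bsub>M\<^esub>, \<zero>\<^bsub>N\<^esub>),
      add = (\<lambda>x y. (fst x \<oplus>\<^bsub>M\<^esub> fst y, snd x \<oplus>\<^bsub>N\<^esub> snd y)),
      smult = (\<lambda>a x. (a \<odot>\<^bsub>M\<^esub> fst x, a \<odot>\<^bsub>N\<^esub> snd x))\<rparr>"

definition cone_complex ::
  "('o, 'm, 'k) dg_cat \<Rightarrow> 'o \<Rightarrow> 'o \<Rightarrow> 'm \<Rightarrow> 'o \<Rightarrow> ('k, 'm \<times> 'm) cpx" where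
  "cone_complex A X Y f W =
     \<lparr>Mdl = (\<lambda>n. direct_sum (Mdl (DHom A W X) (n + 1)) (Mdl (DHom A W Y) n)),
      Dif = (\<lambda>n (a, b).
        (\<ominus>\<^bsub>Mdl (DHom A W X) (n + 2)\<^esub> (ddif A W X (n + 1) a),
         DCmp A W X Y 0 (n + 1) f a \<oplus>\<^bsub>Mdl (DHom A W Y) (n + 1)\<^esub> ddif A W Y n b))\<rparr>"

text \<open>
  \<open>Z\<close> represents the cone of the closed degree \<open>0\<close> morphism \<open>f : X \<rightarrow> Y\<close> up to homotopy.  By the
  Yoneda lemma, a closed degree \<open>0\<close> morphism from the cone of the induced morphism of representable dg
  modules to the dg module represented by \<open>Z\<close> amounts to a closed \<open>i : Y \<rightarrow> Z\<close> of degree \<open>0\<close> and a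
  \<open>j : X \<rightarrow> Z\<close> of degree \<open>-1\<close> with \<open>d j = i f\<close>; it is given by \<open>(a, b) \<mapsto> j a + i b\<close>.
\<close>

definition is_cone ::
  "'k ring \<Rightarrow> ('o, 'm, 'k) dg_cat \<Rightarrow> 'o \<Rightarrow> 'o \<Rightarrow> 'o \<Rightarrow> 'm \<Rightarrow> 'm \<Rightarrow> 'm \<Rightarrow> bool" where
  "is_cone K A X Y Z f i j \<longleftrightarrow>
     X \<in> DObj A \<and> Y \<in> DObj A \<and> Z \<in> DObj A \<and>
     f \<in> dcocyc A X Y 0 \<and> i \<in> dcocyc A Y Z 0 \<and> j \<in> dmor A X Z (-1) \<and>
     ddif A X Z (-1) j = DCmp A X Y Z 0 0 i f \<and>
     (\<forall>W\<in>DObj A. quasi_iso K (cone_complex A X Y f W) (DHom A W Z)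
        (\<lambda>n (a, b). DCmp A W X Z (-1) (n + 1) j a
                     \<oplus>\<^bsub>Mdl (DHom A W Z) n\<^esub> DCmp A W Y Z 0 n i b))"

text \<open>
  The representable dg modules form a triangulated subcategory of the derived category: there is a
  contractible object, and suspensions, desuspensions and cones are representable up to homotopy.
\<close>

definition pretriangulated :: "'k ring \<Rightarrow> ('o, 'm, 'k) dg_cat \<Rightarrow> bool" where
  "pretriangulated K A \<longleftrightarrow> dg_category K A \<and>
     (\<exists>X\<in>DObj A. DIdn A X \<in> dcob A X X 0) \<and>
     (\<forall>X\<in>DObj A. \<exists>Y \<sigma> \<sigma>'. is_suspension A X Y \<sigma> \<sigma>') \<and>
     (\<forall>Y\<in>DObj A. \<exists>X \<sigma> \<sigma>'. is_suspension A X Y \<sigma> \<sigma>') \<and>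
     (\<forall>X\<in>DObj A. \<forall>Y\<in>DObj A. \<forall>f\<in>dcocyc A X Y 0. \<exists>Z i j. is_cone K A X Y Z f i j)"

definition sus_data :: "('o, 'm, 'k) dg_cat \<Rightarrow> 'o \<Rightarrow> 'o \<times> 'm \<times> 'm" where
  "sus_data A X = (SOME (Y, \<sigma>, \<sigma>'). is_suspension A X Y \<sigma> \<sigma>')"

definition sus_obj :: "('o, 'm, 'k) dg_cat \<Rightarrow> 'o \<Rightarrow> 'o" where
  "sus_obj A X = fst (sus_data A X)"

definition sus_to :: "('o, 'm, 'k) dg_cat \<Rightarrow> 'o \<Rightarrow> 'm" where
  "sus_to A X = fst (snd (sus_data A X))"

definition sus_from :: "('o, 'm, 'k) dg_cat \<Rightarrow> 'o \<Rightarrow> 'm" where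
  "sus_from A X = snd (snd (sus_data A X))"

text \<open>
  The triangulated structure on \<open>H\<^sup>0(A)\<close> for pretriangulated \<open>A\<close>, with respect to a choice of
  suspensions.  The suspension of the class of \<open>f\<close> is the class of \<open>\<sigma> f \<sigma>'\<close>.
  A triangle is distinguished if it is isomorphic, in the homotopy category of dg modules, to the
  triangle given by the cone of \<open>f\<close>, its inclusion and its projection.  The morphism \<open>h\<close> represents
  the projection if and only if \<open>(a, b) \<mapsto> h j a + h i b\<close> is homotopic to \<open>(a, b) \<mapsto> \<sigma> a\<close>; a
  homotopy has the form \<open>(a, b) \<mapsto> u a + v b\<close>, which yields the last two equations.
\<close>

definition H0 :: "'k ring \<Rightarrow> ('o, 'm, 'k) dg_cat \<Rightarrow> ('o, 'm set, 'k) tri_cat" where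
  "H0 K A = lin_cat.extend (H0cat A)
     \<lparr>Sus = \<lparr>fobj = sus_obj A,
             fmap = (\<lambda>X Y c. \<Union>f\<in>c. dcls A (sus_obj A X) (sus_obj A Y)
               (DCmp A (sus_obj A X) Y (sus_obj A Y) (-1) 1 (sus_to A Y)
                 (DCmp A (sus_obj A X) X Y 0 1 f (sus_from A X))))\<rparr>,
      Tri = {(X, Y, Z, dcls A X Y f, dcls A Y Z i, dcls A Z (sus_obj A X) h) | X Y Z f i h.
        h \<in> dcocyc A Z (sus_obj A X) 0 \<and>
        (\<exists>j. is_cone K A X Y Z f i j \<and>
          (\<exists>u\<in>dmor A X (sus_obj A X) (-2). \<exists>v\<in>dmor A Y (sus_obj A X) (-1).
             DCmp A X Z (sus_obj A X) 0 (-1) h j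
                 \<ominus>\<^bsub>Mdl (DHom A X (sus_obj A X)) (-1)\<^esub> sus_to A X
               = ddif A X (sus_obj A X) (-2) u
                 \<oplus>\<^bsub>Mdl (DHom A X (sus_obj A X)) (-1)\<^esub>
                 DCmp A X Y (sus_obj A X) (-1) 0 v f \<and>
             DCmp A Y Z (sus_obj A X) 0 0 h i = ddif A Y (sus_obj A X) (-1) v))}\<rparr>"

text \<open>
  The triangle functor induced by a dg functor \<open>F\<close>; the isomorphism \<open>F(\<Sigma>X) \<rightarrow> \<Sigma>F(X)\<close> is the one that
  identifies \<open>F(\<sigma>\<^sub>X)\<close> with \<open>\<sigma>\<^bsub>F(X)\<^esub>\<close>.
\<close>

definition H0func ::
  "('o, 'm, 'k) dg_cat \<Rightarrow> ('p, 'n, 'k) dg_cat \<Rightarrow> ('o, 'm, 'p, 'n) dg_func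
    \<Rightarrow> ('o, 'm set, 'p, 'n set) tri_func" where
  "H0func A B F =
     \<lparr>fobj = dobj F,
      fmap = (\<lambda>X Y c. \<Union>f\<in>c. dcls B (dobj F X) (dobj F Y) (dmap F X Y 0 f)),
      Com = (\<lambda>X. dcls B (dobj F (sus_obj A X)) (sus_obj B (dobj F X))
        (DCmp B (dobj F (sus_obj A X)) (dobj F X) (sus_obj B (dobj F X)) (-1) 1
          (sus_to B (dobj F X)) (dmap F (sus_obj A X) X 1 (sus_from A X))))\<rparr>"

definition quasi_equivalence ::
  "'k ring \<Rightarrow> ('o, 'm, 'k) dg_cat \<Rightarrow> ('p, 'n, 'k) dg_cat \<Rightarrow> ('o, 'm, 'p, 'n) dg_func \<Rightarrow> bool" where
  "quasi_equivalence K A B F \<longleftrightarrow> dg_functor K A B F \<and>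
     (\<forall>X\<in>DObj A. \<forall>Y\<in>DObj A.
        quasi_iso K (DHom A X Y) (DHom B (dobj F X) (dobj F Y)) (dmap F X Y)) \<and>
     (\<forall>Y\<in>DObj B. \<exists>X\<in>DObj A. \<exists>c. is_iso (H0cat B) (dobj F X) Y c)"


section \<open>Dg enhancements\<close>

definition dg_enhancement ::
  "'k ring \<Rightarrow> ('o, 'm, 'k) tri_cat \<Rightarrow> ('p, 'n, 'k) dg_cat \<Rightarrow> ('p, 'n set, 'o, 'm) tri_func \<Rightarrow> bool"
where
  "dg_enhancement K T A E \<longleftrightarrow>
     pretriangulated K A \<and> triangle_functor K (H0 K A) T E \<and> is_equivalence (H0 K A) T E"

text \<open>
  The triangle functor \<open>F : S \<rightarrow> T\<close> is induced by the dg functor \<open>u : A \<rightarrow> B\<close>, where \<open>A\<close> and \<open>B\<close>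
  enhance \<open>S\<close> and \<open>T\<close>: the square formed by \<open>F\<close>, \<open>H\<^sup>0(u)\<close> and the equivalences \<open>D : H\<^sup>0(A) \<rightarrow> S\<close>,
  \<open>E : H\<^sup>0(B) \<rightarrow> T\<close> commutes up to isomorphism of triangle functors.
\<close>

definition induced_by ::
  "'k ring \<Rightarrow> ('o, 'm, 'k) tri_cat \<Rightarrow> ('p, 'n, 'k) tri_cat
    \<Rightarrow> ('a, 'b, 'k) dg_cat \<Rightarrow> ('a, 'b set, 'o, 'm) tri_func
    \<Rightarrow> ('c, 'd, 'k) dg_cat \<Rightarrow> ('c, 'd set, 'p, 'n) tri_func
    \<Rightarrow> ('o, 'm, 'p, 'n) tri_func \<Rightarrow> ('a, 'b, 'c, 'd) dg_func \<Rightarrow> bool" where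
  "induced_by K S T A D B E F u \<longleftrightarrow> dg_functor K A B u \<and>
     (\<exists>\<alpha>. triangle_iso (H0 K A) T
        (tcomp (H0 K A) S T F D)
        (tcomp (H0 K A) (H0 K B) T E (H0func A B u)) \<alpha>)"

text \<open>
  A dg enhancement of a triangle functor \<open>F : S \<rightarrow> T\<close>, with respect to enhancements \<open>A\<close> of \<open>S\<close> and
  \<open>B\<close> of \<open>T\<close>, is a morphism \<open>A \<rightarrow> B\<close> in the localization of the category of dg categories at the
  quasi-equivalences (equivalently, a quasi-functor) that induces \<open>F\<close>.  Such a morphism is given by a
  roof \<open>A \<leftarrow> Q \<rightarrow> B\<close> whose left leg is a quasi-equivalence.  The types of the objects and morphisms of
  \<open>Q\<close> have to be fixed; they only have to be large enough for a cofibrant resolution of \<open>A\<close>, and every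
  morphism of the localization is represented by a roof with \<open>Q\<close> such a resolution.
\<close>

type_synonym ('k, 'a, 'b) roomy = "(nat + 'k + 'a + 'b) list set"

definition admits_dg_enhancement ::
  "'k ring \<Rightarrow> ('o, 'm, 'k) tri_cat \<Rightarrow> ('p, 'n, 'k) tri_cat
    \<Rightarrow> ('a, 'b, 'k) dg_cat \<Rightarrow> ('a, 'b set, 'o, 'm) tri_func
    \<Rightarrow> ('c, 'd, 'k) dg_cat \<Rightarrow> ('c, 'd set, 'p, 'n) tri_func
    \<Rightarrow> ('o, 'm, 'p, 'n) tri_func \<Rightarrow> bool" where
  "admits_dg_enhancement K S T A D B E F \<longleftrightarrow>
     (\<exists>(Q :: (('k, 'a, 'b) roomy, ('k, 'a, 'b) roomy, 'k) dg_cat) w u.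
        pretriangulated K Q \<and> quasi_equivalence K Q A w \<and>
        induced_by K S T Q (tcomp (H0 K Q) (H0 K A) S D (H0func Q A w)) B E F u)"

end

theory Submission
  imports Defs "HOL-Library.Nat_Bijection"
begin

text \<open>
  For every object \<open>X\<close> of \<open>T_dg\<close> choose an object \<open>A\<close> of \<open>S_dg\<close> representing \<open>r X\<close> (or \<open>\<tau> r X\<close>),
  a closed morphism \<open>f : s A \<rightarrow> X\<close> representing the counit, and a cone of \<open>f\<close>.  A morphism between two such
  cones is a morphism of \<open>X\<close> together with all lifts and homotopies; this is a dg category \<open>P\<close> of
  arrows of arrows, with dg functors \<open>base\<close> (the object \<open>X\<close>) and \<open>apex\<close> (the cone) to \<open>T_dg\<close>.
  By the universal property of \<open>f\<close>, \<open>base\<close> induces bijections on \<open>H\<^sup>0\<close> of the morphism complexes as soon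
  as that property holds in degrees \<open>\<le> 0\<close>, and it is a quasi-equivalence if it holds in all degrees.  An aisle
  is closed under suspension only, so \<open>\<tau> r\<close> gives the former and \<open>r\<close> the latter.  Inverting \<open>base\<close> turns
  \<open>apex\<close> into the required functor on \<open>T\<close>, and in the second case the roof formed by \<open>base\<close> and
  \<open>apex\<close> is a dg enhancement of it, once \<open>P\<close> is replaced by a small enough model.
\<close>

text \<open>A cone is not functorial in \<open>T\<close>, since fill-ins of morphisms of triangles
  are not unique. In \<open>P\<close> all choices are part of the morphism, and acyclicity of the
  choices is what makes the projection to \<open>X\<close> invertible on cohomology. Arrows of
  arrows split this projection in two. Forgetting the cone is harmless in every degree, because the
  cone property concerns whole morphism complexes. Forgetting the lift is governed by the
  coreflection. The adjunctions of \<open>S\<close> and \<open>T\<close> only speak of degree 0;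
  other degrees are reached by suspending or desuspending the test object. Bijectivity on H^0
  involves degrees 0 and -1, a quasi-equivalence all degrees. \<open>is_cone\<close> tests morphisms
  into the cone only. An explicit null-homotopy with finitely many components replaces it by
  equations, which dg functors preserve and which also control morphisms out of the cone. The roof
  demanded of an enhancement has types built from \<open>K\<close> and \<open>T_dg\<close>, whereas
  arrows of arrows contain morphisms of \<open>S_dg\<close> as well; terms over \<open>K\<close> and
  \<open>T_dg\<close>, coded as lists, bring the roof into these types.\<close>

section \<open>Computing in abelian groups\<close>

named_theorems abg

lemma abelian_group_ac [abg]:
  assumes "abelian_group G" "x \<in> carrier G" "y \<in> carrier G"
  shows "x \<oplus>\<^bsub>G\<^esub> y = y \<oplus>\<^bsub>G\<^esub> x"
    and "z \<in> carrier G \<Longrightarrow> x \<oplus>\<^bsub>G\<^esub> y \<oplus>\<^bsub>G\<^esub> z = x \<oplus>\<^bsub>G\<^esub> (y \<oplus>\<^bsub>G\<^esub> z)"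
    and "z \<in> carrier G \<Longrightarrow> x \<oplus>\<^bsub>G\<^esub> (y \<oplus>\<^bsub>G\<^esub> z) = y \<oplus>\<^bsub>G\<^esub> (x \<oplus>\<^bsub>G\<^esub> z)"
proof -
  interpret abelian_group G by fact
  show "x \<oplus>\<^bsub>G\<^esub> y = y \<oplus>\<^bsub>G\<^esub> x"
    "z \<in> carrier G \<Longrightarrow> x \<oplus>\<^bsub>G\<^esub> y \<oplus>\<^bsub>G\<^esub> z = x \<oplus>\<^bsub>G\<^esub> (y \<oplus>\<^bsub>G\<^esub> z)"
    "z \<in> carrier G \<Longrightarrow> x \<oplus>\<^bsub>G\<^esub> (y \<oplus>\<^bsub>G\<^esub> z) = y \<oplus>\<^bsub>G\<^esub> (x \<oplus>\<^bsub>G\<^esub> z)"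
    using assms by (simp_all add: a_ac)
qed

text \<open>The part of \<open>abg\<close> that neither reorders sums nor moves terms across an
  equation, for closure conditions and for goals in which only zeros have to disappear.\<close>

named_theorems abgc

lemma abelian_group_closed [abg, abgc]:
  assumes "abelian_group G" 
  shows "\<zero>\<^bsub>G\<^esub> \<in> carrier G"
    and "x \<in> carrier G \<Longrightarrow> \<ominus>\<^bsub>G\<^esub> x \<in> carrier G"
    and "x \<in> carrier G \<Longrightarrow> y \<in> carrier G \<Longrightarrow> x \<oplus>\<^bsub>G\<^esub> y \<in> carrier G"
    and "x \<in> carrier G \<Longrightarrow> y \<in> carrier G \<Longrightarrow> x \<ominus>\<^bsub>G\<^esub> y \<in> carrier G"
proof -
  interpret abelian_group G by fact
  show "\<zero>\<^bsub>G\<^esub> \<in> carrier G"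
    and "x \<in> carrier G \<Longrightarrow> \<ominus>\<^bsub>G\<^esub> x \<in> carrier G"
    and "x \<in> carrier G \<Longrightarrow> y \<in> carrier G \<Longrightarrow> x \<oplus>\<^bsub>G\<^esub> y \<in> carrier G"
    and "x \<in> carrier G \<Longrightarrow> y \<in> carrier G \<Longrightarrow> x \<ominus>\<^bsub>G\<^esub> y \<in> carrier G"
    by simp_all
qed

lemma abelian_group_zero [abg, abgc]:
  assumes "abelian_group G" 
  shows "\<ominus>\<^bsub>G\<^esub> \<zero>\<^bsub>G\<^esub> = \<zero>\<^bsub>G\<^esub>"
    and "x \<in> carrier G \<Longrightarrow> \<zero>\<^bsub>G\<^esub> \<oplus>\<^bsub>G\<^esub> x = x"
    and "x \<in> carrier G \<Longrightarrow> x \<oplus>\<^bsub>G\<^esub> \<zero>\<^bsub>G\<^esub> = x"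
    and "x \<in> carrier G \<Longrightarrow> x \<ominus>\<^bsub>G\<^esub> \<zero>\<^bsub>G\<^esub> = x"
    and "x \<in> carrier G \<Longrightarrow> \<zero>\<^bsub>G\<^esub> \<ominus>\<^bsub>G\<^esub> x = \<ominus>\<^bsub>G\<^esub> x"
    and "x \<in> carrier G \<Longrightarrow> x \<ominus>\<^bsub>G\<^esub> x = \<zero>\<^bsub>G\<^esub>"
    and "x \<in> carrier G \<Longrightarrow> \<ominus>\<^bsub>G\<^esub> (\<ominus>\<^bsub>G\<^esub> x) = x"
proof -
  interpret abelian_group G by fact
  show "\<ominus>\<^bsub>G\<^esub> \<zero>\<^bsub>G\<^esub> = \<zero>\<^bsub>G\<^esub>"
    and "x \<in> carrier G \<Longrightarrow> \<zero>\<^bsub>G\<^esub> \<oplus>\<^bsub>G\<^esub> x = x"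
    and "x \<in> carrier G \<Longrightarrow> x \<oplus>\<^bsub>G\<^esub> \<zero>\<^bsub>G\<^esub> = x"
    and "x \<in> carrier G \<Longrightarrow> x \<ominus>\<^bsub>G\<^esub> \<zero>\<^bsub>G\<^esub> = x"
    and "x \<in> carrier G \<Longrightarrow> \<zero>\<^bsub>G\<^esub> \<ominus>\<^bsub>G\<^esub> x = \<ominus>\<^bsub>G\<^esub> x"
    and "x \<in> carrier G \<Longrightarrow> x \<ominus>\<^bsub>G\<^esub> x = \<zero>\<^bsub>G\<^esub>"
    and "x \<in> carrier G \<Longrightarrow> \<ominus>\<^bsub>G\<^esub> (\<ominus>\<^bsub>G\<^esub> x) = x"
    by (simp_all add: minus_eq r_neg)
qed

lemma abelian_group_eq_iff:
  assumes "abelian_group G" "x \<in> carrier G" "y \<in> carrier G" "z \<in> carrier G"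
  shows "x \<ominus>\<^bsub>G\<^esub> y = z \<longleftrightarrow> x = z \<oplus>\<^bsub>G\<^esub> y"
    and "z = x \<ominus>\<^bsub>G\<^esub> y \<longleftrightarrow> z \<oplus>\<^bsub>G\<^esub> y = x"
    and "\<ominus>\<^bsub>G\<^esub> x = z \<longleftrightarrow> z \<oplus>\<^bsub>G\<^esub> x = \<zero>\<^bsub>G\<^esub>"
    and "z = \<ominus>\<^bsub>G\<^esub> x \<longleftrightarrow> z \<oplus>\<^bsub>G\<^esub> x = \<zero>\<^bsub>G\<^esub>"
    and "x \<oplus>\<^bsub>G\<^esub> y = x \<oplus>\<^bsub>G\<^esub> z \<longleftrightarrow> y = z"
proof -
  interpret abelian_group G by fact
  have *: "x \<ominus>\<^bsub>G\<^esub> y = z \<longleftrightarrow> x = z \<oplus>\<^bsub>G\<^esub> y" if "x \<in> carrier G" "y \<in> carrier G" "z \<in> carrier G" for x y z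
    using that by (metis a_assoc a_inv_closed minus_eq l_neg r_neg r_zero)
  show "x \<ominus>\<^bsub>G\<^esub> y = z \<longleftrightarrow> x = z \<oplus>\<^bsub>G\<^esub> y" "z = x \<ominus>\<^bsub>G\<^esub> y \<longleftrightarrow> z \<oplus>\<^bsub>G\<^esub> y = x"
    using * assms by metis+
  show "\<ominus>\<^bsub>G\<^esub> x = z \<longleftrightarrow> z \<oplus>\<^bsub>G\<^esub> x = \<zero>\<^bsub>G\<^esub>" "z = \<ominus>\<^bsub>G\<^esub> x \<longleftrightarrow> z \<oplus>\<^bsub>G\<^esub> x = \<zero>\<^bsub>G\<^esub>"
    using assms l_neg minus_equality by metis+
  show "x \<oplus>\<^bsub>G\<^esub> y = x \<oplus>\<^bsub>G\<^esub> z \<longleftrightarrow> y = z" using assms by simp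
qed

text \<open>Normal form: a term becomes a sum, the negative of a sum, or a difference of two sums,
  so that signs occur only at the top. \<open>abeq_simps\<close> then moves the negative part across
  the equation, and AC rewriting finishes.\<close>

lemma abelian_group_diff_simps [abg]:
  assumes "abelian_group G" "x \<in> carrier G" "y \<in> carrier G"
  shows "\<ominus>\<^bsub>G\<^esub> (x \<ominus>\<^bsub>G\<^esub> y) = y \<ominus>\<^bsub>G\<^esub> x"
    and "x \<oplus>\<^bsub>G\<^esub> \<ominus>\<^bsub>G\<^esub> y = x \<ominus>\<^bsub>G\<^esub> y"
    and "\<ominus>\<^bsub>G\<^esub> x \<oplus>\<^bsub>G\<^esub> y = y \<ominus>\<^bsub>G\<^esub> x"
    and "x \<ominus>\<^bsub>G\<^esub> \<ominus>\<^bsub>G\<^esub> y = x \<oplus>\<^bsub>G\<^esub> y"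
    and "\<And>z. z \<in> carrier G \<Longrightarrow> x \<oplus>\<^bsub>G\<^esub> (y \<ominus>\<^bsub>G\<^esub> z) = (x \<oplus>\<^bsub>G\<^esub> y) \<ominus>\<^bsub>G\<^esub> z"
    and "\<And>z. z \<in> carrier G \<Longrightarrow> (x \<ominus>\<^bsub>G\<^esub> y) \<oplus>\<^bsub>G\<^esub> z = (x \<oplus>\<^bsub>G\<^esub> z) \<ominus>\<^bsub>G\<^esub> y"
    and "\<And>z. z \<in> carrier G \<Longrightarrow> (x \<ominus>\<^bsub>G\<^esub> y) \<ominus>\<^bsub>G\<^esub> z = x \<ominus>\<^bsub>G\<^esub> (y \<oplus>\<^bsub>G\<^esub> z)"
    and "\<And>z. z \<in> carrier G \<Longrightarrow> x \<ominus>\<^bsub>G\<^esub> (y \<ominus>\<^bsub>G\<^esub> z) = (x \<oplus>\<^bsub>G\<^esub> z) \<ominus>\<^bsub>G\<^esub> y"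
    and "\<ominus>\<^bsub>G\<^esub> x \<ominus>\<^bsub>G\<^esub> y = \<ominus>\<^bsub>G\<^esub> (x \<oplus>\<^bsub>G\<^esub> y)"
proof -
  interpret abelian_group G by fact
  have c[simp]: "\<And>x y. x \<in> carrier G \<Longrightarrow> y \<in> carrier G \<Longrightarrow> x \<ominus>\<^bsub>G\<^esub> y = x \<oplus>\<^bsub>G\<^esub> \<ominus>\<^bsub>G\<^esub> y" by (rule minus_eq)
  show "\<ominus>\<^bsub>G\<^esub> (x \<ominus>\<^bsub>G\<^esub> y) = y \<ominus>\<^bsub>G\<^esub> x"
    and "x \<oplus>\<^bsub>G\<^esub> \<ominus>\<^bsub>G\<^esub> y = x \<ominus>\<^bsub>G\<^esub> y"
    and "\<ominus>\<^bsub>G\<^esub> x \<oplus>\<^bsub>G\<^esub> y = y \<ominus>\<^bsub>G\<^esub> x"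
    and "x \<ominus>\<^bsub>G\<^esub> \<ominus>\<^bsub>G\<^esub> y = x \<oplus>\<^bsub>G\<^esub> y"
    and "\<And>z. z \<in> carrier G \<Longrightarrow> x \<oplus>\<^bsub>G\<^esub> (y \<ominus>\<^bsub>G\<^esub> z) = (x \<oplus>\<^bsub>G\<^esub> y) \<ominus>\<^bsub>G\<^esub> z"
    and "\<And>z. z \<in> carrier G \<Longrightarrow> (x \<ominus>\<^bsub>G\<^esub> y) \<oplus>\<^bsub>G\<^esub> z = (x \<oplus>\<^bsub>G\<^esub> z) \<ominus>\<^bsub>G\<^esub> y"
    and "\<And>z. z \<in> carrier G \<Longrightarrow> (x \<ominus>\<^bsub>G\<^esub> y) \<ominus>\<^bsub>G\<^esub> z = x \<ominus>\<^bsub>G\<^esub> (y \<oplus>\<^bsub>G\<^esub> z)"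
    and "\<And>z. z \<in> carrier G \<Longrightarrow> x \<ominus>\<^bsub>G\<^esub> (y \<ominus>\<^bsub>G\<^esub> z) = (x \<oplus>\<^bsub>G\<^esub> z) \<ominus>\<^bsub>G\<^esub> y"
    and "\<ominus>\<^bsub>G\<^esub> x \<ominus>\<^bsub>G\<^esub> y = \<ominus>\<^bsub>G\<^esub> (x \<oplus>\<^bsub>G\<^esub> y)"
    using assms(2,3) by (simp_all add: minus_add a_ac)
qed

lemmas abge = abelian_group_eq_iff(1-4)

text \<open>
  A copy of equality, so that the simplifier moves negative terms to the other side in the goal
  equation only and not in the equations used to rewrite it.
\<close>

definition abeq :: "'a \<Rightarrow> 'a \<Rightarrow> bool" where
  "abeq x y \<longleftrightarrow> x = y"

lemma abeqI: "abeq x y \<Longrightarrow> x = y"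
  by (simp add: abeq_def)

lemma abeq_simps [abg]:
  assumes "abelian_group G" "x \<in> carrier G" "y \<in> carrier G"
  shows "z \<in> carrier G \<Longrightarrow> abeq (x \<ominus>\<^bsub>G\<^esub> y) z = abeq x (z \<oplus>\<^bsub>G\<^esub> y)"
    and "z \<in> carrier G \<Longrightarrow> abeq z (x \<ominus>\<^bsub>G\<^esub> y) = abeq (z \<oplus>\<^bsub>G\<^esub> y) x"
    and "abeq (\<ominus>\<^bsub>G\<^esub> x) y = abeq (x \<oplus>\<^bsub>G\<^esub> y) \<zero>\<^bsub>G\<^esub>"
    and "abeq y (\<ominus>\<^bsub>G\<^esub> x) = abeq (x \<oplus>\<^bsub>G\<^esub> y) \<zero>\<^bsub>G\<^esub>"
  using assms by (auto simp: abeq_def abelian_group_eq_iff[OF assms(1)] abelian_group_ac(1)[OF assms(1)])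

lemma abeq_refl [abg, abgc]: "abeq x x"
  by (simp add: abeq_def)

section \<open>Complexes\<close>

lemma linear_mapD:
  assumes "linear_map K M N f" "module K M" "module K N"
  shows "x \<in> carrier M \<Longrightarrow> f x \<in> carrier N"
    and "x \<in> carrier M \<Longrightarrow> y \<in> carrier M \<Longrightarrow> f (x \<oplus>\<^bsub>M\<^esub> y) = f x \<oplus>\<^bsub>N\<^esub> f y"
    and "a \<in> carrier K \<Longrightarrow> x \<in> carrier M \<Longrightarrow> f (a \<odot>\<^bsub>M\<^esub> x) = a \<odot>\<^bsub>N\<^esub> f x"
    and "f \<zero>\<^bsub>M\<^esub> = \<zero>\<^bsub>N\<^esub>"
    and "x \<in> carrier M \<Longrightarrow> f (\<ominus>\<^bsub>M\<^esub> x) = \<ominus>\<^bsub>N\<^esub> f x"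
    and "x \<in> carrier M \<Longrightarrow> y \<in> carrier M \<Longrightarrow> f (x \<ominus>\<^bsub>M\<^esub> y) = f x \<ominus>\<^bsub>N\<^esub> f y"
proof -
  interpret M: module K M by fact
  interpret N: module K N by fact
  show c: "\<And>x. x \<in> carrier M \<Longrightarrow> f x \<in> carrier N"
    using assms(1) by (auto simp: linear_map_def)
  show a: "\<And>x y. x \<in> carrier M \<Longrightarrow> y \<in> carrier M \<Longrightarrow> f (x \<oplus>\<^bsub>M\<^esub> y) = f x \<oplus>\<^bsub>N\<^esub> f y"
    using assms(1) by (auto simp: linear_map_def)
  show "a \<in> carrier K \<Longrightarrow> x \<in> carrier M \<Longrightarrow> f (a \<odot>\<^bsub>M\<^esub> x) = a \<odot>\<^bsub>N\<^esub> f x"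
    using assms(1) by (auto simp: linear_map_def)
  have "f \<zero>\<^bsub>M\<^esub> \<oplus>\<^bsub>N\<^esub> f \<zero>\<^bsub>M\<^esub> = f \<zero>\<^bsub>M\<^esub> \<oplus>\<^bsub>N\<^esub> \<zero>\<^bsub>N\<^esub>"
    using a[of "\<zero>\<^bsub>M\<^esub>" "\<zero>\<^bsub>M\<^esub>"] c by simp
  then show z: "f \<zero>\<^bsub>M\<^esub> = \<zero>\<^bsub>N\<^esub>" using c by simp
  show n: "f (\<ominus>\<^bsub>M\<^esub> x) = \<ominus>\<^bsub>N\<^esub> f x" if "x \<in> carrier M" for x
    using a[of "\<ominus>\<^bsub>M\<^esub> x" x] c z that by (metis M.M.a_inv_closed M.M.l_neg N.M.minus_equality)
  show "x \<in> carrier M \<Longrightarrow> y \<in> carrier M \<Longrightarrow> f (x \<ominus>\<^bsub>M\<^esub> y) = f x \<ominus>\<^bsub>N\<^esub> f y"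
    by (simp add: M.M.minus_eq N.M.minus_eq a n c)
qed

lemma module_smult:
  fixes K :: "'k ring" and M :: "('k, 'm) module"
  assumes "module K M" "a \<in> carrier K" "x \<in> carrier M"
  shows "a \<odot>\<^bsub>M\<^esub> x \<in> carrier M"
    and "y \<in> carrier M \<Longrightarrow> a \<odot>\<^bsub>M\<^esub> (x \<oplus>\<^bsub>M\<^esub> y) = a \<odot>\<^bsub>M\<^esub> x \<oplus>\<^bsub>M\<^esub> a \<odot>\<^bsub>M\<^esub> y"
    and "y \<in> carrier M \<Longrightarrow> a \<odot>\<^bsub>M\<^esub> (x \<ominus>\<^bsub>M\<^esub> y) = a \<odot>\<^bsub>M\<^esub> x \<ominus>\<^bsub>M\<^esub> a \<odot>\<^bsub>M\<^esub> y"
    and "a \<odot>\<^bsub>M\<^esub> (\<ominus>\<^bsub>M\<^esub> x) = \<ominus>\<^bsub>M\<^esub> (a \<odot>\<^bsub>M\<^esub> x)"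
    and "a \<odot>\<^bsub>M\<^esub> \<zero>\<^bsub>M\<^esub> = \<zero>\<^bsub>M\<^esub>"
proof -
  interpret module K M by fact
  have l: "linear_map K M M (\<lambda>x. a \<odot>\<^bsub>M\<^esub> x)"
    using assms by (auto simp: linear_map_def smult_r_distr smult_assoc1[symmetric] R.m_comm)
  show "a \<odot>\<^bsub>M\<^esub> x \<in> carrier M" using assms by simp
  show "y \<in> carrier M \<Longrightarrow> a \<odot>\<^bsub>M\<^esub> (x \<oplus>\<^bsub>M\<^esub> y) = a \<odot>\<^bsub>M\<^esub> x \<oplus>\<^bsub>M\<^esub> a \<odot>\<^bsub>M\<^esub> y"
    "y \<in> carrier M \<Longrightarrow> a \<odot>\<^bsub>M\<^esub> (x \<ominus>\<^bsub>M\<^esub> y) = a \<odot>\<^bsub>M\<^esub> x \<ominus>\<^bsub>M\<^esub> a \<odot>\<^bsub>M\<^esub> y"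
    "a \<odot>\<^bsub>M\<^esub> (\<ominus>\<^bsub>M\<^esub> x) = \<ominus>\<^bsub>M\<^esub> (a \<odot>\<^bsub>M\<^esub> x)"
    "a \<odot>\<^bsub>M\<^esub> \<zero>\<^bsub>M\<^esub> = \<zero>\<^bsub>M\<^esub>"
    using linear_mapD[OF l assms(1) assms(1)] assms(3) by auto
qed

lemma (in module) is_abelian_group_M: "abelian_group M"
  by (rule M.abelian_group_axioms)

locale complex =
  fixes K :: "'k ring" and M :: "('k, 'm) cpx"
  assumes is_complex: "is_complex K M"
begin

lemma Mdl_module [simp]: "module K (Mdl M n)"
  using is_complex by (simp add: is_complex_def)

lemma Mdl_group [simp]: "abelian_group (Mdl M n)"
  using Mdl_module by (rule module.is_abelian_group_M)

lemma Dif_linear: "k = n + 1 \<Longrightarrow> linear_map K (Mdl M n) (Mdl M k) (Dif M n)"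
  using is_complex by (simp add: is_complex_def)

lemma Dif_simps [simp]:
  shows "k = n + 1 \<Longrightarrow> x \<in> carrier (Mdl M n) \<Longrightarrow> Dif M n x \<in> carrier (Mdl M k)"
    and "x \<in> carrier (Mdl M n) \<Longrightarrow> y \<in> carrier (Mdl M n) \<Longrightarrow>
      Dif M n (x \<oplus>\<^bsub>Mdl M n\<^esub> y) = Dif M n x \<oplus>\<^bsub>Mdl M (n+1)\<^esub> Dif M n y"
    and "a \<in> carrier K \<Longrightarrow> x \<in> carrier (Mdl M n) \<Longrightarrow>
      Dif M n (a \<odot>\<^bsub>Mdl M n\<^esub> x) = a \<odot>\<^bsub>Mdl M (n+1)\<^esub> Dif M n x"
    and "Dif M n (\<zero>\<^bsub>Mdl M n\<^esub>) = \<zero>\<^bsub>Mdl M (n+1)\<^esub>"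
    and "x \<in> carrier (Mdl M n) \<Longrightarrow> Dif M n (\<ominus>\<^bsub>Mdl M n\<^esub> x) = \<ominus>\<^bsub>Mdl M (n+1)\<^esub> (Dif M n x)"
    and "x \<in> carrier (Mdl M n) \<Longrightarrow> y \<in> carrier (Mdl M n) \<Longrightarrow>
      Dif M n (x \<ominus>\<^bsub>Mdl M n\<^esub> y) = Dif M n x \<ominus>\<^bsub>Mdl M (n+1)\<^esub> Dif M n y"
    and "k = n + 1 \<Longrightarrow> x \<in> carrier (Mdl M n) \<Longrightarrow> Dif M k (Dif M n x) = \<zero>\<^bsub>Mdl M (n+2)\<^esub>"
  using linear_mapD[OF Dif_linear[OF refl] Mdl_module Mdl_module]
    is_complex by (auto simp: is_complex_def)

lemma coboundaries_iff:
  "x \<in> coboundaries M n \<longleftrightarrow> (\<exists>y\<in>carrier (Mdl M (n - 1)). x = Dif M (n - 1) y)"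
  by (auto simp: coboundaries_def)

lemma coboundaries_subgroup: "abelian_subgroup (coboundaries M n) (Mdl M n)"
proof -
  have "Dif M (n - 1) ` carrier (Mdl M (n - 1)) \<subseteq> carrier (Mdl M n)" by auto
  moreover have "\<zero>\<^bsub>Mdl M n\<^esub> \<in> Dif M (n - 1) ` carrier (Mdl M (n-1))"
    using Dif_simps(4)[of "n-1"] by (metis Mdl_group abelian_group_closed(1) diff_add_cancel image_eqI)
  moreover have "\<exists>z\<in>carrier (Mdl M (n-1)). Dif M (n-1) x \<oplus>\<^bsub>Mdl M n\<^esub> Dif M (n-1) y = Dif M (n-1) z"
    if "x \<in> carrier (Mdl M (n-1))" "y \<in> carrier (Mdl M (n-1))" for x y
    using Dif_simps(2)[of x "n-1" y] that by (metis Mdl_group abelian_group_closed(3) diff_add_cancel)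
  moreover have "\<exists>z\<in>carrier (Mdl M (n-1)). \<ominus>\<^bsub>Mdl M n\<^esub> Dif M (n-1) x = Dif M (n-1) z"
    if "x \<in> carrier (Mdl M (n-1))" for x
    using Dif_simps(5)[of x "n-1"] that by (metis Mdl_group abelian_group_closed(2) diff_add_cancel)
  ultimately have "subgroup (coboundaries M n) (add_monoid (Mdl M n))"
    unfolding coboundaries_def
    by (intro subgroup.intro) (auto simp: image_iff simp flip: a_inv_def)
  then show ?thesis
    by (intro abelian_subgroupI3 additive_subgroup.intro) auto
qed

lemma cclass_eq_iff:
  assumes "x \<in> carrier (Mdl M n)" "y \<in> carrier (Mdl M n)"
  shows "cclass M n x = cclass M n y \<longleftrightarrow> x \<ominus>\<^bsub>Mdl M n\<^esub> y \<in> coboundaries M n"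
proof -
  interpret cob: abelian_subgroup "coboundaries M n" "Mdl M n" by (rule coboundaries_subgroup)
  show ?thesis
    unfolding cclass_def using assms
    by (metis cob.a_rcos_module cob.a_rcos_self cob.a_repr_independence' cob.minus_eq)
qed

lemma cclass_self: "x \<in> carrier (Mdl M n) \<Longrightarrow> x \<in> cclass M n x"
  unfolding cclass_def by (rule abelian_subgroup.a_rcos_self[OF coboundaries_subgroup])

lemma cclass_mem:
  assumes "x \<in> carrier (Mdl M n)"
  shows "y \<in> cclass M n x \<longleftrightarrow> y \<in> carrier (Mdl M n) \<and> cclass M n y = cclass M n x"
proof
  interpret cob: abelian_subgroup "coboundaries M n" "Mdl M n" by (rule coboundaries_subgroup)
  assume y: "y \<in> cclass M n x"
  then have "y \<in> carrier (Mdl M n)"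
    using assms cob.a_subset by (auto simp: cclass_def a_r_coset_def' intro!: abelian_group_closed)
  then show "y \<in> carrier (Mdl M n) \<and> cclass M n y = cclass M n x"
    using y assms unfolding cclass_def by (metis cob.a_repr_independence')
next
  assume "y \<in> carrier (Mdl M n) \<and> cclass M n y = cclass M n x"
  then show "y \<in> cclass M n x" using cclass_self by blast
qed

lemma cocyclesD: "x \<in> cocycles M n \<Longrightarrow> x \<in> carrier (Mdl M n)"
    "x \<in> cocycles M n \<Longrightarrow> k = n + 1 \<Longrightarrow> Dif M n x = \<zero>\<^bsub>Mdl M k\<^esub>"
  by (auto simp: cocycles_def)

lemma cohomology_add:
  assumes "x \<in> carrier (Mdl M n)" "y \<in> carrier (Mdl M n)"
  shows "cclass M n x \<oplus>\<^bsub>cohomology M n\<^esub> cclass M n y = cclass M n (x \<oplus>\<^bsub>Mdl M n\<^esub> y)"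
  using abelian_subgroup.a_rcos_sum[OF coboundaries_subgroup assms] by (simp add: cohomology_def cclass_def)

lemma cohomology_smult:
  assumes "x \<in> carrier (Mdl M n)" "a \<in> carrier K"
  shows "a \<odot>\<^bsub>cohomology M n\<^esub> cclass M n x = cclass M n (a \<odot>\<^bsub>Mdl M n\<^esub> x)"
proof -
  interpret m: module K "Mdl M n" by simp
  have "cclass M n (a \<odot>\<^bsub>Mdl M n\<^esub> y) = cclass M n (a \<odot>\<^bsub>Mdl M n\<^esub> x)" if "y \<in> cclass M n x" for y
  proof -
    have y: "y \<in> carrier (Mdl M n)" "y \<ominus>\<^bsub>Mdl M n\<^esub> x \<in> coboundaries M n"
      using that assms cclass_mem cclass_eq_iff by auto
    then obtain z where z: "z \<in> carrier (Mdl M (n - 1))" "y \<ominus>\<^bsub>Mdl M n\<^esub> x = Dif M (n - 1) z"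
      by (auto simp: coboundaries_def)
    have "a \<odot>\<^bsub>Mdl M n\<^esub> y \<ominus>\<^bsub>Mdl M n\<^esub> a \<odot>\<^bsub>Mdl M n\<^esub> x = a \<odot>\<^bsub>Mdl M n\<^esub> (y \<ominus>\<^bsub>Mdl M n\<^esub> x)"
      using y assms linear_mapD(6)[of K "Mdl M n" "Mdl M n" "\<lambda>x. a \<odot>\<^bsub>Mdl M n\<^esub> x" y x]
      by (simp add: linear_map_def m.smult_r_distr m.smult_assoc1[symmetric] m.R.m_comm)
    also have "\<dots> = Dif M (n - 1) (a \<odot>\<^bsub>Mdl M (n - 1)\<^esub> z)"
      using z assms Dif_simps(3)[of a z "n-1"] by simp
    finally have "a \<odot>\<^bsub>Mdl M n\<^esub> y \<ominus>\<^bsub>Mdl M n\<^esub> a \<odot>\<^bsub>Mdl M n\<^esub> x \<in> coboundaries M n"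
      using z(1) assms(2) unfolding coboundaries_iff
      by (intro bexI[of _ "a \<odot>\<^bsub>Mdl M (n - 1)\<^esub> z"]) (simp_all add: module.smult_closed[OF Mdl_module])
    then show ?thesis using y assms by (simp add: cclass_eq_iff)
  qed
  then have "(\<Union>y\<in>cclass M n x. cclass M n (a \<odot>\<^bsub>Mdl M n\<^esub> y)) = cclass M n (a \<odot>\<^bsub>Mdl M n\<^esub> x)"
    using cclass_self[OF assms(1)] by (intro UN_constant_eq ballI)
  then show ?thesis unfolding cohomology_def by simp
qed

lemma cohomology_zero: "\<zero>\<^bsub>cohomology M n\<^esub> = cclass M n \<zero>\<^bsub>Mdl M n\<^esub>"
proof -
  interpret cob: abelian_subgroup "coboundaries M n" "Mdl M n" by (rule coboundaries_subgroup)
  show ?thesis unfolding cohomology_def cclass_def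
    using cob.a_subset by (auto simp: a_r_coset_def' subset_iff abgc)
qed

lemma cohomology_carrier: "carrier (cohomology M n) = cclass M n ` cocycles M n"
  by (simp add: cohomology_def)

end

text \<open>Bijectivity on H^n is split into two conditions on representatives with an explicit
  bounding cochain. Such cochains are the homotopies that the later constructions combine;
  \<open>cohom_bij_iff\<close> returns to classes.\<close>

definition cohom_surj :: "('k, 'm) cpx \<Rightarrow> ('k, 'n) cpx \<Rightarrow> (int \<Rightarrow> 'm \<Rightarrow> 'n) \<Rightarrow> int \<Rightarrow> bool" where
  "cohom_surj M N \<phi> n \<longleftrightarrow> (\<forall>y\<in>cocycles N n. \<exists>x\<in>cocycles M n. \<exists>z\<in>carrier (Mdl N (n - 1)).
     \<phi> n x = y \<oplus>\<^bsub>Mdl N n\<^esub> Dif N (n - 1) z)"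

definition cohom_inj :: "('k, 'm) cpx \<Rightarrow> ('k, 'n) cpx \<Rightarrow> (int \<Rightarrow> 'm \<Rightarrow> 'n) \<Rightarrow> int \<Rightarrow> bool" where
  "cohom_inj M N \<phi> n \<longleftrightarrow> (\<forall>x\<in>cocycles M n. \<forall>z\<in>carrier (Mdl N (n - 1)). \<phi> n x = Dif N (n - 1) z \<longrightarrow>
     (\<exists>y\<in>carrier (Mdl M (n - 1)). x = Dif M (n - 1) y))"

locale complex_map = M: complex K M + N: complex K N
  for K :: "'k ring" and M :: "('k, 'm) cpx" and N :: "('k, 'n) cpx" and \<phi> :: "int \<Rightarrow> 'm \<Rightarrow> 'n" +
  assumes chain_map: "chain_map K M N \<phi>"
begin

lemma phi_linear: "linear_map K (Mdl M n) (Mdl N n) (\<phi> n)"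
  using chain_map by (simp add: chain_map_def)

lemma phi_simps [simp]:
  shows "x \<in> carrier (Mdl M n) \<Longrightarrow> \<phi> n x \<in> carrier (Mdl N n)"
    and "x \<in> carrier (Mdl M n) \<Longrightarrow> y \<in> carrier (Mdl M n) \<Longrightarrow>
      \<phi> n (x \<oplus>\<^bsub>Mdl M n\<^esub> y) = \<phi> n x \<oplus>\<^bsub>Mdl N n\<^esub> \<phi> n y"
    and "a \<in> carrier K \<Longrightarrow> x \<in> carrier (Mdl M n) \<Longrightarrow>
      \<phi> n (a \<odot>\<^bsub>Mdl M n\<^esub> x) = a \<odot>\<^bsub>Mdl N n\<^esub> \<phi> n x"
    and "\<phi> n (\<zero>\<^bsub>Mdl M n\<^esub>) = \<zero>\<^bsub>Mdl N n\<^esub>"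
    and "x \<in> carrier (Mdl M n) \<Longrightarrow> \<phi> n (\<ominus>\<^bsub>Mdl M n\<^esub> x) = \<ominus>\<^bsub>Mdl N n\<^esub> (\<phi> n x)"
    and "x \<in> carrier (Mdl M n) \<Longrightarrow> y \<in> carrier (Mdl M n) \<Longrightarrow>
      \<phi> n (x \<ominus>\<^bsub>Mdl M n\<^esub> y) = \<phi> n x \<ominus>\<^bsub>Mdl N n\<^esub> \<phi> n y"
  using linear_mapD[OF phi_linear M.Mdl_module N.Mdl_module] by auto

lemma phi_Dif: "k = n + 1 \<Longrightarrow> x \<in> carrier (Mdl M n) \<Longrightarrow> \<phi> k (Dif M n x) = Dif N n (\<phi> n x)"
  using chain_map by (simp add: chain_map_def)

lemma phi_cocycle: "x \<in> cocycles M n \<Longrightarrow> \<phi> n x \<in> cocycles N n"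
  using phi_Dif[of "n+1" n x] by (auto simp: cocycles_def)

lemma phi_coboundary: "x \<in> coboundaries M n \<Longrightarrow> \<phi> n x \<in> coboundaries N n"
  by (force simp: M.coboundaries_iff N.coboundaries_iff phi_Dif)

lemma phi_class:
  assumes "x \<in> carrier (Mdl M n)"
  shows "(\<Union>y\<in>cclass M n x. cclass N n (\<phi> n y)) = cclass N n (\<phi> n x)"
proof -
  have "cclass N n (\<phi> n y) = cclass N n (\<phi> n x)" if "y \<in> cclass M n x" for y
  proof -
    have y: "y \<in> carrier (Mdl M n)" "y \<ominus>\<^bsub>Mdl M n\<^esub> x \<in> coboundaries M n"
      using that assms M.cclass_mem M.cclass_eq_iff by auto
    then show ?thesis
      using assms phi_coboundary[of "y \<ominus>\<^bsub>Mdl M n\<^esub> x" n] by (simp add: N.cclass_eq_iff)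
  qed
  then show ?thesis using M.cclass_self[OF assms] by (intro UN_constant_eq ballI)
qed

lemma cohom_bij_iff:
  "bij_betw (\<lambda>c. \<Union>x\<in>c. cclass N n (\<phi> n x)) (carrier (cohomology M n)) (carrier (cohomology N n))
    \<longleftrightarrow> cohom_surj M N \<phi> n \<and> cohom_inj M N \<phi> n" (is "bij_betw ?f ?A ?B \<longleftrightarrow> _")
proof -
  have f: "?f (cclass M n x) = cclass N n (\<phi> n x)" if "x \<in> cocycles M n" for x
    using phi_class that M.cocyclesD by blast
  have fA: "?f ` ?A \<subseteq> ?B"
    using f phi_cocycle by (auto simp: M.cohomology_carrier N.cohomology_carrier)
  have "?f ` ?A = ?B \<longleftrightarrow> cohom_surj M N \<phi> n"
  proof
    assume eq: "?f ` ?A = ?B"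
    show "cohom_surj M N \<phi> n" unfolding cohom_surj_def
    proof
      fix y assume y: "y \<in> cocycles N n"
      then have "cclass N n y \<in> ?f ` ?A" using eq by (simp add: N.cohomology_carrier)
      then obtain x where x: "x \<in> cocycles M n" "cclass N n y = cclass N n (\<phi> n x)"
        using f by (auto simp: M.cohomology_carrier)
      then have "\<phi> n x \<ominus>\<^bsub>Mdl N n\<^esub> y \<in> coboundaries N n"
        using y by (metis N.cclass_eq_iff N.cocyclesD(1) phi_cocycle)
      then show "\<exists>x\<in>cocycles M n. \<exists>z\<in>carrier (Mdl N (n - 1)). \<phi> n x = y \<oplus>\<^bsub>Mdl N n\<^esub> Dif N (n - 1) z"
        using x y N.cocyclesD M.cocyclesD
        by (auto simp: N.coboundaries_iff abge abelian_group_ac(1) intro!: bexI[of _ x])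
    qed
  next
    assume s: "cohom_surj M N \<phi> n"
    have "cclass N n y \<in> ?f ` ?A" if y: "y \<in> cocycles N n" for y
    proof -
      obtain x z where x: "x \<in> cocycles M n" "z \<in> carrier (Mdl N (n - 1))" "\<phi> n x = y \<oplus>\<^bsub>Mdl N n\<^esub> Dif N (n - 1) z"
        using s y by (auto simp: cohom_surj_def)
      then have "\<phi> n x \<ominus>\<^bsub>Mdl N n\<^esub> y = Dif N (n - 1) z"
        using y N.cocyclesD M.cocyclesD by (simp add: abg abge)
      then have "\<phi> n x \<ominus>\<^bsub>Mdl N n\<^esub> y \<in> coboundaries N n"
        using x(2) by (auto simp: N.coboundaries_iff)
      then have "cclass N n (\<phi> n x) = cclass N n y"
        using M.cocyclesD(1)[OF x(1)] N.cocyclesD(1)[OF y] by (simp only: N.cclass_eq_iff phi_simps)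
      then show ?thesis
        using f[OF x(1)] x(1) unfolding M.cohomology_carrier image_image by (metis (lifting) image_eqI)
    qed
    then show "?f ` ?A = ?B" using fA by (auto simp: N.cohomology_carrier)
  qed
  moreover have "inj_on ?f ?A \<longleftrightarrow> cohom_inj M N \<phi> n"
  proof
    assume i: "inj_on ?f ?A"
    show "cohom_inj M N \<phi> n" unfolding cohom_inj_def
    proof (intro ballI impI)
      fix x z assume x: "x \<in> cocycles M n" "z \<in> carrier (Mdl N (n - 1))" "\<phi> n x = Dif N (n - 1) z"
      then have "cclass N n (\<phi> n x) = cclass N n (\<phi> n \<zero>\<^bsub>Mdl M n\<^esub>)"
        by (subst N.cclass_eq_iff) (auto simp: N.coboundaries_iff abgc)
      then have "?f (cclass M n x) = ?f (cclass M n \<zero>\<^bsub>Mdl M n\<^esub>)"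
        using x f phi_class abelian_group_closed(1) M.Mdl_group by metis
      moreover have "\<zero>\<^bsub>Mdl M n\<^esub> \<in> cocycles M n" by (simp add: cocycles_def abgc)
      ultimately have "cclass M n x = cclass M n \<zero>\<^bsub>Mdl M n\<^esub>"
        using i x by (auto simp: M.cohomology_carrier inj_on_def)
      then have "x \<ominus>\<^bsub>Mdl M n\<^esub> \<zero>\<^bsub>Mdl M n\<^esub> \<in> coboundaries M n"
        using x M.cocyclesD by (simp add: M.cclass_eq_iff abgc)
      then show "\<exists>y\<in>carrier (Mdl M (n - 1)). x = Dif M (n - 1) y"
        using x M.cocyclesD by (simp add: M.coboundaries_iff abgc)
    qed
  next
    assume i: "cohom_inj M N \<phi> n"
    have "cclass M n x = cclass M n y"
      if x: "x \<in> cocycles M n" "y \<in> cocycles M n" "cclass N n (\<phi> n x) = cclass N n (\<phi> n y)" for x y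
    proof -
      have "\<phi> n (x \<ominus>\<^bsub>Mdl M n\<^esub> y) \<in> coboundaries N n"
        using x M.cocyclesD by (simp add: N.cclass_eq_iff)
      moreover have "x \<ominus>\<^bsub>Mdl M n\<^esub> y \<in> cocycles M n"
        using x by (simp add: cocycles_def abgc)
      ultimately have "x \<ominus>\<^bsub>Mdl M n\<^esub> y \<in> coboundaries M n"
        using i by (auto simp: N.coboundaries_iff M.coboundaries_iff cohom_inj_def)
      then show ?thesis using x M.cocyclesD by (simp add: M.cclass_eq_iff)
    qed
    then show "inj_on ?f ?A"
      unfolding M.cohomology_carrier by (intro inj_onI; elim imageE) (metis f)
  qed
  ultimately show ?thesis by (auto simp: bij_betw_def)
qed

lemma quasi_iso_iff: "quasi_iso K M N \<phi> \<longleftrightarrow> (\<forall>n. cohom_surj M N \<phi> n \<and> cohom_inj M N \<phi> n)"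
  unfolding quasi_iso_def using chain_map cohom_bij_iff by simp

text \<open>This says that the mapping cone of a quasi-isomorphism is acyclic.\<close>

lemma quasi_iso_lift:
  assumes q: "\<forall>n. cohom_surj M N \<phi> n \<and> cohom_inj M N \<phi> n"
    and x: "x \<in> carrier (Mdl M (n + 1))" "Dif M (n + 1) x = \<zero>\<^bsub>Mdl M (n + 2)\<^esub>"
    and y: "y \<in> carrier (Mdl N n)" "\<phi> (n + 1) x = Dif N n y"
  obtains x' y' where "x' \<in> carrier (Mdl M n)" "y' \<in> carrier (Mdl N (n - 1))"
    "Dif M n x' = x" "\<phi> n x' = y \<oplus>\<^bsub>Mdl N n\<^esub> Dif N (n - 1) y'"
proof -
  have "x \<in> cocycles M (n + 1)" using x by (simp add: cocycles_def add.commute)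
  then obtain x0 where x0: "x0 \<in> carrier (Mdl M n)" "x = Dif M n x0"
    using y q[rule_format, of "n+1"] unfolding cohom_inj_def by auto
  \<comment> \<open>\<open>x0\<close> bounds \<open>x\<close>, but its image may differ from
    \<open>y\<close> by a cocycle. Surjectivity in degree \<open>n\<close> supplies the cocycle
    \<open>x1\<close> that corrects \<open>x0\<close> without changing its differential.\<close>
  then have "y \<ominus>\<^bsub>Mdl N n\<^esub> \<phi> n x0 \<in> cocycles N n"
    using y by (simp add: cocycles_def phi_Dif abgc)
  then obtain x1 y' where x1: "x1 \<in> cocycles M n" "y' \<in> carrier (Mdl N (n - 1))"
      "\<phi> n x1 = (y \<ominus>\<^bsub>Mdl N n\<^esub> \<phi> n x0) \<oplus>\<^bsub>Mdl N n\<^esub> Dif N (n - 1) y'"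
    using q[rule_format, of n] unfolding cohom_surj_def by blast
  show thesis
  proof
    show "x0 \<oplus>\<^bsub>Mdl M n\<^esub> x1 \<in> carrier (Mdl M n)" "y' \<in> carrier (Mdl N (n - 1))"
      using x0 x1 M.cocyclesD by (auto simp: abgc)
    show "Dif M n (x0 \<oplus>\<^bsub>Mdl M n\<^esub> x1) = x"
      using x0 x1 x M.cocyclesD by (auto simp: abgc add.commute)
    show "\<phi> n (x0 \<oplus>\<^bsub>Mdl M n\<^esub> x1) = y \<oplus>\<^bsub>Mdl N n\<^esub> Dif N (n - 1) y'"
      using x0 x1 y M.cocyclesD by (simp add: abg abge)
  qed
qed

end

section \<open>Computing in dg categories\<close>

abbreviation dM :: "('o, 'm, 'k) dg_cat \<Rightarrow> 'o \<Rightarrow> 'o \<Rightarrow> int \<Rightarrow> ('k, 'm) module" where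
  "dM A X Y \<equiv> Mdl (DHom A X Y)"

abbreviation dzero :: "('o, 'm, 'k) dg_cat \<Rightarrow> 'o \<Rightarrow> 'o \<Rightarrow> int \<Rightarrow> 'm" where
  "dzero A X Y n \<equiv> \<zero>\<^bsub>dM A X Y n\<^esub>"

text \<open>These rules push differentials inside by the Leibniz rule, expand compositions by
  linearity and associate them to the left. An identity between dg expressions thereby becomes one
  between sums of atoms, which \<open>abg\<close> settles.\<close>

named_theorems dgs

lemma koszul_zero [dgs]: "abelian_group M \<Longrightarrow> koszul M m \<zero>\<^bsub>M\<^esub> = \<zero>\<^bsub>M\<^esub>"
  by (simp add: koszul_def abgc)

context dg_category
begin

lemma DHom_is_complex: "X \<in> DObj A \<Longrightarrow> Y \<in> DObj A \<Longrightarrow> complex K (DHom A X Y)"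
  by (simp add: complex.intro DHom_complex)

lemma dmor_module [dgs]: "X \<in> DObj A \<Longrightarrow> Y \<in> DObj A \<Longrightarrow> module K (dM A X Y n)"
  by (rule complex.Mdl_module[OF DHom_is_complex])

lemma dmor_group [dgs]: "X \<in> DObj A \<Longrightarrow> Y \<in> DObj A \<Longrightarrow> abelian_group (dM A X Y n)"
  by (rule complex.Mdl_group[OF DHom_is_complex])

lemma dmor_smult [dgs]:
  assumes "X \<in> DObj A" "Y \<in> DObj A" "a \<in> carrier K" "x \<in> dmor A X Y n"
  shows "a \<odot>\<^bsub>dM A X Y n\<^esub> x \<in> dmor A X Y n"
    and "y \<in> dmor A X Y n \<Longrightarrow> a \<odot>\<^bsub>dM A X Y n\<^esub> (x \<oplus>\<^bsub>dM A X Y n\<^esub> y)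
      = a \<odot>\<^bsub>dM A X Y n\<^esub> x \<oplus>\<^bsub>dM A X Y n\<^esub> a \<odot>\<^bsub>dM A X Y n\<^esub> y"
    and "y \<in> dmor A X Y n \<Longrightarrow> a \<odot>\<^bsub>dM A X Y n\<^esub> (x \<ominus>\<^bsub>dM A X Y n\<^esub> y)
      = a \<odot>\<^bsub>dM A X Y n\<^esub> x \<ominus>\<^bsub>dM A X Y n\<^esub> a \<odot>\<^bsub>dM A X Y n\<^esub> y"
    and "a \<odot>\<^bsub>dM A X Y n\<^esub> (\<ominus>\<^bsub>dM A X Y n\<^esub> x) = \<ominus>\<^bsub>dM A X Y n\<^esub> (a \<odot>\<^bsub>dM A X Y n\<^esub> x)"
    and "a \<odot>\<^bsub>dM A X Y n\<^esub> (dzero A X Y n) = (dzero A X Y n)"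
  using module_smult[OF dmor_module[OF assms(1,2)] assms(3,4)] by auto

lemma ddif_simps [dgs]:
  assumes "X \<in> DObj A" "Y \<in> DObj A"
  shows "k = n + 1 \<Longrightarrow> x \<in> dmor A X Y n \<Longrightarrow> ddif A X Y n x \<in> dmor A X Y k"
    and "x \<in> dmor A X Y n \<Longrightarrow> y \<in> dmor A X Y n \<Longrightarrow>
      ddif A X Y n (x \<oplus>\<^bsub>dM A X Y n\<^esub> y) = ddif A X Y n x \<oplus>\<^bsub>dM A X Y (n+1)\<^esub> ddif A X Y n y"
    and "ddif A X Y n ((dzero A X Y n)) = (dzero A X Y (n+1))"
    and "x \<in> dmor A X Y n \<Longrightarrow>
      ddif A X Y n (\<ominus>\<^bsub>dM A X Y n\<^esub> x) = \<ominus>\<^bsub>dM A X Y (n+1)\<^esub> (ddif A X Y n x)"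
    and "x \<in> dmor A X Y n \<Longrightarrow> y \<in> dmor A X Y n \<Longrightarrow>
      ddif A X Y n (x \<ominus>\<^bsub>dM A X Y n\<^esub> y) = ddif A X Y n x \<ominus>\<^bsub>dM A X Y (n+1)\<^esub> ddif A X Y n y"
    and "k = n + 1 \<Longrightarrow> x \<in> dmor A X Y n \<Longrightarrow> ddif A X Y k (ddif A X Y n x) = (dzero A X Y (k+1))"
    and "a \<in> carrier K \<Longrightarrow> x \<in> dmor A X Y n \<Longrightarrow>
      ddif A X Y n (a \<odot>\<^bsub>dM A X Y n\<^esub> x) = a \<odot>\<^bsub>dM A X Y (n+1)\<^esub> ddif A X Y n x"
proof -
  interpret complex K "DHom A X Y" using assms by (rule DHom_is_complex)
  show "k = n + 1 \<Longrightarrow> x \<in> dmor A X Y n \<Longrightarrow> ddif A X Y n x \<in> dmor A X Y k"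
    and "x \<in> dmor A X Y n \<Longrightarrow> y \<in> dmor A X Y n \<Longrightarrow>
      ddif A X Y n (x \<oplus>\<^bsub>dM A X Y n\<^esub> y) = ddif A X Y n x \<oplus>\<^bsub>dM A X Y (n+1)\<^esub> ddif A X Y n y"
    and "ddif A X Y n ((dzero A X Y n)) = (dzero A X Y (n+1))"
    and "x \<in> dmor A X Y n \<Longrightarrow>
      ddif A X Y n (\<ominus>\<^bsub>dM A X Y n\<^esub> x) = \<ominus>\<^bsub>dM A X Y (n+1)\<^esub> (ddif A X Y n x)"
    and "x \<in> dmor A X Y n \<Longrightarrow> y \<in> dmor A X Y n \<Longrightarrow>
      ddif A X Y n (x \<ominus>\<^bsub>dM A X Y n\<^esub> y) = ddif A X Y n x \<ominus>\<^bsub>dM A X Y (n+1)\<^esub> ddif A X Y n y"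
    and "k = n + 1 \<Longrightarrow> x \<in> dmor A X Y n \<Longrightarrow> ddif A X Y k (ddif A X Y n x) = (dzero A X Y (k+1))"
    and "a \<in> carrier K \<Longrightarrow> x \<in> dmor A X Y n \<Longrightarrow>
      ddif A X Y n (a \<odot>\<^bsub>dM A X Y n\<^esub> x) = a \<odot>\<^bsub>dM A X Y (n+1)\<^esub> ddif A X Y n x"
    by (simp_all add: add.commute)
qed

lemma DCmp_simps [dgs]:
  assumes "X \<in> DObj A" "Y \<in> DObj A" "Z \<in> DObj A"
  shows "f \<in> dmor A X Y n \<Longrightarrow> g \<in> dmor A Y Z m \<Longrightarrow> k = m + n \<Longrightarrow> DCmp A X Y Z m n g f \<in> dmor A X Z k"
    and "f \<in> dmor A X Y n \<Longrightarrow> f' \<in> dmor A X Y n \<Longrightarrow> g \<in> dmor A Y Z m \<Longrightarrow>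
      DCmp A X Y Z m n g (f \<oplus>\<^bsub>dM A X Y n\<^esub> f')
        = DCmp A X Y Z m n g f \<oplus>\<^bsub>dM A X Z (m + n)\<^esub> DCmp A X Y Z m n g f'"
    and "f \<in> dmor A X Y n \<Longrightarrow> f' \<in> dmor A X Y n \<Longrightarrow> g \<in> dmor A Y Z m \<Longrightarrow>
      DCmp A X Y Z m n g (f \<ominus>\<^bsub>dM A X Y n\<^esub> f')
        = DCmp A X Y Z m n g f \<ominus>\<^bsub>dM A X Z (m + n)\<^esub> DCmp A X Y Z m n g f'"
    and "f \<in> dmor A X Y n \<Longrightarrow> g \<in> dmor A Y Z m \<Longrightarrow>
      DCmp A X Y Z m n g (\<ominus>\<^bsub>dM A X Y n\<^esub> f) = \<ominus>\<^bsub>dM A X Z (m + n)\<^esub> DCmp A X Y Z m n g f"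
    and "g \<in> dmor A Y Z m \<Longrightarrow> DCmp A X Y Z m n g ((dzero A X Y n)) = (dzero A X Z (m + n))"
    and "a \<in> carrier K \<Longrightarrow> f \<in> dmor A X Y n \<Longrightarrow> g \<in> dmor A Y Z m \<Longrightarrow>
      DCmp A X Y Z m n g (a \<odot>\<^bsub>dM A X Y n\<^esub> f) = a \<odot>\<^bsub>dM A X Z (m + n)\<^esub> DCmp A X Y Z m n g f"
    and "f \<in> dmor A X Y n \<Longrightarrow> g \<in> dmor A Y Z m \<Longrightarrow> g' \<in> dmor A Y Z m \<Longrightarrow>
      DCmp A X Y Z m n (g \<oplus>\<^bsub>dM A Y Z m\<^esub> g') f
        = DCmp A X Y Z m n g f \<oplus>\<^bsub>dM A X Z (m + n)\<^esub> DCmp A X Y Z m n g' f"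
    and "f \<in> dmor A X Y n \<Longrightarrow> g \<in> dmor A Y Z m \<Longrightarrow> g' \<in> dmor A Y Z m \<Longrightarrow>
      DCmp A X Y Z m n (g \<ominus>\<^bsub>dM A Y Z m\<^esub> g') f
        = DCmp A X Y Z m n g f \<ominus>\<^bsub>dM A X Z (m + n)\<^esub> DCmp A X Y Z m n g' f"
    and "f \<in> dmor A X Y n \<Longrightarrow> g \<in> dmor A Y Z m \<Longrightarrow>
      DCmp A X Y Z m n (\<ominus>\<^bsub>dM A Y Z m\<^esub> g) f = \<ominus>\<^bsub>dM A X Z (m + n)\<^esub> DCmp A X Y Z m n g f"
    and "f \<in> dmor A X Y n \<Longrightarrow> DCmp A X Y Z m n ((dzero A Y Z m)) f = (dzero A X Z (m + n))"
    and "a \<in> carrier K \<Longrightarrow> f \<in> dmor A X Y n \<Longrightarrow> g \<in> dmor A Y Z m \<Longrightarrow>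
      DCmp A X Y Z m n (a \<odot>\<^bsub>dM A Y Z m\<^esub> g) f = a \<odot>\<^bsub>dM A X Z (m + n)\<^esub> DCmp A X Y Z m n g f"
  using linear_mapD[OF DCmp_linear_right[OF assms, of g m n] dmor_module dmor_module]
    linear_mapD[OF DCmp_linear_left[OF assms, of f n m] dmor_module dmor_module] assms by auto

text \<open>The inner degree is a variable \<open>k\<close> with premise \<open>k = m + n\<close>.
  Arithmetic simplification destroys the literal sum, for instance when it is a numeral, and the
  rule must still apply.\<close>

lemma DCmp_left_assoc [dgs]:
  "\<lbrakk>W \<in> DObj A; X \<in> DObj A; Y \<in> DObj A; Z \<in> DObj A;
        f \<in> dmor A W X n; g \<in> dmor A X Y m; h \<in> dmor A Y Z l; k = m + n\<rbrakk>
        \<Longrightarrow> DCmp A W Y Z l k h (DCmp A W X Y m n g f)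
          = DCmp A W X Z (l + m) n (DCmp A X Y Z l m h g) f"
  using DCmp_assoc by simp

lemma DIdn_dmor [dgs]: "X \<in> DObj A \<Longrightarrow> k = 0 \<Longrightarrow> DIdn A X \<in> dmor A X X k"
  using DIdn_mor by simp

lemmas [dgs] = DCmp_DIdn_left DCmp_DIdn_right

lemma ddif_DCmp [dgs]:
  "\<lbrakk>X \<in> DObj A; Y \<in> DObj A; Z \<in> DObj A; f \<in> dmor A X Y n; g \<in> dmor A Y Z m; k = m + n\<rbrakk>
        \<Longrightarrow> ddif A X Z k (DCmp A X Y Z m n g f)
          = DCmp A X Y Z (m + 1) n (ddif A Y Z m g) f
            \<oplus>\<^bsub>dM A X Z (k + 1)\<^esub>
            koszul (dM A X Z (k + 1)) m (DCmp A X Y Z m (n + 1) g (ddif A X Y n f))"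
  using Leibniz by simp

lemma koszul_closed [dgs]:
  "X \<in> DObj A \<Longrightarrow> Y \<in> DObj A \<Longrightarrow> x \<in> dmor A X Y n \<Longrightarrow> koszul (dM A X Y n) m x \<in> dmor A X Y n"
  by (simp add: koszul_def dgs abgc)

text \<open>The Leibniz rule for \<open>1 1 = 1\<close> reads
  \<open>d 1 = d 1 + d 1\<close>.\<close>

lemma ddif_DIdn [dgs]:
  assumes "X \<in> DObj A" shows "ddif A X X 0 (DIdn A X) = (dzero A X X 1)"
proof -
  interpret G: abelian_group "dM A X X 1" using assms by (simp add: dgs)
  have "ddif A X X 0 (DIdn A X) = ddif A X X 0 (DIdn A X) \<oplus>\<^bsub>dM A X X 1\<^esub> ddif A X X 0 (DIdn A X)"
    using ddif_DCmp[OF assms assms assms DIdn_mor[OF assms] DIdn_mor[OF assms], of 0] assms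
    by (simp add: koszul_def dgs)
  then show ?thesis using assms by (metis DIdn_dmor G.add.r_cancel_one' add_0 ddif_simps(1))
qed

lemma koszul_simps [dgs]:
  "even m \<Longrightarrow> koszul M m x = x" "odd m \<Longrightarrow> koszul M m x = \<ominus>\<^bsub>M\<^esub> x"
  by (simp_all add: koszul_def)

end

section \<open>Cones as finite systems of equations, and the triangles of the homotopy
  category\<close>

section \<open>Cones are contractions\<close>

text \<open>
  The Yoneda lemma applied to the identity of the contractible twisted complex
  \<open>X \<rightarrow> Y \<rightarrow> Z\<close>: its null-homotopy has nine components.
\<close>

locale cone_contraction = dg_category K A
  for K :: "'k ring" and A :: "('o, 'm, 'k) dg_cat" +
  fixes X Y Z :: 'o and f i j \<alpha> \<beta> \<gamma> a1 b1 c1 a0 b0 c0 :: 'm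
  assumes obj: "X \<in> DObj A" "Y \<in> DObj A" "Z \<in> DObj A"
    and mors: "f \<in> dmor A X Y 0" "i \<in> dmor A Y Z 0" "j \<in> dmor A X Z (-1)"
      "\<alpha> \<in> dmor A Z X 1" "\<beta> \<in> dmor A Z Y 0" "\<gamma> \<in> dmor A Z Z (-1)"
      "a1 \<in> dmor A Y X 0" "b1 \<in> dmor A Y Y (-1)" "c1 \<in> dmor A Y Z (-2)"
      "a0 \<in> dmor A X X (-1)" "b0 \<in> dmor A X Y (-2)" "c0 \<in> dmor A X Z (-3)"
    and difs: "ddif A X Y 0 f = (dzero A X Y 1)"
      "ddif A Y Z 0 i = (dzero A Y Z 1)"
      "ddif A X Z (-1) j = DCmp A X Y Z 0 0 i f"
      "ddif A Z X 1 \<alpha> = (dzero A Z X 2)"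
      "ddif A Z Y 0 \<beta> = \<ominus>\<^bsub>dM A Z Y 1\<^esub> DCmp A Z X Y 0 1 f \<alpha>"
      "ddif A Z Z (-1) \<gamma> = DIdn A Z \<ominus>\<^bsub>dM A Z Z 0\<^esub>
        (DCmp A Z X Z (-1) 1 j \<alpha> \<oplus>\<^bsub>dM A Z Z 0\<^esub> DCmp A Z Y Z 0 0 i \<beta>)"
      "ddif A Y X 0 a1 = \<ominus>\<^bsub>dM A Y X 1\<^esub> DCmp A Y Z X 1 0 \<alpha> i"
      "ddif A Y Y (-1) b1 = DCmp A Y Z Y 0 0 \<beta> i \<ominus>\<^bsub>dM A Y Y 0\<^esub>
        (DIdn A Y \<oplus>\<^bsub>dM A Y Y 0\<^esub> DCmp A Y X Y 0 0 f a1)"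
      "ddif A Y Z (-2) c1 = \<ominus>\<^bsub>dM A Y Z (-1)\<^esub> (DCmp A Y Z Z (-1) 0 \<gamma> i \<oplus>\<^bsub>dM A Y Z (-1)\<^esub>
        (DCmp A Y X Z (-1) 0 j a1 \<oplus>\<^bsub>dM A Y Z (-1)\<^esub> DCmp A Y Y Z 0 (-1) i b1))"
      "ddif A X X (-1) a0 = (DIdn A X \<oplus>\<^bsub>dM A X X 0\<^esub> DCmp A X Y X 0 0 a1 f)
        \<ominus>\<^bsub>dM A X X 0\<^esub> DCmp A X Z X 1 (-1) \<alpha> j"
      "ddif A X Y (-2) b0 = DCmp A X Z Y 0 (-1) \<beta> j \<ominus>\<^bsub>dM A X Y (-1)\<^esub>
        (DCmp A X Y Y (-1) 0 b1 f \<oplus>\<^bsub>dM A X Y (-1)\<^esub> DCmp A X X Y 0 (-1) f a0)"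
      "ddif A X Z (-3) c0 = DCmp A X Y Z (-2) 0 c1 f \<ominus>\<^bsub>dM A X Z (-2)\<^esub> (DCmp A X Z Z (-1) (-1) \<gamma> j
        \<oplus>\<^bsub>dM A X Z (-2)\<^esub>
        (DCmp A X X Z (-1) (-1) j a0 \<oplus>\<^bsub>dM A X Z (-2)\<^esub> DCmp A X Y Z 0 (-2) i b0))"
begin

lemmas data = obj mors difs

text \<open>The triple \<open>(a, b, y)\<close> is a cocycle in the complex of morphisms from
  \<open>W\<close> to the contractible twisted complex. Composing it with the nine components of the
  null-homotopy gives the primitive \<open>(a', b', y')\<close>; the signs come from the shifts of
  \<open>X\<close> and \<open>Y\<close>.\<close>

lemma covariant:
  assumes W: "W \<in> DObj A" and m: "a \<in> dmor A W X (n + 2)" "b \<in> dmor A W Y (n + 1)" "y \<in> dmor A W Z n"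
    and d: "ddif A W X (n + 2) a = (dzero A W X (n + 3))"
      "ddif A W Y (n + 1) b = \<ominus>\<^bsub>dM A W Y (n + 2)\<^esub> DCmp A W X Y 0 (n + 2) f a"
      "ddif A W Z n y = DCmp A W X Z (-1) (n + 2) j a \<oplus>\<^bsub>dM A W Z (n + 1)\<^esub> DCmp A W Y Z 0 (n + 1) i b"
  obtains a' b' y' where "a' \<in> dmor A W X (n + 1)" "b' \<in> dmor A W Y n" "y' \<in> dmor A W Z (n - 1)"
    "ddif A W X (n + 1) a' = \<ominus>\<^bsub>dM A W X (n + 2)\<^esub> a"
    "ddif A W Y n b' = b \<ominus>\<^bsub>dM A W Y (n + 1)\<^esub> DCmp A W X Y 0 (n + 1) f a'"
    "ddif A W Z (n - 1) y' = y \<ominus>\<^bsub>dM A W Z n\<^esub>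
      (DCmp A W X Z (-1) (n + 1) j a' \<oplus>\<^bsub>dM A W Z n\<^esub> DCmp A W Y Z 0 n i b')"
proof
  let ?a = "DCmp A W Z X 1 n \<alpha> y \<ominus>\<^bsub>dM A W X (n + 1)\<^esub> (DCmp A W Y X 0 (n + 1) a1 b
    \<oplus>\<^bsub>dM A W X (n + 1)\<^esub> DCmp A W X X (-1) (n + 2) a0 a)"
  let ?b = "DCmp A W Z Y 0 n \<beta> y \<ominus>\<^bsub>dM A W Y n\<^esub> (DCmp A W Y Y (-1) (n + 1) b1 b
    \<oplus>\<^bsub>dM A W Y n\<^esub> DCmp A W X Y (-2) (n + 2) b0 a)"
  let ?y = "DCmp A W Z Z (-1) n \<gamma> y \<ominus>\<^bsub>dM A W Z (n - 1)\<^esub> (DCmp A W Y Z (-2) (n + 1) c1 b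
    \<oplus>\<^bsub>dM A W Z (n - 1)\<^esub> DCmp A W X Z (-3) (n + 2) c0 a)"
  show "?a \<in> dmor A W X (n + 1)" "?b \<in> dmor A W Y n" "?y \<in> dmor A W Z (n - 1)"
    using W m data by (simp_all add: dgs abgc)
  show "ddif A W X (n + 1) ?a = \<ominus>\<^bsub>dM A W X (n + 2)\<^esub> a"
    by (rule abeqI) (use W m d data in \<open>simp add: dgs abg algebra_simps\<close>)
  show "ddif A W Y n ?b = b \<ominus>\<^bsub>dM A W Y (n + 1)\<^esub> DCmp A W X Y 0 (n + 1) f ?a"
    by (rule abeqI) (use W m d data in \<open>simp add: dgs abg algebra_simps\<close>)
  show "ddif A W Z (n - 1) ?y = y \<ominus>\<^bsub>dM A W Z n\<^esub>
      (DCmp A W X Z (-1) (n + 1) j ?a \<oplus>\<^bsub>dM A W Z n\<^esub> DCmp A W Y Z 0 n i ?b)"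
    by (rule abeqI) (use W m d data in \<open>simp add: dgs abg algebra_simps\<close>)
qed

end

text \<open>Converse of \<open>quasi_iso_lift\<close>: the lifting property with
  \<open>x = 0\<close> is surjectivity, and one degree lower, with its second equation dropped, it
  is injectivity.\<close>

lemma (in complex_map) quasi_isoI_lift:
  assumes "\<And>n x y. \<lbrakk>x \<in> carrier (Mdl M (n + 1)); Dif M (n + 1) x = \<zero>\<^bsub>Mdl M (n + 2)\<^esub>;
      y \<in> carrier (Mdl N n); \<phi> (n + 1) x = Dif N n y\<rbrakk> \<Longrightarrow>
      \<exists>x'\<in>carrier (Mdl M n). \<exists>y'\<in>carrier (Mdl N (n - 1)). Dif M n x' = x \<and> \<phi> n x' = y \<oplus>\<^bsub>Mdl N n\<^esub> Dif N (n - 1) y'"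
  shows "cohom_surj M N \<phi> n" "cohom_inj M N \<phi> n"
proof -
  show "cohom_surj M N \<phi> n" unfolding cohom_surj_def
  proof
    fix y assume "y \<in> cocycles N n"
    then show "\<exists>x\<in>cocycles M n. \<exists>z\<in>carrier (Mdl N (n - 1)). \<phi> n x = y \<oplus>\<^bsub>Mdl N n\<^esub> Dif N (n - 1) z"
      using assms[of "\<zero>\<^bsub>Mdl M (n + 1)\<^esub>" n y] by (auto simp: cocycles_def abgc add.commute)
  qed
  show "cohom_inj M N \<phi> n" unfolding cohom_inj_def
  proof (intro ballI impI)
    fix x z assume "x \<in> cocycles M n" "z \<in> carrier (Mdl N (n - 1))" "\<phi> n x = Dif N (n - 1) z"
    then show "\<exists>y\<in>carrier (Mdl M (n - 1)). x = Dif M (n - 1) y"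
      using assms[of x "n - 1" z] by (auto simp: cocycles_def add.commute)
  qed
qed

section \<open>Direct sums\<close>

lemma direct_sum_module:
  assumes "module K M" "module K N"
  shows "module K (direct_sum M N)"
proof -
  interpret M: module K M by fact
  interpret N: module K N by fact
  show ?thesis
  proof (rule moduleI)
    show "cring K" by (rule M.cring_axioms)
    show "abelian_group (direct_sum M N)"
    proof (rule abelian_groupI)
      fix x assume "x \<in> carrier (direct_sum M N)"
      then show "\<exists>y\<in>carrier (direct_sum M N). y \<oplus>\<^bsub>direct_sum M N\<^esub> x = \<zero>\<^bsub>direct_sum M N\<^esub>"
        by (intro bexI[of _ "(\<ominus>\<^bsub>M\<^esub> fst x, \<ominus>\<^bsub>N\<^esub> snd x)"]) (auto simp: direct_sum_def M.M.l_neg N.M.l_neg)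
    qed (auto simp: direct_sum_def abg M.M.abelian_group_axioms N.M.abelian_group_axioms)
  qed (auto simp: direct_sum_def M.smult_l_distr N.smult_l_distr M.smult_r_distr N.smult_r_distr
      M.smult_assoc1 N.smult_assoc1)
qed

lemma direct_sum_simps [simp]:
  "carrier (direct_sum M N) = carrier M \<times> carrier N"
  "\<zero>\<^bsub>direct_sum M N\<^esub> = (\<zero>\<^bsub>M\<^esub>, \<zero>\<^bsub>N\<^esub>)"
  "(a, b) \<oplus>\<^bsub>direct_sum M N\<^esub> (c, d) = (a \<oplus>\<^bsub>M\<^esub> c, b \<oplus>\<^bsub>N\<^esub> d)"
  "k \<odot>\<^bsub>direct_sum M N\<^esub> (a, b) = (k \<odot>\<^bsub>M\<^esub> a, k \<odot>\<^bsub>N\<^esub> b)"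
  by (simp_all add: direct_sum_def)

lemma direct_sum_minus:
  assumes "module K M" "module K N" "a \<in> carrier M" "b \<in> carrier N"
  shows "\<ominus>\<^bsub>direct_sum M N\<^esub> (a, b) = (\<ominus>\<^bsub>M\<^esub> a, \<ominus>\<^bsub>N\<^esub> b)"
proof -
  interpret M: module K M by fact
  interpret N: module K N by fact
  interpret D: module K "direct_sum M N" by (rule direct_sum_module; fact)
  show ?thesis
    using assms(3,4) by (intro D.M.minus_equality) (auto simp: M.M.l_neg N.M.l_neg)
qed

section \<open>Cones in dg categories\<close>

text \<open>This is acyclicity of the mapping cone of the comparison
  \<open>(a, b) \<mapsto> j a + i b\<close> from \<open>is_cone\<close>, written out:
  \<open>(a, b)\<close> is a cocycle of the cone complex whose image is bounded by \<open>y\<close>,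
  and the conclusion is a primitive of the pair formed by both. In this form solutions can be lifted
  or perturbed component by component.\<close>

definition cone_acyclic :: "('o, 'm, 'k) dg_cat \<Rightarrow> 'o \<Rightarrow> 'o \<Rightarrow> 'o \<Rightarrow> 'm \<Rightarrow> 'm \<Rightarrow> 'm \<Rightarrow> bool" where
  "cone_acyclic A X Y Z f i j \<longleftrightarrow> (\<forall>W\<in>DObj A. \<forall>n. \<forall>a\<in>dmor A W X (n + 2). \<forall>b\<in>dmor A W Y (n + 1). \<forall>y\<in>dmor A W Z n.
     ddif A W X (n + 2) a = (dzero A W X (n + 3)) \<and>
      ddif A W Y (n + 1) b = \<ominus>\<^bsub>dM A W Y (n + 2)\<^esub> DCmp A W X Y 0 (n + 2) f a \<and>
      ddif A W Z n y = DCmp A W X Z (-1) (n + 2) j a \<oplus>\<^bsub>dM A W Z (n + 1)\<^esub> DCmp A W Y Z 0 (n + 1) i b \<longrightarrow>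
     (\<exists>a'\<in>dmor A W X (n + 1). \<exists>b'\<in>dmor A W Y n. \<exists>y'\<in>dmor A W Z (n - 1).
    ddif A W X (n + 1) a' = \<ominus>\<^bsub>dM A W X (n + 2)\<^esub> a \<and>
    ddif A W Y n b' = b \<ominus>\<^bsub>dM A W Y (n + 1)\<^esub> DCmp A W X Y 0 (n + 1) f a' \<and>
    ddif A W Z (n - 1) y' = y \<ominus>\<^bsub>dM A W Z n\<^esub>
      (DCmp A W X Z (-1) (n + 1) j a' \<oplus>\<^bsub>dM A W Z n\<^esub> DCmp A W Y Z 0 n i b')))"

definition cone_data :: "('o, 'm, 'k) dg_cat \<Rightarrow> 'o \<Rightarrow> 'o \<Rightarrow> 'o \<Rightarrow> 'm \<Rightarrow> 'm \<Rightarrow> 'm \<Rightarrow> bool" where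
  "cone_data A X Y Z f i j \<longleftrightarrow> X \<in> DObj A \<and> Y \<in> DObj A \<and> Z \<in> DObj A \<and>
     f \<in> dmor A X Y 0 \<and> i \<in> dmor A Y Z 0 \<and> j \<in> dmor A X Z (-1) \<and>
     ddif A X Y 0 f = (dzero A X Y 1) \<and>
     ddif A Y Z 0 i = (dzero A Y Z 1) \<and>
     ddif A X Z (-1) j = DCmp A X Y Z 0 0 i f"

context dg_category
begin

lemma cone_complex_complex:
  assumes "X \<in> DObj A" "Y \<in> DObj A" "W \<in> DObj A" "f \<in> dmor A X Y 0" "ddif A X Y 0 f = (dzero A X Y 1)"
  shows "complex K (cone_complex A X Y f W)"
proof
  show "is_complex K (cone_complex A X Y f W)"
    unfolding is_complex_def
  proof (intro conjI allI ballI)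
    fix n
    show "module K (Mdl (cone_complex A X Y f W) n)"
      using assms by (simp add: cone_complex_def direct_sum_module dgs)
    show "linear_map K (Mdl (cone_complex A X Y f W) n) (Mdl (cone_complex A X Y f W) (n + 1)) (Dif (cone_complex A X Y f W) n)"
      unfolding linear_map_def using assms
      by (auto simp: cone_complex_def dgs abg algebra_simps intro!: abeqI)
    show "Dif (cone_complex A X Y f W) (n + 1) (Dif (cone_complex A X Y f W) n x) = \<zero>\<^bsub>Mdl (cone_complex A X Y f W) (n + 2)\<^esub>"
      if "x \<in> carrier (Mdl (cone_complex A X Y f W) n)" for x
      using that assms by (auto simp: cone_complex_def dgs abg algebra_simps intro!: abeqI)
  qed
qed

lemma cone_complex_map:
  assumes "cone_data A X Y Z f i j" "W \<in> DObj A"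
  shows "complex_map K (cone_complex A X Y f W) (DHom A W Z)
        (\<lambda>n (a, b). DCmp A W X Z (-1) (n + 1) j a
                     \<oplus>\<^bsub>dM A W Z n\<^esub> DCmp A W Y Z 0 n i b)"
proof -
  note a = assms[unfolded cone_data_def]
  interpret M: complex K "cone_complex A X Y f W" using a by (intro cone_complex_complex) auto
  interpret N: complex K "DHom A W Z" using a by (intro DHom_is_complex) auto
  show ?thesis
  proof
    show "chain_map K (cone_complex A X Y f W) (DHom A W Z)
        (\<lambda>n (a, b). DCmp A W X Z (-1) (n + 1) j a
                     \<oplus>\<^bsub>dM A W Z n\<^esub> DCmp A W Y Z 0 n i b)"
      unfolding chain_map_def
    proof (intro conjI allI ballI)
      fix n
      show "linear_map K (Mdl (cone_complex A X Y f W) n) (dM A W Z n)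
        (\<lambda>(a, b). DCmp A W X Z (-1) (n + 1) j a \<oplus>\<^bsub>dM A W Z n\<^esub> DCmp A W Y Z 0 n i b)"
        unfolding linear_map_def using a
        by (auto simp: cone_complex_def dgs abg algebra_simps intro!: abeqI)
      fix x assume "x \<in> carrier (Mdl (cone_complex A X Y f W) n)"
      then show "(case Dif (cone_complex A X Y f W) n x of (a, b) \<Rightarrow> DCmp A W X Z (-1) (n + 1 + 1) j a
                     \<oplus>\<^bsub>dM A W Z (n + 1)\<^esub> DCmp A W Y Z 0 (n + 1) i b) =
         Dif (DHom A W Z) n (case x of (a, b) \<Rightarrow> DCmp A W X Z (-1) (n + 1) j a
                     \<oplus>\<^bsub>dM A W Z n\<^esub> DCmp A W Y Z 0 n i b)"
        using a by (auto simp: cone_complex_def dgs abg algebra_simps intro!: abeqI)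
    qed
  qed
qed

text \<open>The two directions are \<open>quasi_iso_lift\<close> and \<open>quasi_isoI_lift\<close>
  for the comparison map of each test object \<open>W\<close>.\<close>

lemma is_cone_iff: "is_cone K A X Y Z f i j \<longleftrightarrow> cone_data A X Y Z f i j \<and> cone_acyclic A X Y Z f i j"
proof -
  let ?q = "\<forall>W\<in>DObj A. quasi_iso K (cone_complex A X Y f W) (DHom A W Z)
        (\<lambda>n (a, b). DCmp A W X Z (-1) (n + 1) j a
                     \<oplus>\<^bsub>dM A W Z n\<^esub> DCmp A W Y Z 0 n i b)"
  have *: "is_cone K A X Y Z f i j \<longleftrightarrow> cone_data A X Y Z f i j \<and> ?q"
    unfolding is_cone_def cone_data_def cocycles_def by auto
  have "?q \<longleftrightarrow> cone_acyclic A X Y Z f i j" if cd: "cone_data A X Y Z f i j"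
  proof
    note c = cd[unfolded cone_data_def]
    assume q: ?q
    show "cone_acyclic A X Y Z f i j"
      unfolding cone_acyclic_def
    proof (intro ballI allI impI; elim conjE)
      fix W n a b y assume W: "W \<in> DObj A" and m: "a \<in> dmor A W X (n + 2)" "b \<in> dmor A W Y (n + 1)" "y \<in> dmor A W Z n"
        and d: "ddif A W X (n + 2) a = (dzero A W X (n + 3))"
          "ddif A W Y (n + 1) b = \<ominus>\<^bsub>dM A W Y (n + 2)\<^esub> DCmp A W X Y 0 (n + 2) f a"
          "ddif A W Z n y = DCmp A W X Z (-1) (n + 2) j a \<oplus>\<^bsub>dM A W Z (n + 1)\<^esub> DCmp A W Y Z 0 (n + 1) i b"
      let ?\<phi> = "\<lambda>n (a, b). DCmp A W X Z (-1) (n + 1) j a \<oplus>\<^bsub>dM A W Z n\<^esub> DCmp A W Y Z 0 n i b"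
      interpret complex_map K "cone_complex A X Y f W" "DHom A W Z" ?\<phi>
        using cd W by (rule cone_complex_map)
      have q': "\<forall>n. cohom_surj (cone_complex A X Y f W) (DHom A W Z) ?\<phi> n \<and> cohom_inj (cone_complex A X Y f W) (DHom A W Z) ?\<phi> n"
        using q W quasi_iso_iff by blast
      obtain x' y' where x: "x' \<in> carrier (Mdl (cone_complex A X Y f W) n)" "y' \<in> dmor A W Z (n - 1)"
        "Dif (cone_complex A X Y f W) n x' = (a, b)" "?\<phi> n x' = y \<oplus>\<^bsub>dM A W Z n\<^esub> ddif A W Z (n - 1) y'"
      proof (rule quasi_iso_lift[OF q', of "(a, b)" n y])
        show "(a, b) \<in> carrier (Mdl (cone_complex A X Y f W) (n + 1))"
          using m by (simp add: cone_complex_def algebra_simps)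
        show "Dif (cone_complex A X Y f W) (n + 1) (a, b) = \<zero>\<^bsub>Mdl (cone_complex A X Y f W) (n + 2)\<^esub>"
          using m W d c by (simp add: cone_complex_def dgs abg algebra_simps)
        show "y \<in> dmor A W Z n" by fact
        show "?\<phi> (n + 1) (a, b) = ddif A W Z n y"
          using m W d c by (simp add: algebra_simps)
      qed blast
      obtain a' b' where ab: "x' = (a', b')" by (cases x')
      have ab': "a' \<in> dmor A W X (n + 1)" "b' \<in> dmor A W Y n" "\<ominus>\<^bsub>dM A W X (n + 2)\<^esub> (ddif A W X (n + 1) a') = a"
         "DCmp A W X Y 0 (n + 1) f a' \<oplus>\<^bsub>dM A W Y (n + 1)\<^esub> ddif A W Y n b' = b"
         "DCmp A W X Z (-1) (n + 1) j a' \<oplus>\<^bsub>dM A W Z n\<^esub> DCmp A W Y Z 0 n i b' = y \<oplus>\<^bsub>dM A W Z n\<^esub> ddif A W Z (n - 1) y'"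
        using x by (simp_all add: ab cone_complex_def)
      show "\<exists>a'\<in>dmor A W X (n + 1). \<exists>b'\<in>dmor A W Y n. \<exists>y'\<in>dmor A W Z (n - 1).
          ddif A W X (n + 1) a' = \<ominus>\<^bsub>dM A W X (n + 2)\<^esub> a \<and>
          ddif A W Y n b' = b \<ominus>\<^bsub>dM A W Y (n + 1)\<^esub> DCmp A W X Y 0 (n + 1) f a' \<and>
          ddif A W Z (n - 1) y' = y \<ominus>\<^bsub>dM A W Z n\<^esub>
            (DCmp A W X Z (-1) (n + 1) j a' \<oplus>\<^bsub>dM A W Z n\<^esub> DCmp A W Y Z 0 n i b')"
      \<comment> \<open>The lift satisfies \<open>\<phi> x' = y + d y'\<close>, while
        \<open>cone_acyclic\<close> asks for \<open>d y' = y - \<phi> x'\<close>; hence the negative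
        of \<open>y'\<close>.\<close>
      proof (rule bexI[of _ a'], rule bexI[of _ b'], rule bexI[of _ "\<ominus>\<^bsub>dM A W Z (n - 1)\<^esub> y'"], intro conjI)
        show "ddif A W X (n + 1) a' = \<ominus>\<^bsub>dM A W X (n + 2)\<^esub> a"
          unfolding ab'(3)[symmetric] using ab'(1,2) W c by (simp add: dgs abgc algebra_simps)
        show "ddif A W Y n b' = b \<ominus>\<^bsub>dM A W Y (n + 1)\<^esub> DCmp A W X Y 0 (n + 1) f a'"
          unfolding ab'(4)[symmetric] by (rule abeqI) (use ab'(1,2) W c in \<open>simp add: dgs abg algebra_simps\<close>)
        show "ddif A W Z (n - 1) (\<ominus>\<^bsub>dM A W Z (n - 1)\<^esub> y') = y \<ominus>\<^bsub>dM A W Z n\<^esub>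
            (DCmp A W X Z (-1) (n + 1) j a' \<oplus>\<^bsub>dM A W Z n\<^esub> DCmp A W Y Z 0 n i b')"
          unfolding ab'(5) by (rule abeqI) (use ab'(1,2) x(2) m W c in \<open>simp add: dgs abg algebra_simps\<close>)
        show "\<ominus>\<^bsub>dM A W Z (n - 1)\<^esub> y' \<in> dmor A W Z (n - 1)" "b' \<in> dmor A W Y n" "a' \<in> dmor A W X (n + 1)"
          using ab' x W c by (simp_all add: dgs abgc)
      qed
    qed
  next
    note c = cd[unfolded cone_data_def]
    assume ac: "cone_acyclic A X Y Z f i j"
    show ?q
    proof
      fix W assume W: "W \<in> DObj A"
      let ?\<phi> = "\<lambda>n (a, b). DCmp A W X Z (-1) (n + 1) j a \<oplus>\<^bsub>dM A W Z n\<^esub> DCmp A W Y Z 0 n i b"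
      interpret complex_map K "cone_complex A X Y f W" "DHom A W Z" ?\<phi>
        using cd W by (rule cone_complex_map)
      have "\<exists>x'\<in>carrier (Mdl (cone_complex A X Y f W) n). \<exists>y'\<in>dmor A W Z (n - 1).
          Dif (cone_complex A X Y f W) n x' = x \<and> ?\<phi> n x' = y \<oplus>\<^bsub>dM A W Z n\<^esub> ddif A W Z (n - 1) y'"
        if x: "x \<in> carrier (Mdl (cone_complex A X Y f W) (n + 1))"
          "Dif (cone_complex A X Y f W) (n + 1) x = \<zero>\<^bsub>Mdl (cone_complex A X Y f W) (n + 2)\<^esub>"
          "y \<in> dmor A W Z n" "?\<phi> (n + 1) x = ddif A W Z n y" for n x y
      proof -
        obtain a b where ab: "x = (a, b)" by (cases x)
        have m: "a \<in> dmor A W X (n + 2)" "b \<in> dmor A W Y (n + 1)"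
          using x(1) by (simp_all add: ab cone_complex_def algebra_simps)
        have d: "\<ominus>\<^bsub>dM A W X (n + 3)\<^esub> (ddif A W X (n + 2) a) = (dzero A W X (n + 3))"
          "DCmp A W X Y 0 (n + 2) f a \<oplus>\<^bsub>dM A W Y (n + 2)\<^esub> ddif A W Y (n + 1) b = (dzero A W Y (n + 2))"
          using x(2) by (simp_all add: ab cone_complex_def algebra_simps)
        have "ddif A W X (n + 2) a = \<ominus>\<^bsub>dM A W X (n + 3)\<^esub> (\<ominus>\<^bsub>dM A W X (n + 3)\<^esub> (ddif A W X (n + 2) a))"
          using W c m by (simp add: dgs abgc)
        then have d1: "ddif A W X (n + 2) a = (dzero A W X (n + 3))"
          unfolding d(1) using W c by (simp add: dgs abgc)
        have "ddif A W Y (n + 1) b = (DCmp A W X Y 0 (n + 2) f a \<oplus>\<^bsub>dM A W Y (n + 2)\<^esub> ddif A W Y (n + 1) b)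
            \<ominus>\<^bsub>dM A W Y (n + 2)\<^esub> DCmp A W X Y 0 (n + 2) f a"
          by (rule abeqI) (use W c m in \<open>simp add: dgs abg algebra_simps\<close>)
        then have d2: "ddif A W Y (n + 1) b = \<ominus>\<^bsub>dM A W Y (n + 2)\<^esub> DCmp A W X Y 0 (n + 2) f a"
          unfolding d(2) using W c m by (simp add: dgs abgc)
        have d3: "ddif A W Z n y = DCmp A W X Z (-1) (n + 2) j a \<oplus>\<^bsub>dM A W Z (n + 1)\<^esub> DCmp A W Y Z 0 (n + 1) i b"
          using x(4) by (simp add: ab algebra_simps)
        obtain a' b' y' where r: "a'\<in>dmor A W X (n + 1)" "b'\<in>dmor A W Y n" "y'\<in>dmor A W Z (n - 1)"
          "ddif A W X (n + 1) a' = \<ominus>\<^bsub>dM A W X (n + 2)\<^esub> a"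
          "ddif A W Y n b' = b \<ominus>\<^bsub>dM A W Y (n + 1)\<^esub> DCmp A W X Y 0 (n + 1) f a'"
          "ddif A W Z (n - 1) y' = y \<ominus>\<^bsub>dM A W Z n\<^esub>
            (DCmp A W X Z (-1) (n + 1) j a' \<oplus>\<^bsub>dM A W Z n\<^esub> DCmp A W Y Z 0 n i b')"
          using ac W m x(3) d1 d2 d3 unfolding cone_acyclic_def by blast
        show ?thesis
        proof (intro bexI[of _ "(a', b')"] bexI[of _ "\<ominus>\<^bsub>dM A W Z (n - 1)\<^esub> y'"] conjI)
          show "Dif (cone_complex A X Y f W) n (a', b') = x"
            unfolding ab using r(1,2,4,5) W c m
            by (auto simp: cone_complex_def dgs abg algebra_simps intro!: abeqI)
          have "ddif A W Z (n - 1) (\<ominus>\<^bsub>dM A W Z (n - 1)\<^esub> y') = \<ominus>\<^bsub>dM A W Z n\<^esub> (y \<ominus>\<^bsub>dM A W Z n\<^esub>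
            (DCmp A W X Z (-1) (n + 1) j a' \<oplus>\<^bsub>dM A W Z n\<^esub> DCmp A W Y Z 0 n i b'))"
            using r(3) W c by (simp add: dgs r(6)[symmetric])
          then show "?\<phi> n (a', b') = y \<oplus>\<^bsub>dM A W Z n\<^esub> ddif A W Z (n - 1) (\<ominus>\<^bsub>dM A W Z (n - 1)\<^esub> y')"
            by (intro abeqI) (use r(1,2) x(3) W c in \<open>simp add: dgs abg algebra_simps\<close>)
        qed (use r(1-3) W c in \<open>auto simp: cone_complex_def dgs abgc\<close>)
      qed
      then show "quasi_iso K (cone_complex A X Y f W) (DHom A W Z) ?\<phi>"
        using quasi_isoI_lift quasi_iso_iff by blast
    qed
  qed
  then show ?thesis using * by blast
qed

text \<open>Yoneda by hand: acyclicity is applied to the universal test objects \<open>Z\<close>,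
  \<open>Y\<close> and \<open>X\<close> in turn. Each time, the failure of the components found so
  far to be a null-homotopy of the identity is a cocycle, and its primitive supplies the next three
  components.\<close>

lemma is_cone_contraction:
  assumes "is_cone K A X Y Z f i j"
  shows "\<exists>\<alpha> \<beta> \<gamma> a1 b1 c1 a0 b0 c0. cone_contraction K A X Y Z f i j \<alpha> \<beta> \<gamma> a1 b1 c1 a0 b0 c0"
proof -
  have c: "X \<in> DObj A" "Y \<in> DObj A" "Z \<in> DObj A"
     "f \<in> dmor A X Y 0" "i \<in> dmor A Y Z 0" "j \<in> dmor A X Z (-1)"
     "ddif A X Y 0 f = (dzero A X Y 1)"
     "ddif A Y Z 0 i = (dzero A Y Z 1)"
     "ddif A X Z (-1) j = DCmp A X Y Z 0 0 i f"
    using assms unfolding is_cone_iff cone_data_def by auto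
  have lift: "\<exists>a'\<in>dmor A W X (n + 1). \<exists>b'\<in>dmor A W Y n. \<exists>y'\<in>dmor A W Z (n - 1).
    ddif A W X (n + 1) a' = \<ominus>\<^bsub>dM A W X (n + 2)\<^esub> a \<and>
    ddif A W Y n b' = b \<ominus>\<^bsub>dM A W Y (n + 1)\<^esub> DCmp A W X Y 0 (n + 1) f a' \<and>
    ddif A W Z (n - 1) y' = y \<ominus>\<^bsub>dM A W Z n\<^esub>
      (DCmp A W X Z (-1) (n + 1) j a' \<oplus>\<^bsub>dM A W Z n\<^esub> DCmp A W Y Z 0 n i b')"
    if "W \<in> DObj A" "a\<in>dmor A W X (n + 2)" "b\<in>dmor A W Y (n + 1)" "y\<in>dmor A W Z n"
     "ddif A W X (n + 2) a = (dzero A W X (n + 3))"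
      "ddif A W Y (n + 1) b = \<ominus>\<^bsub>dM A W Y (n + 2)\<^esub> DCmp A W X Y 0 (n + 2) f a"
      "ddif A W Z n y = DCmp A W X Z (-1) (n + 2) j a \<oplus>\<^bsub>dM A W Z (n + 1)\<^esub> DCmp A W Y Z 0 (n + 1) i b"
    for W n a b y
    using assms that unfolding is_cone_iff cone_acyclic_def by blast
  \<comment> \<open>\<open>W = Z\<close> with the cocycle \<open>(0, 0, 1)\<close>: the identity of
    \<open>Z\<close> is compared with the part that comes from the cone.\<close>
  obtain \<alpha> \<beta> \<gamma> where z: "\<alpha> \<in> dmor A Z X 1" "\<beta> \<in> dmor A Z Y 0" "\<gamma> \<in> dmor A Z Z (-1)"
      "ddif A Z X 1 \<alpha> = (dzero A Z X 2)"
      "ddif A Z Y 0 \<beta> = \<ominus>\<^bsub>dM A Z Y 1\<^esub> DCmp A Z X Y 0 1 f \<alpha>"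
      "ddif A Z Z (-1) \<gamma> = DIdn A Z \<ominus>\<^bsub>dM A Z Z 0\<^esub>
        (DCmp A Z X Z (-1) 1 j \<alpha> \<oplus>\<^bsub>dM A Z Z 0\<^esub> DCmp A Z Y Z 0 0 i \<beta>)"
    using lift[of Z "(dzero A Z X 2)" 0 "(dzero A Z Y 1)" "DIdn A Z"] c
    by (auto simp: dgs abgc)
  obtain a1 b1 c1 where y: "a1 \<in> dmor A Y X 0" "b1 \<in> dmor A Y Y (-1)" "c1 \<in> dmor A Y Z (-2)"
    "ddif A Y X 0 a1 = \<ominus>\<^bsub>dM A Y X 1\<^esub> DCmp A Y Z X 1 0 \<alpha> i"
    "ddif A Y Y (-1) b1 = (DCmp A Y Z Y 0 0 \<beta> i \<ominus>\<^bsub>dM A Y Y 0\<^esub> DIdn A Y) \<ominus>\<^bsub>dM A Y Y 0\<^esub> DCmp A Y X Y 0 0 f a1"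
    "ddif A Y Z (-2) c1 = \<ominus>\<^bsub>dM A Y Z (-1)\<^esub> DCmp A Y Z Z (-1) 0 \<gamma> i \<ominus>\<^bsub>dM A Y Z (-1)\<^esub>
        (DCmp A Y X Z (-1) 0 j a1 \<oplus>\<^bsub>dM A Y Z (-1)\<^esub> DCmp A Y Y Z 0 (-1) i b1)"
  proof -
    \<comment> \<open>\<open>W = Y\<close>, \<open>n = -1\<close>: restricted along
      \<open>i\<close>, the components \<open>\<alpha>\<close>, \<open>\<beta>\<close>,
      \<open>\<gamma>\<close> reproduce the identity of \<open>Y\<close> only up to homotopy. This
      triple is the defect.\<close>
    let ?a = "DCmp A Y Z X 1 0 \<alpha> i" and ?b = "DCmp A Y Z Y 0 0 \<beta> i \<ominus>\<^bsub>dM A Y Y 0\<^esub> DIdn A Y"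
      and ?y = "\<ominus>\<^bsub>dM A Y Z (-1)\<^esub> DCmp A Y Z Z (-1) 0 \<gamma> i"
    have "ddif A Y X (-1 + 2) ?a = (dzero A Y X (-1+3))"
      "ddif A Y Y (-1 + 1) ?b = \<ominus>\<^bsub>dM A Y Y (-1 + 2)\<^esub> DCmp A Y X Y 0 (-1 + 2) f ?a"
      using c z by (simp_all add: dgs abgc)
    moreover have "ddif A Y Z (-1) ?y = DCmp A Y X Z (-1) (-1 + 2) j ?a \<oplus>\<^bsub>dM A Y Z (-1 + 1)\<^esub> DCmp A Y Y Z 0 (-1 + 1) i ?b"
      by (rule abeqI) (use c z in \<open>simp add: dgs abg\<close>)
    ultimately show thesis
      using lift[of Y ?a "-1" ?b ?y] c z that by (auto simp: dgs abgc)
  qed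
  obtain a0 b0 c0 where x: "a0 \<in> dmor A X X (-1)" "b0 \<in> dmor A X Y (-2)" "c0 \<in> dmor A X Z (-3)"
    "ddif A X X (-1) a0 = \<ominus>\<^bsub>dM A X X 0\<^esub> (DCmp A X Z X 1 (-1) \<alpha> j \<ominus>\<^bsub>dM A X X 0\<^esub>
       (DIdn A X \<oplus>\<^bsub>dM A X X 0\<^esub> DCmp A X Y X 0 0 a1 f))"
    "ddif A X Y (-2) b0 = (DCmp A X Z Y 0 (-1) \<beta> j \<ominus>\<^bsub>dM A X Y (-1)\<^esub> DCmp A X Y Y (-1) 0 b1 f)
        \<ominus>\<^bsub>dM A X Y (-1)\<^esub> DCmp A X X Y 0 (-1) f a0"
    "ddif A X Z (-3) c0 = (DCmp A X Y Z (-2) 0 c1 f \<ominus>\<^bsub>dM A X Z (-2)\<^esub> DCmp A X Z Z (-1) (-1) \<gamma> j)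
        \<ominus>\<^bsub>dM A X Z (-2)\<^esub>
        (DCmp A X X Z (-1) (-1) j a0 \<oplus>\<^bsub>dM A X Z (-2)\<^esub> DCmp A X Y Z 0 (-2) i b0)"
  proof -
    \<comment> \<open>\<open>W = X\<close>, \<open>n = -2\<close>: the same defect along
      \<open>j\<close>, corrected by the components \<open>a1\<close>, \<open>b1\<close>,
      \<open>c1\<close> composed with \<open>f\<close>.\<close>
    let ?a = "DCmp A X Z X 1 (-1) \<alpha> j \<ominus>\<^bsub>dM A X X 0\<^esub> (DIdn A X \<oplus>\<^bsub>dM A X X 0\<^esub> DCmp A X Y X 0 0 a1 f)"
      and ?b = "DCmp A X Z Y 0 (-1) \<beta> j \<ominus>\<^bsub>dM A X Y (-1)\<^esub> DCmp A X Y Y (-1) 0 b1 f"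
      and ?y = "DCmp A X Y Z (-2) 0 c1 f \<ominus>\<^bsub>dM A X Z (-2)\<^esub> DCmp A X Z Z (-1) (-1) \<gamma> j"
    have "ddif A X X (-2 + 2) ?a = (dzero A X X (-2+3))"
      by (rule abeqI) (use c z y in \<open>simp add: dgs abg\<close>)
    moreover have "ddif A X Y (-2 + 1) ?b = \<ominus>\<^bsub>dM A X Y (-2 + 2)\<^esub> DCmp A X X Y 0 (-2 + 2) f ?a"
      by (rule abeqI) (use c z y in \<open>simp add: dgs abg\<close>)
    moreover have "ddif A X Z (-2) ?y = DCmp A X X Z (-1) (-2 + 2) j ?a \<oplus>\<^bsub>dM A X Z (-2 + 1)\<^esub> DCmp A X Y Z 0 (-2 + 1) i ?b"
      by (rule abeqI) (use c z y in \<open>simp add: dgs abg\<close>)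
    ultimately show thesis
      using lift[of X ?a "-2" ?b ?y] c z y that by (auto simp: dgs abgc)
  qed
  have "cone_contraction K A X Y Z f i j \<alpha> \<beta> \<gamma> a1 b1 c1 a0 b0 c0"
    by unfold_locales (use c z y x in \<open>auto simp: dgs abg intro!: abeqI\<close>)
  then show ?thesis by blast
qed

end

context cone_contraction
begin

lemma is_cone: "is_cone K A X Y Z f i j"
  unfolding is_cone_iff cone_data_def cone_acyclic_def
proof (intro conjI allI ballI impI data; elim conjE)
  fix W n a b y
  assume "W \<in> DObj A" "a \<in> dmor A W X (n + 2)" "b \<in> dmor A W Y (n + 1)" "y \<in> dmor A W Z n"
    "ddif A W X (n + 2) a = (dzero A W X (n + 3))"
    "ddif A W Y (n + 1) b = \<ominus>\<^bsub>dM A W Y (n + 2)\<^esub> DCmp A W X Y 0 (n + 2) f a"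
    "ddif A W Z n y = DCmp A W X Z (-1) (n + 2) j a \<oplus>\<^bsub>dM A W Z (n + 1)\<^esub> DCmp A W Y Z 0 (n + 1) i b"
  from covariant[OF this] show "\<exists>a'\<in>dmor A W X (n + 1). \<exists>b'\<in>dmor A W Y n. \<exists>y'\<in>dmor A W Z (n - 1).
    ddif A W X (n + 1) a' = \<ominus>\<^bsub>dM A W X (n + 2)\<^esub> a \<and>
    ddif A W Y n b' = b \<ominus>\<^bsub>dM A W Y (n + 1)\<^esub> DCmp A W X Y 0 (n + 1) f a' \<and>
    ddif A W Z (n - 1) y' = y \<ominus>\<^bsub>dM A W Z n\<^esub>
      (DCmp A W X Z (-1) (n + 1) j a' \<oplus>\<^bsub>dM A W Z n\<^esub> DCmp A W Y Z 0 n i b')"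
    by metis
qed

text \<open>The null-homotopy also acts by precomposition. A pair \<open>(v, w)\<close>, that is
  \<open>v\<close> together with a null-homotopy of \<open>v f\<close>, is a cocycle of morphisms
  out of the cone, and \<open>v \<beta> + w \<alpha>\<close> extends it to \<open>Z\<close> up to
  homotopy. The definition of a cone says nothing directly about morphisms out of \<open>Z\<close>,
  so the explicit components are essential here.\<close>

lemma contravariant_surj:
  assumes W: "W \<in> DObj A" and m: "v \<in> dmor A Y W n" "w \<in> dmor A X W (n - 1)"
    and d: "ddif A Y W n v = (dzero A Y W (n + 1))"
      "ddif A X W (n - 1) w = koszul (dM A X W n) n (DCmp A X Y W n 0 v f)"
  obtains z v' w' where "z \<in> dmor A Z W n" "v' \<in> dmor A Y W (n - 1)" "w' \<in> dmor A X W (n - 2)"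
    "ddif A Z W n z = (dzero A Z W (n + 1))"
    "DCmp A Y Z W n 0 z i = v \<oplus>\<^bsub>dM A Y W n\<^esub> ddif A Y W (n - 1) v'"
    "DCmp A X Z W n (-1) z j = w \<oplus>\<^bsub>dM A X W (n - 1)\<^esub>
      (koszul (dM A X W (n - 1)) n (DCmp A X Y W (n - 1) 0 v' f)
        \<oplus>\<^bsub>dM A X W (n - 1)\<^esub> ddif A X W (n - 2) w')"
proof
  let ?z = "DCmp A Z Y W n 0 v \<beta> \<oplus>\<^bsub>dM A Z W n\<^esub> DCmp A Z X W (n - 1) 1 w \<alpha>"
  let ?v = "koszul (dM A Y W (n - 1)) n (DCmp A Y Y W n (-1) v b1 \<oplus>\<^bsub>dM A Y W (n - 1)\<^esub> DCmp A Y X W (n - 1) 0 w a1)"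
  let ?w = "koszul (dM A X W (n - 2)) n (DCmp A X Y W n (-2) v b0 \<oplus>\<^bsub>dM A X W (n - 2)\<^esub> DCmp A X X W (n - 1) (-1) w a0)"
  show "?z \<in> dmor A Z W n" "?v \<in> dmor A Y W (n - 1)" "?w \<in> dmor A X W (n - 2)"
    using W m data by (simp_all add: dgs abgc)
  show "ddif A Z W n ?z = (dzero A Z W (n + 1))"
    by (rule abeqI, cases "even n") (use W m d data in \<open>simp_all add: dgs abg algebra_simps\<close>)
  show "DCmp A Y Z W n 0 ?z i = v \<oplus>\<^bsub>dM A Y W n\<^esub> ddif A Y W (n - 1) ?v"
    by (rule abeqI, cases "even n") (use W m d data in \<open>simp_all add: dgs abg algebra_simps\<close>)
  show "DCmp A X Z W n (-1) ?z j = w \<oplus>\<^bsub>dM A X W (n - 1)\<^esub>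
      (koszul (dM A X W (n - 1)) n (DCmp A X Y W (n - 1) 0 ?v f)
        \<oplus>\<^bsub>dM A X W (n - 1)\<^esub> ddif A X W (n - 2) ?w)"
    by (rule abeqI, cases "even n") (use W m d data in \<open>simp_all add: dgs abg algebra_simps\<close>)
qed

text \<open>Uniqueness of the extension: a null-homotopy \<open>(v, w)\<close> of the restriction of
  \<open>z\<close>, composed with \<open>\<beta>\<close> and \<open>\<alpha>\<close>, bounds
  \<open>z\<close> up to the error \<open>z \<gamma>\<close>, which the homotopy
  \<open>\<gamma>\<close> of the contraction accounts for.\<close>

lemma contravariant_inj:
  assumes W: "W \<in> DObj A" and m: "z \<in> dmor A Z W n" "v \<in> dmor A Y W (n - 1)" "w \<in> dmor A X W (n - 2)"
    and d: "ddif A Z W n z = (dzero A Z W (n + 1))"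
    "DCmp A Y Z W n 0 z i = ddif A Y W (n - 1) v"
    "DCmp A X Z W n (-1) z j = 
      koszul (dM A X W (n - 1)) n (DCmp A X Y W (n - 1) 0 v f)
        \<oplus>\<^bsub>dM A X W (n - 1)\<^esub> ddif A X W (n - 2) w"
  obtains y where "y \<in> dmor A Z W (n - 1)" "z = ddif A Z W (n - 1) y"
proof
  let ?y = "DCmp A Z Y W (n - 1) 0 v \<beta> \<oplus>\<^bsub>dM A Z W (n - 1)\<^esub> (DCmp A Z X W (n - 2) 1 w \<alpha>
     \<oplus>\<^bsub>dM A Z W (n - 1)\<^esub> koszul (dM A Z W (n - 1)) n (DCmp A Z Z W n (-1) z \<gamma>))"
  show "?y \<in> dmor A Z W (n - 1)"
    using W m data by (simp_all add: dgs abgc)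
  show "z = ddif A Z W (n - 1) ?y"
    by (rule abeqI, cases "even n") (use W m d data in \<open>simp_all add: dgs abg algebra_simps\<close>)
qed

end

section \<open>Linear categories\<close>

named_theorems cats

context linear_category
begin

lemma mor_group [cats]: "X \<in> Obj C \<Longrightarrow> Y \<in> Obj C \<Longrightarrow> abelian_group (Hom C X Y)"
  by (rule module.is_abelian_group_M[OF Hom_module])

lemma Cmp_simps [cats]:
  assumes "X \<in> Obj C" "Y \<in> Obj C" "Z \<in> Obj C"
  shows "f \<in> mor C X Y \<Longrightarrow> g \<in> mor C Y Z \<Longrightarrow> Cmp C X Y Z g f \<in> mor C X Z"
    and "f \<in> mor C X Y \<Longrightarrow> f' \<in> mor C X Y \<Longrightarrow> g \<in> mor C Y Z \<Longrightarrow>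
      Cmp C X Y Z g (f \<oplus>\<^bsub>Hom C X Y\<^esub> f') = Cmp C X Y Z g f \<oplus>\<^bsub>Hom C X Z\<^esub> Cmp C X Y Z g f'"
    and "f \<in> mor C X Y \<Longrightarrow> f' \<in> mor C X Y \<Longrightarrow> g \<in> mor C Y Z \<Longrightarrow>
      Cmp C X Y Z g (f \<ominus>\<^bsub>Hom C X Y\<^esub> f') = Cmp C X Y Z g f \<ominus>\<^bsub>Hom C X Z\<^esub> Cmp C X Y Z g f'"
    and "f \<in> mor C X Y \<Longrightarrow> g \<in> mor C Y Z \<Longrightarrow> Cmp C X Y Z g (\<ominus>\<^bsub>Hom C X Y\<^esub> f) = \<ominus>\<^bsub>Hom C X Z\<^esub> Cmp C X Y Z g f"
    and "g \<in> mor C Y Z \<Longrightarrow> Cmp C X Y Z g (\<zero>\<^bsub>Hom C X Y\<^esub>) = \<zero>\<^bsub>Hom C X Z\<^esub>"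
    and "a \<in> carrier K \<Longrightarrow> f \<in> mor C X Y \<Longrightarrow> g \<in> mor C Y Z \<Longrightarrow>
      Cmp C X Y Z g (a \<odot>\<^bsub>Hom C X Y\<^esub> f) = a \<odot>\<^bsub>Hom C X Z\<^esub> Cmp C X Y Z g f"
    and "f \<in> mor C X Y \<Longrightarrow> g \<in> mor C Y Z \<Longrightarrow> g' \<in> mor C Y Z \<Longrightarrow>
      Cmp C X Y Z (g \<oplus>\<^bsub>Hom C Y Z\<^esub> g') f = Cmp C X Y Z g f \<oplus>\<^bsub>Hom C X Z\<^esub> Cmp C X Y Z g' f"
    and "f \<in> mor C X Y \<Longrightarrow> g \<in> mor C Y Z \<Longrightarrow> g' \<in> mor C Y Z \<Longrightarrow>
      Cmp C X Y Z (g \<ominus>\<^bsub>Hom C Y Z\<^esub> g') f = Cmp C X Y Z g f \<ominus>\<^bsub>Hom C X Z\<^esub> Cmp C X Y Z g' f"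
    and "f \<in> mor C X Y \<Longrightarrow> g \<in> mor C Y Z \<Longrightarrow> Cmp C X Y Z (\<ominus>\<^bsub>Hom C Y Z\<^esub> g) f = \<ominus>\<^bsub>Hom C X Z\<^esub> Cmp C X Y Z g f"
    and "f \<in> mor C X Y \<Longrightarrow> Cmp C X Y Z (\<zero>\<^bsub>Hom C Y Z\<^esub>) f = \<zero>\<^bsub>Hom C X Z\<^esub>"
    and "a \<in> carrier K \<Longrightarrow> f \<in> mor C X Y \<Longrightarrow> g \<in> mor C Y Z \<Longrightarrow>
      Cmp C X Y Z (a \<odot>\<^bsub>Hom C Y Z\<^esub> g) f = a \<odot>\<^bsub>Hom C X Z\<^esub> Cmp C X Y Z g f"
  using linear_mapD[OF Cmp_linear_right[OF assms, of g] Hom_module Hom_module]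
    linear_mapD[OF Cmp_linear_left[OF assms, of f] Hom_module Hom_module] assms by auto

lemma Cmp_left_assoc [cats]:
  "\<lbrakk>W \<in> Obj C; X \<in> Obj C; Y \<in> Obj C; Z \<in> Obj C; f \<in> mor C W X; g \<in> mor C X Y; h \<in> mor C Y Z\<rbrakk>
    \<Longrightarrow> Cmp C W Y Z h (Cmp C W X Y g f) = Cmp C W X Z (Cmp C X Y Z h g) f"
  by (rule Cmp_assoc)

lemmas [cats] = Idn_mor Cmp_Idn_left Cmp_Idn_right

text \<open>Under left association a known composite \<open>g f\<close> is no longer a subterm of
  \<open>(h g) f\<close>. This form lets an equation for \<open>g f\<close> be used behind a further
  factor.\<close>

lemma Cmp_prefix:
  "\<lbrakk>Cmp C W X Y g f = c; W \<in> Obj C; X \<in> Obj C; Y \<in> Obj C; Z \<in> Obj C;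
    f \<in> mor C W X; g \<in> mor C X Y; h \<in> mor C Y Z\<rbrakk>
    \<Longrightarrow> Cmp C W X Z (Cmp C X Y Z h g) f = Cmp C W Y Z h c"
  using Cmp_assoc by metis

end

lemma linear_category_cong:
  assumes "linear_category K C" "Obj D = Obj C" "Hom D = Hom C" "Cmp D = Cmp C" "Idn D = Idn C"
  shows "linear_category K D"
  using assms unfolding linear_category_def linear_category_axioms_def by simp

section \<open>The homotopy category of a dg category\<close>

text \<open>Operations on classes are unions over representatives; it is enough to see that changing
  the representative by a coboundary leaves the result fixed.\<close>

lemma (in complex) UN_cclass:
  assumes "f \<in> carrier (Mdl M n)"
    and "\<And>k. k \<in> carrier (Mdl M (n - 1)) \<Longrightarrow> g (f \<oplus>\<^bsub>Mdl M n\<^esub> Dif M (n - 1) k) = c"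
  shows "(\<Union>x\<in>cclass M n f. g x) = c"
proof (rule UN_constant_eq[of f])
  show "f \<in> cclass M n f" using assms cclass_self by simp
  show "\<forall>x\<in>cclass M n f. g x = c"
  proof
    fix x assume "x \<in> cclass M n f"
    then have x: "x \<in> carrier (Mdl M n)" "x \<ominus>\<^bsub>Mdl M n\<^esub> f \<in> coboundaries M n"
      using assms cclass_mem cclass_eq_iff by auto
    then obtain k where "k \<in> carrier (Mdl M (n - 1))" "x \<ominus>\<^bsub>Mdl M n\<^esub> f = Dif M (n - 1) k"
      by (auto simp: coboundaries_iff)
    moreover from this have "x = f \<oplus>\<^bsub>Mdl M n\<^esub> Dif M (n - 1) k"
      using x assms by (simp add: abge abelian_group_ac(1))
    ultimately show "g x = c" using assms(2) by simp
  qed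
qed

lemma (in complex) cohomology_module: "module K (cohomology M n)"
proof -
  interpret G: module K "Mdl M n" by simp
  have c: "x \<in> cocycles M n \<Longrightarrow> x \<in> carrier (Mdl M n)" for x by (rule cocyclesD)
  have cz: "\<zero>\<^bsub>Mdl M n\<^esub> \<in> cocycles M n"
    and ca: "\<And>x y. x \<in> cocycles M n \<Longrightarrow> y \<in> cocycles M n \<Longrightarrow> x \<oplus>\<^bsub>Mdl M n\<^esub> y \<in> cocycles M n"
    and cn: "\<And>x. x \<in> cocycles M n \<Longrightarrow> \<ominus>\<^bsub>Mdl M n\<^esub> x \<in> cocycles M n"
    and cs: "\<And>a x. a \<in> carrier K \<Longrightarrow> x \<in> cocycles M n \<Longrightarrow> a \<odot>\<^bsub>Mdl M n\<^esub> x \<in> cocycles M n"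
    using module_smult(5)[OF Mdl_module, where x = "\<zero>\<^bsub>Mdl M (n+1)\<^esub>"]
    by (auto simp: cocycles_def abgc)
  note add = cohomology_add[OF c c]
  note smult = cohomology_smult[OF c]
  show ?thesis
  proof (rule moduleI)
    show "cring K" by (rule G.cring_axioms)
    show "abelian_group (cohomology M n)"
    proof (rule abelian_groupI)
      fix x assume "x \<in> carrier (cohomology M n)"
      then obtain f where f: "f \<in> cocycles M n" "x = cclass M n f" by (auto simp: cohomology_carrier)
      show "\<exists>y\<in>carrier (cohomology M n). y \<oplus>\<^bsub>cohomology M n\<^esub> x = \<zero>\<^bsub>cohomology M n\<^esub>"
      proof
        show "cclass M n (\<ominus>\<^bsub>Mdl M n\<^esub> f) \<oplus>\<^bsub>cohomology M n\<^esub> x = \<zero>\<^bsub>cohomology M n\<^esub>"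
          using f cn by (simp add: add cohomology_zero c G.M.l_neg)
        show "cclass M n (\<ominus>\<^bsub>Mdl M n\<^esub> f) \<in> carrier (cohomology M n)"
          using f cn by (auto simp: cohomology_carrier)
      qed
    qed (auto simp: cohomology_carrier add ca c cz cohomology_zero G.M.a_ac)
  qed (auto simp: cohomology_carrier add smult ca cs c G.smult_l_distr G.smult_r_distr G.smult_assoc1)
qed

context dg_category
begin

lemma DCmp_prefix:
  "\<lbrakk>DCmp A W X Y m n g f = c; W \<in> DObj A; X \<in> DObj A; Y \<in> DObj A; Z \<in> DObj A;
    f \<in> dmor A W X n; g \<in> dmor A X Y m; h \<in> dmor A Y Z l; k = l + m\<rbrakk>
    \<Longrightarrow> DCmp A W X Z k n (DCmp A X Y Z l m h g) f = DCmp A W Y Z l (m + n) h c"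
  using DCmp_assoc by metis

lemma dcocyc_iff [dgs]: "f \<in> dcocyc A X Y n \<longleftrightarrow> f \<in> dmor A X Y n \<and> ddif A X Y n f = (dzero A X Y (n + 1))"
  by (simp add: cocycles_def)

lemma dcls_eqI:
  assumes "X \<in> DObj A" "Y \<in> DObj A" "g \<in> dmor A X Y 0" "h \<in> dmor A X Y (-1)"
    "f = g \<oplus>\<^bsub>dM A X Y 0\<^esub> ddif A X Y (-1) h"
  shows "dcls A X Y f = dcls A X Y g"
proof -
  interpret complex K "DHom A X Y" using assms by (intro DHom_is_complex)
  have "f \<in> dmor A X Y 0" using assms by (simp add: dgs abgc)
  moreover have "f \<ominus>\<^bsub>dM A X Y 0\<^esub> g = ddif A X Y (-1) h"
    unfolding assms(5) by (rule abeqI) (use assms(1-4) in \<open>simp add: dgs abg\<close>)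
  ultimately show ?thesis
    using assms by (subst cclass_eq_iff) (auto simp: coboundaries_iff)
qed

lemma dcls_eqE:
  assumes "X \<in> DObj A" "Y \<in> DObj A" "f \<in> dmor A X Y 0" "g \<in> dmor A X Y 0" "dcls A X Y f = dcls A X Y g"
  obtains h where "h \<in> dmor A X Y (-1)" "f = g \<oplus>\<^bsub>dM A X Y 0\<^esub> ddif A X Y (-1) h"
proof -
  interpret complex K "DHom A X Y" using assms by (intro DHom_is_complex)
  obtain h where h: "h \<in> dmor A X Y (-1)" "f \<ominus>\<^bsub>dM A X Y 0\<^esub> g = ddif A X Y (-1) h"
    using cclass_eq_iff[of f 0 g] assms by (auto simp: coboundaries_iff)
  have "f = g \<oplus>\<^bsub>dM A X Y 0\<^esub> (f \<ominus>\<^bsub>dM A X Y 0\<^esub> g)"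
    by (rule abeqI) (use assms(1-4) in \<open>simp add: dgs abg\<close>)
  then show thesis using that[OF h(1)] by (simp add: h(2))
qed

lemma UN_dcls:
  assumes "X \<in> DObj A" "Y \<in> DObj A" "f \<in> dmor A X Y 0"
    and "\<And>k. k \<in> dmor A X Y (-1) \<Longrightarrow> g (f \<oplus>\<^bsub>dM A X Y 0\<^esub> ddif A X Y (-1) k) = c"
  shows "(\<Union>x\<in>dcls A X Y f. g x) = c"
  by (rule complex.UN_cclass[OF DHom_is_complex[OF assms(1,2)] assms(3)]) (simp add: assms(4))

lemma H0_sel [simp]:
  "Obj (H0 K A) = DObj A" "Obj (H0cat A) = DObj A"
  "Hom (H0 K A) X Y = cohomology (DHom A X Y) 0" "Hom (H0cat A) X Y = cohomology (DHom A X Y) 0"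
  "Idn (H0 K A) X = dcls A X X (DIdn A X)" "Idn (H0cat A) X = dcls A X X (DIdn A X)"
  "Cmp (H0 K A) = Cmp (H0cat A)" "sob (H0 K A) = sus_obj A"
  by (simp_all add: H0_def lin_cat.extend_def H0cat_def)

lemma H0_mor: "carrier (cohomology (DHom A X Y) 0) = dcls A X Y ` dcocyc A X Y 0"
  by (simp add: cohomology_def)

lemma H0_Cmp:
  assumes o: "X \<in> DObj A" "Y \<in> DObj A" "Z \<in> DObj A" and f: "f \<in> dcocyc A X Y 0" and g: "g \<in> dcocyc A Y Z 0"
  shows "Cmp (H0cat A) X Y Z (dcls A Y Z g) (dcls A X Y f) = dcls A X Z (DCmp A X Y Z 0 0 g f)"
proof -
  have f': "f \<in> dmor A X Y 0" "ddif A X Y 0 f = (dzero A X Y 1)" using f by (auto simp: dgs)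
  have g': "g \<in> dmor A Y Z 0" "ddif A Y Z 0 g = (dzero A Y Z 1)" using g by (auto simp: dgs)
  have "(\<Union>g\<in>dcls A Y Z g. \<Union>f\<in>dcls A X Y f. dcls A X Z (DCmp A X Y Z 0 0 g f)) = dcls A X Z (DCmp A X Y Z 0 0 g f)"
  proof (rule UN_dcls[OF o(2,3) g'(1)], rule UN_dcls[OF o(1,2) f'(1)])
    fix k l assume k: "k \<in> dmor A Y Z (-1)" and l: "l \<in> dmor A X Y (-1)"
    show "dcls A X Z (DCmp A X Y Z 0 0 (g \<oplus>\<^bsub>dM A Y Z 0\<^esub> ddif A Y Z (-1) k)
            (f \<oplus>\<^bsub>dM A X Y 0\<^esub> ddif A X Y (-1) l)) = dcls A X Z (DCmp A X Y Z 0 0 g f)"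
    proof (rule dcls_eqI[OF o(1,3)])
      \<comment> \<open>The three summands bound the three terms of the expanded product other than
        \<open>g f\<close>; \<open>f\<close>, \<open>g\<close> and \<open>d l\<close> are
        closed.\<close>
      show "DCmp A X Y Z (-1) 0 k f \<oplus>\<^bsub>dM A X Z (-1)\<^esub> (DCmp A X Y Z 0 (-1) g l \<oplus>\<^bsub>dM A X Z (-1)\<^esub>
        DCmp A X Y Z (-1) 0 k (ddif A X Y (-1) l)) \<in> dmor A X Z (-1)"
        using o f' g' k l by (simp add: dgs abgc)
      show "DCmp A X Y Z 0 0 (g \<oplus>\<^bsub>dM A Y Z 0\<^esub> ddif A Y Z (-1) k)
            (f \<oplus>\<^bsub>dM A X Y 0\<^esub> ddif A X Y (-1) l) = DCmp A X Y Z 0 0 g f \<oplus>\<^bsub>dM A X Z 0\<^esub>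
          ddif A X Z (-1) (DCmp A X Y Z (-1) 0 k f \<oplus>\<^bsub>dM A X Z (-1)\<^esub> (DCmp A X Y Z 0 (-1) g l \<oplus>\<^bsub>dM A X Z (-1)\<^esub>
        DCmp A X Y Z (-1) 0 k (ddif A X Y (-1) l)))"
        by (rule abeqI) (use o f' g' k l in \<open>simp add: dgs abg\<close>)
    qed (use o f' g' in \<open>simp add: dgs\<close>)
  qed
  then show ?thesis by (simp add: H0cat_def)
qed

lemma dcocyc_DCmp: 
  "\<lbrakk>X \<in> DObj A; Y \<in> DObj A; Z \<in> DObj A; f \<in> dcocyc A X Y n; g \<in> dcocyc A Y Z m; k = m + n\<rbrakk> \<Longrightarrow> DCmp A X Y Z m n g f \<in> dcocyc A X Z k"
  by (cases "even m") (simp_all add: dgs abgc algebra_simps)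

lemma dcocyc_DIdn: "X \<in> DObj A \<Longrightarrow> DIdn A X \<in> dcocyc A X X 0"
  by (simp add: dgs)

lemma dcocyc_group: 
  assumes "X \<in> DObj A" "Y \<in> DObj A"
  shows "f \<in> dcocyc A X Y n \<Longrightarrow> g \<in> dcocyc A X Y n \<Longrightarrow> f \<oplus>\<^bsub>dM A X Y n\<^esub> g \<in> dcocyc A X Y n"
    and "a \<in> carrier K \<Longrightarrow> f \<in> dcocyc A X Y n \<Longrightarrow> a \<odot>\<^bsub>dM A X Y n\<^esub> f \<in> dcocyc A X Y n"
  using module_smult(5)[OF dmor_module[OF assms, of "n+1"], where x = "(dzero A X Y (n+1))"] assms
  by (simp_all add: dgs abgc)

lemma dcls_add: 
  assumes "X \<in> DObj A" "Y \<in> DObj A" "f \<in> dcocyc A X Y 0" "g \<in> dcocyc A X Y 0"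
  shows "dcls A X Y f \<oplus>\<^bsub>cohomology (DHom A X Y) 0\<^esub> dcls A X Y g = dcls A X Y (f \<oplus>\<^bsub>dM A X Y 0\<^esub> g)"
  using complex.cohomology_add[OF DHom_is_complex[OF assms(1,2)]] assms by (simp add: dgs)

lemma dcls_smult: 
  assumes "X \<in> DObj A" "Y \<in> DObj A" "f \<in> dcocyc A X Y 0" "a \<in> carrier K"
  shows "a \<odot>\<^bsub>cohomology (DHom A X Y) 0\<^esub> dcls A X Y f = dcls A X Y (a \<odot>\<^bsub>dM A X Y 0\<^esub> f)"
  using complex.cohomology_smult[OF DHom_is_complex[OF assms(1,2)]] assms by (simp add: dgs)

lemma H0cat_linear_category: "linear_category K (H0cat A)"
proof (intro linear_category.intro linear_category_axioms.intro)
  show "cring K" by (rule cring_axioms)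
next
  fix X Y Z assume o: "X \<in> Obj (H0cat A)" "Y \<in> Obj (H0cat A)" "Z \<in> Obj (H0cat A)"
  { fix g assume "g \<in> mor (H0cat A) Y Z"
    then show "linear_map K (Hom (H0cat A) X Y) (Hom (H0cat A) X Z) (Cmp (H0cat A) X Y Z g)"
      using o by (auto simp: linear_map_def H0_mor H0_Cmp dcls_add dcls_smult dcocyc_DCmp dcocyc_group)
        (simp_all add: dgs) }
  { fix f assume "f \<in> mor (H0cat A) X Y"
    then show "linear_map K (Hom (H0cat A) Y Z) (Hom (H0cat A) X Z) (\<lambda>g. Cmp (H0cat A) X Y Z g f)"
      using o by (auto simp: linear_map_def H0_mor H0_Cmp dcls_add dcls_smult dcocyc_DCmp dcocyc_group)
        (simp_all add: dgs) }
next
  fix W X Y Z f g h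
  assume o: "W \<in> Obj (H0cat A)" "X \<in> Obj (H0cat A)" "Y \<in> Obj (H0cat A)" "Z \<in> Obj (H0cat A)"
    and m: "f \<in> mor (H0cat A) W X" "g \<in> mor (H0cat A) X Y" "h \<in> mor (H0cat A) Y Z"
  show "Cmp (H0cat A) W Y Z h (Cmp (H0cat A) W X Y g f) = Cmp (H0cat A) W X Z (Cmp (H0cat A) X Y Z h g) f"
  proof -
    obtain f' g' h' where *: "f' \<in> dcocyc A W X 0" "g' \<in> dcocyc A X Y 0" "h' \<in> dcocyc A Y Z 0"
      "f = dcls A W X f'" "g = dcls A X Y g'" "h = dcls A Y Z h'"
      using m o by (auto simp: H0_mor)
    moreover have "DCmp A W Y Z 0 0 h' (DCmp A W X Y 0 0 g' f') = DCmp A W X Z 0 0 (DCmp A X Y Z 0 0 h' g') f'"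
      using * o by (simp add: dgs)
    ultimately show ?thesis using o by (simp add: H0_Cmp dcocyc_DCmp)
  qed
next
  fix X Y assume o: "X \<in> Obj (H0cat A)" "Y \<in> Obj (H0cat A)"
  show "module K (Hom (H0cat A) X Y)"
    using o complex.cohomology_module[OF DHom_is_complex] by simp
next
  fix X assume "X \<in> Obj (H0cat A)"
  then show "Idn (H0cat A) X \<in> mor (H0cat A) X X"
    by (simp add: H0_mor dcocyc_DIdn)
next
  fix X Y assume o: "X \<in> Obj (H0cat A)" "Y \<in> Obj (H0cat A)"
  fix f assume f: "f \<in> mor (H0cat A) X Y"
  show "Cmp (H0cat A) X Y Y (Idn (H0cat A) Y) f = f" "Cmp (H0cat A) X X Y f (Idn (H0cat A) X) = f"
    using o f by (auto simp: H0_mor H0_Cmp dcocyc_DIdn) (simp_all add: dgs)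
qed

lemma H0_linear_category: "linear_category K (H0 K A)"
  by (rule linear_category_cong[OF H0cat_linear_category]) (auto simp: fun_eq_iff H0_def lin_cat.extend_def)

end

section \<open>Dg functors\<close>

locale dg_functor_between = A: dg_category K A + B: dg_category K B
  for K :: "'k ring" and A :: "('o, 'm, 'k) dg_cat" and B :: "('p, 'n, 'k) dg_cat" +
  fixes F :: "('o, 'm, 'p, 'n) dg_func"
  assumes dg_functor: "dg_functor K A B F"
begin

lemma dobj_closed [dgs]: "X \<in> DObj A \<Longrightarrow> dobj F X \<in> DObj B"
  using dg_functor by (auto simp: dg_functor_def)

lemma dmap_chain_map: "X \<in> DObj A \<Longrightarrow> Y \<in> DObj A \<Longrightarrow> chain_map K (DHom A X Y) (DHom B (dobj F X) (dobj F Y)) (dmap F X Y)"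
  using dg_functor by (auto simp: dg_functor_def)

lemma dmap_complex_map: "X \<in> DObj A \<Longrightarrow> Y \<in> DObj A \<Longrightarrow> complex_map K (DHom A X Y) (DHom B (dobj F X) (dobj F Y)) (dmap F X Y)"
  by (simp add: complex_map_def complex_map_axioms_def dmap_chain_map A.DHom_is_complex B.DHom_is_complex dobj_closed)

lemma dmap_simps [dgs]:
  assumes "X \<in> DObj A" "Y \<in> DObj A"
  shows "f \<in> dmor A X Y n \<Longrightarrow> dmap F X Y n f \<in> dmor B (dobj F X) (dobj F Y) n"
    and "f \<in> dmor A X Y n \<Longrightarrow> g \<in> dmor A X Y n \<Longrightarrow> dmap F X Y n (f \<oplus>\<^bsub>dM A X Y n\<^esub> g)
       = dmap F X Y n f \<oplus>\<^bsub>dM B (dobj F X) (dobj F Y) n\<^esub> dmap F X Y n g"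
    and "f \<in> dmor A X Y n \<Longrightarrow> g \<in> dmor A X Y n \<Longrightarrow> dmap F X Y n (f \<ominus>\<^bsub>dM A X Y n\<^esub> g)
       = dmap F X Y n f \<ominus>\<^bsub>dM B (dobj F X) (dobj F Y) n\<^esub> dmap F X Y n g"
    and "f \<in> dmor A X Y n \<Longrightarrow> dmap F X Y n (\<ominus>\<^bsub>dM A X Y n\<^esub> f)
       = \<ominus>\<^bsub>dM B (dobj F X) (dobj F Y) n\<^esub> dmap F X Y n f"
    and "dmap F X Y n ((dzero A X Y n)) = (dzero B (dobj F X) (dobj F Y) n)"
    and "a \<in> carrier K \<Longrightarrow> f \<in> dmor A X Y n \<Longrightarrow> dmap F X Y n (a \<odot>\<^bsub>dM A X Y n\<^esub> f)
       = a \<odot>\<^bsub>dM B (dobj F X) (dobj F Y) n\<^esub> dmap F X Y n f"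
    and "f \<in> dmor A X Y n \<Longrightarrow> ddif B (dobj F X) (dobj F Y) n (dmap F X Y n f) = dmap F X Y (n + 1) (ddif A X Y n f)"
proof -
  interpret complex_map K "DHom A X Y" "DHom B (dobj F X) (dobj F Y)" "dmap F X Y"
    using assms by (rule dmap_complex_map)
  show "f \<in> dmor A X Y n \<Longrightarrow> dmap F X Y n f \<in> dmor B (dobj F X) (dobj F Y) n"
    and "f \<in> dmor A X Y n \<Longrightarrow> g \<in> dmor A X Y n \<Longrightarrow> dmap F X Y n (f \<oplus>\<^bsub>dM A X Y n\<^esub> g)
       = dmap F X Y n f \<oplus>\<^bsub>dM B (dobj F X) (dobj F Y) n\<^esub> dmap F X Y n g"
    and "f \<in> dmor A X Y n \<Longrightarrow> g \<in> dmor A X Y n \<Longrightarrow> dmap F X Y n (f \<ominus>\<^bsub>dM A X Y n\<^esub> g)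
       = dmap F X Y n f \<ominus>\<^bsub>dM B (dobj F X) (dobj F Y) n\<^esub> dmap F X Y n g"
    and "f \<in> dmor A X Y n \<Longrightarrow> dmap F X Y n (\<ominus>\<^bsub>dM A X Y n\<^esub> f)
       = \<ominus>\<^bsub>dM B (dobj F X) (dobj F Y) n\<^esub> dmap F X Y n f"
    and "dmap F X Y n ((dzero A X Y n)) = (dzero B (dobj F X) (dobj F Y) n)"
    and "a \<in> carrier K \<Longrightarrow> f \<in> dmor A X Y n \<Longrightarrow> dmap F X Y n (a \<odot>\<^bsub>dM A X Y n\<^esub> f)
       = a \<odot>\<^bsub>dM B (dobj F X) (dobj F Y) n\<^esub> dmap F X Y n f"
    and "f \<in> dmor A X Y n \<Longrightarrow> ddif B (dobj F X) (dobj F Y) n (dmap F X Y n f) = dmap F X Y (n + 1) (ddif A X Y n f)"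
    by (simp_all add: phi_Dif)
qed

lemma dmap_DCmp [dgs]:
  "\<lbrakk>X \<in> DObj A; Y \<in> DObj A; Z \<in> DObj A; f \<in> dmor A X Y n; g \<in> dmor A Y Z m; k = m + n\<rbrakk> \<Longrightarrow>
    dmap F X Z k (DCmp A X Y Z m n g f) = DCmp B (dobj F X) (dobj F Y) (dobj F Z) m n (dmap F Y Z m g) (dmap F X Y n f)"
  using dg_functor by (simp add: dg_functor_def)

lemma dmap_DIdn [dgs]: "X \<in> DObj A \<Longrightarrow> k = 0 \<Longrightarrow> dmap F X X k (DIdn A X) = DIdn B (dobj F X)"
  using dg_functor by (simp add: dg_functor_def)

text \<open>\<open>is_cone\<close> in \<open>B\<close> quantifies over all test objects of
  \<open>B\<close>, which \<open>F\<close> need not reach. A contraction, however, is a finite set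
  of equations and is carried over by \<open>F\<close>.\<close>

lemma preserves_cones:
  assumes "is_cone K A X Y Z f i j"
  shows "is_cone K B (dobj F X) (dobj F Y) (dobj F Z) (dmap F X Y 0 f) (dmap F Y Z 0 i) (dmap F X Z (-1) j)"
proof -
  obtain \<alpha> \<beta> \<gamma> a1 b1 c1 a0 b0 c0 where "cone_contraction K A X Y Z f i j \<alpha> \<beta> \<gamma> a1 b1 c1 a0 b0 c0"
    using A.is_cone_contraction[OF assms] by blast
  then interpret c: cone_contraction K A X Y Z f i j \<alpha> \<beta> \<gamma> a1 b1 c1 a0 b0 c0 .
  interpret d: cone_contraction K B "dobj F X" "dobj F Y" "dobj F Z" "dmap F X Y 0 f" "dmap F Y Z 0 i" "dmap F X Z (-1) j"
    "dmap F Z X 1 \<alpha>" "dmap F Z Y 0 \<beta>" "dmap F Z Z (-1) \<gamma>"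
    "dmap F Y X 0 a1" "dmap F Y Y (-1) b1" "dmap F Y Z (-2) c1"
    "dmap F X X (-1) a0" "dmap F X Y (-2) b0" "dmap F X Z (-3) c0"
    by unfold_locales (use c.data in \<open>simp_all add: dgs abgc\<close>)
  show ?thesis by (rule d.is_cone)
qed

lemma dmap_dcocyc: "X \<in> DObj A \<Longrightarrow> Y \<in> DObj A \<Longrightarrow> f \<in> dcocyc A X Y n \<Longrightarrow> dmap F X Y n f \<in> dcocyc B (dobj F X) (dobj F Y) n"
  by (simp add: dgs abgc)

lemma H0func_sel [simp]: "fobj (H0func A B F) = dobj F"
  by (simp add: H0func_def)

lemma H0func_map:
  "\<lbrakk>X \<in> DObj A; Y \<in> DObj A; f \<in> dcocyc A X Y 0\<rbrakk> \<Longrightarrow>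
    fmap (H0func A B F) X Y (dcls A X Y f) = dcls B (dobj F X) (dobj F Y) (dmap F X Y 0 f)"
  using complex_map.phi_class[OF dmap_complex_map[of X Y]] by (simp add: H0func_def dgs)

lemma H0func_linear: "linear_functor K (H0 K A) (H0 K B) (H0func A B F)"
  unfolding linear_functor_def is_functor_def linear_map_def
  by (auto simp: dobj_closed A.H0_mor B.H0_mor H0func_map dmap_dcocyc A.dcls_add B.dcls_add A.dcls_smult B.dcls_smult
    A.dcocyc_DIdn A.H0_Cmp B.H0_Cmp A.dcocyc_group A.dcocyc_DCmp) (simp_all add: dgs)

end

lemma dg_functor_idf:
  assumes "dg_category K A"
  shows "dg_functor K A A \<lparr>dobj = (\<lambda>X. X), dmap = (\<lambda>X Y n f. f)\<rparr>"
  unfolding dg_functor_def chain_map_def linear_map_def by auto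

definition dg_comp :: "('p, 'n, 'q, 'l) dg_func \<Rightarrow> ('o, 'm, 'p, 'n) dg_func \<Rightarrow> ('o, 'm, 'q, 'l) dg_func" where
  "dg_comp G F = \<lparr>dobj = (\<lambda>X. dobj G (dobj F X)), dmap = (\<lambda>X Y n f. dmap G (dobj F X) (dobj F Y) n (dmap F X Y n f))\<rparr>"

lemma dg_functor_comp:
  assumes "dg_functor_between K A B F" "dg_functor_between K B C G"
  shows "dg_functor_between K A C (dg_comp G F)"
proof -
  interpret F: dg_functor_between K A B F by fact
  interpret G: dg_functor_between K B C G by fact
  have "dg_functor K A C (dg_comp G F)"
    unfolding dg_functor_def chain_map_def linear_map_def
    by (auto simp: dg_comp_def dgs)
  then show ?thesis by unfold_locales
qed

section \<open>Suspensions and connecting morphisms\<close>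

context dg_category
begin

lemma dcob_iff:
  assumes "X \<in> DObj A" "Y \<in> DObj A" "f \<in> dmor A X Y n" "g \<in> dmor A X Y n"
  shows "f \<ominus>\<^bsub>dM A X Y n\<^esub> g \<in> dcob A X Y n \<longleftrightarrow>
    (\<exists>k\<in>dmor A X Y (n - 1). f = g \<oplus>\<^bsub>dM A X Y n\<^esub> ddif A X Y (n - 1) k)"
proof -
  have "f \<ominus>\<^bsub>dM A X Y n\<^esub> g = ddif A X Y (n - 1) k \<longleftrightarrow> f = g \<oplus>\<^bsub>dM A X Y n\<^esub> ddif A X Y (n - 1) k"
    if "k \<in> dmor A X Y (n - 1)" for k
    using assms that abelian_group_eq_iff(1)[OF dmor_group[OF assms(1,2)] assms(3,4), of "ddif A X Y (n - 1) k"]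
      abelian_group_ac(1)[OF dmor_group[OF assms(1,2)] assms(4), of "ddif A X Y (n - 1) k"]
    by (simp add: dgs)
  then show ?thesis by (auto simp: coboundaries_def)
qed

lemma is_suspension_iff: "is_suspension A X Y \<sigma> \<sigma>' \<longleftrightarrow>
  X \<in> DObj A \<and> Y \<in> DObj A \<and> \<sigma> \<in> dmor A X Y (-1) \<and> \<sigma>' \<in> dmor A Y X 1 \<and>
  ddif A X Y (-1) \<sigma> = (dzero A X Y 0) \<and> ddif A Y X 1 \<sigma>' = (dzero A Y X 2) \<and>
  (\<exists>k\<in>dmor A X X (-1). DCmp A X Y X 1 (-1) \<sigma>' \<sigma> = DIdn A X \<oplus>\<^bsub>dM A X X 0\<^esub> ddif A X X (-1) k) \<and>
  (\<exists>l\<in>dmor A Y Y (-1). DCmp A Y X Y (-1) 1 \<sigma> \<sigma>' = DIdn A Y \<oplus>\<^bsub>dM A Y Y 0\<^esub> ddif A Y Y (-1) l)"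
  unfolding is_suspension_def dcocyc_iff
  by (simp add: dcob_iff DCmp_simps DIdn_dmor cong: conj_cong) blast

text \<open>The condition on \<open>h\<close> in \<open>H0\<close>, solved for \<open>h j\<close>:
  restricted to the cone of \<open>f\<close>, the morphism \<open>h\<close> is homotopic through
  \<open>u\<close> and \<open>v\<close> to the projection onto the suspension of
  \<open>X\<close>.\<close>

definition connecting :: "'o \<Rightarrow> 'o \<Rightarrow> 'o \<Rightarrow> 'm \<Rightarrow> 'm \<Rightarrow> 'm \<Rightarrow> 'm \<Rightarrow> bool" where
  "connecting X Y Z f i j h \<longleftrightarrow> h \<in> dcocyc A Z (sus_obj A X) 0 \<and>
     (\<exists>u\<in>dmor A X (sus_obj A X) (-2). \<exists>v\<in>dmor A Y (sus_obj A X) (-1).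
       DCmp A X Z (sus_obj A X) 0 (-1) h j = sus_to A X \<oplus>\<^bsub>dM A X (sus_obj A X) (-1)\<^esub>
         (ddif A X (sus_obj A X) (-2) u \<oplus>\<^bsub>dM A X (sus_obj A X) (-1)\<^esub> DCmp A X Y (sus_obj A X) (-1) 0 v f) \<and>
       DCmp A Y Z (sus_obj A X) 0 0 h i = ddif A Y (sus_obj A X) (-1) v)"

end

locale pretriangulated_dg = dg_category K A
  for K :: "'k ring" and A :: "('o, 'm, 'k) dg_cat" +
  assumes pretri: "pretriangulated K A"
begin

lemma sus_is_suspension:
  assumes "X \<in> DObj A"
  shows "is_suspension A X (sus_obj A X) (sus_to A X) (sus_from A X)"
proof -
  have "\<exists>d. case d of (Y, \<sigma>, \<sigma>') \<Rightarrow> is_suspension A X Y \<sigma> \<sigma>'"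
    using pretri assms by (force simp: pretriangulated_def)
  then have "case sus_data A X of (Y, \<sigma>, \<sigma>') \<Rightarrow> is_suspension A X Y \<sigma> \<sigma>'"
    unfolding sus_data_def by (rule someI_ex)
  then show ?thesis by (auto simp: sus_obj_def sus_to_def sus_from_def split: prod.splits)
qed

lemma sus_simps [dgs]:
  assumes "X \<in> DObj A"
  shows "sus_obj A X \<in> DObj A" "k = -1 \<Longrightarrow> sus_to A X \<in> dmor A X (sus_obj A X) k" "sus_from A X \<in> dmor A (sus_obj A X) X 1"
    "ddif A X (sus_obj A X) (-1) (sus_to A X) = (dzero A X (sus_obj A X) 0)"
    "ddif A (sus_obj A X) X 1 (sus_from A X) = (dzero A (sus_obj A X) X 2)"
  using sus_is_suspension[OF assms] by (auto simp: is_suspension_iff)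

lemma sus_homotopy:
  assumes "X \<in> DObj A"
  obtains k where "k \<in> dmor A X X (-1)"
    "DCmp A X (sus_obj A X) X 1 (-1) (sus_from A X) (sus_to A X) = DIdn A X \<oplus>\<^bsub>dM A X X 0\<^esub> ddif A X X (-1) k"
  using sus_is_suspension[OF assms] by (auto simp: is_suspension_iff)

lemma sus_homotopy':
  assumes "X \<in> DObj A"
  obtains l where "l \<in> dmor A (sus_obj A X) (sus_obj A X) (-1)"
    "DCmp A (sus_obj A X) X (sus_obj A X) (-1) 1 (sus_to A X) (sus_from A X)
      = DIdn A (sus_obj A X) \<oplus>\<^bsub>dM A (sus_obj A X) (sus_obj A X) 0\<^esub> ddif A (sus_obj A X) (sus_obj A X) (-1) l"
  using sus_is_suspension[OF assms] by (auto simp: is_suspension_iff)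

abbreviation sus_mor :: "'o \<Rightarrow> 'o \<Rightarrow> 'm \<Rightarrow> 'm" where
  "sus_mor X Y f \<equiv> DCmp A (sus_obj A X) Y (sus_obj A Y) (-1) 1 (sus_to A Y) (DCmp A (sus_obj A X) X Y 0 1 f (sus_from A X))"

lemma sus_mor_dcocyc: "\<lbrakk>X \<in> DObj A; Y \<in> DObj A; f \<in> dcocyc A X Y 0\<rbrakk> \<Longrightarrow> sus_mor X Y f \<in> dcocyc A (sus_obj A X) (sus_obj A Y) 0"
  by (simp add: dgs abgc)

lemma H0_Sus_map:
  assumes o: "X \<in> DObj A" "Y \<in> DObj A" and f: "f \<in> dcocyc A X Y 0"
  shows "fmap (Sus (H0 K A)) X Y (dcls A X Y f) = dcls A (sus_obj A X) (sus_obj A Y) (sus_mor X Y f)"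
proof -
  have f': "f \<in> dmor A X Y 0" "ddif A X Y 0 f = (dzero A X Y 1)" using f by (auto simp: dgs)
  have "(\<Union>f\<in>dcls A X Y f. dcls A (sus_obj A X) (sus_obj A Y) (sus_mor X Y f)) = dcls A (sus_obj A X) (sus_obj A Y) (sus_mor X Y f)"
  proof (rule UN_dcls[OF o f'(1)])
    fix k assume k: "k \<in> dmor A X Y (-1)"
    show "dcls A (sus_obj A X) (sus_obj A Y) (sus_mor X Y (f \<oplus>\<^bsub>dM A X Y 0\<^esub> ddif A X Y (-1) k))
      = dcls A (sus_obj A X) (sus_obj A Y) (sus_mor X Y f)"
    proof (rule dcls_eqI)
      \<comment> \<open>The sign is there because the differential passes \<open>sus_to\<close>,
        which is closed of odd degree.\<close>
      show "\<ominus>\<^bsub>dM A (sus_obj A X) (sus_obj A Y) (-1)\<^esub> DCmp A (sus_obj A X) Y (sus_obj A Y) (-1) 0 (sus_to A Y)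
         (DCmp A (sus_obj A X) X Y (-1) 1 k (sus_from A X)) \<in> dmor A (sus_obj A X) (sus_obj A Y) (-1)"
        using o k by (simp add: dgs abgc)
      show "sus_mor X Y (f \<oplus>\<^bsub>dM A X Y 0\<^esub> ddif A X Y (-1) k) = sus_mor X Y f
        \<oplus>\<^bsub>dM A (sus_obj A X) (sus_obj A Y) 0\<^esub> ddif A (sus_obj A X) (sus_obj A Y) (-1)
         (\<ominus>\<^bsub>dM A (sus_obj A X) (sus_obj A Y) (-1)\<^esub> DCmp A (sus_obj A X) Y (sus_obj A Y) (-1) 0 (sus_to A Y)
         (DCmp A (sus_obj A X) X Y (-1) 1 k (sus_from A X)))"
        by (rule abeqI) (use o f' k in \<open>simp add: dgs abg\<close>)
    qed (use o f' in \<open>simp_all add: dgs\<close>)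
  qed
  then show ?thesis by (simp add: H0_def lin_cat.extend_def)
qed

lemma H0_Tri_iff:
  "t \<in> Tri (H0 K A) \<longleftrightarrow> (\<exists>X Y Z f i h j. t = (X, Y, Z, dcls A X Y f, dcls A Y Z i, dcls A Z (sus_obj A X) h) \<and>
     is_cone K A X Y Z f i j \<and> connecting X Y Z f i j h)"
proof -
  have *: "(DCmp A X Z (sus_obj A X) 0 (-1) h j \<ominus>\<^bsub>dM A X (sus_obj A X) (-1)\<^esub> sus_to A X
               = ddif A X (sus_obj A X) (-2) u \<oplus>\<^bsub>dM A X (sus_obj A X) (-1)\<^esub>
                 DCmp A X Y (sus_obj A X) (-1) 0 v f) \<longleftrightarrow>
      (DCmp A X Z (sus_obj A X) 0 (-1) h j = sus_to A X \<oplus>\<^bsub>dM A X (sus_obj A X) (-1)\<^esub>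
         (ddif A X (sus_obj A X) (-2) u \<oplus>\<^bsub>dM A X (sus_obj A X) (-1)\<^esub> DCmp A X Y (sus_obj A X) (-1) 0 v f))"
    if "is_cone K A X Y Z f i j" "h \<in> dcocyc A Z (sus_obj A X) 0" "u\<in>dmor A X (sus_obj A X) (-2)" "v\<in>dmor A Y (sus_obj A X) (-1)"
    for X Y Z f i h j u v
    using that unfolding is_cone_iff cone_data_def dcocyc_iff
    by (simp add: dgs abge abgc abelian_group_ac(1)[of _ "sus_to A X"])
  show ?thesis
    unfolding H0_def lin_cat.extend_def connecting_def by (simp, safe; insert *, metis)
qed

text \<open>The pair \<open>(0, sus_to A X)\<close> is a cocycle of morphisms out of the cone,
  because \<open>sus_to\<close> is closed. Its extension to \<open>Z\<close> is
  \<open>h\<close>.\<close>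

lemma connecting_exists:
  assumes "is_cone K A X Y Z f i j"
  shows "\<exists>h. connecting X Y Z f i j h"
proof -
  obtain \<alpha> \<beta> \<gamma> a1 b1 c1 a0 b0 c0 where "cone_contraction K A X Y Z f i j \<alpha> \<beta> \<gamma> a1 b1 c1 a0 b0 c0"
    using is_cone_contraction[OF assms] by blast
  then interpret c: cone_contraction K A X Y Z f i j \<alpha> \<beta> \<gamma> a1 b1 c1 a0 b0 c0 .
  obtain h v u where "h \<in> dmor A Z (sus_obj A X) 0" "v \<in> dmor A Y (sus_obj A X) (-1)" "u \<in> dmor A X (sus_obj A X) (-2)"
    "ddif A Z (sus_obj A X) 0 h = (dzero A Z (sus_obj A X) 1)"
    "DCmp A Y Z (sus_obj A X) 0 0 h i = ddif A Y (sus_obj A X) (-1) v"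
    "DCmp A X Z (sus_obj A X) 0 (-1) h j = sus_to A X \<oplus>\<^bsub>dM A X (sus_obj A X) (-1)\<^esub>
      (DCmp A X Y (sus_obj A X) (-1) 0 v f \<oplus>\<^bsub>dM A X (sus_obj A X) (-1)\<^esub> ddif A X (sus_obj A X) (-2) u)"
    using c.contravariant_surj[of "sus_obj A X" "(dzero A Y (sus_obj A X) 0)" 0 "sus_to A X"] c.data
    by (auto simp: dgs abgc)
  then show ?thesis using c.obj c.mors(1) unfolding connecting_def
    by (intro exI[of _ h] conjI, simp add: dgs)
      (rule bexI[of _ u], rule bexI[of _ v], auto simp: dgs abelian_group_ac(1) intro!: abelian_group_ac(1))
qed

text \<open>Axiom \<open>Tri_fill\<close> would only provide some third morphism. Here
  \<open>c\<close> is given, and the homotopies \<open>p\<close> and \<open>q\<close> of the two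
  squares together with the secondary homotopy \<open>m\<close> make it a morphism of cones. The
  difference of the two composites then restricts to a boundary on the first cone, and
  \<open>contravariant_inj\<close> bounds it on \<open>Z1\<close>.\<close>

lemma connecting_natural:
  assumes c1: "is_cone K A X1 Y1 Z1 f1 i1 j1" "connecting X1 Y1 Z1 f1 i1 j1 h1"
    and c2: "is_cone K A X2 Y2 Z2 f2 i2 j2" "connecting X2 Y2 Z2 f2 i2 j2 h2"
    and m: "a \<in> dcocyc A X1 X2 0" "x \<in> dcocyc A Y1 Y2 0" "c \<in> dcocyc A Z1 Z2 0"
      "p \<in> dmor A X1 Y2 (-1)" "q \<in> dmor A Y1 Z2 (-1)" "m \<in> dmor A X1 Z2 (-2)"
    and d: "ddif A X1 Y2 (-1) p = DCmp A X1 X2 Y2 0 0 f2 a \<ominus>\<^bsub>dM A X1 Y2 0\<^esub> DCmp A X1 Y1 Y2 0 0 x f1"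
      "ddif A Y1 Z2 (-1) q = DCmp A Y1 Y2 Z2 0 0 i2 x \<ominus>\<^bsub>dM A Y1 Z2 0\<^esub> DCmp A Y1 Z1 Z2 0 0 c i1"
      "ddif A X1 Z2 (-2) m = DCmp A X1 X2 Z2 (-1) 0 j2 a \<ominus>\<^bsub>dM A X1 Z2 (-1)\<^esub>
        (DCmp A X1 Y1 Z2 (-1) 0 q f1 \<oplus>\<^bsub>dM A X1 Z2 (-1)\<^esub> (DCmp A X1 Y2 Z2 0 (-1) i2 p
          \<oplus>\<^bsub>dM A X1 Z2 (-1)\<^esub> DCmp A X1 Z1 Z2 0 (-1) c j1))"
  shows "dcls A Z1 (sus_obj A X2) (DCmp A Z1 Z2 (sus_obj A X2) 0 0 h2 c)
    = dcls A Z1 (sus_obj A X2) (DCmp A Z1 (sus_obj A X1) (sus_obj A X2) 0 0 (sus_mor X1 X2 a) h1)"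
proof -
  obtain \<alpha> \<beta> \<gamma> a1 b1 e1 a0 b0 e0 where "cone_contraction K A X1 Y1 Z1 f1 i1 j1 \<alpha> \<beta> \<gamma> a1 b1 e1 a0 b0 e0"
    using is_cone_contraction[OF c1(1)] by blast
  then interpret c: cone_contraction K A X1 Y1 Z1 f1 i1 j1 \<alpha> \<beta> \<gamma> a1 b1 e1 a0 b0 e0 .
  have o2: "X2 \<in> DObj A" "Y2 \<in> DObj A" "Z2 \<in> DObj A" "f2 \<in> dmor A X2 Y2 0" "i2 \<in> dmor A Y2 Z2 0" "j2 \<in> dmor A X2 Z2 (-1)"
    "ddif A X2 Y2 0 f2 = (dzero A X2 Y2 1)" "ddif A Y2 Z2 0 i2 = (dzero A Y2 Z2 1)"
    "ddif A X2 Z2 (-1) j2 = DCmp A X2 Y2 Z2 0 0 i2 f2"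
    using c2(1) unfolding is_cone_iff cone_data_def by auto
  let ?S1 = "sus_obj A X1" and ?S2 = "sus_obj A X2"
  obtain u1 v1 where h1: "h1 \<in> dmor A Z1 ?S1 0" "ddif A Z1 ?S1 0 h1 = (dzero A Z1 ?S1 1)"
      "u1 \<in> dmor A X1 ?S1 (-2)" "v1 \<in> dmor A Y1 ?S1 (-1)"
    and h1j: "DCmp A X1 Z1 ?S1 0 (-1) h1 j1 = sus_to A X1 \<oplus>\<^bsub>dM A X1 ?S1 (-1)\<^esub>
         (ddif A X1 ?S1 (-2) u1 \<oplus>\<^bsub>dM A X1 ?S1 (-1)\<^esub> DCmp A X1 Y1 ?S1 (-1) 0 v1 f1)"
    and h1i: "DCmp A Y1 Z1 ?S1 0 0 h1 i1 = ddif A Y1 ?S1 (-1) v1"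
    using c1(2) unfolding connecting_def dcocyc_iff by auto
  obtain u2 v2 where h2: "h2 \<in> dmor A Z2 ?S2 0" "ddif A Z2 ?S2 0 h2 = (dzero A Z2 ?S2 1)"
      "u2 \<in> dmor A X2 ?S2 (-2)" "v2 \<in> dmor A Y2 ?S2 (-1)"
    and h2j: "DCmp A X2 Z2 ?S2 0 (-1) h2 j2 = sus_to A X2 \<oplus>\<^bsub>dM A X2 ?S2 (-1)\<^esub>
         (ddif A X2 ?S2 (-2) u2 \<oplus>\<^bsub>dM A X2 ?S2 (-1)\<^esub> DCmp A X2 Y2 ?S2 (-1) 0 v2 f2)"
    and h2i: "DCmp A Y2 Z2 ?S2 0 0 h2 i2 = ddif A Y2 ?S2 (-1) v2"
    using c2(2) unfolding connecting_def dcocyc_iff by auto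
  obtain k where k: "k \<in> dmor A X1 X1 (-1)"
    and ss: "DCmp A X1 ?S1 X1 1 (-1) (sus_from A X1) (sus_to A X1) = DIdn A X1 \<oplus>\<^bsub>dM A X1 X1 0\<^esub> ddif A X1 X1 (-1) k"
    using sus_homotopy c.obj by metis
  have m': "a \<in> dmor A X1 X2 0" "x \<in> dmor A Y1 Y2 0" "c \<in> dmor A Z1 Z2 0" 
    "ddif A X1 X2 0 a = (dzero A X1 X2 1)" "ddif A Y1 Y2 0 x = (dzero A Y1 Y2 1)" "ddif A Z1 Z2 0 c = (dzero A Z1 Z2 1)"
    using m by (auto simp: dgs)
  note facts = c.data o2 h1 h2 k m' m(4-6)
  note rels = h1j h1i h2j h2i ss
  note pre = DCmp_prefix[OF h1j] DCmp_prefix[OF h1i] DCmp_prefix[OF h2j] DCmp_prefix[OF h2i] DCmp_prefix[OF ss]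
  \<comment> \<open>The defining equations of the homotopies are solved for composites so that they
    can serve as rewrite rules.\<close>
  have cj: "DCmp A X1 Z1 Z2 0 (-1) c j1 = DCmp A X1 X2 Z2 (-1) 0 j2 a \<ominus>\<^bsub>dM A X1 Z2 (-1)\<^esub>
        (DCmp A X1 Y1 Z2 (-1) 0 q f1 \<oplus>\<^bsub>dM A X1 Z2 (-1)\<^esub> (DCmp A X1 Y2 Z2 0 (-1) i2 p
          \<oplus>\<^bsub>dM A X1 Z2 (-1)\<^esub> ddif A X1 Z2 (-2) m))"
    unfolding d(3) by (rule abeqI) (use facts in \<open>simp add: dgs abg\<close>)
  have ci: "DCmp A Y1 Z1 Z2 0 0 c i1 = DCmp A Y1 Y2 Z2 0 0 i2 x \<ominus>\<^bsub>dM A Y1 Z2 0\<^esub> ddif A Y1 Z2 (-1) q"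
    unfolding d(2) by (rule abeqI) (use facts in \<open>simp add: dgs abg\<close>)
  have fa: "DCmp A X1 X2 Y2 0 0 f2 a = DCmp A X1 Y1 Y2 0 0 x f1 \<oplus>\<^bsub>dM A X1 Y2 0\<^esub> ddif A X1 Y2 (-1) p"
    unfolding d(1) by (rule abeqI) (use facts in \<open>simp add: dgs abg\<close>)
  note rels' = rels cj ci fa
  note pre' = pre DCmp_prefix[OF cj] DCmp_prefix[OF ci] DCmp_prefix[OF fa]
  let ?g = "sus_mor X1 X2 a"
  let ?z = "DCmp A Z1 Z2 ?S2 0 0 h2 c \<ominus>\<^bsub>dM A Z1 ?S2 0\<^esub> DCmp A Z1 ?S1 ?S2 0 0 ?g h1"
  \<comment> \<open>\<open>?v\<close> and \<open>?w\<close> bound the restrictions of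
    \<open>?z\<close> along \<open>i1\<close> and \<open>j1\<close>. Every summand carries one
    homotopy: \<open>u2\<close>, \<open>v2\<close> from \<open>h2\<close>, \<open>u1\<close>,
    \<open>v1\<close> from \<open>h1\<close>, \<open>p\<close>, \<open>q\<close>, \<open>m\<close>
    from the morphism of cones, and \<open>k\<close> from the homotopy between
    \<open>sus_from sus_to\<close> and the identity of \<open>X1\<close>.\<close>
  let ?v = "DCmp A Y1 Y2 ?S2 (-1) 0 v2 x \<ominus>\<^bsub>dM A Y1 ?S2 (-1)\<^esub>
    (DCmp A Y1 Z2 ?S2 0 (-1) h2 q \<oplus>\<^bsub>dM A Y1 ?S2 (-1)\<^esub> DCmp A Y1 ?S1 ?S2 0 (-1) ?g v1)"
  let ?w = "(DCmp A X1 X2 ?S2 (-2) 0 u2 a \<oplus>\<^bsub>dM A X1 ?S2 (-2)\<^esub>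
       DCmp A X1 X1 ?S2 (-1) (-1) (DCmp A X1 X2 ?S2 (-1) 0 (sus_to A X2) a) k) \<ominus>\<^bsub>dM A X1 ?S2 (-2)\<^esub>
    (DCmp A X1 Z2 ?S2 0 (-2) h2 m \<oplus>\<^bsub>dM A X1 ?S2 (-2)\<^esub> (DCmp A X1 Y2 ?S2 (-1) (-1) v2 p
       \<oplus>\<^bsub>dM A X1 ?S2 (-2)\<^esub> DCmp A X1 ?S1 ?S2 0 (-2) ?g u1))"
  obtain y where y: "y \<in> dmor A Z1 ?S2 (0 - 1)" "?z = ddif A Z1 ?S2 (0 - 1) y"
  proof (rule c.contravariant_inj[of ?S2 ?z 0 ?v ?w])
    show "?S2 \<in> DObj A" "?z \<in> dmor A Z1 ?S2 0" "?v \<in> dmor A Y1 ?S2 (0-1)" "?w \<in> dmor A X1 ?S2 (0-2)"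
      using facts by (simp_all add: dgs abgc)
    show "ddif A Z1 ?S2 0 ?z = (dzero A Z1 ?S2 (0+1))"
      by (rule abeqI) (use facts in \<open>simp add: dgs abg\<close>)
    show "DCmp A Y1 Z1 ?S2 0 0 ?z i1 = ddif A Y1 ?S2 (0-1) ?v"
      by (rule abeqI) (use facts rels' in \<open>simp add: dgs abg pre'\<close>)
    show "DCmp A X1 Z1 ?S2 0 (-1) ?z j1 = koszul (dM A X1 ?S2 (0-1)) 0 (DCmp A X1 Y1 ?S2 (0-1) 0 ?v f1)
        \<oplus>\<^bsub>dM A X1 ?S2 (0-1)\<^esub> ddif A X1 ?S2 (0-2) ?w"
      by (rule abeqI) (use facts rels' in \<open>simp add: dgs abg pre'\<close>)
  qed blast
  have y': "y \<in> dmor A Z1 ?S2 (-1)" "?z = ddif A Z1 ?S2 (-1) y" using y by simp_all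
  show ?thesis
  proof (rule dcls_eqI[OF _ _ _ y'(1)])
    show "DCmp A Z1 Z2 ?S2 0 0 h2 c = DCmp A Z1 ?S1 ?S2 0 0 ?g h1 \<oplus>\<^bsub>dM A Z1 ?S2 0\<^esub> ddif A Z1 ?S2 (-1) y"
      unfolding y'(2)[symmetric] by (rule abeqI) (use facts in \<open>simp add: dgs abg\<close>)
  qed (use facts in \<open>simp_all add: dgs\<close>)
qed

end

locale pretriangulated_dg_functor = dg_functor_between K A B F + A: pretriangulated_dg K A + B: pretriangulated_dg K B
  for K :: "'k ring" and A :: "('o, 'm, 'k) dg_cat" and B :: "('p, 'n, 'k) dg_cat" and F
begin

abbreviation sus_com :: "'o \<Rightarrow> 'n" where
  "sus_com X \<equiv> DCmp B (dobj F (sus_obj A X)) (dobj F X) (sus_obj B (dobj F X)) (-1) 1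
          (sus_to B (dobj F X)) (dmap F (sus_obj A X) X 1 (sus_from A X))"

text \<open>The inverse is \<open>F(sus_to)\<close> after \<open>sus_from\<close>. A dg functor
  preserves the data of a suspension, so \<open>F(sus_obj A X)\<close> and
  \<open>sus_obj B (dobj F X)\<close> are two suspensions of the same object.\<close>

lemma sus_com_iso:
  assumes o: "X \<in> DObj A"
  shows "is_iso (H0 K B) (dobj F (sus_obj A X)) (sus_obj B (dobj F X))
    (dcls B (dobj F (sus_obj A X)) (sus_obj B (dobj F X)) (sus_com X))"
proof -
  let ?FS = "dobj F (sus_obj A X)" and ?FX = "dobj F X" and ?SF = "sus_obj B (dobj F X)"
  let ?r = "DCmp B ?SF ?FX ?FS (-1) 1 (dmap F X (sus_obj A X) (-1) (sus_to A X)) (sus_from B ?FX)"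
  obtain k where k: "k \<in> dmor A X X (-1)" and
    ss: "DCmp A X (sus_obj A X) X 1 (-1) (sus_from A X) (sus_to A X) = DIdn A X \<oplus>\<^bsub>dM A X X 0\<^esub> ddif A X X (-1) k"
    using A.sus_homotopy o by metis
  obtain l where l: "l \<in> dmor A (sus_obj A X) (sus_obj A X) (-1)" and
    ss': "DCmp A (sus_obj A X) X (sus_obj A X) (-1) 1 (sus_to A X) (sus_from A X)
      = DIdn A (sus_obj A X) \<oplus>\<^bsub>dM A (sus_obj A X) (sus_obj A X) 0\<^esub> ddif A (sus_obj A X) (sus_obj A X) (-1) l"
    using A.sus_homotopy' o by metis
  obtain k2 where k2: "k2 \<in> dmor B ?FX ?FX (-1)" and
    t: "DCmp B ?FX ?SF ?FX 1 (-1) (sus_from B ?FX) (sus_to B ?FX) = DIdn B ?FX \<oplus>\<^bsub>dM B ?FX ?FX 0\<^esub> ddif B ?FX ?FX (-1) k2"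
    using B.sus_homotopy o dobj_closed by metis
  obtain l2 where l2: "l2 \<in> dmor B ?SF ?SF (-1)" and
    t': "DCmp B ?SF ?FX ?SF (-1) 1 (sus_to B ?FX) (sus_from B ?FX) = DIdn B ?SF \<oplus>\<^bsub>dM B ?SF ?SF 0\<^esub> ddif B ?SF ?SF (-1) l2"
    using B.sus_homotopy' o dobj_closed by metis
  have Fss: "DCmp B ?FX ?FS ?FX 1 (-1) (dmap F (sus_obj A X) X 1 (sus_from A X)) (dmap F X (sus_obj A X) (-1) (sus_to A X))
     = DIdn B ?FX \<oplus>\<^bsub>dM B ?FX ?FX 0\<^esub> dmap F X X 0 (ddif A X X (-1) k)"
    using arg_cong[OF ss, of "dmap F X X 0"] o k by (simp add: dgs)
  have Fss': "DCmp B ?FS ?FX ?FS (-1) 1 (dmap F X (sus_obj A X) (-1) (sus_to A X)) (dmap F (sus_obj A X) X 1 (sus_from A X))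
     = DIdn B ?FS \<oplus>\<^bsub>dM B ?FS ?FS 0\<^esub> dmap F (sus_obj A X) (sus_obj A X) 0 (ddif A (sus_obj A X) (sus_obj A X) (-1) l)"
    using arg_cong[OF ss', of "dmap F (sus_obj A X) (sus_obj A X) 0"] o l by (simp add: dgs)
  note pre = B.DCmp_prefix[OF t] B.DCmp_prefix[OF t'] B.DCmp_prefix[OF Fss] B.DCmp_prefix[OF Fss']
  have c: "sus_com X \<in> dcocyc B ?FS ?SF 0" "?r \<in> dcocyc B ?SF ?FS 0"
    using o by (simp_all add: dgs abgc)
  have "dcls B ?FS ?FS (DCmp B ?FS ?SF ?FS 0 0 ?r (sus_com X)) = dcls B ?FS ?FS (DIdn B ?FS)"
  proof (rule B.dcls_eqI)
    let ?h = "dmap F (sus_obj A X) (sus_obj A X) (-1) l \<ominus>\<^bsub>dM B ?FS ?FS (-1)\<^esub> DCmp B ?FS ?FX ?FS (-2) 1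
       (DCmp B ?FX ?FX ?FS (-1) (-1) (dmap F X (sus_obj A X) (-1) (sus_to A X)) k2) (dmap F (sus_obj A X) X 1 (sus_from A X))"
    show "?h \<in> dmor B ?FS ?FS (-1)" using o l k2 by (simp add: dgs abgc)
    show "DCmp B ?FS ?SF ?FS 0 0 ?r (sus_com X) = DIdn B ?FS \<oplus>\<^bsub>dM B ?FS ?FS 0\<^esub> ddif B ?FS ?FS (-1) ?h"
      by (rule abeqI) (use o l k2 Fss' t in \<open>simp add: dgs abg pre\<close>)
  qed (use o in \<open>simp_all add: dgs\<close>)
  moreover have "dcls B ?SF ?SF (DCmp B ?SF ?FS ?SF 0 0 (sus_com X) ?r) = dcls B ?SF ?SF (DIdn B ?SF)"
  proof (rule B.dcls_eqI)
    let ?h = "l2 \<ominus>\<^bsub>dM B ?SF ?SF (-1)\<^esub> DCmp B ?SF ?FX ?SF (-2) 1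
       (DCmp B ?FX ?FX ?SF (-1) (-1) (sus_to B ?FX) (dmap F X X (-1) k)) (sus_from B ?FX)"
    show "?h \<in> dmor B ?SF ?SF (-1)" using o k l2 by (simp add: dgs abgc)
    show "DCmp B ?SF ?FS ?SF 0 0 (sus_com X) ?r = DIdn B ?SF \<oplus>\<^bsub>dM B ?SF ?SF 0\<^esub> ddif B ?SF ?SF (-1) ?h"
      by (rule abeqI) (use o k l2 Fss t' in \<open>simp add: dgs abg pre\<close>)
  qed (use o in \<open>simp_all add: dgs\<close>)
  ultimately show ?thesis
    unfolding is_iso_def using c o
    by (auto simp: B.H0_mor B.H0_Cmp dgs intro!: bexI[of _ "dcls B ?SF ?FS ?r"])
qed

text \<open>\<open>F\<close> preserves cones by \<open>preserves_cones\<close>, and the image of a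
  connecting morphism becomes a connecting morphism for the chosen suspension of \<open>B\<close>
  after composition with \<open>sus_com\<close>.\<close>

lemma H0func_triangle: "triangle_functor K (H0 K A) (H0 K B) (H0func A B F)"
  unfolding triangle_functor_def
proof (intro conjI allI impI)
  show "linear_functor K (H0 K A) (H0 K B) (H0func A B F)" by (rule H0func_linear)
  have Com: "Com (H0func A B F) X = dcls B (dobj F (sus_obj A X)) (sus_obj B (dobj F X)) (sus_com X)" for X
    by (simp add: H0func_def)
  have sc: "sus_com X \<in> dcocyc B (dobj F (sus_obj A X)) (sus_obj B (dobj F X)) 0" if "X \<in> DObj A" for X
    using that by (simp add: dgs abgc)
  have nat: "Cmp (H0cat B) (dobj F (sus_obj A X)) (dobj F (sus_obj A Y)) (sus_obj B (dobj F Y))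
      (Com (H0func A B F) Y) (fmap (H0func A B F) (sus_obj A X) (sus_obj A Y) (fmap (Sus (H0 K A)) X Y (dcls A X Y f)))
    = Cmp (H0cat B) (dobj F (sus_obj A X)) (sus_obj B (dobj F X)) (sus_obj B (dobj F Y))
      (fmap (Sus (H0 K B)) (dobj F X) (dobj F Y) (fmap (H0func A B F) X Y (dcls A X Y f))) (Com (H0func A B F) X)"
    if o: "X \<in> DObj A" "Y \<in> DObj A" and f: "f \<in> dcocyc A X Y 0" for X Y f
  proof -
    let ?FSX = "dobj F (sus_obj A X)" and ?SFY = "sus_obj B (dobj F Y)"
    have f': "f \<in> dmor A X Y 0" "ddif A X Y 0 f = (dzero A X Y 1)" using f by (auto simp: dgs)
    obtain k where k: "k \<in> dmor A Y Y (-1)" and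
      ss: "DCmp A Y (sus_obj A Y) Y 1 (-1) (sus_from A Y) (sus_to A Y) = DIdn A Y \<oplus>\<^bsub>dM A Y Y 0\<^esub> ddif A Y Y (-1) k"
      using A.sus_homotopy o by metis
    obtain k2 where k2: "k2 \<in> dmor B (dobj F X) (dobj F X) (-1)" and
      t: "DCmp B (dobj F X) (sus_obj B (dobj F X)) (dobj F X) 1 (-1) (sus_from B (dobj F X)) (sus_to B (dobj F X))
        = DIdn B (dobj F X) \<oplus>\<^bsub>dM B (dobj F X) (dobj F X) 0\<^esub> ddif B (dobj F X) (dobj F X) (-1) k2"
      using B.sus_homotopy o dobj_closed by metis
    have Fss: "DCmp B (dobj F Y) (dobj F (sus_obj A Y)) (dobj F Y) 1 (-1) (dmap F (sus_obj A Y) Y 1 (sus_from A Y)) (dmap F Y (sus_obj A Y) (-1) (sus_to A Y))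
       = DIdn B (dobj F Y) \<oplus>\<^bsub>dM B (dobj F Y) (dobj F Y) 0\<^esub> dmap F Y Y 0 (ddif A Y Y (-1) k)"
      using arg_cong[OF ss, of "dmap F Y Y 0"] o k by (simp add: dgs)
    note pre = B.DCmp_prefix[OF t] B.DCmp_prefix[OF Fss]
    \<comment> \<open>Both composites reduce to \<open>?m\<close> up to homotopy: on the left the
      image under \<open>F\<close> of \<open>sus_from sus_to\<close> at \<open>Y\<close> cancels, on
      the right \<open>sus_from sus_to\<close> at \<open>dobj F X\<close>.\<close>
    let ?m = "DCmp B ?FSX (dobj F Y) ?SFY (-1) 1 (sus_to B (dobj F Y)) (DCmp B ?FSX (dobj F X) (dobj F Y) 0 1 (dmap F X Y 0 f) (dmap F (sus_obj A X) X 1 (sus_from A X)))"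
    let ?l = "DCmp B ?FSX (dobj F (sus_obj A Y)) ?SFY 0 0 (sus_com Y) (dmap F (sus_obj A X) (sus_obj A Y) 0 (A.sus_mor X Y f))"
    let ?r = "DCmp B ?FSX (sus_obj B (dobj F X)) ?SFY 0 0 (B.sus_mor (dobj F X) (dobj F Y) (dmap F X Y 0 f)) (sus_com X)"
    have "dcls B ?FSX ?SFY ?l = dcls B ?FSX ?SFY ?m"
    proof (rule B.dcls_eqI)
      let ?h = "\<ominus>\<^bsub>dM B ?FSX ?SFY (-1)\<^esub> DCmp B ?FSX (dobj F X) ?SFY (-2) 1 (DCmp B (dobj F X) (dobj F Y) ?SFY (-2) 0 (DCmp B (dobj F Y) (dobj F Y) ?SFY (-1) (-1) 
        (sus_to B (dobj F Y)) (dmap F Y Y (-1) k)) (dmap F X Y 0 f)) (dmap F (sus_obj A X) X 1 (sus_from A X))"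
      show "?h \<in> dmor B ?FSX ?SFY (-1)" using o k f' by (simp add: dgs abgc)
      show "?l = ?m \<oplus>\<^bsub>dM B ?FSX ?SFY 0\<^esub> ddif B ?FSX ?SFY (-1) ?h"
        by (rule abeqI) (use o k f' Fss in \<open>simp add: dgs abg pre\<close>)
    qed (use o f' in \<open>simp_all add: dgs\<close>)
    also have "\<dots> = dcls B ?FSX ?SFY ?r"
    proof (rule B.dcls_eqI[symmetric])
      let ?h = "\<ominus>\<^bsub>dM B ?FSX ?SFY (-1)\<^esub> DCmp B ?FSX (dobj F X) ?SFY (-2) 1 (DCmp B (dobj F X) (dobj F X) ?SFY (-1) (-1) 
        (DCmp B (dobj F X) (dobj F Y) ?SFY (-1) 0 (sus_to B (dobj F Y)) (dmap F X Y 0 f)) k2) (dmap F (sus_obj A X) X 1 (sus_from A X))"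
      show "?h \<in> dmor B ?FSX ?SFY (-1)" using o k2 f' by (simp add: dgs abgc)
      show "?r = ?m \<oplus>\<^bsub>dM B ?FSX ?SFY 0\<^esub> ddif B ?FSX ?SFY (-1) ?h"
        by (rule abeqI) (use o k2 f' t in \<open>simp add: dgs abg pre\<close>)
    qed (use o f' in \<open>simp_all add: dgs\<close>)
    finally show ?thesis
      using o f A.sus_mor_dcocyc[OF o f] dmap_dcocyc[OF o f] B.sus_mor_dcocyc[OF _ _ dmap_dcocyc[OF o f]]
        dmap_dcocyc[OF _ _ A.sus_mor_dcocyc[OF o f]]
      by (simp add: Com H0func_map A.H0_Sus_map B.H0_Sus_map B.H0_Cmp sc dobj_closed A.sus_simps(1) B.sus_simps(1))
  qed
  show "nat_iso (H0 K A) (H0 K B) (func_comp (H0func A B F) (Sus (H0 K A))) (func_comp (Sus (H0 K B)) (H0func A B F)) (Com (H0func A B F))"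
    unfolding nat_iso_def nat_trans_def using sus_com_iso sc
    by (auto simp: func_comp_def Com[symmetric] A.H0_mor nat simp del: ) (auto simp: Com B.H0_mor)
  fix X Y Z f g h
  assume "(X, Y, Z, f, g, h) \<in> Tri (H0 K A)"
  then obtain f' i j h' where e: "f = dcls A X Y f'" "g = dcls A Y Z i" "h = dcls A Z (sus_obj A X) h'"
    and ic: "is_cone K A X Y Z f' i j" and cn: "A.connecting X Y Z f' i j h'"
    unfolding A.H0_Tri_iff by blast
  let ?S = "sus_obj A X" and ?SF = "sus_obj B (dobj F X)"
  have o: "X \<in> DObj A" "Y \<in> DObj A" "Z \<in> DObj A" "f' \<in> dmor A X Y 0" "i \<in> dmor A Y Z 0" "j \<in> dmor A X Z (-1)"
    "ddif A X Y 0 f' = (dzero A X Y 1)" "ddif A Y Z 0 i = (dzero A Y Z 1)"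
    "ddif A X Z (-1) j = DCmp A X Y Z 0 0 i f'"
    using ic unfolding A.is_cone_iff cone_data_def by auto
  obtain u v where h: "h' \<in> dmor A Z ?S 0" "ddif A Z ?S 0 h' = (dzero A Z ?S 1)"
      "u \<in> dmor A X ?S (-2)" "v \<in> dmor A Y ?S (-1)"
    and hj: "DCmp A X Z ?S 0 (-1) h' j = sus_to A X \<oplus>\<^bsub>dM A X ?S (-1)\<^esub>
         (ddif A X ?S (-2) u \<oplus>\<^bsub>dM A X ?S (-1)\<^esub> DCmp A X Y ?S (-1) 0 v f')"
    and hi: "DCmp A Y Z ?S 0 0 h' i = ddif A Y ?S (-1) v"
    using cn unfolding A.connecting_def A.dcocyc_iff by auto
  obtain k where k: "k \<in> dmor A X X (-1)" and
    ss: "DCmp A X ?S X 1 (-1) (sus_from A X) (sus_to A X) = DIdn A X \<oplus>\<^bsub>dM A X X 0\<^esub> ddif A X X (-1) k"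
    using A.sus_homotopy o by metis
  let ?h = "DCmp B (dobj F Z) (dobj F ?S) ?SF 0 0 (sus_com X) (dmap F Z ?S 0 h')"
  have hc: "?h \<in> dcocyc B (dobj F Z) ?SF 0" using o h by (simp add: dgs abgc)
  have "B.connecting (dobj F X) (dobj F Y) (dobj F Z) (dmap F X Y 0 f') (dmap F Y Z 0 i) (dmap F X Z (-1) j) ?h"
    unfolding B.connecting_def
  proof (intro conjI bexI hc)
    have Fss: "DCmp B (dobj F X) (dobj F ?S) (dobj F X) 1 (-1) (dmap F ?S X 1 (sus_from A X)) (dmap F X ?S (-1) (sus_to A X))
       = DIdn B (dobj F X) \<oplus>\<^bsub>dM B (dobj F X) (dobj F X) 0\<^esub> dmap F X X 0 (ddif A X X (-1) k)"
      using arg_cong[OF ss, of "dmap F X X 0"] o k by (simp add: dgs)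
    have Fhj: "DCmp B (dobj F X) (dobj F Z) (dobj F ?S) 0 (-1) (dmap F Z ?S 0 h') (dmap F X Z (-1) j)
      = dmap F X ?S (-1) (sus_to A X) \<oplus>\<^bsub>dM B (dobj F X) (dobj F ?S) (-1)\<^esub>
         (dmap F X ?S (-1) (ddif A X ?S (-2) u) \<oplus>\<^bsub>dM B (dobj F X) (dobj F ?S) (-1)\<^esub>
           DCmp B (dobj F X) (dobj F Y) (dobj F ?S) (-1) 0 (dmap F Y ?S (-1) v) (dmap F X Y 0 f'))"
      using arg_cong[OF hj, of "dmap F X ?S (-1)"] o h by (simp add: dgs abgc)
    have Fhi: "DCmp B (dobj F Y) (dobj F Z) (dobj F ?S) 0 0 (dmap F Z ?S 0 h') (dmap F Y Z 0 i)
      = dmap F Y ?S 0 (ddif A Y ?S (-1) v)"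
      using arg_cong[OF hi, of "dmap F Y ?S 0"] o h by (simp add: dgs abgc)
    note pre = B.DCmp_prefix[OF Fss] B.DCmp_prefix[OF Fhj] B.DCmp_prefix[OF Fhi]
    \<comment> \<open>The second summand corrects the cancellation of
      \<open>F(sus_from) F(sus_to)\<close> inside \<open>sus_com\<close>, which holds only up to the
      image of \<open>d k\<close>.\<close>
    let ?u = "DCmp B (dobj F X) (dobj F ?S) ?SF 0 (-2) (sus_com X) (dmap F X ?S (-2) u) \<ominus>\<^bsub>dM B (dobj F X) ?SF (-2)\<^esub>
      DCmp B (dobj F X) (dobj F X) ?SF (-1) (-1) (sus_to B (dobj F X)) (dmap F X X (-1) k)"
    let ?v = "DCmp B (dobj F Y) (dobj F ?S) ?SF 0 (-1) (sus_com X) (dmap F Y ?S (-1) v)"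
    show "?u \<in> dmor B (dobj F X) ?SF (-2)" "?v \<in> dmor B (dobj F Y) ?SF (-1)"
      using o h k by (simp_all add: dgs abgc)
    show "DCmp B (dobj F X) (dobj F Z) ?SF 0 (-1) ?h (dmap F X Z (-1) j) = sus_to B (dobj F X) \<oplus>\<^bsub>dM B (dobj F X) ?SF (-1)\<^esub>
         (ddif B (dobj F X) ?SF (-2) ?u \<oplus>\<^bsub>dM B (dobj F X) ?SF (-1)\<^esub> DCmp B (dobj F X) (dobj F Y) ?SF (-1) 0 ?v (dmap F X Y 0 f'))"
      by (rule abeqI) (use o h k Fss Fhj Fhi in \<open>simp add: dgs abg pre\<close>)
    show "DCmp B (dobj F Y) (dobj F Z) ?SF 0 0 ?h (dmap F Y Z 0 i) = ddif B (dobj F Y) ?SF (-1) ?v"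
      by (rule abeqI) (use o h k Fss Fhj Fhi in \<open>simp add: dgs abg pre\<close>)
  qed
  moreover have "Cmp (H0cat B) (dobj F Z) (dobj F ?S) ?SF (Com (H0func A B F) X) (fmap (H0func A B F) Z ?S h)
      = dcls B (dobj F Z) ?SF ?h"
    unfolding Com e using o h by (subst H0func_map) (auto simp: dgs B.H0_Cmp abgc)
  moreover have "fmap (H0func A B F) X Y f = dcls B (dobj F X) (dobj F Y) (dmap F X Y 0 f')"
     "fmap (H0func A B F) Y Z g = dcls B (dobj F Y) (dobj F Z) (dmap F Y Z 0 i)"
    unfolding e using o by (simp_all add: H0func_map dgs)
  ultimately show "(fobj (H0func A B F) X, fobj (H0func A B F) Y, fobj (H0func A B F) Z,
        fmap (H0func A B F) X Y f, fmap (H0func A B F) Y Z g,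
        Cmp (H0 K B) (fobj (H0func A B F) Z) (fobj (H0func A B F) (sob (H0 K A) X)) (sob (H0 K B) (fobj (H0func A B F) X))
            (Com (H0func A B F) X) (fmap (H0func A B F) Z (sob (H0 K A) X) h)) \<in> Tri (H0 K B)"
    unfolding B.H0_Tri_iff using preserves_cones[OF ic] by auto
qed

end

section \<open>Arrow categories, transfer of pretriangulated structures, and small models\<close>

section \<open>The dg category of arrows of a dg functor\<close>

text \<open>The morphism complex is the homotopy fibre of
  \<open>(u, v) \<mapsto> \<nu>' F(u) - v \<nu>\<close>: the third component is a homotopy, one
  degree lower. A closed morphism of degree 0 is therefore a square that commutes up to a specified
  homotopy.\<close>

definition arrow_cat :: "('o, 'm, 'k) dg_cat \<Rightarrow> ('p, 'n, 'k) dg_cat \<Rightarrow> ('o, 'm, 'p, 'n) dg_func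
    \<Rightarrow> ('o \<times> 'p \<times> 'n, 'm \<times> 'n \<times> 'n, 'k) dg_cat" where
  "arrow_cat A B F =
    \<lparr>DObj = {(x, y, \<nu>). x \<in> DObj A \<and> y \<in> DObj B \<and> \<nu> \<in> dcocyc B (dobj F x) y 0},
     DHom = (\<lambda>(x, y, \<nu>) (x', y', \<nu>').
       \<lparr>Mdl = (\<lambda>n. direct_sum (dM A x x' n)
          (direct_sum (dM B y y' n) (dM B (dobj F x) y' (n - 1)))),
        Dif = (\<lambda>n (u, v, w). (ddif A x x' n u, ddif B y y' n v,
          (DCmp B (dobj F x) (dobj F x') y' 0 n \<nu>' (dmap F x x' n u)
            \<ominus>\<^bsub>dM B (dobj F x) y' n\<^esub> DCmp B (dobj F x) y y' n 0 v \<nu>)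
            \<ominus>\<^bsub>dM B (dobj F x) y' n\<^esub> ddif B (dobj F x) y' (n - 1) w))\<rparr>),
     DCmp = (\<lambda>(x, y, \<nu>) (x', y', \<nu>') (x'', y'', \<nu>'') m n (u', v', w') (u, v, w).
       (DCmp A x x' x'' m n u' u, DCmp B y y' y'' m n v' v,
        koszul (dM B (dobj F x) y'' (m + n - 1)) m (DCmp B (dobj F x) y' y'' m (n - 1) v' w)
          \<oplus>\<^bsub>dM B (dobj F x) y'' (m + n - 1)\<^esub>
          DCmp B (dobj F x) (dobj F x') y'' (m - 1) n w' (dmap F x x' n u))),
     DIdn = (\<lambda>(x, y, \<nu>). (DIdn A x, DIdn B y, (dzero B (dobj F x) y (-1))))\<rparr>"

definition arrow_src :: "('o \<times> 'p \<times> 'n, 'm \<times> 'n \<times> 'n, 'o, 'm) dg_func" where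
  "arrow_src = \<lparr>dobj = (\<lambda>(x, y, \<nu>). x), dmap = (\<lambda>p q n (u, v, w). u)\<rparr>"

definition arrow_tgt :: "('o \<times> 'p \<times> 'n, 'm \<times> 'n \<times> 'n, 'p, 'n) dg_func" where
  "arrow_tgt = \<lparr>dobj = (\<lambda>(x, y, \<nu>). y), dmap = (\<lambda>p q n (u, v, w). v)\<rparr>"

context dg_functor_between
begin

lemma arrow_obj [dgs]:
  "(x, y, \<nu>) \<in> DObj (arrow_cat A B F) \<longleftrightarrow> x \<in> DObj A \<and> y \<in> DObj B \<and>
     \<nu> \<in> dmor B (dobj F x) y 0 \<and> ddif B (dobj F x) y 0 \<nu> = (dzero B (dobj F x) y 1)"
  by (auto simp: arrow_cat_def cocycles_def)

lemma arrow_mor [dgs]: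
  "(u, v, w) \<in> dmor (arrow_cat A B F) (x, y, \<nu>) (x', y', \<nu>') n \<longleftrightarrow>
     u \<in> dmor A x x' n \<and> v \<in> dmor B y y' n \<and> w \<in> dmor B (dobj F x) y' (n - 1)"
  by (auto simp: arrow_cat_def)

lemma arrow_zero [dgs]:
  "(dzero (arrow_cat A B F) (x, y, \<nu>) (x', y', \<nu>') n) =
     ((dzero A x x' n), (dzero B y y' n), (dzero B (dobj F x) y' (n - 1)))"
  by (auto simp: arrow_cat_def)

lemma arrow_add [dgs]:
  "(u, v, w) \<oplus>\<^bsub>dM (arrow_cat A B F) (x, y, \<nu>) (x', y', \<nu>') n\<^esub> (u', v', w') =
     (u \<oplus>\<^bsub>dM A x x' n\<^esub> u', v \<oplus>\<^bsub>dM B y y' n\<^esub> v', w \<oplus>\<^bsub>dM B (dobj F x) y' (n - 1)\<^esub> w')"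
  by (auto simp: arrow_cat_def)

lemma arrow_smult [dgs]:
  "a \<odot>\<^bsub>dM (arrow_cat A B F) (x, y, \<nu>) (x', y', \<nu>') n\<^esub> (u, v, w) =
     (a \<odot>\<^bsub>dM A x x' n\<^esub> u, a \<odot>\<^bsub>dM B y y' n\<^esub> v, a \<odot>\<^bsub>dM B (dobj F x) y' (n - 1)\<^esub> w)"
  by (auto simp: arrow_cat_def)

lemma arrow_dif [dgs]:
  "ddif (arrow_cat A B F) (x, y, \<nu>) (x', y', \<nu>') n (u, v, w) = (ddif A x x' n u, ddif B y y' n v,
          (DCmp B (dobj F x) (dobj F x') y' 0 n \<nu>' (dmap F x x' n u)
            \<ominus>\<^bsub>dM B (dobj F x) y' n\<^esub> DCmp B (dobj F x) y y' n 0 v \<nu>)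
            \<ominus>\<^bsub>dM B (dobj F x) y' n\<^esub> ddif B (dobj F x) y' (n - 1) w)"
  by (simp add: arrow_cat_def)

lemma arrow_cmp [dgs]:
  "DCmp (arrow_cat A B F) (x, y, \<nu>) (x', y', \<nu>') (x'', y'', \<nu>'') m n (u', v', w') (u, v, w) =
       (DCmp A x x' x'' m n u' u, DCmp B y y' y'' m n v' v,
        koszul (dM B (dobj F x) y'' (m + n - 1)) m (DCmp B (dobj F x) y' y'' m (n - 1) v' w)
          \<oplus>\<^bsub>dM B (dobj F x) y'' (m + n - 1)\<^esub>
          DCmp B (dobj F x) (dobj F x') y'' (m - 1) n w' (dmap F x x' n u))"
  by (simp add: arrow_cat_def)

lemma arrow_idn [dgs]:
  "DIdn (arrow_cat A B F) (x, y, \<nu>) = (DIdn A x, DIdn B y, (dzero B (dobj F x) y (-1)))"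
  by (simp add: arrow_cat_def)

lemma arrow_module:
  assumes "p \<in> DObj (arrow_cat A B F)" "q \<in> DObj (arrow_cat A B F)"
  shows "module K (dM (arrow_cat A B F) p q n)"
  using assms by (cases p; cases q)
    (auto simp: dgs, auto simp: arrow_cat_def dgs intro!: direct_sum_module)

lemma arrow_minus [dgs]:
  assumes "(x, y, \<nu>) \<in> DObj (arrow_cat A B F)" "(x', y', \<nu>') \<in> DObj (arrow_cat A B F)"
    "u \<in> dmor A x x' n" "v \<in> dmor B y y' n" "w \<in> dmor B (dobj F x) y' (n - 1)"
  shows "\<ominus>\<^bsub>dM (arrow_cat A B F) (x, y, \<nu>) (x', y', \<nu>') n\<^esub> (u, v, w) =
     (\<ominus>\<^bsub>dM A x x' n\<^esub> u, \<ominus>\<^bsub>dM B y y' n\<^esub> v, \<ominus>\<^bsub>dM B (dobj F x) y' (n - 1)\<^esub> w)"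
  using assms by (simp add: dgs, simp add: arrow_cat_def dgs direct_sum_minus[where K = K] direct_sum_module)

lemma arrow_koszul [dgs]:
  assumes "(x, y, \<nu>) \<in> DObj (arrow_cat A B F)" "(x', y', \<nu>') \<in> DObj (arrow_cat A B F)"
    "u \<in> dmor A x x' n" "v \<in> dmor B y y' n" "w \<in> dmor B (dobj F x) y' (n - 1)"
  shows "koszul (dM (arrow_cat A B F) (x, y, \<nu>) (x', y', \<nu>') n) m (u, v, w) =
     (koszul (dM A x x' n) m u, koszul (dM B y y' n) m v, koszul (dM B (dobj F x) y' (n - 1)) m w)"
  using assms by (simp add: koszul_def arrow_minus)

lemma arrow_complex:
  assumes "p \<in> DObj (arrow_cat A B F)" "q \<in> DObj (arrow_cat A B F)"
  shows "is_complex K (DHom (arrow_cat A B F) p q)"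
proof -
  obtain x y \<nu> x' y' \<nu>' where pq: "p = (x, y, \<nu>)" "q = (x', y', \<nu>')" by (cases p; cases q)
  show ?thesis
    unfolding is_complex_def
  proof (intro conjI allI ballI)
    fix n
    show "module K (dM (arrow_cat A B F) p q n)" using assms by (rule arrow_module)
    show "linear_map K (dM (arrow_cat A B F) p q n) (dM (arrow_cat A B F) p q (n + 1)) (ddif (arrow_cat A B F) p q n)"
      using assms unfolding pq linear_map_def
      by (auto simp: dgs abg algebra_simps intro!: abeqI)
    fix h assume "h \<in> dmor (arrow_cat A B F) p q n"
    then show "ddif (arrow_cat A B F) p q (n + 1) (ddif (arrow_cat A B F) p q n h) = (dzero (arrow_cat A B F) p q (n + 2))"
      using assms unfolding pq by (cases h) (auto simp: dgs abg algebra_simps intro!: abeqI)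
  qed
qed

text \<open>The sign \<open>(-1)^m\<close> before \<open>v' w\<close> in the composite accounts for
  the degree shift of the homotopy component. Splitting by the parity of degrees turns
  \<open>koszul\<close> into ordinary signs, after which everything is rewriting.\<close>

lemma arrow_dg_category: "dg_category K (arrow_cat A B F)"
proof (intro dg_category.intro dg_category_axioms.intro)
  show "cring K" by (rule A.cring_axioms)
next
  fix p q assume "p \<in> DObj (arrow_cat A B F)" "q \<in> DObj (arrow_cat A B F)"
  then show "is_complex K (DHom (arrow_cat A B F) p q)" by (rule arrow_complex)
next
  fix p q r g m n
  assume o: "p \<in> DObj (arrow_cat A B F)" "q \<in> DObj (arrow_cat A B F)" "r \<in> DObj (arrow_cat A B F)"
    and g: "g \<in> dmor (arrow_cat A B F) q r m"
  then show "linear_map K (dM (arrow_cat A B F) p q n) (dM (arrow_cat A B F) p r (m + n))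
              (\<lambda>f. DCmp (arrow_cat A B F) p q r m n g f)"
    by (cases p; cases q; cases r; cases g; cases "even m")
       (auto simp: linear_map_def dgs abg algebra_simps intro!: abeqI)
next
  fix p q r f m n
  assume o: "p \<in> DObj (arrow_cat A B F)" "q \<in> DObj (arrow_cat A B F)" "r \<in> DObj (arrow_cat A B F)"
    and f: "f \<in> dmor (arrow_cat A B F) p q n"
  then show "linear_map K (dM (arrow_cat A B F) q r m) (dM (arrow_cat A B F) p r (m + n))
              (\<lambda>g. DCmp (arrow_cat A B F) p q r m n g f)"
    by (cases p; cases q; cases r; cases f; cases "even m")
       (auto simp: linear_map_def dgs abg algebra_simps intro!: abeqI)
next
  fix p q r f g m n
  assume o: "p \<in> DObj (arrow_cat A B F)" "q \<in> DObj (arrow_cat A B F)" "r \<in> DObj (arrow_cat A B F)"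
    and f: "f \<in> dmor (arrow_cat A B F) p q n" and g: "g \<in> dmor (arrow_cat A B F) q r m"
  then show "ddif (arrow_cat A B F) p r (m + n) (DCmp (arrow_cat A B F) p q r m n g f)
          = DCmp (arrow_cat A B F) p q r (m + 1) n (ddif (arrow_cat A B F) q r m g) f
            \<oplus>\<^bsub>dM (arrow_cat A B F) p r (m + n + 1)\<^esub>
            koszul (dM (arrow_cat A B F) p r (m + n + 1)) m (DCmp (arrow_cat A B F) p q r m (n + 1) g (ddif (arrow_cat A B F) p q n f))"
    by (cases p; cases q; cases r; cases f; cases g; cases "even m"; cases "even n")
      (auto simp: dgs abg algebra_simps intro!: abeqI)
next
  fix p q r t f g h l m n
  assume o: "p \<in> DObj (arrow_cat A B F)" "q \<in> DObj (arrow_cat A B F)" "r \<in> DObj (arrow_cat A B F)" "t \<in> DObj (arrow_cat A B F)"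
    and f: "f \<in> dmor (arrow_cat A B F) p q n" and g: "g \<in> dmor (arrow_cat A B F) q r m" and h: "h \<in> dmor (arrow_cat A B F) r t l"
  then show "DCmp (arrow_cat A B F) p r t l (m + n) h (DCmp (arrow_cat A B F) p q r m n g f)
          = DCmp (arrow_cat A B F) p q t (l + m) n (DCmp (arrow_cat A B F) q r t l m h g) f"
    by (cases p; cases q; cases r; cases t; cases f; cases g; cases h; cases "even m"; cases "even n"; cases "even l")
      (auto simp: dgs abg algebra_simps intro!: abeqI)
next
  fix p assume "p \<in> DObj (arrow_cat A B F)"
  then show "DIdn (arrow_cat A B F) p \<in> dmor (arrow_cat A B F) p p 0"
    by (cases p) (auto simp: dgs abgc)
next
  fix p q f n assume "p \<in> DObj (arrow_cat A B F)" "q \<in> DObj (arrow_cat A B F)" "f \<in> dmor (arrow_cat A B F) p q n"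
  then show "DCmp (arrow_cat A B F) p q q 0 n (DIdn (arrow_cat A B F) q) f = f"
    by (cases p; cases q; cases f) (auto simp: dgs abgc)
next
  fix p q f n assume "p \<in> DObj (arrow_cat A B F)" "q \<in> DObj (arrow_cat A B F)" "f \<in> dmor (arrow_cat A B F) p q n"
  then show "DCmp (arrow_cat A B F) p p q n 0 f (DIdn (arrow_cat A B F) p) = f"
    by (cases p; cases q; cases f; cases "even n") (auto simp: dgs abgc)
qed

lemma arrow_src_dg_functor: "dg_functor_between K (arrow_cat A B F) A arrow_src"
  unfolding dg_functor_between_def dg_functor_between_axioms_def dg_functor_def chain_map_def linear_map_def
  by (auto simp: arrow_dg_category A.dg_category_axioms arrow_src_def dgs)

lemma arrow_tgt_dg_functor: "dg_functor_between K (arrow_cat A B F) B arrow_tgt"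
  unfolding dg_functor_between_def dg_functor_between_axioms_def dg_functor_def chain_map_def linear_map_def
  by (auto simp: arrow_dg_category B.dg_category_axioms arrow_tgt_def dgs)

section \<open>Cohomology of the two projections of an arrow category\<close>

context
  fixes x y \<nu> x' y' \<nu>'
  assumes p: "(x, y, \<nu>) \<in> DObj (arrow_cat A B F)" and p': "(x', y', \<nu>') \<in> DObj (arrow_cat A B F)"
begin

abbreviation (input) "push \<equiv> \<lambda>n u. DCmp B (dobj F x) (dobj F x') y' 0 n \<nu>' (dmap F x x' n u)"
abbreviation (input) "pull \<equiv> \<lambda>n v. DCmp B (dobj F x) y y' n 0 v \<nu>"

lemma arrow_facts:
  "x \<in> DObj A" "y \<in> DObj B" "\<nu> \<in> dmor B (dobj F x) y 0" "ddif B (dobj F x) y 0 \<nu> = (dzero B (dobj F x) y 1)"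
  "x' \<in> DObj A" "y' \<in> DObj B" "\<nu>' \<in> dmor B (dobj F x') y' 0" "ddif B (dobj F x') y' 0 \<nu>' = (dzero B (dobj F x') y' 1)"
  using p p' by (auto simp: arrow_obj)

text \<open>The kernel of the projection to \<open>v\<close> is the homotopy fibre of
  \<open>push\<close>. To lift a cocycle \<open>v\<close>, the cocycle \<open>pull n v\<close> is
  hit by \<open>push\<close> up to a boundary; the preimage is \<open>u\<close> and the bounding
  cochain is the homotopy.\<close>

lemma arrow_tgt_surj:
  assumes "cohom_surj (DHom A x x') (DHom B (dobj F x) y') push n"
  shows "cohom_surj (DHom (arrow_cat A B F) (x, y, \<nu>) (x', y', \<nu>')) (DHom B y y') (dmap arrow_tgt (x, y, \<nu>) (x', y', \<nu>')) n"
  unfolding cohom_surj_def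
proof
  note f = arrow_facts
  fix v assume "v \<in> dcocyc B y y' n"
  then have v: "v \<in> dmor B y y' n" "ddif B y y' n v = (dzero B y y' (n + 1))" by (auto simp: dgs)
  have "pull n v \<in> dcocyc B (dobj F x) y' n"
    by (cases "even n") (use v f in \<open>simp_all add: dgs abgc algebra_simps\<close>)
  then obtain u e where u: "u \<in> dmor A x x' n" "ddif A x x' n u = (dzero A x x' (n + 1))" "e \<in> dmor B (dobj F x) y' (n - 1)"
    "push n u = pull n v \<oplus>\<^bsub>dM B (dobj F x) y' n\<^esub> ddif B (dobj F x) y' (n - 1) e"
    using assms unfolding cohom_surj_def by (auto simp: cocycles_def)
  show "\<exists>h\<in>dcocyc (arrow_cat A B F) (x, y, \<nu>) (x', y', \<nu>') n. \<exists>z\<in>dmor B y y' (n - 1).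
     dmap arrow_tgt (x, y, \<nu>) (x', y', \<nu>') n h = v \<oplus>\<^bsub>dM B y y' n\<^esub> ddif B y y' (n - 1) z"
  proof (rule bexI[of _ "(u, v, e)"], rule bexI[of _ "(dzero B y y' (n - 1))"])
    have "(pull n v \<oplus>\<^bsub>dM B (dobj F x) y' n\<^esub> ddif B (dobj F x) y' (n - 1) e) \<ominus>\<^bsub>dM B (dobj F x) y' n\<^esub> pull n v
       \<ominus>\<^bsub>dM B (dobj F x) y' n\<^esub> ddif B (dobj F x) y' (n - 1) e = (dzero B (dobj F x) y' n)"
      by (rule abeqI) (use u(1,3) v f in \<open>simp add: dgs abg algebra_simps\<close>)
    then show "(u, v, e) \<in> dcocyc (arrow_cat A B F) (x, y, \<nu>) (x', y', \<nu>') n"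
      using u v by (simp add: cocycles_def arrow_mor arrow_dif arrow_zero)
  qed (use u v f in \<open>simp_all add: arrow_tgt_def dgs abgc\<close>)
qed

text \<open>Injectivity involves two degrees: \<open>push\<close> has to be injective in degree
  \<open>n\<close>, to bound \<open>u\<close>, and surjective in degree \<open>n - 1\<close>, to
  match the homotopy component. For \<open>n = 0\<close> these are the degrees 0 and -1.\<close>

lemma arrow_tgt_inj:
  assumes i: "cohom_inj (DHom A x x') (DHom B (dobj F x) y') push n"
    and s: "cohom_surj (DHom A x x') (DHom B (dobj F x) y') push (n - 1)"
  shows "cohom_inj (DHom (arrow_cat A B F) (x, y, \<nu>) (x', y', \<nu>')) (DHom B y y') (dmap arrow_tgt (x, y, \<nu>) (x', y', \<nu>')) n"
  unfolding cohom_inj_def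
proof (intro ballI impI)
  note f = arrow_facts
  fix h v' assume h: "h \<in> dcocyc (arrow_cat A B F) (x, y, \<nu>) (x', y', \<nu>') n" and v': "v' \<in> dmor B y y' (n - 1)"
    "dmap arrow_tgt (x, y, \<nu>) (x', y', \<nu>') n h = ddif B y y' (n - 1) v'"
  obtain u v w where [simp]: "h = (u, v, w)" by (cases h)
  let ?M = "dM B (dobj F x) y'"
  have d: "u \<in> dmor A x x' n" "w \<in> dmor B (dobj F x) y' (n - 1)" "v = ddif B y y' (n - 1) v'"
     "ddif A x x' n u = (dzero A x x' (n + 1))"
     "(push n u \<ominus>\<^bsub>?M n\<^esub> pull n v) \<ominus>\<^bsub>?M n\<^esub> ddif B (dobj F x) y' (n - 1) w = \<zero>\<^bsub>?M n\<^esub>"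
    using h v' by (auto simp: cocycles_def arrow_mor arrow_dif arrow_zero arrow_tgt_def)
  have pu: "push n u = ddif B (dobj F x) y' (n - 1) (w \<oplus>\<^bsub>?M (n - 1)\<^esub> pull (n - 1) v')"
  proof -
    have "push n u = ((push n u \<ominus>\<^bsub>?M n\<^esub> pull n v) \<ominus>\<^bsub>?M n\<^esub> ddif B (dobj F x) y' (n - 1) w) \<oplus>\<^bsub>?M n\<^esub>
       ddif B (dobj F x) y' (n - 1) (w \<oplus>\<^bsub>?M (n - 1)\<^esub> pull (n - 1) v')"
      unfolding d(3) by (rule abeqI, cases "even n") (use d(1,2) v' f in \<open>simp_all add: dgs abg algebra_simps\<close>)
    then show ?thesis unfolding d(5) using d(1,2) v' f by (simp add: dgs abgc)
  qed
  then obtain u' where u': "u' \<in> dmor A x x' (n - 1)" "u = ddif A x x' (n - 1) u'"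
    using i[unfolded cohom_inj_def, THEN bspec, THEN bspec, THEN mp, OF _ _ pu] d(1,2,4) v' f
    by (auto simp: cocycles_def dgs abgc)
  \<comment> \<open>\<open>?w\<close> measures how far \<open>(u', v')\<close> is from bounding the
    homotopy component. It is a cocycle of degree \<open>n - 1\<close>, so adding a cocycle
    \<open>u''\<close> that \<open>push\<close> maps to its class repairs \<open>u'\<close>.\<close>
  let ?w = "(w \<oplus>\<^bsub>?M (n - 1)\<^esub> pull (n - 1) v') \<ominus>\<^bsub>?M (n - 1)\<^esub> push (n - 1) u'"
  have w1: "?w \<in> dmor B (dobj F x) y' (n - 1)" using d u' v' f by (simp add: dgs abgc)
  have "ddif B (dobj F x) y' (n - 1) ?w = push n u \<ominus>\<^bsub>?M n\<^esub> push n u"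
  proof -
    have "ddif B (dobj F x) y' (n - 1) ?w = ddif B (dobj F x) y' (n - 1) (w \<oplus>\<^bsub>?M (n - 1)\<^esub> pull (n - 1) v')
       \<ominus>\<^bsub>?M n\<^esub> ddif B (dobj F x) y' (n - 1) (push (n - 1) u')"
      using d u' v' f by (simp add: dgs abgc)
    also have "ddif B (dobj F x) y' (n - 1) (push (n - 1) u') = push n u"
      unfolding u'(2) using u'(1) f by (simp add: dgs abgc)
    finally show ?thesis using pu by simp
  qed
  then have "ddif B (dobj F x) y' (n - 1) ?w = \<zero>\<^bsub>?M n\<^esub>"
    using d(1) f by (simp add: dgs abgc)
  then obtain u'' e where u'': "u'' \<in> dmor A x x' (n - 1)" "ddif A x x' (n - 1) u'' = (dzero A x x' n)" "e \<in> dmor B (dobj F x) y' (n - 1 - 1)"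
    "push (n - 1) u'' = ?w \<oplus>\<^bsub>?M (n - 1)\<^esub> ddif B (dobj F x) y' (n - 1 - 1) e"
    using s w1 unfolding cohom_surj_def by (auto simp: cocycles_def)
  show "\<exists>h'\<in>dmor (arrow_cat A B F) (x, y, \<nu>) (x', y', \<nu>') (n - 1). h = ddif (arrow_cat A B F) (x, y, \<nu>) (x', y', \<nu>') (n - 1) h'"
  proof
    let ?h = "(u' \<oplus>\<^bsub>dM A x x' (n - 1)\<^esub> u'', v', e)"
    show "?h \<in> dmor (arrow_cat A B F) (x, y, \<nu>) (x', y', \<nu>') (n - 1)"
      using u' u'' v' f by (simp add: arrow_mor dgs abgc)
    have "u = ddif A x x' (n - 1) (u' \<oplus>\<^bsub>dM A x x' (n - 1)\<^esub> u'')"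
      using u' u'' f by (simp add: dgs abgc)
    moreover have "(push (n - 1) (u' \<oplus>\<^bsub>dM A x x' (n - 1)\<^esub> u'') \<ominus>\<^bsub>?M (n - 1)\<^esub> pull (n - 1) v') \<ominus>\<^bsub>?M (n - 1)\<^esub> ddif B (dobj F x) y' (n - 1 - 1) e = w"
    proof -
      have "push (n - 1) (u' \<oplus>\<^bsub>dM A x x' (n - 1)\<^esub> u'') = push (n - 1) u' \<oplus>\<^bsub>?M (n - 1)\<^esub> push (n - 1) u''"
        using u' u''(1) f by (simp add: dgs)
      then show ?thesis unfolding u''(4)
        by (simp, intro abeqI) (use u' u''(1,3) d(1,2) v' f in \<open>simp add: dgs abg algebra_simps\<close>)
    qed
    ultimately show "h = ddif (arrow_cat A B F) (x, y, \<nu>) (x', y', \<nu>') (n - 1) ?h"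
      using d(3) by (simp add: arrow_dif)
  qed
qed

text \<open>The mirror image with \<open>pull\<close> in place of \<open>push\<close>. Here
  \<open>v\<close> is solved for instead of \<open>u\<close>, so the homotopy enters with the
  opposite sign.\<close>

lemma arrow_src_surj:
  assumes "cohom_surj (DHom B y y') (DHom B (dobj F x) y') pull n"
  shows "cohom_surj (DHom (arrow_cat A B F) (x, y, \<nu>) (x', y', \<nu>')) (DHom A x x') (dmap arrow_src (x, y, \<nu>) (x', y', \<nu>')) n"
  unfolding cohom_surj_def
proof
  note f = arrow_facts
  let ?M = "dM B (dobj F x) y'"
  fix u assume "u \<in> dcocyc A x x' n"
  then have u: "u \<in> dmor A x x' n" "ddif A x x' n u = (dzero A x x' (n + 1))" by (auto simp: dgs)
  have "push n u \<in> dcocyc B (dobj F x) y' n"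
    using u f by (simp add: dgs abgc algebra_simps)
  then obtain v e where v: "v \<in> dmor B y y' n" "ddif B y y' n v = (dzero B y y' (n + 1))" "e \<in> dmor B (dobj F x) y' (n - 1)"
    "pull n v = push n u \<oplus>\<^bsub>?M n\<^esub> ddif B (dobj F x) y' (n - 1) e"
    using assms unfolding cohom_surj_def by (auto simp: cocycles_def)
  show "\<exists>h\<in>dcocyc (arrow_cat A B F) (x, y, \<nu>) (x', y', \<nu>') n. \<exists>z\<in>dmor A x x' (n - 1).
     dmap arrow_src (x, y, \<nu>) (x', y', \<nu>') n h = u \<oplus>\<^bsub>dM A x x' n\<^esub> ddif A x x' (n - 1) z"
  proof (rule bexI[of _ "(u, v, \<ominus>\<^bsub>?M (n - 1)\<^esub> e)"], rule bexI[of _ "(dzero A x x' (n - 1))"])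
    have "(push n u \<ominus>\<^bsub>?M n\<^esub> (push n u \<oplus>\<^bsub>?M n\<^esub> ddif B (dobj F x) y' (n - 1) e))
       \<ominus>\<^bsub>?M n\<^esub> ddif B (dobj F x) y' (n - 1) (\<ominus>\<^bsub>?M (n - 1)\<^esub> e) = \<zero>\<^bsub>?M n\<^esub>"
      by (rule abeqI) (use v(1,3) u f in \<open>simp add: dgs abg algebra_simps\<close>)
    then show "(u, v, \<ominus>\<^bsub>?M (n - 1)\<^esub> e) \<in> dcocyc (arrow_cat A B F) (x, y, \<nu>) (x', y', \<nu>') n"
      using u v f by (simp add: cocycles_def arrow_mor arrow_dif arrow_zero dgs abgc)
  qed (use u v f in \<open>simp_all add: arrow_src_def dgs abgc\<close>)
qed

lemma arrow_src_inj:
  assumes i: "cohom_inj (DHom B y y') (DHom B (dobj F x) y') pull n"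
    and s: "cohom_surj (DHom B y y') (DHom B (dobj F x) y') pull (n - 1)"
  shows "cohom_inj (DHom (arrow_cat A B F) (x, y, \<nu>) (x', y', \<nu>')) (DHom A x x') (dmap arrow_src (x, y, \<nu>) (x', y', \<nu>')) n"
  unfolding cohom_inj_def
proof (intro ballI impI)
  note f = arrow_facts
  fix h u' assume h: "h \<in> dcocyc (arrow_cat A B F) (x, y, \<nu>) (x', y', \<nu>') n" and u': "u' \<in> dmor A x x' (n - 1)"
    "dmap arrow_src (x, y, \<nu>) (x', y', \<nu>') n h = ddif A x x' (n - 1) u'"
  obtain u v w where [simp]: "h = (u, v, w)" by (cases h)
  let ?M = "dM B (dobj F x) y'"
  have d: "v \<in> dmor B y y' n" "w \<in> dmor B (dobj F x) y' (n - 1)" "u = ddif A x x' (n - 1) u'"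
     "ddif B y y' n v = (dzero B y y' (n + 1))"
     "(push n u \<ominus>\<^bsub>?M n\<^esub> pull n v) \<ominus>\<^bsub>?M n\<^esub> ddif B (dobj F x) y' (n - 1) w = \<zero>\<^bsub>?M n\<^esub>"
    using h u' by (auto simp: cocycles_def arrow_mor arrow_dif arrow_zero arrow_src_def)
  have pv: "pull n v = ddif B (dobj F x) y' (n - 1) (push (n - 1) u' \<ominus>\<^bsub>?M (n - 1)\<^esub> w)"
  proof -
    have "pull n v = ddif B (dobj F x) y' (n - 1) (push (n - 1) u' \<ominus>\<^bsub>?M (n - 1)\<^esub> w) \<ominus>\<^bsub>?M n\<^esub>
       ((push n u \<ominus>\<^bsub>?M n\<^esub> pull n v) \<ominus>\<^bsub>?M n\<^esub> ddif B (dobj F x) y' (n - 1) w)"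
      unfolding d(3) by (rule abeqI) (use d(1,2) u' f in \<open>simp_all add: dgs abg algebra_simps\<close>)
    then show ?thesis unfolding d(5) using d(1,2) u' f by (simp add: dgs abgc)
  qed
  then obtain v' where v': "v' \<in> dmor B y y' (n - 1)" "v = ddif B y y' (n - 1) v'"
    using i[unfolded cohom_inj_def, THEN bspec, THEN bspec, THEN mp, OF _ _ pv] d(1,2,4) u' f
    by (auto simp: cocycles_def dgs abgc)
  let ?w = "(push (n - 1) u' \<ominus>\<^bsub>?M (n - 1)\<^esub> w) \<ominus>\<^bsub>?M (n - 1)\<^esub> pull (n - 1) v'"
  have w1: "?w \<in> dmor B (dobj F x) y' (n - 1)" using d u' v' f by (simp add: dgs abgc)
  have "ddif B (dobj F x) y' (n - 1) ?w = pull n v \<ominus>\<^bsub>?M n\<^esub> pull n v"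
  proof -
    have "ddif B (dobj F x) y' (n - 1) ?w = ddif B (dobj F x) y' (n - 1) (push (n - 1) u' \<ominus>\<^bsub>?M (n - 1)\<^esub> w)
       \<ominus>\<^bsub>?M n\<^esub> ddif B (dobj F x) y' (n - 1) (pull (n - 1) v')"
      using d u' v' f by (simp add: dgs abgc)
    also have "ddif B (dobj F x) y' (n - 1) (pull (n - 1) v') = pull n v"
      unfolding v'(2) by (cases "even n") (use v'(1) f in \<open>simp_all add: dgs abgc\<close>)
    finally show ?thesis using pv by simp
  qed
  then have "ddif B (dobj F x) y' (n - 1) ?w = \<zero>\<^bsub>?M n\<^esub>"
    using d(1) f by (simp add: dgs abgc)
  then obtain v'' e where v'': "v'' \<in> dmor B y y' (n - 1)" "ddif B y y' (n - 1) v'' = (dzero B y y' n)" "e \<in> dmor B (dobj F x) y' (n - 1 - 1)"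
    "pull (n - 1) v'' = ?w \<oplus>\<^bsub>?M (n - 1)\<^esub> ddif B (dobj F x) y' (n - 1 - 1) e"
    using s w1 unfolding cohom_surj_def by (auto simp: cocycles_def)
  show "\<exists>h'\<in>dmor (arrow_cat A B F) (x, y, \<nu>) (x', y', \<nu>') (n - 1). h = ddif (arrow_cat A B F) (x, y, \<nu>) (x', y', \<nu>') (n - 1) h'"
  proof
    let ?h = "(u', v' \<oplus>\<^bsub>dM B y y' (n - 1)\<^esub> v'', \<ominus>\<^bsub>?M (n - 1 - 1)\<^esub> e)"
    show "?h \<in> dmor (arrow_cat A B F) (x, y, \<nu>) (x', y', \<nu>') (n - 1)"
      using u' v'' v' f by (simp add: arrow_mor dgs abgc)
    have "v = ddif B y y' (n - 1) (v' \<oplus>\<^bsub>dM B y y' (n - 1)\<^esub> v'')"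
      using v' v'' f by (simp add: dgs abgc)
    moreover have "(push (n - 1) u' \<ominus>\<^bsub>?M (n - 1)\<^esub> pull (n - 1) (v' \<oplus>\<^bsub>dM B y y' (n - 1)\<^esub> v'')) \<ominus>\<^bsub>?M (n - 1)\<^esub>
        ddif B (dobj F x) y' (n - 1 - 1) (\<ominus>\<^bsub>?M (n - 1 - 1)\<^esub> e) = w"
    proof -
      have "pull (n - 1) (v' \<oplus>\<^bsub>dM B y y' (n - 1)\<^esub> v'') = pull (n - 1) v' \<oplus>\<^bsub>?M (n - 1)\<^esub> pull (n - 1) v''"
        using v' v''(1) f by (simp add: dgs)
      then show ?thesis unfolding v''(4)
        by (simp, intro abeqI) (use v' v''(1,3) d(1,2) u' f in \<open>simp add: dgs abg algebra_simps\<close>)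
    qed
    ultimately show "h = ddif (arrow_cat A B F) (x, y, \<nu>) (x', y', \<nu>') (n - 1) ?h"
      using d(3) by (simp add: arrow_dif)
  qed
qed

end

end

section \<open>Quasi-equivalences reflect pretriangulatedness\<close>

text \<open>Surjectivity on objects is meant literally, so that suspensions and cones found in
  \<open>B\<close> can be lifted without intervening isomorphisms. \<open>base\<close> and its small
  model have this property.\<close>

locale surjective_quasi_equivalence = dg_functor_between K A B F
  for K :: "'k ring" and A :: "('o, 'm, 'k) dg_cat" and B :: "('p, 'n, 'k) dg_cat" and F +
  assumes quasi: "\<lbrakk>X \<in> DObj A; Y \<in> DObj A\<rbrakk> \<Longrightarrow>
      cohom_surj (DHom A X Y) (DHom B (dobj F X) (dobj F Y)) (dmap F X Y) n \<and>
      cohom_inj (DHom A X Y) (DHom B (dobj F X) (dobj F Y)) (dmap F X Y) n"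
    and dobj_surj: "V \<in> DObj B \<Longrightarrow> \<exists>U\<in>DObj A. dobj F U = V"
begin

lemma lift:
  assumes "X \<in> DObj A" "Y \<in> DObj A" "x \<in> dmor A X Y (n + 1)" "ddif A X Y (n + 1) x = (dzero A X Y (n + 2))"
    "y \<in> dmor B (dobj F X) (dobj F Y) n" "dmap F X Y (n + 1) x = ddif B (dobj F X) (dobj F Y) n y"
  obtains x' y' where "x' \<in> dmor A X Y n" "y' \<in> dmor B (dobj F X) (dobj F Y) (n - 1)"
    "ddif A X Y n x' = x" "dmap F X Y n x' = y \<oplus>\<^bsub>dM B (dobj F X) (dobj F Y) n\<^esub> ddif B (dobj F X) (dobj F Y) (n - 1) y'"
proof -
  interpret complex_map K "DHom A X Y" "DHom B (dobj F X) (dobj F Y)" "dmap F X Y"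
    using assms by (intro dmap_complex_map)
  show thesis using quasi_iso_lift[OF _ assms(3-6)] quasi[OF assms(1,2)] that by blast
qed

lemma lift_cocycle:
  assumes "X \<in> DObj A" "Y \<in> DObj A"
    "y \<in> dmor B (dobj F X) (dobj F Y) n" "ddif B (dobj F X) (dobj F Y) n y = (dzero B (dobj F X) (dobj F Y) (n + 1))"
  obtains x' y' where "x' \<in> dmor A X Y n" "y' \<in> dmor B (dobj F X) (dobj F Y) (n - 1)"
    "ddif A X Y n x' = (dzero A X Y (n + 1))"
    "dmap F X Y n x' = y \<oplus>\<^bsub>dM B (dobj F X) (dobj F Y) n\<^esub> ddif B (dobj F X) (dobj F Y) (n - 1) y'"
  using quasi[OF assms(1,2), of n] assms(3,4) unfolding cohom_surj_def cocycles_def by auto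

text \<open>The cocycle is mapped to \<open>B\<close>, bounded there, and the primitive is lifted
  one component at a time. A lift agrees with the primitive in \<open>B\<close> only up to a
  boundary, and each such boundary is absorbed by the equation for the next component.\<close>

lemma reflects_cone_acyclic:
  assumes cd: "cone_data A X Y Z f i j"
    and ac: "cone_acyclic B (dobj F X) (dobj F Y) (dobj F Z) (dmap F X Y 0 f) (dmap F Y Z 0 i) (dmap F X Z (-1) j)"
  shows "cone_acyclic A X Y Z f i j"
  unfolding cone_acyclic_def
proof (intro ballI allI impI; elim conjE)
  note c = cd[unfolded cone_data_def]
  fix W n a b y assume W: "W \<in> DObj A" and m: "a \<in> dmor A W X (n + 2)" "b \<in> dmor A W Y (n + 1)" "y \<in> dmor A W Z n"
    and d: "ddif A W X (n + 2) a = (dzero A W X (n + 3))"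
      "ddif A W Y (n + 1) b = \<ominus>\<^bsub>dM A W Y (n + 2)\<^esub> DCmp A W X Y 0 (n + 2) f a"
      "ddif A W Z n y = DCmp A W X Z (-1) (n + 2) j a \<oplus>\<^bsub>dM A W Z (n + 1)\<^esub> DCmp A W Y Z 0 (n + 1) i b"
  let ?W = "dobj F W" and ?X = "dobj F X" and ?Y = "dobj F Y" and ?Z = "dobj F Z"
  let ?f = "dmap F X Y 0 f" and ?i = "dmap F Y Z 0 i" and ?j = "dmap F X Z (-1) j"
  let ?a = "dmap F W X (n + 2) a" and ?b = "dmap F W Y (n + 1) b" and ?y = "dmap F W Z n y"
  have "?a \<in> dmor B ?W ?X (n + 2)" "?b \<in> dmor B ?W ?Y (n + 1)" "?y \<in> dmor B ?W ?Z n"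
    "ddif B ?W ?X (n + 2) ?a = (dzero B ?W ?X (n + 3))"
    "ddif B ?W ?Y (n + 1) ?b = \<ominus>\<^bsub>dM B ?W ?Y (n + 2)\<^esub> DCmp B ?W ?X ?Y 0 (n + 2) ?f ?a"
    "ddif B ?W ?Z n ?y = DCmp B ?W ?X ?Z (-1) (n + 2) ?j ?a \<oplus>\<^bsub>dM B ?W ?Z (n + 1)\<^esub> DCmp B ?W ?Y ?Z 0 (n + 1) ?i ?b"
    using W m d c by (simp_all add: dgs abgc algebra_simps)
  then obtain a1 b1 y1 where r: "a1\<in>dmor B ?W ?X (n + 1)" "b1\<in>dmor B ?W ?Y n" "y1\<in>dmor B ?W ?Z (n - 1)"
    "ddif B ?W ?X (n + 1) a1 = \<ominus>\<^bsub>dM B ?W ?X (n + 2)\<^esub> ?a"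
    "ddif B ?W ?Y n b1 = ?b \<ominus>\<^bsub>dM B ?W ?Y (n + 1)\<^esub> DCmp B ?W ?X ?Y 0 (n + 1) ?f a1"
    "ddif B ?W ?Z (n - 1) y1 = ?y \<ominus>\<^bsub>dM B ?W ?Z n\<^esub>
            (DCmp B ?W ?X ?Z (-1) (n + 1) ?j a1 \<oplus>\<^bsub>dM B ?W ?Z n\<^esub> DCmp B ?W ?Y ?Z 0 n ?i b1)"
    using ac W unfolding cone_acyclic_def by (metis dobj_closed)
  \<comment> \<open>\<open>p\<close> records the deviation of the lifted \<open>a'\<close> from
    \<open>a1\<close>.\<close>
  obtain a' p where a': "a' \<in> dmor A W X (n + 1)" "p \<in> dmor B ?W ?X n" "ddif A W X (n + 1) a' = \<ominus>\<^bsub>dM A W X (n + 2)\<^esub> a"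
      "dmap F W X (n + 1) a' = a1 \<oplus>\<^bsub>dM B ?W ?X (n + 1)\<^esub> ddif B ?W ?X n p"
    using lift[of W X "\<ominus>\<^bsub>dM A W X (n + 2)\<^esub> a" "n + 1" a1] W m d(1) c r(1,4)
    by (auto simp: dgs abgc algebra_simps)
  \<comment> \<open>The equation for \<open>b'\<close> now contains the lifted \<open>a'\<close>;
    its solution in \<open>B\<close> is \<open>b1\<close> corrected by \<open>f p\<close>, and the
    lift creates the next deviation \<open>q\<close>.\<close>
  let ?b' = "b \<ominus>\<^bsub>dM A W Y (n + 1)\<^esub> DCmp A W X Y 0 (n + 1) f a'"
  have bc: "ddif A W Y (n + 1) ?b' = (dzero A W Y (n + 2))"
    by (rule abeqI) (use W m d(1,2) c a'(1,3) in \<open>simp add: dgs abg algebra_simps\<close>)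
  have bF: "dmap F W Y (n + 1) ?b' = ddif B ?W ?Y n (b1 \<ominus>\<^bsub>dM B ?W ?Y n\<^esub> DCmp B ?W ?X ?Y 0 n ?f p)"
    by (rule abeqI) (use W m d(1,2) c a' r(1,2,5) in \<open>simp add: dgs abg algebra_simps\<close>)
  obtain b' q where b': "b' \<in> dmor A W Y n" "q \<in> dmor B ?W ?Y (n - 1)" "ddif A W Y n b' = ?b'"
     "dmap F W Y n b' = (b1 \<ominus>\<^bsub>dM B ?W ?Y n\<^esub> DCmp B ?W ?X ?Y 0 n ?f p) \<oplus>\<^bsub>dM B ?W ?Y n\<^esub> ddif B ?W ?Y (n - 1) q"
    by (rule lift[OF _ _ _ bc _ bF]) (use W m c a' r(1,2) in \<open>auto simp: dgs abgc\<close>)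
  let ?y' = "y \<ominus>\<^bsub>dM A W Z n\<^esub> (DCmp A W X Z (-1) (n + 1) j a' \<oplus>\<^bsub>dM A W Z n\<^esub> DCmp A W Y Z 0 n i b')"
  have yc: "ddif A W Z (n - 1 + 1) ?y' = (dzero A W Z (n - 1 + 2))"
    by (rule abeqI) (use W m d c a'(1,3) b'(1,3) in \<open>simp add: dgs abg algebra_simps\<close>)
  have yF: "dmap F W Z (n - 1 + 1) ?y' = ddif B ?W ?Z (n - 1)
      ((y1 \<oplus>\<^bsub>dM B ?W ?Z (n - 1)\<^esub> DCmp B ?W ?X ?Z (-1) n ?j p) \<ominus>\<^bsub>dM B ?W ?Z (n - 1)\<^esub> DCmp B ?W ?Y ?Z 0 (n - 1) ?i q)"
    by (rule abeqI) (use W m c a'(1,2,4) b'(1,2,4) r(1,2,3,6) in \<open>simp add: dgs abg algebra_simps\<close>)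
  obtain y' where y': "y' \<in> dmor A W Z (n - 1)" "ddif A W Z (n - 1) y' = ?y'"
    by (rule lift[OF _ _ _ yc _ yF]) (use W m c a'(1,2) b'(1,2) r(3) in \<open>auto simp: dgs abgc\<close>)
  show "\<exists>a'\<in>dmor A W X (n + 1). \<exists>b'\<in>dmor A W Y n. \<exists>y'\<in>dmor A W Z (n - 1).
          ddif A W X (n + 1) a' = \<ominus>\<^bsub>dM A W X (n + 2)\<^esub> a \<and>
          ddif A W Y n b' = b \<ominus>\<^bsub>dM A W Y (n + 1)\<^esub> DCmp A W X Y 0 (n + 1) f a' \<and>
          ddif A W Z (n - 1) y' = y \<ominus>\<^bsub>dM A W Z n\<^esub>
            (DCmp A W X Z (-1) (n + 1) j a' \<oplus>\<^bsub>dM A W Z n\<^esub> DCmp A W Y Z 0 n i b')"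
    using a'(1,3) b'(1,3) y' by blast
qed

end

text \<open>The changes of \<open>i\<close> and \<open>j\<close> alter the comparison map
  \<open>(a, b) \<mapsto> j a + i b\<close> by the boundary of
  \<open>(a, b) \<mapsto> k a + v b\<close>. Cones lifted along a quasi-equivalence agree with the
  given cone only up to such a change.\<close>

lemma (in dg_category) cone_acyclic_perturb:
  assumes cd: "cone_data A X Y Z f i j" and ac: "cone_acyclic A X Y Z f i j"
    and v: "v \<in> dmor A Y Z (-1)" "k \<in> dmor A X Z (-2)"
  shows "cone_acyclic A X Y Z f (i \<oplus>\<^bsub>dM A Y Z 0\<^esub> ddif A Y Z (-1) v)
    (j \<oplus>\<^bsub>dM A X Z (-1)\<^esub> (DCmp A X Y Z (-1) 0 v f \<oplus>\<^bsub>dM A X Z (-1)\<^esub> ddif A X Z (-2) k))" (is "cone_acyclic A X Y Z f ?i ?j")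
  unfolding cone_acyclic_def
proof (intro ballI allI impI; elim conjE)
  note c = cd[unfolded cone_data_def]
  fix W n a b y assume W: "W \<in> DObj A" and m: "a \<in> dmor A W X (n + 2)" "b \<in> dmor A W Y (n + 1)" "y \<in> dmor A W Z n"
    and d: "ddif A W X (n + 2) a = (dzero A W X (n + 3))"
      "ddif A W Y (n + 1) b = \<ominus>\<^bsub>dM A W Y (n + 2)\<^esub> DCmp A W X Y 0 (n + 2) f a"
      "ddif A W Z n y = DCmp A W X Z (-1) (n + 2) ?j a \<oplus>\<^bsub>dM A W Z (n + 1)\<^esub> DCmp A W Y Z 0 (n + 1) ?i b"
  \<comment> \<open>Subtracting the homotopy evaluated at \<open>(a, b)\<close> turns a cocycle for
    the new comparison map into one for the old.\<close>
  let ?y = "y \<ominus>\<^bsub>dM A W Z n\<^esub> (DCmp A W Y Z (-1) (n + 1) v b \<oplus>\<^bsub>dM A W Z n\<^esub> DCmp A W X Z (-2) (n + 2) k a)"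
  have "?y \<in> dmor A W Z n" using W m c v by (simp add: dgs abgc)
  moreover have "ddif A W Z n ?y = DCmp A W X Z (-1) (n + 2) j a \<oplus>\<^bsub>dM A W Z (n + 1)\<^esub> DCmp A W Y Z 0 (n + 1) i b"
    by (rule abeqI) (use W m c v d in \<open>simp add: dgs abg algebra_simps\<close>)
  ultimately obtain a' b' y' where r: "a'\<in>dmor A W X (n + 1)" "b'\<in>dmor A W Y n" "y'\<in>dmor A W Z (n - 1)"
    "ddif A W X (n + 1) a' = \<ominus>\<^bsub>dM A W X (n + 2)\<^esub> a"
    "ddif A W Y n b' = b \<ominus>\<^bsub>dM A W Y (n + 1)\<^esub> DCmp A W X Y 0 (n + 1) f a'"
    "ddif A W Z (n - 1) y' = ?y \<ominus>\<^bsub>dM A W Z n\<^esub>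
            (DCmp A W X Z (-1) (n + 1) j a' \<oplus>\<^bsub>dM A W Z n\<^esub> DCmp A W Y Z 0 n i b')"
    using ac W m d(1,2) unfolding cone_acyclic_def by metis
  show "\<exists>a'\<in>dmor A W X (n + 1). \<exists>b'\<in>dmor A W Y n. \<exists>y'\<in>dmor A W Z (n - 1).
          ddif A W X (n + 1) a' = \<ominus>\<^bsub>dM A W X (n + 2)\<^esub> a \<and>
          ddif A W Y n b' = b \<ominus>\<^bsub>dM A W Y (n + 1)\<^esub> DCmp A W X Y 0 (n + 1) f a' \<and>
          ddif A W Z (n - 1) y' = y \<ominus>\<^bsub>dM A W Z n\<^esub>
            (DCmp A W X Z (-1) (n + 1) ?j a' \<oplus>\<^bsub>dM A W Z n\<^esub> DCmp A W Y Z 0 n ?i b')"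
  proof (rule bexI[of _ a'], rule bexI[of _ b'],
      rule bexI[of _ "y' \<ominus>\<^bsub>dM A W Z (n - 1)\<^esub> (DCmp A W Y Z (-1) n v b' \<oplus>\<^bsub>dM A W Z (n - 1)\<^esub> DCmp A W X Z (-2) (n + 1) k a')"],
      intro conjI r)
    show "ddif A W Z (n - 1) (y' \<ominus>\<^bsub>dM A W Z (n - 1)\<^esub> (DCmp A W Y Z (-1) n v b' \<oplus>\<^bsub>dM A W Z (n - 1)\<^esub> DCmp A W X Z (-2) (n + 1) k a'))
       = y \<ominus>\<^bsub>dM A W Z n\<^esub>
            (DCmp A W X Z (-1) (n + 1) ?j a' \<oplus>\<^bsub>dM A W Z n\<^esub> DCmp A W Y Z 0 n ?i b')"
      by (rule abeqI) (use W m c v r in \<open>simp add: dgs abg algebra_simps\<close>)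
  qed (use W m c v r in \<open>simp_all add: dgs abgc\<close>)
qed

context surjective_quasi_equivalence
begin

text \<open>The two cocycles lift up to boundaries. Their composites minus the identities are
  cocycles with bounded image, hence are bounded already in \<open>A\<close>.\<close>

lemma lift_suspension:
  assumes o: "X \<in> DObj A" "Y \<in> DObj A" and s: "is_suspension B (dobj F X) (dobj F Y) \<sigma> \<sigma>'"
  shows "\<exists>\<sigma> \<sigma>'. is_suspension A X Y \<sigma> \<sigma>'"
proof -
  let ?X = "dobj F X" and ?Y = "dobj F Y"
  obtain k l where s: "\<sigma> \<in> dmor B ?X ?Y (-1)" "\<sigma>' \<in> dmor B ?Y ?X 1"
    "ddif B ?X ?Y (-1) \<sigma> = (dzero B ?X ?Y 0)" "ddif B ?Y ?X 1 \<sigma>' = (dzero B ?Y ?X 2)"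
    "k\<in>dmor B ?X ?X (-1)" "l\<in>dmor B ?Y ?Y (-1)"
    and ss: "DCmp B ?X ?Y ?X 1 (-1) \<sigma>' \<sigma> = DIdn B ?X \<oplus>\<^bsub>dM B ?X ?X 0\<^esub> ddif B ?X ?X (-1) k"
    "DCmp B ?Y ?X ?Y (-1) 1 \<sigma> \<sigma>' = DIdn B ?Y \<oplus>\<^bsub>dM B ?Y ?Y 0\<^esub> ddif B ?Y ?Y (-1) l"
    using s unfolding B.is_suspension_iff by auto
  obtain t p where t: "t \<in> dmor A X Y (-1)" "p \<in> dmor B ?X ?Y (-2)" "ddif A X Y (-1) t = (dzero A X Y 0)"
    "dmap F X Y (-1) t = \<sigma> \<oplus>\<^bsub>dM B ?X ?Y (-1)\<^esub> ddif B ?X ?Y (-2) p"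
    using lift_cocycle[OF o s(1)] s(3) by auto
  obtain t' p' where t': "t' \<in> dmor A Y X 1" "p' \<in> dmor B ?Y ?X 0" "ddif A Y X 1 t' = (dzero A Y X 2)"
    "dmap F Y X 1 t' = \<sigma>' \<oplus>\<^bsub>dM B ?Y ?X 1\<^esub> ddif B ?Y ?X 0 p'"
    using lift_cocycle[OF o(2,1) s(2)] s(4) by auto
  have "\<exists>k\<in>dmor A X X (-1). DCmp A X Y X 1 (-1) t' t = DIdn A X \<oplus>\<^bsub>dM A X X 0\<^esub> ddif A X X (-1) k"
  proof -
    let ?x = "DCmp A X Y X 1 (-1) t' t \<ominus>\<^bsub>dM A X X 0\<^esub> DIdn A X"
    \<comment> \<open>Besides the homotopy \<open>k\<close> from \<open>B\<close>, the bounding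
      cochain contains the deviations \<open>p\<close> and \<open>p'\<close> of the two
      lifts.\<close>
    let ?k = "k \<oplus>\<^bsub>dM B ?X ?X (-1)\<^esub> (DCmp B ?X ?Y ?X 0 (-1) p' (\<sigma> \<oplus>\<^bsub>dM B ?X ?Y (-1)\<^esub> ddif B ?X ?Y (-2) p)
       \<ominus>\<^bsub>dM B ?X ?X (-1)\<^esub> DCmp B ?X ?Y ?X 1 (-2) \<sigma>' p)"
    have F: "dmap F X X (-1+1) ?x = ddif B ?X ?X (-1) ?k"
      by (rule abeqI) (use o s t t' ss in \<open>simp add: dgs abg\<close>)
    have c: "ddif A X X (-1+1) ?x = (dzero A X X (-1+2))"
      by (rule abeqI) (use o t t' in \<open>simp add: dgs abg\<close>)
    obtain k' where k': "k' \<in> dmor A X X (-1)" "ddif A X X (-1) k' = ?x"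
      by (rule lift[OF _ _ _ c _ F]) (use o s t t' in \<open>auto simp: dgs abgc\<close>)
    show ?thesis
      by (rule bexI[OF _ k'(1)], rule abeqI) (use o t t' k' in \<open>simp add: dgs abg\<close>)
  qed
  moreover have "\<exists>k\<in>dmor A Y Y (-1). DCmp A Y X Y (-1) 1 t t' = DIdn A Y \<oplus>\<^bsub>dM A Y Y 0\<^esub> ddif A Y Y (-1) k"
  proof -
    let ?x = "DCmp A Y X Y (-1) 1 t t' \<ominus>\<^bsub>dM A Y Y 0\<^esub> DIdn A Y"
    let ?k = "l \<oplus>\<^bsub>dM B ?Y ?Y (-1)\<^esub> (DCmp B ?Y ?X ?Y (-2) 1 p (\<sigma>' \<oplus>\<^bsub>dM B ?Y ?X 1\<^esub> ddif B ?Y ?X 0 p')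
       \<ominus>\<^bsub>dM B ?Y ?Y (-1)\<^esub> DCmp B ?Y ?X ?Y (-1) 0 \<sigma> p')"
    have F: "dmap F Y Y (-1+1) ?x = ddif B ?Y ?Y (-1) ?k"
      by (rule abeqI) (use o s t t' ss in \<open>simp add: dgs abg\<close>)
    have c: "ddif A Y Y (-1+1) ?x = (dzero A Y Y (-1+2))"
      by (rule abeqI) (use o t t' in \<open>simp add: dgs abg\<close>)
    obtain k' where k': "k' \<in> dmor A Y Y (-1)" "ddif A Y Y (-1) k' = ?x"
      by (rule lift[OF _ _ _ c _ F]) (use o s t t' in \<open>auto simp: dgs abgc\<close>)
    show ?thesis
      by (rule bexI[OF _ k'(1)], rule abeqI) (use o t t' k' in \<open>simp add: dgs abg\<close>)
  qed
  ultimately show ?thesis unfolding A.is_suspension_iff using o t t' by blast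
qed

text \<open>Each required object is taken in \<open>B\<close>, its preimage under
  \<open>dobj F\<close> is used in \<open>A\<close>, and only the accompanying morphisms and
  homotopies have to be lifted.\<close>

lemma reflects_pretriangulated:
  assumes "pretriangulated K B"
  shows "pretriangulated K A"
  unfolding pretriangulated_def
proof (intro conjI ballI)
  show "dg_category K A" by (rule A.dg_category_axioms)
  obtain X where X: "X \<in> DObj B" "DIdn B X \<in> dcob B X X 0" using assms by (auto simp: pretriangulated_def)
  obtain X' where X': "X' \<in> DObj A" "dobj F X' = X" using dobj_surj X by blast
  obtain e where "e \<in> dmor B X X (-1)" "DIdn B X = ddif B X X (-1) e" using X by (auto simp: coboundaries_def)
  \<comment> \<open>The identity is a cocycle whose image is bounded by \<open>e\<close>;
    \<open>lift\<close> makes it a boundary in \<open>A\<close>.\<close>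
  then obtain e' where "e' \<in> dmor A X' X' (-1)" "ddif A X' X' (-1) e' = DIdn A X'"
    using lift[of X' X' "DIdn A X'" "-1" e] X' by (auto simp: dgs)
  then show "\<exists>X\<in>DObj A. DIdn A X \<in> dcob A X X 0"
    using X' by (intro bexI[of _ X']) (auto simp: coboundaries_def intro!: image_eqI[of _ _ e'])
next
  fix X assume X: "X \<in> DObj A"
  then obtain Y \<sigma> \<sigma>' where s: "is_suspension B (dobj F X) Y \<sigma> \<sigma>'"
    using assms dobj_closed unfolding pretriangulated_def by blast
  then have "Y \<in> DObj B" by (simp add: is_suspension_def)
  then obtain Y' where "Y' \<in> DObj A" "dobj F Y' = Y" using dobj_surj by blast
  then show "\<exists>Y \<sigma> \<sigma>'. is_suspension A X Y \<sigma> \<sigma>'" using lift_suspension[of X Y'] X s by blast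
next
  fix Y assume Y: "Y \<in> DObj A"
  then obtain X \<sigma> \<sigma>' where s: "is_suspension B X (dobj F Y) \<sigma> \<sigma>'"
    using assms dobj_closed unfolding pretriangulated_def by blast
  then have "X \<in> DObj B" by (simp add: is_suspension_def)
  then obtain X' where "X' \<in> DObj A" "dobj F X' = X" using dobj_surj by blast
  then show "\<exists>X \<sigma> \<sigma>'. is_suspension A X Y \<sigma> \<sigma>'" using lift_suspension[of X' Y] Y s by blast
next
  fix X Y f assume o: "X \<in> DObj A" "Y \<in> DObj A" and f: "f \<in> dcocyc A X Y 0"
  let ?X = "dobj F X" and ?Y = "dobj F Y" and ?f = "dmap F X Y 0 f"
  have f': "f \<in> dmor A X Y 0" "ddif A X Y 0 f = (dzero A X Y 1)" using f by (auto simp: dgs)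
  obtain Z0 i0 j0 where c: "is_cone K B ?X ?Y Z0 ?f i0 j0"
    using assms o dmap_dcocyc[OF o f] dobj_closed unfolding pretriangulated_def by blast
  then have "Z0 \<in> DObj B" by (simp add: is_cone_def)
  then obtain Z where Z: "Z \<in> DObj A" "dobj F Z = Z0" using dobj_surj by blast
  have cB: "cone_data B ?X ?Y (dobj F Z) ?f i0 j0" "cone_acyclic B ?X ?Y (dobj F Z) ?f i0 j0"
    using c Z by (auto simp: B.is_cone_iff)
  note cd = cB(1)[unfolded cone_data_def]
  obtain i v where i: "i \<in> dmor A Y Z 0" "v \<in> dmor B ?Y (dobj F Z) (-1)" "ddif A Y Z 0 i = (dzero A Y Z 1)"
    "dmap F Y Z 0 i = i0 \<oplus>\<^bsub>dM B ?Y (dobj F Z) 0\<^esub> ddif B ?Y (dobj F Z) (-1) v"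
    using lift_cocycle[of Y Z i0 0] o Z(1) cd by auto
  \<comment> \<open>Since \<open>F i\<close> is only \<open>i0 + d v\<close>, the image of
    \<open>i f\<close> is bounded by \<open>j0 + v f\<close> and not by \<open>j0\<close>. Lifting
    this cochain gives \<open>j\<close>, and \<open>cone_acyclic_perturb\<close> shows that the
    perturbed data still form a cone.\<close>
  have F: "dmap F X Z (-1+1) (DCmp A X Y Z 0 0 i f) = ddif B ?X (dobj F Z) (-1)
      (j0 \<oplus>\<^bsub>dM B ?X (dobj F Z) (-1)\<^esub> DCmp B ?X ?Y (dobj F Z) (-1) 0 v ?f)"
    by (rule abeqI) (use o Z(1) f' i cd in \<open>simp add: dgs abg\<close>)
  obtain j k where j: "j \<in> dmor A X Z (-1)" "k \<in> dmor B ?X (dobj F Z) (-1-1)" "ddif A X Z (-1) j = DCmp A X Y Z 0 0 i f"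
    "dmap F X Z (-1) j = (j0 \<oplus>\<^bsub>dM B ?X (dobj F Z) (-1)\<^esub> DCmp B ?X ?Y (dobj F Z) (-1) 0 v ?f)
       \<oplus>\<^bsub>dM B ?X (dobj F Z) (-1)\<^esub> ddif B ?X (dobj F Z) (-1-1) k"
    by (rule lift[OF _ _ _ _ _ F]) (use o Z(1) f' i cd in \<open>auto simp: dgs abgc\<close>)
  have cdA: "cone_data A X Y Z f i j" unfolding cone_data_def using o Z(1) f' i j by simp
  have "dmap F X Z (-1) j = j0 \<oplus>\<^bsub>dM B ?X (dobj F Z) (-1)\<^esub> (DCmp B ?X ?Y (dobj F Z) (-1) 0 v ?f
       \<oplus>\<^bsub>dM B ?X (dobj F Z) (-1)\<^esub> ddif B ?X (dobj F Z) (-2) k)"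
    unfolding j(4) by (rule abeqI) (use o Z(1) f' i j(1,2) cd in \<open>simp add: dgs abg\<close>)
  then have "cone_acyclic B ?X ?Y (dobj F Z) ?f (dmap F Y Z 0 i) (dmap F X Z (-1) j)"
    using B.cone_acyclic_perturb[OF cB i(2), of k] j(2) i(4) by simp
  then have "is_cone K A X Y Z f i j"
    using reflects_cone_acyclic[OF cdA] cdA by (simp add: A.is_cone_iff)
  then show "\<exists>Z i j. is_cone K A X Y Z f i j" by blast
qed

end

section \<open>Small models\<close>

text \<open>
  A dg category that maps quasi-fully faithfully to \<open>B\<close>, injectively on objects, has a
  quasi-equivalent dg subcategory whose morphisms are values of finite terms over \<open>K\<close> and \<open>B\<close>.
\<close>

lemma dg_category_pullback:
  fixes Q :: "('q, 'l, 'k) dg_cat" and A :: "('o, 'm, 'k) dg_cat"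
  assumes A: "dg_category K A"
    and obj: "\<And>X. X \<in> DObj Q \<Longrightarrow> dobj J X \<in> DObj A"
    and inj: "\<And>X Y n. X \<in> DObj Q \<Longrightarrow> Y \<in> DObj Q \<Longrightarrow> inj_on (dmap J X Y n) (dmor Q X Y n)"
    and map: "\<And>X Y n f. X \<in> DObj Q \<Longrightarrow> Y \<in> DObj Q \<Longrightarrow> f \<in> dmor Q X Y n \<Longrightarrow> dmap J X Y n f \<in> dmor A (dobj J X) (dobj J Y) n"
    and zero: "\<And>X Y n. X \<in> DObj Q \<Longrightarrow> Y \<in> DObj Q \<Longrightarrow> (dzero Q X Y n) \<in> dmor Q X Y n"
      "\<And>X Y n. X \<in> DObj Q \<Longrightarrow> Y \<in> DObj Q \<Longrightarrow> dmap J X Y n (dzero Q X Y n) = (dzero A (dobj J X) (dobj J Y) n)"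
    and add: "\<And>X Y n f g. X \<in> DObj Q \<Longrightarrow> Y \<in> DObj Q \<Longrightarrow> f \<in> dmor Q X Y n \<Longrightarrow> g \<in> dmor Q X Y n \<Longrightarrow> f \<oplus>\<^bsub>dM Q X Y n\<^esub> g \<in> dmor Q X Y n"
      "\<And>X Y n f g. X \<in> DObj Q \<Longrightarrow> Y \<in> DObj Q \<Longrightarrow> f \<in> dmor Q X Y n \<Longrightarrow> g \<in> dmor Q X Y n \<Longrightarrow>
         dmap J X Y n (f \<oplus>\<^bsub>dM Q X Y n\<^esub> g) = dmap J X Y n f \<oplus>\<^bsub>dM A (dobj J X) (dobj J Y) n\<^esub> dmap J X Y n g"
    and smult: "\<And>X Y n f a. X \<in> DObj Q \<Longrightarrow> Y \<in> DObj Q \<Longrightarrow> f \<in> dmor Q X Y n \<Longrightarrow> a \<in> carrier K \<Longrightarrow> a \<odot>\<^bsub>dM Q X Y n\<^esub> f \<in> dmor Q X Y n"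
      "\<And>X Y n f a. X \<in> DObj Q \<Longrightarrow> Y \<in> DObj Q \<Longrightarrow> f \<in> dmor Q X Y n \<Longrightarrow> a \<in> carrier K \<Longrightarrow>
         dmap J X Y n (a \<odot>\<^bsub>dM Q X Y n\<^esub> f) = a \<odot>\<^bsub>dM A (dobj J X) (dobj J Y) n\<^esub> dmap J X Y n f"
    and dif: "\<And>X Y n f. X \<in> DObj Q \<Longrightarrow> Y \<in> DObj Q \<Longrightarrow> f \<in> dmor Q X Y n \<Longrightarrow> ddif Q X Y n f \<in> dmor Q X Y (n + 1)"
      "\<And>X Y n f. X \<in> DObj Q \<Longrightarrow> Y \<in> DObj Q \<Longrightarrow> f \<in> dmor Q X Y n \<Longrightarrow>
         dmap J X Y (n + 1) (ddif Q X Y n f) = ddif A (dobj J X) (dobj J Y) n (dmap J X Y n f)"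
    and cmp: "\<And>X Y Z m n f g. X \<in> DObj Q \<Longrightarrow> Y \<in> DObj Q \<Longrightarrow> Z \<in> DObj Q \<Longrightarrow> f \<in> dmor Q X Y n \<Longrightarrow> g \<in> dmor Q Y Z m \<Longrightarrow>
         DCmp Q X Y Z m n g f \<in> dmor Q X Z (m + n)"
      "\<And>X Y Z m n f g. X \<in> DObj Q \<Longrightarrow> Y \<in> DObj Q \<Longrightarrow> Z \<in> DObj Q \<Longrightarrow> f \<in> dmor Q X Y n \<Longrightarrow> g \<in> dmor Q Y Z m \<Longrightarrow>
         dmap J X Z (m + n) (DCmp Q X Y Z m n g f) = DCmp A (dobj J X) (dobj J Y) (dobj J Z) m n (dmap J Y Z m g) (dmap J X Y n f)"
    and idn: "\<And>X. X \<in> DObj Q \<Longrightarrow> DIdn Q X \<in> dmor Q X X 0" "\<And>X. X \<in> DObj Q \<Longrightarrow> dmap J X X 0 (DIdn Q X) = DIdn A (dobj J X)"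
  shows "dg_functor_between K Q A J"
proof -
  interpret A: dg_category K A by fact
  \<comment> \<open>The engine of the proof: an equation in \<open>Q\<close> holds as soon as its
    image under \<open>dmap J\<close> does, because \<open>dmap J\<close> is injective on
    morphisms.\<close>
  have eqI: "f = g" if "X \<in> DObj Q" "Y \<in> DObj Q" "f \<in> dmor Q X Y n" "g \<in> dmor Q X Y n" "dmap J X Y n f = dmap J X Y n g" for X Y n f g
    using inj_onD[OF inj[OF that(1,2)] that(5,3,4)] .
  have mod: "module K (dM Q X Y n)" if o: "X \<in> DObj Q" "Y \<in> DObj Q" for X Y n
  proof -
    interpret M: module K "dM A (dobj J X) (dobj J Y) n" using o obj by (simp add: A.dmor_module)
    note rules = obj map zero add smult o
    show ?thesis
    proof (rule moduleI)
      show "cring K" by (rule A.cring_axioms)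
      show "abelian_group (dM Q X Y n)"
      proof (rule abelian_groupI)
        fix f assume f: "f \<in> dmor Q X Y n"
        show "\<exists>g\<in>dmor Q X Y n. g \<oplus>\<^bsub>dM Q X Y n\<^esub> f = (dzero Q X Y n)"
        proof
          \<comment> \<open>Additive inverses arise as multiples by \<open>-1\<close>, which the
            closure under scalars provides.\<close>
          let ?g = "(\<ominus>\<^bsub>K\<^esub> \<one>\<^bsub>K\<^esub>) \<odot>\<^bsub>dM Q X Y n\<^esub> f"
          show g: "?g \<in> dmor Q X Y n" using f by (simp add: rules)
          have "(\<ominus>\<^bsub>K\<^esub> \<one>\<^bsub>K\<^esub>) \<odot>\<^bsub>dM A (dobj J X) (dobj J Y) n\<^esub> dmap J X Y n f \<oplus>\<^bsub>dM A (dobj J X) (dobj J Y) n\<^esub> dmap J X Y n f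
             = (\<ominus>\<^bsub>K\<^esub> \<one>\<^bsub>K\<^esub> \<oplus>\<^bsub>K\<^esub> \<one>\<^bsub>K\<^esub>) \<odot>\<^bsub>dM A (dobj J X) (dobj J Y) n\<^esub> dmap J X Y n f"
            using map[OF o f] by (simp add: M.smult_l_distr)
          then show "?g \<oplus>\<^bsub>dM Q X Y n\<^esub> f = (dzero Q X Y n)"
            using f g map[OF o f] by (intro eqI[OF o, of _ n]) (simp_all add: rules A.l_neg M.smult_l_null)
        qed
      qed (simp_all add: rules, (rule eqI[OF o, of _ n]; simp add: rules M.M.a_ac)+)
    qed (simp_all add: rules, (rule eqI[OF o, of _ n]; simp add: rules M.smult_l_distr M.smult_r_distr M.smult_assoc1)+)
  qed
  have grp: "abelian_group (dM Q X Y n)" if o: "X \<in> DObj Q" "Y \<in> DObj Q" for X Y n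
    by (rule module.is_abelian_group_M[OF mod[OF that]])
  have neg: "dmap J X Y n (\<ominus>\<^bsub>dM Q X Y n\<^esub> f) = \<ominus>\<^bsub>dM A (dobj J X) (dobj J Y) n\<^esub> dmap J X Y n f"
    if "X \<in> DObj Q" "Y \<in> DObj Q" "f \<in> dmor Q X Y n" for X Y n f
    using that obj map add smult by (intro linear_mapD(5)[OF _ mod A.dmor_module]) (auto simp: linear_map_def)
  have kos: "dmap J X Y n (koszul (dM Q X Y n) m f) = koszul (dM A (dobj J X) (dobj J Y) n) m (dmap J X Y n f)"
    "koszul (dM Q X Y n) m f \<in> dmor Q X Y n"
    if "X \<in> DObj Q" "Y \<in> DObj Q" "f \<in> dmor Q X Y n" for X Y n m f
    using that by (auto simp: koszul_def neg grp abgc)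
  note rules = obj map zero add smult dif cmp idn kos
  have "dg_category K Q"
  proof (intro dg_category.intro dg_category_axioms.intro)
    show "cring K" by (rule A.cring_axioms)
  next
    fix X Y assume o: "X \<in> DObj Q" "Y \<in> DObj Q"
    show "is_complex K (DHom Q X Y)"
      unfolding is_complex_def
    proof (intro conjI allI ballI)
      fix n
      show "module K (dM Q X Y n)" by (rule mod[OF o])
      show "linear_map K (dM Q X Y n) (dM Q X Y (n + 1)) (ddif Q X Y n)"
        unfolding linear_map_def using o
        by (auto simp: rules A.ddif_simps intro!: eqI[of X Y _ "n + 1"])
      fix x assume x: "x \<in> dmor Q X Y n"
      show "ddif Q X Y (n + 1) (ddif Q X Y n x) = (dzero Q X Y (n + 2))"
        using o x dif(1)[OF o dif(1)[OF o x]] dif(2)[OF o dif(1)[OF o x]] dif(2)[OF o x] zero[OF o, of "n + 2"]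
        by (intro eqI[of X Y _ "n + 2"]) (simp_all add: obj map A.ddif_simps algebra_simps)
    qed
  next
    fix X Y Z g m n assume "X \<in> DObj Q" "Y \<in> DObj Q" "Z \<in> DObj Q" "g \<in> dmor Q Y Z m"
    then show "linear_map K (dM Q X Y n) (dM Q X Z (m + n)) (\<lambda>f. DCmp Q X Y Z m n g f)"
      unfolding linear_map_def by (auto simp: rules A.DCmp_simps intro!: eqI[of X Z _ "m + n"])
  next
    fix X Y Z f m n assume "X \<in> DObj Q" "Y \<in> DObj Q" "Z \<in> DObj Q" "f \<in> dmor Q X Y n"
    then show "linear_map K (dM Q Y Z m) (dM Q X Z (m + n)) (\<lambda>g. DCmp Q X Y Z m n g f)"
      unfolding linear_map_def by (auto simp: rules A.DCmp_simps intro!: eqI[of X Z _ "m + n"])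
  next
    fix X Y Z f g m n assume o: "X \<in> DObj Q" "Y \<in> DObj Q" "Z \<in> DObj Q" and f: "f \<in> dmor Q X Y n" "g \<in> dmor Q Y Z m"
    have "DCmp Q X Y Z (m + 1) n (ddif Q Y Z m g) f \<in> dmor Q X Z (m + n + 1)"
      "DCmp Q X Y Z m (n + 1) g (ddif Q X Y n f) \<in> dmor Q X Z (m + n + 1)"
      "dmap J X Z (m + n + 1) (DCmp Q X Y Z (m + 1) n (ddif Q Y Z m g) f) =
        DCmp A (dobj J X) (dobj J Y) (dobj J Z) (m + 1) n (ddif A (dobj J Y) (dobj J Z) m (dmap J Y Z m g)) (dmap J X Y n f)"
      "dmap J X Z (m + n + 1) (DCmp Q X Y Z m (n + 1) g (ddif Q X Y n f)) =
        DCmp A (dobj J X) (dobj J Y) (dobj J Z) m (n + 1) (dmap J Y Z m g) (ddif A (dobj J X) (dobj J Y) n (dmap J X Y n f))"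
      using cmp(1)[OF o f(1) dif(1)[OF o(2,3) f(2)]] cmp(1)[OF o dif(1)[OF o(1,2) f(1)] f(2)]
        cmp(2)[OF o f(1) dif(1)[OF o(2,3) f(2)]] cmp(2)[OF o dif(1)[OF o(1,2) f(1)] f(2)] dif(2)[OF o(2,3) f(2)] dif(2)[OF o(1,2) f(1)]
      by (simp_all add: algebra_simps)
    then show "ddif Q X Z (m + n) (DCmp Q X Y Z m n g f)
          = DCmp Q X Y Z (m + 1) n (ddif Q Y Z m g) f
            \<oplus>\<^bsub>dM Q X Z (m + n + 1)\<^esub>
            koszul (dM Q X Z (m + n + 1)) m (DCmp Q X Y Z m (n + 1) g (ddif Q X Y n f))"
      using o f by (intro eqI[OF o(1,3), of _ "m + n + 1"]) (simp_all add: rules A.Leibniz)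
  next
    fix W X Y Z f g h l m n assume o: "W \<in> DObj Q" "X \<in> DObj Q" "Y \<in> DObj Q" "Z \<in> DObj Q"
      and f: "f \<in> dmor Q W X n" "g \<in> dmor Q X Y m" "h \<in> dmor Q Y Z l"
    show "DCmp Q W Y Z l (m + n) h (DCmp Q W X Y m n g f) = DCmp Q W X Z (l + m) n (DCmp Q X Y Z l m h g) f"
      using cmp(1)[OF o(1,3,4) cmp(1)[OF o(1,2,3) f(1,2)] f(3)] cmp(1)[OF o(1,2,4) f(1) cmp(1)[OF o(2,3,4) f(2,3)]]
        cmp(2)[OF o(1,3,4) cmp(1)[OF o(1,2,3) f(1,2)] f(3)] cmp(2)[OF o(1,2,4) f(1) cmp(1)[OF o(2,3,4) f(2,3)]]
        cmp(2)[OF o(1,2,3) f(1,2)] cmp(2)[OF o(2,3,4) f(2,3)]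
        A.DCmp_assoc[OF obj[OF o(1)] obj[OF o(2)] obj[OF o(3)] obj[OF o(4)] map[OF o(1,2) f(1)] map[OF o(2,3) f(2)] map[OF o(3,4) f(3)]]
      by (intro eqI[OF o(1,4), of _ "l + (m + n)"]) (simp_all add: add.assoc)
  next
    fix X assume "X \<in> DObj Q" then show "DIdn Q X \<in> dmor Q X X 0" by (rule idn)
  next
    fix X Y f n assume o: "X \<in> DObj Q" "Y \<in> DObj Q" and f: "f \<in> dmor Q X Y n"
    show "DCmp Q X Y Y 0 n (DIdn Q Y) f = f" "DCmp Q X X Y n 0 f (DIdn Q X) = f"
      using cmp[OF o(1,2,2) f idn(1)[OF o(2)]] cmp[OF o(1,1,2) idn(1)[OF o(1)] f] o f
      by (auto intro!: eqI[OF o, of _ n] simp: rules A.DCmp_DIdn_left A.DCmp_DIdn_right)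
  qed
  moreover have "dg_functor K Q A J"
    unfolding dg_functor_def chain_map_def linear_map_def by (auto simp: rules)
  ultimately show ?thesis using A by (simp add: dg_functor_between_def dg_functor_between_axioms_def)
qed

text \<open>\<open>Gen b\<close> denotes a chosen cocycle over the class of \<open>b\<close>, and
  \<open>Prim t\<close> a chosen primitive of the value of \<open>t\<close>; the other constructors
  close these under the dg operations. The middle object of a composite is named by its image in
  \<open>B\<close>, so that only \<open>K\<close> and \<open>B\<close> contribute to the
  type.\<close>

datatype ('k, 'p, 'n) dg_term =
    Gen 'n
  | Prim "('k, 'p, 'n) dg_term"
  | Zero
  | Add "('k, 'p, 'n) dg_term" "('k, 'p, 'n) dg_term"
  | Smult 'k "('k, 'p, 'n) dg_term"
  | Diff "('k, 'p, 'n) dg_term"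
  | Iden
  | Comp 'p int int "('k, 'p, 'n) dg_term" "('k, 'p, 'n) dg_term"

text \<open>Polish notation: the leading number determines the constructor and thereby how many
  arguments follow.\<close>

primrec term_code :: "('k, 'p, 'n) dg_term \<Rightarrow> (nat + 'k + 'p + 'n) list" where
  "term_code (Gen b) = [Inl 0, Inr (Inr (Inr b))]"
| "term_code (Prim t) = Inl 1 # term_code t"
| "term_code Zero = [Inl 2]"
| "term_code (Add s t) = Inl 3 # term_code s @ term_code t"
| "term_code (Smult a t) = Inl 4 # Inr (Inl a) # term_code t"
| "term_code (Diff t) = Inl 5 # term_code t"
| "term_code Iden = [Inl 6]"
| "term_code (Comp z m n s t) = Inl 7 # Inr (Inr (Inl z)) # Inl (int_encode m) # Inl (int_encode n) # term_code s @ term_code t"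

text \<open>Arbitrary tails are appended so that the induction passes through concatenated codes:
  the first subterm is split off, and the remainder is an instance for the second.\<close>

lemma term_code_prefix_free: "term_code s @ xs = term_code t @ ys \<Longrightarrow> s = t \<and> xs = ys"
proof (induction s arbitrary: t xs ys)
  case (Add s1 s2)
  obtain t1 t2 where t: "t = Add t1 t2" using Add.prems by (cases t) auto
  then have "term_code s1 @ (term_code s2 @ xs) = term_code t1 @ (term_code t2 @ ys)" using Add.prems by simp
  from Add.IH(1)[OF this] Add.IH(2)[of xs t2 ys] show ?case using t by simp
next
  case (Comp z m n s1 s2)
  obtain t1 t2 where t: "t = Comp z m n t1 t2" using Comp.prems by (cases t) (auto simp: int_encode_eq)
  then have "term_code s1 @ (term_code s2 @ xs) = term_code t1 @ (term_code t2 @ ys)" using Comp.prems by simp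
  from Comp.IH(1)[OF this] Comp.IH(2)[of xs t2 ys] show ?case using t by simp
next
  case (Prim s)
  obtain t' where "t = Prim t'" using Prim.prems by (cases t) auto
  then show ?case using Prim.IH[of xs t' ys] Prim.prems by simp
next
  case (Diff s)
  obtain t' where "t = Diff t'" using Diff.prems by (cases t) auto
  then show ?case using Diff.IH[of xs t' ys] Diff.prems by simp
next
  case (Smult a s)
  obtain t' where "t = Smult a t'" using Smult.prems by (cases t) auto
  then show ?case using Smult.IH[of xs t' ys] Smult.prems by simp
qed (case_tac t; simp)+

lemma inj_term_code: "inj term_code"
  by (rule injI) (metis append_Nil2 term_code_prefix_free)

section \<open>The dg subcategory formed by the values of terms\<close>

locale injective_dg_functor = dg_functor_between K A B F
  for K :: "'k ring" and A :: "('o, 'm, 'k) dg_cat" and B :: "('p, 'n, 'k) dg_cat" and F +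
  assumes inj_obj: "inj_on (dobj F) (DObj A)"
begin

abbreviation ob :: "'p \<Rightarrow> 'o" where
  "ob \<equiv> inv_into (DObj A) (dobj F)"

definition gen :: "'o \<Rightarrow> 'o \<Rightarrow> int \<Rightarrow> 'n \<Rightarrow> 'm" where
  "gen X Y n b = (SOME f. f \<in> dcocyc A X Y n \<and> (\<exists>z\<in>dmor B (dobj F X) (dobj F Y) (n - 1).
     dmap F X Y n f = b \<oplus>\<^bsub>dM B (dobj F X) (dobj F Y) n\<^esub> ddif B (dobj F X) (dobj F Y) (n - 1) z))"

definition prim :: "'o \<Rightarrow> 'o \<Rightarrow> int \<Rightarrow> 'm \<Rightarrow> 'm" where
  "prim X Y n f = (SOME g. g \<in> dmor A X Y n \<and> ddif A X Y n g = f)"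

primrec val :: "('k, 'p, 'n) dg_term \<Rightarrow> 'o \<Rightarrow> 'o \<Rightarrow> int \<Rightarrow> 'm" where
  "val (Gen b) X Y n = gen X Y n b"
| "val (Prim t) X Y n = prim X Y n (val t X Y (n + 1))"
| "val Zero X Y n = (dzero A X Y n)"
| "val (Add s t) X Y n = val s X Y n \<oplus>\<^bsub>dM A X Y n\<^esub> val t X Y n"
| "val (Smult a t) X Y n = a \<odot>\<^bsub>dM A X Y n\<^esub> val t X Y n"
| "val (Diff t) X Y n = ddif A X Y (n - 1) (val t X Y (n - 1))"
| "val Iden X Y n = DIdn A X"
| "val (Comp z k l s t) X Y n = DCmp A X (ob z) Y k l (val s (ob z) Y k) (val t X (ob z) l)"

text \<open>\<open>val\<close> is total and returns arbitrary results for senseless terms.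
  \<open>wt\<close> selects the terms whose degrees fit and whose choices by \<open>SOME\<close> are
  justified; source, target and degree are parameters because one term may be read in several
  morphism modules.\<close>

primrec wt :: "('k, 'p, 'n) dg_term \<Rightarrow> 'o \<Rightarrow> 'o \<Rightarrow> int \<Rightarrow> bool" where
  "wt (Gen b) X Y n \<longleftrightarrow> (\<exists>f. f \<in> dcocyc A X Y n \<and> (\<exists>z\<in>dmor B (dobj F X) (dobj F Y) (n - 1).
     dmap F X Y n f = b \<oplus>\<^bsub>dM B (dobj F X) (dobj F Y) n\<^esub> ddif B (dobj F X) (dobj F Y) (n - 1) z))"
| "wt (Prim t) X Y n \<longleftrightarrow> wt t X Y (n + 1) \<and> (\<exists>g. g \<in> dmor A X Y n \<and> ddif A X Y n g = val t X Y (n + 1))"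
| "wt Zero X Y n \<longleftrightarrow> True"
| "wt (Add s t) X Y n \<longleftrightarrow> wt s X Y n \<and> wt t X Y n"
| "wt (Smult a t) X Y n \<longleftrightarrow> a \<in> carrier K \<and> wt t X Y n"
| "wt (Diff t) X Y n \<longleftrightarrow> wt t X Y (n - 1)"
| "wt Iden X Y n \<longleftrightarrow> X = Y \<and> n = 0"
| "wt (Comp z k l s t) X Y n \<longleftrightarrow> z \<in> dobj F ` DObj A \<and> n = k + l \<and> wt s (ob z) Y k \<and> wt t X (ob z) l"

lemma gen_prop:
  assumes "wt (Gen b) X Y n"
  shows "gen X Y n b \<in> dcocyc A X Y n \<and> (\<exists>z\<in>dmor B (dobj F X) (dobj F Y) (n - 1).
     dmap F X Y n (gen X Y n b) = b \<oplus>\<^bsub>dM B (dobj F X) (dobj F Y) n\<^esub> ddif B (dobj F X) (dobj F Y) (n - 1) z)"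
  unfolding gen_def by (rule someI_ex) (use assms in simp)

lemma prim_prop:
  assumes "wt (Prim t) X Y n"
  shows "prim X Y n (val t X Y (n + 1)) \<in> dmor A X Y n \<and> ddif A X Y n (prim X Y n (val t X Y (n + 1))) = val t X Y (n + 1)"
  unfolding prim_def by (rule someI_ex) (use assms in simp)

lemma ob_closed: "z \<in> dobj F ` DObj A \<Longrightarrow> ob z \<in> DObj A"
  by (rule inv_into_into)

lemma val_dmor: "X \<in> DObj A \<Longrightarrow> Y \<in> DObj A \<Longrightarrow> wt t X Y n \<Longrightarrow> val t X Y n \<in> dmor A X Y n"
proof (induction t arbitrary: X Y n)
  case (Gen b)
  then show ?case using gen_prop by (simp add: A.dcocyc_iff)
next
  case (Prim t)
  then show ?case using prim_prop by simp
qed (auto simp: dgs abgc ob_closed)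

definition sub :: "'o \<Rightarrow> 'o \<Rightarrow> int \<Rightarrow> 'm set" where
  "sub X Y n = {val t X Y n |t. wt t X Y n}"

text \<open>A morphism is coded by the set of all terms that denote it, so no term has to be
  selected. The set is nonempty on \<open>sub\<close>, and any element of it recovers the morphism;
  this is why the code is injective there.\<close>

definition code :: "'o \<Rightarrow> 'o \<Rightarrow> int \<Rightarrow> 'm \<Rightarrow> (nat + 'k + 'p + 'n) list set" where
  "code X Y n f = term_code ` {t. wt t X Y n \<and> val t X Y n = f}"

definition decode :: "'o \<Rightarrow> 'o \<Rightarrow> int \<Rightarrow> (nat + 'k + 'p + 'n) list set \<Rightarrow> 'm" where
  "decode X Y n = inv_into (sub X Y n) (code X Y n)"

lemma inj_code: "inj_on (code X Y n) (sub X Y n)"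
proof (rule inj_onI)
  fix f g assume "f \<in> sub X Y n" "g \<in> sub X Y n" and eq: "code X Y n f = code X Y n g"
  then obtain t where t: "wt t X Y n" "val t X Y n = f" by (auto simp: sub_def)
  then have "term_code t \<in> code X Y n g" using eq unfolding code_def by blast
  then show "f = g" using t inj_term_code by (auto simp: code_def dest: injD)
qed

lemma decode_code: "f \<in> sub X Y n \<Longrightarrow> decode X Y n (code X Y n f) = f"
  unfolding decode_def by (rule inv_into_f_f[OF inj_code])

lemma sub_dmor: "X \<in> DObj A \<Longrightarrow> Y \<in> DObj A \<Longrightarrow> f \<in> sub X Y n \<Longrightarrow> f \<in> dmor A X Y n"
  using val_dmor by (auto simp: sub_def)

lemma sub_closed:
  shows "(dzero A X Y n) \<in> sub X Y n"
    and "f \<in> sub X Y n \<Longrightarrow> g \<in> sub X Y n \<Longrightarrow> f \<oplus>\<^bsub>dM A X Y n\<^esub> g \<in> sub X Y n"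
    and "a \<in> carrier K \<Longrightarrow> f \<in> sub X Y n \<Longrightarrow> a \<odot>\<^bsub>dM A X Y n\<^esub> f \<in> sub X Y n"
    and "f \<in> sub X Y n \<Longrightarrow> ddif A X Y n f \<in> sub X Y (n + 1)"
    and "DIdn A X \<in> sub X X 0"
proof -
  show "(dzero A X Y n) \<in> sub X Y n"
    unfolding sub_def by (auto intro!: exI[of _ Zero])
  show "f \<oplus>\<^bsub>dM A X Y n\<^esub> g \<in> sub X Y n" if "f \<in> sub X Y n" "g \<in> sub X Y n"
  proof -
    obtain s t where "wt s X Y n" "val s X Y n = f" "wt t X Y n" "val t X Y n = g" using \<open>f \<in> _\<close> \<open>g \<in> _\<close> by (auto simp: sub_def)
    then show ?thesis unfolding sub_def by (auto intro!: exI[of _ "Add s t"])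
  qed
  show "a \<odot>\<^bsub>dM A X Y n\<^esub> f \<in> sub X Y n" if "a \<in> carrier K" "f \<in> sub X Y n"
  proof -
    obtain s where "wt s X Y n" "val s X Y n = f" using \<open>f \<in> _\<close> by (auto simp: sub_def)
    then show ?thesis unfolding sub_def using that by (auto intro!: exI[of _ "Smult a s"])
  qed
  show "ddif A X Y n f \<in> sub X Y (n + 1)" if "f \<in> sub X Y n"
  proof -
    obtain s where "wt s X Y n" "val s X Y n = f" using \<open>f \<in> _\<close> by (auto simp: sub_def)
    then show ?thesis unfolding sub_def by (auto intro!: exI[of _ "Diff s"])
  qed
  show "DIdn A X \<in> sub X X 0"
    unfolding sub_def by (auto intro!: exI[of _ Iden])
qed

lemma sub_DCmp:
  assumes "Y \<in> DObj A" "f \<in> sub X Y n" "g \<in> sub Y Z m"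
  shows "DCmp A X Y Z m n g f \<in> sub X Z (m + n)"
proof -
  obtain s t where "wt s X Y n" "val s X Y n = f" "wt t Y Z m" "val t Y Z m = g" using assms by (auto simp: sub_def)
  moreover have "ob (dobj F Y) = Y" using assms inj_obj by simp
  ultimately show ?thesis unfolding sub_def using assms by (auto intro!: exI[of _ "Comp (dobj F Y) m n t s"])
qed

definition obj_code :: "'o \<Rightarrow> (nat + 'k + 'p + 'n) list set" where
  "obj_code X = {[Inr (Inr (Inl (dobj F X)))]}"

abbreviation obj_decode :: "(nat + 'k + 'p + 'n) list set \<Rightarrow> 'o" where
  "obj_decode \<equiv> inv_into (DObj A) obj_code"

lemma inj_obj_code: "inj_on obj_code (DObj A)"
  using inj_obj by (auto simp: inj_on_def obj_code_def)

text \<open>All operations are transported along \<open>code\<close> and \<open>decode\<close>.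
  Objects and morphisms thereby belong to the type that \<open>roomy\<close> prescribes for the
  middle of a roof.\<close>

definition small_model :: "((nat + 'k + 'p + 'n) list set, (nat + 'k + 'p + 'n) list set, 'k) dg_cat" where
  "small_model =
    \<lparr>DObj = obj_code ` DObj A,
     DHom = (\<lambda>p q. let X = obj_decode p; Y = obj_decode q in
       \<lparr>Mdl = (\<lambda>n. \<lparr>carrier = code X Y n ` sub X Y n, mult = undefined, one = undefined,
          zero = code X Y n (dzero A X Y n),
          add = (\<lambda>c d. code X Y n (decode X Y n c \<oplus>\<^bsub>dM A X Y n\<^esub> decode X Y n d)),
          smult = (\<lambda>a c. code X Y n (a \<odot>\<^bsub>dM A X Y n\<^esub> decode X Y n c))\<rparr>),
        Dif = (\<lambda>n c. code X Y (n + 1) (ddif A X Y n (decode X Y n c)))\<rparr>),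
     DCmp = (\<lambda>p q r m n d c. let X = obj_decode p; Y = obj_decode q; Z = obj_decode r in
       code X Z (m + n) (DCmp A X Y Z m n (decode Y Z m d) (decode X Y n c))),
     DIdn = (\<lambda>p. let X = obj_decode p in code X X 0 (DIdn A X))\<rparr>"

definition small_model_incl :: "((nat + 'k + 'p + 'n) list set, (nat + 'k + 'p + 'n) list set, 'o, 'm) dg_func" where
  "small_model_incl = \<lparr>dobj = obj_decode, dmap = (\<lambda>p q. decode (obj_decode p) (obj_decode q))\<rparr>"

lemma small_model_obj: "p \<in> DObj small_model \<Longrightarrow> obj_decode p \<in> DObj A"
  using inj_obj_code by (auto simp: small_model_def)

lemma small_model_incl_dg_functor: "dg_functor_between K small_model A small_model_incl"
  by (rule dg_category_pullback[OF A.dg_category_axioms])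
    (auto simp: small_model_obj small_model_incl_def small_model_def Let_def decode_code sub_closed sub_DCmp
      inj_obj_code inv_into_into intro!: inj_onI sub_dmor)

lemma small_model_incl_obj: "dobj small_model_incl ` DObj small_model = DObj A"
  using inj_obj_code by (auto simp: small_model_def small_model_incl_def image_image)

text \<open>\<open>Gen\<close> and \<open>Prim\<close> were included for exactly these two
  properties: the subcategory contains a cocycle over every class of \<open>B\<close>, and a
  primitive of each of its elements that is a boundary in \<open>A\<close>.\<close>

lemma small_model_quasi:
  assumes quasi: "\<And>X Y n. \<lbrakk>X \<in> DObj A; Y \<in> DObj A\<rbrakk> \<Longrightarrow>
      cohom_surj (DHom A X Y) (DHom B (dobj F X) (dobj F Y)) (dmap F X Y) n \<and>
      cohom_inj (DHom A X Y) (DHom B (dobj F X) (dobj F Y)) (dmap F X Y) n"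
    and p: "p \<in> DObj small_model" "q \<in> DObj small_model"
  defines "w \<equiv> dg_comp F small_model_incl"
  shows "cohom_surj (DHom small_model p q) (DHom B (dobj w p) (dobj w q)) (dmap w p q) n \<and>
      cohom_inj (DHom small_model p q) (DHom B (dobj w p) (dobj w q)) (dmap w p q) n"
proof -
  interpret J: dg_functor_between K small_model A small_model_incl by (rule small_model_incl_dg_functor)
  define X where "X = obj_decode p"
  define Y where "Y = obj_decode q"
  have o: "X \<in> DObj A" "Y \<in> DObj A" using p small_model_obj by (auto simp: X_def Y_def)
  have w: "dobj w p = dobj F X" "dobj w q = dobj F Y" "\<And>n. dmap w p q n c = dmap F X Y n (decode X Y n c)" for c
    by (auto simp: w_def dg_comp_def small_model_incl_def X_def Y_def)
  have car: "carrier (dM small_model p q n) = code X Y n ` sub X Y n" for n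
    by (simp add: small_model_def Let_def X_def Y_def)
  have dif: "ddif small_model p q n (code X Y n f) = code X Y (n + 1) (ddif A X Y n f)" if "f \<in> sub X Y n" for n f
    using that by (simp add: small_model_def Let_def decode_code flip: X_def Y_def)
  have zero: "(dzero small_model p q n) = code X Y n (dzero A X Y n)" for n
    by (simp add: small_model_def Let_def X_def Y_def)
  have coc: "code X Y n f \<in> dcocyc small_model p q n \<longleftrightarrow> f \<in> dcocyc A X Y n" if "f \<in> sub X Y n" for n f
    using that sub_closed sub_dmor[OF o that] inj_onD[OF inj_code[of X Y "n+1"], of "ddif A X Y n f" "(dzero A X Y (n+1))"]
    by (auto simp: cocycles_def car dif zero)
  show ?thesis
  proof
    show "cohom_surj (DHom small_model p q) (DHom B (dobj w p) (dobj w q)) (dmap w p q) n"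
      unfolding cohom_surj_def w
    proof
      fix b assume b: "b \<in> dcocyc B (dobj F X) (dobj F Y) n"
      then obtain f z where "f \<in> dcocyc A X Y n" "z \<in> dmor B (dobj F X) (dobj F Y) (n - 1)"
         "dmap F X Y n f = b \<oplus>\<^bsub>dM B (dobj F X) (dobj F Y) n\<^esub> ddif B (dobj F X) (dobj F Y) (n - 1) z"
        using quasi[OF o, of n] unfolding cohom_surj_def by blast
      \<comment> \<open>The given \<open>f\<close> need not be the value of a term, but its
        existence makes \<open>Gen b\<close> well typed, and the cocycle chosen for
        \<open>Gen b\<close> serves instead.\<close>
      then have wt: "wt (Gen b) X Y n" unfolding wt.simps by (intro exI[of _ f] conjI bexI[of _ z])
      then have s: "gen X Y n b \<in> sub X Y n" unfolding sub_def by (intro CollectI exI[of _ "Gen b"]) (simp del: wt.simps)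
      from gen_prop[OF wt] show "\<exists>c\<in>dcocyc small_model p q n. \<exists>z\<in>dmor B (dobj F X) (dobj F Y) (n - 1).
        dmap F X Y n (decode X Y n c) = b \<oplus>\<^bsub>dM B (dobj F X) (dobj F Y) n\<^esub> ddif B (dobj F X) (dobj F Y) (n - 1) z"
        using s by (intro bexI[of _ "code X Y n (gen X Y n b)"]) (auto simp: decode_code coc)
    qed
    show "cohom_inj (DHom small_model p q) (DHom B (dobj w p) (dobj w q)) (dmap w p q) n"
      unfolding cohom_inj_def w
    proof (intro ballI impI)
      fix c z assume c: "c \<in> dcocyc small_model p q n" and z: "z \<in> dmor B (dobj F X) (dobj F Y) (n - 1)"
        and eq: "dmap F X Y n (decode X Y n c) = ddif B (dobj F X) (dobj F Y) (n - 1) z"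
      from c obtain f where f: "f \<in> sub X Y n" "c = code X Y n f" by (auto simp: cocycles_def car)
      then obtain t where t: "wt t X Y n" "val t X Y n = f" by (auto simp: sub_def)
      have fc: "f \<in> dcocyc A X Y n" using c f coc by simp
      then obtain g where "g \<in> dmor A X Y (n - 1)" "ddif A X Y (n - 1) g = f"
        using quasi[OF o, of n] eq z f by (auto simp: cohom_inj_def decode_code)
      \<comment> \<open>Likewise \<open>g\<close> only shows that a primitive exists; the chosen one
        is the value of \<open>Prim t\<close>.\<close>
      then have wt: "wt (Prim t) X Y (n - 1)" using t by auto
      let ?g = "prim X Y (n - 1) f"
      have s: "?g \<in> sub X Y (n - 1)" unfolding sub_def using wt t by (auto intro!: exI[of _ "Prim t"])
      have "ddif A X Y (n - 1) ?g = f" using prim_prop[OF wt] t by simp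
      then show "\<exists>d\<in>dmor small_model p q (n - 1). c = ddif small_model p q (n - 1) d"
        using s f dif[OF s] by (intro bexI[of _ "code X Y (n - 1) ?g"]) (auto simp: car)
    qed
  qed
qed

end

section \<open>Category theory on the homotopy level: equivalences, triangles and descent\<close>

section \<open>Functors between linear categories\<close>

locale functor_between = C: linear_category K C + D: linear_category K D
  for K :: "'k ring" and C :: "('o, 'm, 'k, 'y) lin_cat_scheme" and D :: "('p, 'n, 'k, 'z) lin_cat_scheme" +
  fixes F :: "('o, 'm, 'p, 'n, 'x) func_scheme"
  assumes is_functor: "is_functor C D F"
begin

lemma functor_simps [cats]:
  "X \<in> Obj C \<Longrightarrow> fobj F X \<in> Obj D"
  "X \<in> Obj C \<Longrightarrow> Y \<in> Obj C \<Longrightarrow> f \<in> mor C X Y \<Longrightarrow> fmap F X Y f \<in> mor D (fobj F X) (fobj F Y)"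
  "X \<in> Obj C \<Longrightarrow> fmap F X X (Idn C X) = Idn D (fobj F X)"
  "X \<in> Obj C \<Longrightarrow> Y \<in> Obj C \<Longrightarrow> Z \<in> Obj C \<Longrightarrow> f \<in> mor C X Y \<Longrightarrow> g \<in> mor C Y Z \<Longrightarrow>
    fmap F X Z (Cmp C X Y Z g f) = Cmp D (fobj F X) (fobj F Y) (fobj F Z) (fmap F Y Z g) (fmap F X Y f)"
  using is_functor by (auto simp: is_functor_def)

end

locale linear_functor_between = functor_between K C D F
  for K :: "'k ring" and C :: "('o, 'm, 'k, 'y) lin_cat_scheme" and D :: "('p, 'n, 'k, 'z) lin_cat_scheme"
    and F :: "('o, 'm, 'p, 'n, 'x) func_scheme" +
  assumes is_linear: "linear_functor K C D F"
begin

lemma linear_simps [cats]: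
  assumes "X \<in> Obj C" "Y \<in> Obj C"
  shows "f \<in> mor C X Y \<Longrightarrow> g \<in> mor C X Y \<Longrightarrow> fmap F X Y (f \<oplus>\<^bsub>Hom C X Y\<^esub> g) = fmap F X Y f \<oplus>\<^bsub>Hom D (fobj F X) (fobj F Y)\<^esub> fmap F X Y g"
    and "a \<in> carrier K \<Longrightarrow> f \<in> mor C X Y \<Longrightarrow> fmap F X Y (a \<odot>\<^bsub>Hom C X Y\<^esub> f) = a \<odot>\<^bsub>Hom D (fobj F X) (fobj F Y)\<^esub> fmap F X Y f"
    and "fmap F X Y \<zero>\<^bsub>Hom C X Y\<^esub> = \<zero>\<^bsub>Hom D (fobj F X) (fobj F Y)\<^esub>"
    and "f \<in> mor C X Y \<Longrightarrow> fmap F X Y (\<ominus>\<^bsub>Hom C X Y\<^esub> f) = \<ominus>\<^bsub>Hom D (fobj F X) (fobj F Y)\<^esub> fmap F X Y f"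
    and "f \<in> mor C X Y \<Longrightarrow> g \<in> mor C X Y \<Longrightarrow> fmap F X Y (f \<ominus>\<^bsub>Hom C X Y\<^esub> g) = fmap F X Y f \<ominus>\<^bsub>Hom D (fobj F X) (fobj F Y)\<^esub> fmap F X Y g"
proof -
  have l: "linear_map K (Hom C X Y) (Hom D (fobj F X) (fobj F Y)) (fmap F X Y)"
    using is_linear assms by (simp add: linear_functor_def)
  show "f \<in> mor C X Y \<Longrightarrow> g \<in> mor C X Y \<Longrightarrow> fmap F X Y (f \<oplus>\<^bsub>Hom C X Y\<^esub> g) = fmap F X Y f \<oplus>\<^bsub>Hom D (fobj F X) (fobj F Y)\<^esub> fmap F X Y g"
    and "a \<in> carrier K \<Longrightarrow> f \<in> mor C X Y \<Longrightarrow> fmap F X Y (a \<odot>\<^bsub>Hom C X Y\<^esub> f) = a \<odot>\<^bsub>Hom D (fobj F X) (fobj F Y)\<^esub> fmap F X Y f"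
    and "fmap F X Y \<zero>\<^bsub>Hom C X Y\<^esub> = \<zero>\<^bsub>Hom D (fobj F X) (fobj F Y)\<^esub>"
    and "f \<in> mor C X Y \<Longrightarrow> fmap F X Y (\<ominus>\<^bsub>Hom C X Y\<^esub> f) = \<ominus>\<^bsub>Hom D (fobj F X) (fobj F Y)\<^esub> fmap F X Y f"
    and "f \<in> mor C X Y \<Longrightarrow> g \<in> mor C X Y \<Longrightarrow> fmap F X Y (f \<ominus>\<^bsub>Hom C X Y\<^esub> g) = fmap F X Y f \<ominus>\<^bsub>Hom D (fobj F X) (fobj F Y)\<^esub> fmap F X Y g"
    using linear_mapD[OF l C.Hom_module[OF assms] D.Hom_module] assms functor_simps(1) by auto
qed

end

lemma functor_betweenI:
  "linear_category K C \<Longrightarrow> linear_category K D \<Longrightarrow> is_functor C D F \<Longrightarrow> functor_between K C D F"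
  by (simp add: functor_between_def functor_between_axioms_def)

lemma linear_functor_betweenI:
  "linear_category K C \<Longrightarrow> linear_category K D \<Longrightarrow> linear_functor K C D F \<Longrightarrow> linear_functor_between K C D F"
  by (simp add: linear_functor_between_def linear_functor_between_axioms_def functor_betweenI linear_functor_def)

lemma func_comp_simps [simp]:
  "fobj (func_comp G F) X = fobj G (fobj F X)"
  "fmap (func_comp G F) X Y f = fmap G (fobj F X) (fobj F Y) (fmap F X Y f)"
  by (simp_all add: func_comp_def)

lemma idf_simps [simp]: "fobj idf X = X" "fmap idf X Y f = f"
  by (simp_all add: idf_def)

lemma tcomp_simps [simp]:
  "fobj (tcomp C D E G F) X = fobj G (fobj F X)"
  "fmap (tcomp C D E G F) X Y f = fmap G (fobj F X) (fobj F Y) (fmap F X Y f)"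
  by (simp_all add: tcomp_def)

lemma is_functor_comp: "is_functor B C F \<Longrightarrow> is_functor C D G \<Longrightarrow> is_functor B D (func_comp G F)"
  unfolding is_functor_def by (auto simp: Pi_iff)

lemma linear_functor_comp: "linear_functor K B C F \<Longrightarrow> linear_functor K C D G \<Longrightarrow> linear_functor K B D (func_comp G F)"
  unfolding linear_functor_def using is_functor_comp
  by (auto simp: is_functor_def linear_map_def Pi_iff)

lemma linear_functor_cong:
  "(\<And>X. fobj F X = fobj G X) \<Longrightarrow> (\<And>X Y f. fmap F X Y f = fmap G X Y f) \<Longrightarrow> linear_functor K C D F = linear_functor K C D G"
  by (simp add: linear_functor_def is_functor_def Pi_iff linear_map_def)

section \<open>Isomorphisms\<close>

definition inv_mor :: "('o, 'm, 'k, 'z) lin_cat_scheme \<Rightarrow> 'o \<Rightarrow> 'o \<Rightarrow> 'm \<Rightarrow> 'm" where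
  "inv_mor C X Y f = (SOME g. g \<in> mor C Y X \<and> Cmp C X Y X g f = Idn C X \<and> Cmp C Y X Y f g = Idn C Y)"

lemma inv_mor:
  assumes "is_iso C X Y f"
  shows "f \<in> mor C X Y" "inv_mor C X Y f \<in> mor C Y X"
    "Cmp C X Y X (inv_mor C X Y f) f = Idn C X" "Cmp C Y X Y f (inv_mor C X Y f) = Idn C Y"
proof -
  have "\<exists>g. g \<in> mor C Y X \<and> Cmp C X Y X g f = Idn C X \<and> Cmp C Y X Y f g = Idn C Y"
    using assms by (auto simp: is_iso_def)
  from someI_ex[OF this] show "inv_mor C X Y f \<in> mor C Y X"
    "Cmp C X Y X (inv_mor C X Y f) f = Idn C X" "Cmp C Y X Y f (inv_mor C X Y f) = Idn C Y"
    by (auto simp: inv_mor_def)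
  show "f \<in> mor C X Y" using assms by (simp add: is_iso_def)
qed

lemma is_iso_inv_mor: "is_iso C X Y f \<Longrightarrow> is_iso C Y X (inv_mor C X Y f)"
  using inv_mor[of C X Y f] by (auto simp: is_iso_def)

context linear_category
begin

lemma iso_cancel:
  assumes "is_iso C X Y f" "X \<in> Obj C" "Y \<in> Obj C" "Z \<in> Obj C"
  shows "h \<in> mor C X Z \<Longrightarrow> Cmp C Y X Z h (inv_mor C X Y f) = k \<longleftrightarrow> k \<in> mor C Y Z \<and> h = Cmp C X Y Z k f"
    and "h \<in> mor C Y Z \<Longrightarrow> Cmp C X Y Z h f = k \<longleftrightarrow> k \<in> mor C X Z \<and> h = Cmp C Y X Z k (inv_mor C X Y f)"
    and "h \<in> mor C X Z \<Longrightarrow> Cmp C X Y Z (Cmp C Y X Z h (inv_mor C X Y f)) f = h"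
    and "h \<in> mor C Y Z \<Longrightarrow> Cmp C Y X Z (Cmp C X Y Z h f) (inv_mor C X Y f) = h"
proof -
  note i = inv_mor[OF assms(1)] assms(2-)
  show *: "h \<in> mor C X Z \<Longrightarrow> Cmp C X Y Z (Cmp C Y X Z h (inv_mor C X Y f)) f = h" for h
    using i Cmp_prefix[OF i(3), of Z h] by (simp add: cats)
  show **: "h \<in> mor C Y Z \<Longrightarrow> Cmp C Y X Z (Cmp C X Y Z h f) (inv_mor C X Y f) = h" for h
    using i Cmp_prefix[OF i(4), of Z h] by (simp add: cats)
  show "h \<in> mor C X Z \<Longrightarrow> Cmp C Y X Z h (inv_mor C X Y f) = k \<longleftrightarrow> k \<in> mor C Y Z \<and> h = Cmp C X Y Z k f"
    using * ** i by (auto simp: cats)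
  show "h \<in> mor C Y Z \<Longrightarrow> Cmp C X Y Z h f = k \<longleftrightarrow> k \<in> mor C X Z \<and> h = Cmp C Y X Z k (inv_mor C X Y f)"
    using * ** i by (auto simp: cats)
qed

lemma is_iso_Cmp:
  assumes "is_iso C X Y f" "is_iso C Y Z g" "X \<in> Obj C" "Y \<in> Obj C" "Z \<in> Obj C"
  shows "is_iso C X Z (Cmp C X Y Z g f)"
proof -
  note i = inv_mor[OF assms(1)] inv_mor[OF assms(2)] assms(3-)
  let ?k = "Cmp C Z Y X (inv_mor C X Y f) (inv_mor C Y Z g)"
  have "Cmp C X Z X ?k (Cmp C X Y Z g f) = Idn C X" "Cmp C Z X Z (Cmp C X Y Z g f) ?k = Idn C Z"
    using i by (simp_all add: cats Cmp_prefix[OF i(3)] Cmp_prefix[OF i(4)] Cmp_prefix[OF i(7)] Cmp_prefix[OF i(8)])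
  then show ?thesis using i unfolding is_iso_def by (intro conjI bexI[of _ ?k]) (auto simp: cats)
qed

lemma is_iso_Idn: "X \<in> Obj C \<Longrightarrow> is_iso C X X (Idn C X)"
  unfolding is_iso_def by (auto simp: cats intro!: bexI[of _ "Idn C X"])

end

lemma (in functor_between) is_iso_fmap:
  assumes "is_iso C X Y f" "X \<in> Obj C" "Y \<in> Obj C"
  shows "is_iso D (fobj F X) (fobj F Y) (fmap F X Y f)"
proof -
  note i = inv_mor[OF assms(1)] assms(2-)
  have "Cmp D (fobj F X) (fobj F Y) (fobj F X) (fmap F Y X (inv_mor C X Y f)) (fmap F X Y f) = Idn D (fobj F X)"
    "Cmp D (fobj F Y) (fobj F X) (fobj F Y) (fmap F X Y f) (fmap F Y X (inv_mor C X Y f)) = Idn D (fobj F Y)"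
    using i by (simp_all flip: functor_simps(3,4))
  then show ?thesis using i unfolding is_iso_def by (auto simp: cats)
qed

section \<open>Natural transformations\<close>

lemma nat_transD:
  assumes "nat_trans C D F G \<alpha>"
  shows "X \<in> Obj C \<Longrightarrow> \<alpha> X \<in> mor D (fobj F X) (fobj G X)"
    "X \<in> Obj C \<Longrightarrow> Y \<in> Obj C \<Longrightarrow> f \<in> mor C X Y \<Longrightarrow> 
      Cmp D (fobj F X) (fobj F Y) (fobj G Y) (\<alpha> Y) (fmap F X Y f) = Cmp D (fobj F X) (fobj G X) (fobj G Y) (fmap G X Y f) (\<alpha> X)"
  using assms by (auto simp: nat_trans_def)

lemma nat_trans_comp:
  assumes "functor_between K C D F" "functor_between K C D G" "functor_between K C D H"
    "nat_trans C D F G \<alpha>" "nat_trans C D G H \<beta>"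
  shows "nat_trans C D F H (\<lambda>X. Cmp D (fobj F X) (fobj G X) (fobj H X) (\<beta> X) (\<alpha> X))"
proof -
  interpret F: functor_between K C D F by fact
  interpret G: functor_between K C D G by fact
  interpret H: functor_between K C D H by fact
  note a = nat_transD[OF assms(4)] and b = nat_transD[OF assms(5)]
  show ?thesis unfolding nat_trans_def
  proof (intro conjI ballI)
    fix X assume "X \<in> Obj C" then show "Cmp D (fobj F X) (fobj G X) (fobj H X) (\<beta> X) (\<alpha> X) \<in> mor D (fobj F X) (fobj H X)"
      using a b by (simp add: cats)
  next
    fix X Y f assume o: "X \<in> Obj C" "Y \<in> Obj C" and f: "f \<in> mor C X Y"
    have "Cmp D (fobj F X) (fobj F Y) (fobj H Y) (Cmp D (fobj F Y) (fobj G Y) (fobj H Y) (\<beta> Y) (\<alpha> Y)) (fmap F X Y f)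
      = Cmp D (fobj F X) (fobj G Y) (fobj H Y) (\<beta> Y) (Cmp D (fobj F X) (fobj F Y) (fobj G Y) (\<alpha> Y) (fmap F X Y f))"
      using o f a(1) b(1) by (simp add: cats)
    also have "\<dots> = Cmp D (fobj F X) (fobj G X) (fobj H Y) (Cmp D (fobj G X) (fobj G Y) (fobj H Y) (\<beta> Y) (fmap G X Y f)) (\<alpha> X)"
      unfolding a(2)[OF o f] using o f a(1) b(1) by (simp add: cats)
    also have "\<dots> = Cmp D (fobj F X) (fobj H X) (fobj H Y) (fmap H X Y f) (Cmp D (fobj F X) (fobj G X) (fobj H X) (\<beta> X) (\<alpha> X))"
      unfolding b(2)[OF o f] using o f a(1) b(1) by (simp add: cats)
    finally show "Cmp D (fobj F X) (fobj F Y) (fobj H Y) (Cmp D (fobj F Y) (fobj G Y) (fobj H Y) (\<beta> Y) (\<alpha> Y)) (fmap F X Y f)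
      = Cmp D (fobj F X) (fobj H X) (fobj H Y) (fmap H X Y f) (Cmp D (fobj F X) (fobj G X) (fobj H X) (\<beta> X) (\<alpha> X))" .
  qed
qed

lemma nat_iso_comp:
  assumes "functor_between K C D F" "functor_between K C D G" "functor_between K C D H"
    "nat_iso C D F G \<alpha>" "nat_iso C D G H \<beta>"
  shows "nat_iso C D F H (\<lambda>X. Cmp D (fobj F X) (fobj G X) (fobj H X) (\<beta> X) (\<alpha> X))"
proof -
  interpret F: functor_between K C D F by fact
  interpret G: functor_between K C D G by fact
  interpret H: functor_between K C D H by fact
  show ?thesis
    using nat_trans_comp[OF assms(1-3)] assms(4,5) unfolding nat_iso_def
    by (auto intro!: F.D.is_iso_Cmp simp: cats)
qed

lemma nat_iso_inverse:
  assumes "functor_between K C D F" "functor_between K C D G" "nat_iso C D F G \<alpha>"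
  shows "nat_iso C D G F (\<lambda>X. inv_mor D (fobj F X) (fobj G X) (\<alpha> X))"
proof -
  interpret F: functor_between K C D F by fact
  interpret G: functor_between K C D G by fact
  have i: "is_iso D (fobj F X) (fobj G X) (\<alpha> X)" if "X \<in> Obj C" for X
    using assms that by (auto simp: nat_iso_def)
  note n = nat_transD[of C D F G \<alpha>]
  show ?thesis unfolding nat_iso_def nat_trans_def
  proof (intro conjI ballI)
    fix X Y f assume o: "X \<in> Obj C" "Y \<in> Obj C" and f: "f \<in> mor C X Y"
    note iX = inv_mor[OF i[OF o(1)]] and iY = inv_mor[OF i[OF o(2)]]
    let ?FX = "fobj F X" and ?GX = "fobj G X" and ?FY = "fobj F Y" and ?GY = "fobj G Y"
    have oo: "?FX \<in> Obj D" "?FY \<in> Obj D" "?GX \<in> Obj D" "?GY \<in> Obj D" using o by (simp_all add: cats)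
    have ff: "fmap F X Y f \<in> mor D ?FX ?FY" "fmap G X Y f \<in> mor D ?GX ?GY" using o f by (simp_all add: cats)
    have nf: "Cmp D ?FX ?FY ?GY (\<alpha> Y) (fmap F X Y f) = Cmp D ?FX ?GX ?GY (fmap G X Y f) (\<alpha> X)"
      using assms(3) o f by (auto simp: nat_iso_def nat_trans_def)
    have "Cmp D ?GX ?GY ?FY (inv_mor D ?FY ?GY (\<alpha> Y)) (fmap G X Y f)
       = Cmp D ?GX ?FX ?FY (Cmp D ?FX ?GX ?FY (Cmp D ?GX ?GY ?FY (inv_mor D ?FY ?GY (\<alpha> Y)) (fmap G X Y f)) (\<alpha> X)) (inv_mor D ?FX ?GX (\<alpha> X))"
      using F.D.iso_cancel(4)[OF i[OF o(1)]] oo ff iY by (simp add: cats)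
    also have "Cmp D ?FX ?GX ?FY (Cmp D ?GX ?GY ?FY (inv_mor D ?FY ?GY (\<alpha> Y)) (fmap G X Y f)) (\<alpha> X)
       = Cmp D ?FX ?GY ?FY (inv_mor D ?FY ?GY (\<alpha> Y)) (Cmp D ?FX ?FY ?GY (\<alpha> Y) (fmap F X Y f))"
      unfolding nf using oo ff iX iY by (simp add: cats)
    also have "\<dots> = fmap F X Y f"
      using oo ff iY by (simp add: cats)
    finally show "Cmp D ?GX ?GY ?FY (inv_mor D ?FY ?GY (\<alpha> Y)) (fmap G X Y f) = Cmp D ?GX ?FX ?FY (fmap F X Y f) (inv_mor D ?FX ?GX (\<alpha> X))" .
  qed (use inv_mor[OF i] is_iso_inv_mor[OF i] in auto)
qed

lemma nat_trans_whisker_left: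
  assumes "functor_between K D E U" "functor_between K C D F" "functor_between K C D G" "nat_trans C D F G \<alpha>"
  shows "nat_trans C E (func_comp U F) (func_comp U G) (\<lambda>X. fmap U (fobj F X) (fobj G X) (\<alpha> X))"
proof -
  interpret U: functor_between K D E U by fact
  interpret F: functor_between K C D F by fact
  interpret G: functor_between K C D G by fact
  note a = nat_transD[OF assms(4)]
  show ?thesis unfolding nat_trans_def
    by (auto simp: cats a simp flip: U.functor_simps(4)) 
qed

lemma nat_iso_whisker_left:
  assumes "functor_between K D E U" "functor_between K C D F" "functor_between K C D G" "nat_iso C D F G \<alpha>"
  shows "nat_iso C E (func_comp U F) (func_comp U G) (\<lambda>X. fmap U (fobj F X) (fobj G X) (\<alpha> X))"
proof -
  interpret U: functor_between K D E U by fact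
  interpret F: functor_between K C D F by fact
  interpret G: functor_between K C D G by fact
  show ?thesis
    using nat_trans_whisker_left[OF assms(1-3)] assms(4) unfolding nat_iso_def
    by (auto intro!: U.is_iso_fmap simp: cats)
qed

lemma nat_trans_whisker_right:
  assumes "is_functor B C W" "nat_trans C D F G \<alpha>"
  shows "nat_trans B D (func_comp F W) (func_comp G W) (\<lambda>X. \<alpha> (fobj W X))"
  using assms unfolding nat_trans_def is_functor_def by (auto simp: Pi_iff)

lemma nat_iso_whisker_right:
  assumes "is_functor B C W" "nat_iso C D F G \<alpha>"
  shows "nat_iso B D (func_comp F W) (func_comp G W) (\<lambda>X. \<alpha> (fobj W X))"
  using nat_trans_whisker_right[OF assms(1)] assms unfolding nat_iso_def is_functor_def by (auto simp: Pi_iff)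

section \<open>Equivalences\<close>

text \<open>Full, faithful and essentially surjective: this form can be checked for
  \<open>base\<close> on H^0, where no inverse functor is at hand. A quasi-inverse is then chosen
  together with the comparison isomorphisms \<open>cmp\<close>.\<close>

locale linear_equivalence = linear_functor_between K C D E
  for K :: "'k ring" and C :: "('o, 'm, 'k, 'y) lin_cat_scheme" and D :: "('p, 'n, 'k, 'z) lin_cat_scheme"
    and E :: "('o, 'm, 'p, 'n, 'x) func_scheme" +
  assumes full: "\<lbrakk>X \<in> Obj C; Y \<in> Obj C; g \<in> mor D (fobj E X) (fobj E Y)\<rbrakk> \<Longrightarrow> \<exists>f\<in>mor C X Y. fmap E X Y f = g"
    and faithful: "\<lbrakk>X \<in> Obj C; Y \<in> Obj C; f \<in> mor C X Y; f' \<in> mor C X Y; fmap E X Y f = fmap E X Y f'\<rbrakk> \<Longrightarrow> f = f'"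
    and ess_surj: "V \<in> Obj D \<Longrightarrow> \<exists>U\<in>Obj C. \<exists>b. is_iso D (fobj E U) V b"
begin

definition choice :: "'p \<Rightarrow> 'o \<times> 'n" where
  "choice V = (SOME (U, b). U \<in> Obj C \<and> is_iso D (fobj E U) V b)"

definition pre :: "'p \<Rightarrow> 'o" where "pre V = fst (choice V)"
definition cmp :: "'p \<Rightarrow> 'n" where "cmp V = snd (choice V)"

lemma pre_cmp: "V \<in> Obj D \<Longrightarrow> pre V \<in> Obj C \<and> is_iso D (fobj E (pre V)) V (cmp V)"
proof -
  assume "V \<in> Obj D"
  then obtain U b where "U \<in> Obj C" "is_iso D (fobj E U) V b" using ess_surj[of V] by blast
  then have "\<exists>c. case c of (U, b) \<Rightarrow> U \<in> Obj C \<and> is_iso D (fobj E U) V b" by (intro exI[of _ "(U, b)"]) simp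
  then have "case choice V of (U, b) \<Rightarrow> U \<in> Obj C \<and> is_iso D (fobj E U) V b"
    unfolding choice_def by (rule someI_ex)
  then show ?thesis by (auto simp: pre_def cmp_def split: prod.splits)
qed

abbreviation cmp' :: "'p \<Rightarrow> 'n" where "cmp' V \<equiv> inv_mor D (fobj E (pre V)) V (cmp V)"

lemma cmp_simps [cats]:
  assumes "V \<in> Obj D"
  shows "pre V \<in> Obj C" "cmp V \<in> mor D (fobj E (pre V)) V" "cmp' V \<in> mor D V (fobj E (pre V))"
    "Cmp D (fobj E (pre V)) V (fobj E (pre V)) (cmp' V) (cmp V) = Idn D (fobj E (pre V))"
    "Cmp D V (fobj E (pre V)) V (cmp V) (cmp' V) = Idn D V"
    "Z \<in> Obj D \<Longrightarrow> h \<in> mor D (fobj E (pre V)) Z \<Longrightarrow> Cmp D (fobj E (pre V)) V Z (Cmp D V (fobj E (pre V)) Z h (cmp' V)) (cmp V) = h"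
    "Z \<in> Obj D \<Longrightarrow> h \<in> mor D V Z \<Longrightarrow> Cmp D V (fobj E (pre V)) Z (Cmp D (fobj E (pre V)) V Z h (cmp V)) (cmp' V) = h"
  using pre_cmp[OF assms] inv_mor[of D "fobj E (pre V)" V "cmp V"] D.iso_cancel(3,4)[of "fobj E (pre V)" V "cmp V" Z h]
    assms functor_simps(1) by auto

definition preim :: "'o \<Rightarrow> 'o \<Rightarrow> 'n \<Rightarrow> 'm" where
  "preim X Y = inv_into (mor C X Y) (fmap E X Y)"

lemma preim:
  assumes "X \<in> Obj C" "Y \<in> Obj C" "g \<in> mor D (fobj E X) (fobj E Y)"
  shows "preim X Y g \<in> mor C X Y" "fmap E X Y (preim X Y g) = g"
proof -
  have "g \<in> fmap E X Y ` mor C X Y" using full[OF assms] by auto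
  then show "preim X Y g \<in> mor C X Y" "fmap E X Y (preim X Y g) = g"
    unfolding preim_def by (rule inv_into_into, rule f_inv_into_f)
qed

definition quasi_inverse :: "('p, 'n, 'o, 'm) func" where
  "quasi_inverse = \<lparr>fobj = pre, fmap = (\<lambda>V W g. preim (pre V) (pre W)
     (Cmp D (fobj E (pre V)) W (fobj E (pre W)) (cmp' W) (Cmp D (fobj E (pre V)) V W g (cmp V))))\<rparr>"

lemma quasi_inverse_obj: "fobj quasi_inverse = pre"
  by (simp add: quasi_inverse_def)

lemma quasi_inverse_map:
  assumes "V \<in> Obj D" "W \<in> Obj D" "g \<in> mor D V W"
  shows "fmap quasi_inverse V W g \<in> mor C (pre V) (pre W)"
    "fmap E (pre V) (pre W) (fmap quasi_inverse V W g) =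
     Cmp D (fobj E (pre V)) W (fobj E (pre W)) (cmp' W) (Cmp D (fobj E (pre V)) V W g (cmp V))"
  unfolding quasi_inverse_def using preim[of "pre V" "pre W"] assms by (auto simp: cats)

lemma quasi_inverse_linear: "linear_functor K D C quasi_inverse"
proof -
  have dif: "fmap quasi_inverse V W g = f"
    if "V \<in> Obj D" "W \<in> Obj D" "g \<in> mor D V W" "f \<in> mor C (pre V) (pre W)"
      "fmap E (pre V) (pre W) f = Cmp D (fobj E (pre V)) W (fobj E (pre W)) (cmp' W) (Cmp D (fobj E (pre V)) V W g (cmp V))" for V W f g
    using faithful[of "pre V" "pre W"] quasi_inverse_map[OF that(1-3)] that by (auto simp: cats)
  have sm: "a \<odot>\<^bsub>Hom D V W\<^esub> g \<in> mor D V W" if "V \<in> Obj D" "W \<in> Obj D" "a \<in> carrier K" "g \<in> mor D V W" for a V W g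
    using that module_smult(1)[OF D.Hom_module] by blast
  have smC: "a \<odot>\<^bsub>Hom C V W\<^esub> g \<in> mor C V W" if "V \<in> Obj C" "W \<in> Obj C" "a \<in> carrier K" "g \<in> mor C V W" for a V W g
    using that module_smult(1)[OF C.Hom_module] by blast
  show ?thesis
    unfolding linear_functor_def is_functor_def linear_map_def quasi_inverse_obj
  proof (intro conjI ballI funcsetI)
    fix V assume V: "V \<in> Obj D"
    then show "pre V \<in> Obj C" by (simp add: cats)
    show "fmap quasi_inverse V V (Idn D V) = Idn C (pre V)"
      using V by (intro dif) (simp_all add: cats)
  next
    fix U V W f g assume o: "U \<in> Obj D" "V \<in> Obj D" "W \<in> Obj D" and m: "f \<in> mor D U V" "g \<in> mor D V W"
    show "fmap quasi_inverse U W (Cmp D U V W g f) = Cmp C (pre U) (pre V) (pre W) (fmap quasi_inverse V W g) (fmap quasi_inverse U V f)"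
      using o m quasi_inverse_map[OF o(1,2) m(1)] quasi_inverse_map[OF o(2,3) m(2)]
      by (intro dif) (simp_all add: cats)
  qed (auto simp: quasi_inverse_map cats abgc sm smC intro!: dif)
qed

text \<open>Fullness makes \<open>\<xi>\<close> natural for all morphisms between objects in the
  image of \<open>E\<close>. Conjugating with \<open>cmp\<close> spreads it over \<open>D\<close>,
  and naturality with respect to \<open>cmp\<close> itself shows that the old values are
  recovered.\<close>

lemma extend_nat_trans:
  fixes U :: "('p, 'n, 'q, 'l, 'v) func_scheme" and V :: "('p, 'n, 'q, 'l, 'w) func_scheme"
  assumes "functor_between K D B U" "functor_between K D B V" "nat_trans C B (func_comp U E) (func_comp V E) \<xi>"
  defines "\<xi>' \<equiv> \<lambda>Y. Cmp B (fobj U Y) (fobj V (fobj E (pre Y))) (fobj V Y) (fmap V (fobj E (pre Y)) Y (cmp Y))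
     (Cmp B (fobj U Y) (fobj U (fobj E (pre Y))) (fobj V (fobj E (pre Y))) (\<xi> (pre Y)) (fmap U Y (fobj E (pre Y)) (cmp' Y)))"
  shows "nat_trans D B U V \<xi>'" "X \<in> Obj C \<Longrightarrow> \<xi>' (fobj E X) = \<xi> X"
proof -
  interpret U: functor_between K D B U by fact
  interpret V: functor_between K D B V by fact
  have x: "\<xi> X \<in> mor B (fobj U (fobj E X)) (fobj V (fobj E X))" if "X \<in> Obj C" for X
    using nat_transD(1)[OF assms(3) that] by simp
  have xn: "Cmp B (fobj U (fobj E X)) (fobj U (fobj E Y)) (fobj V (fobj E Y)) (\<xi> Y) (fmap U (fobj E X) (fobj E Y) g)
     = Cmp B (fobj U (fobj E X)) (fobj V (fobj E X)) (fobj V (fobj E Y)) (fmap V (fobj E X) (fobj E Y) g) (\<xi> X)"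
    if o: "X \<in> Obj C" "Y \<in> Obj C" and g: "g \<in> mor D (fobj E X) (fobj E Y)" for X Y g
    using nat_transD(2)[OF assms(3) o preim(1)[OF o g]] preim(2)[OF o g] by simp
  show "nat_trans D B U V \<xi>'"
    unfolding nat_trans_def
  proof (intro conjI ballI)
    fix Y assume "Y \<in> Obj D" then show "\<xi>' Y \<in> mor B (fobj U Y) (fobj V Y)" unfolding \<xi>'_def using x by (simp add: cats)
  next
    fix Y Z y assume o: "Y \<in> Obj D" "Z \<in> Obj D" and y: "y \<in> mor D Y Z"
    let ?Y = "fobj E (pre Y)" and ?Z = "fobj E (pre Z)"
    let ?g = "Cmp D ?Y Z ?Z (cmp' Z) (Cmp D ?Y Y Z y (cmp Y))"
    have g: "?g \<in> mor D ?Y ?Z" using o y by (simp add: cats)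
    \<comment> \<open>\<open>y\<close> is conjugate under \<open>cmp\<close> to \<open>?g\<close>, a
      morphism between objects in the image of \<open>E\<close>, for which naturality of
      \<open>\<xi>\<close> is available.\<close>
    have 1: "Cmp D Y Z ?Z (cmp' Z) y = Cmp D Y ?Y ?Z ?g (cmp' Y)" using o y by (simp add: cats)
    have 2: "Cmp D ?Y Y Z y (cmp Y) = Cmp D ?Y ?Z Z (cmp Z) ?g" using o y by (simp add: cats)
    have "Cmp B (fobj U Y) (fobj U Z) (fobj V Z) (\<xi>' Z) (fmap U Y Z y)
      = Cmp B (fobj U Y) (fobj V ?Z) (fobj V Z) (fmap V ?Z Z (cmp Z)) (Cmp B (fobj U Y) (fobj U ?Z) (fobj V ?Z) (\<xi> (pre Z)) (fmap U Y ?Z (Cmp D Y Z ?Z (cmp' Z) y)))"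
      unfolding \<xi>'_def using o y x by (simp add: cats)
    also have "\<dots> = Cmp B (fobj U Y) (fobj V ?Z) (fobj V Z) (fmap V ?Z Z (cmp Z)) (Cmp B (fobj U Y) (fobj U ?Y) (fobj V ?Z)
        (Cmp B (fobj U ?Y) (fobj U ?Z) (fobj V ?Z) (\<xi> (pre Z)) (fmap U ?Y ?Z ?g)) (fmap U Y ?Y (cmp' Y)))"
    proof -
      have Ug: "fmap U ?Y ?Z ?g \<in> mor B (fobj U ?Y) (fobj U ?Z)" using g o by (simp add: cats)
      have "fmap U Y ?Z (Cmp D Y ?Y ?Z ?g (cmp' Y)) = Cmp B (fobj U Y) (fobj U ?Y) (fobj U ?Z) (fmap U ?Y ?Z ?g) (fmap U Y ?Y (cmp' Y))"
        using o g by (intro U.functor_simps(4)) (simp_all add: cats)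
      moreover have "fmap U Y ?Y (cmp' Y) \<in> mor B (fobj U Y) (fobj U ?Y)"
        "fobj V ?Z \<in> Obj B" "fobj U Y \<in> Obj B" "fobj U ?Y \<in> Obj B" "fobj U ?Z \<in> Obj B"
        "\<xi> (pre Z) \<in> mor B (fobj U ?Z) (fobj V ?Z)"
        using o x by (simp_all add: cats)
      ultimately show ?thesis unfolding 1 using Ug by (simp add: U.D.Cmp_left_assoc)
    qed
    also have "\<dots> = Cmp B (fobj U Y) (fobj V ?Y) (fobj V Z) (fmap V ?Y Z (Cmp D ?Y ?Z Z (cmp Z) ?g)) (Cmp B (fobj U Y) (fobj U ?Y) (fobj V ?Y)
        (\<xi> (pre Y)) (fmap U Y ?Y (cmp' Y)))"
    proof -
      have Vg: "fmap V ?Y ?Z ?g \<in> mor B (fobj V ?Y) (fobj V ?Z)" using g o by (simp add: cats)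
      have "fmap V ?Y Z (Cmp D ?Y ?Z Z (cmp Z) ?g) = Cmp B (fobj V ?Y) (fobj V ?Z) (fobj V Z) (fmap V ?Z Z (cmp Z)) (fmap V ?Y ?Z ?g)"
        using o g by (intro V.functor_simps(4)) (simp_all add: cats)
      moreover have "Cmp B (fobj U ?Y) (fobj U ?Z) (fobj V ?Z) (\<xi> (pre Z)) (fmap U ?Y ?Z ?g)
         = Cmp B (fobj U ?Y) (fobj V ?Y) (fobj V ?Z) (fmap V ?Y ?Z ?g) (\<xi> (pre Y))"
        using o g by (intro xn) (simp_all add: cats)
      moreover have "fmap V ?Z Z (cmp Z) \<in> mor B (fobj V ?Z) (fobj V Z)" "fmap U Y ?Y (cmp' Y) \<in> mor B (fobj U Y) (fobj U ?Y)"
        "fobj V ?Y \<in> Obj B" "fobj V ?Z \<in> Obj B" "fobj V Z \<in> Obj B" "fobj U Y \<in> Obj B" "fobj U ?Y \<in> Obj B"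
        "\<xi> (pre Y) \<in> mor B (fobj U ?Y) (fobj V ?Y)"
        using o x by (simp_all add: cats)
      ultimately show ?thesis using Vg by (simp add: U.D.Cmp_left_assoc U.D.Cmp_simps(1))
    qed
    also have "\<dots> = Cmp B (fobj U Y) (fobj V Y) (fobj V Z) (fmap V Y Z y) (\<xi>' Y)"
      unfolding 2[symmetric] \<xi>'_def using o y x by (simp add: cats)
    finally show "Cmp B (fobj U Y) (fobj U Z) (fobj V Z) (\<xi>' Z) (fmap U Y Z y) = Cmp B (fobj U Y) (fobj V Y) (fobj V Z) (fmap V Y Z y) (\<xi>' Y)" .
  qed
  show "\<xi>' (fobj E X) = \<xi> X" if X: "X \<in> Obj C"
  proof -
    let ?Y = "fobj E X"
    let ?P = "fobj E (pre ?Y)"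
    have Y: "?Y \<in> Obj D" using X by (simp add: cats)
    have e: "Cmp B (fobj U ?Y) (fobj U ?P) (fobj V ?P) (\<xi> (pre ?Y)) (fmap U ?Y ?P (cmp' ?Y))
       = Cmp B (fobj U ?Y) (fobj V ?Y) (fobj V ?P) (fmap V ?Y ?P (cmp' ?Y)) (\<xi> X)"
      using X Y by (intro xn) (simp_all add: cats)
    have "\<xi>' ?Y = Cmp B (fobj U ?Y) (fobj V ?Y) (fobj V ?Y) (Cmp B (fobj V ?Y) (fobj V ?P) (fobj V ?Y) (fmap V ?P ?Y (cmp ?Y)) (fmap V ?Y ?P (cmp' ?Y))) (\<xi> X)"
      unfolding \<xi>'_def e using X Y x by (simp add: cats)
    also have "Cmp B (fobj V ?Y) (fobj V ?P) (fobj V ?Y) (fmap V ?P ?Y (cmp ?Y)) (fmap V ?Y ?P (cmp' ?Y)) = fmap V ?Y ?Y (Cmp D ?Y ?P ?Y (cmp ?Y) (cmp' ?Y))"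
      using Y by (intro V.functor_simps(4)[symmetric]) (simp_all add: cats)
    also have "\<dots> = Idn B (fobj V ?Y)" using Y by (simp add: cats)
    finally show ?thesis using X Y x by (simp add: cats)
  qed
qed

text \<open>The preimages under \<open>E\<close> of the isomorphisms \<open>cmp\<close> at
  \<open>fobj E X\<close> identify the composite of \<open>E\<close> with its quasi-inverse with the
  identity of \<open>C\<close>; applying \<open>F\<close> gives \<open>\<zeta>\<close>.\<close>

lemma factor_iso:
  assumes "functor_between K C B F"
  shows "\<exists>\<zeta>. nat_iso C B (func_comp (func_comp F quasi_inverse) E) F \<zeta>"
proof -
  interpret F: functor_between K C B F by fact
  interpret G: linear_functor_between K D C quasi_inverse
    by (rule linear_functor_betweenI[OF D.linear_category_axioms C.linear_category_axioms quasi_inverse_linear])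
  define a where "a X = preim (pre (fobj E X)) X (cmp (fobj E X))" for X
  have a: "a X \<in> mor C (pre (fobj E X)) X" "fmap E (pre (fobj E X)) X (a X) = cmp (fobj E X)" if "X \<in> Obj C" for X
    unfolding a_def using that by (auto intro!: preim simp: cats)
  have iso: "is_iso C (pre (fobj E X)) X (a X)" if X: "X \<in> Obj C" for X
  proof -
    let ?P = "pre (fobj E X)"
    have P: "?P \<in> Obj C" "fobj E X \<in> Obj D" using X by (simp_all add: cats)
    define i where "i = preim X ?P (cmp' (fobj E X))"
    have i: "i \<in> mor C X ?P" "fmap E X ?P i = cmp' (fobj E X)"
      unfolding i_def using X P by (auto intro!: preim simp: cats)
    have "Cmp C ?P X ?P i (a X) = Idn C ?P"
      using X P i a[OF X] by (intro faithful[of ?P ?P]) (simp_all add: cats)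
    moreover have "Cmp C X ?P X (a X) i = Idn C X"
      using X P i a[OF X] by (intro faithful[of X X]) (simp_all add: cats)
    ultimately show ?thesis using i a[OF X] unfolding is_iso_def by blast
  qed
  have "nat_iso C C (func_comp quasi_inverse E) idf a"
    unfolding nat_iso_def nat_trans_def
  proof (intro conjI ballI)
    fix X Y f assume o: "X \<in> Obj C" "Y \<in> Obj C" and f: "f \<in> mor C X Y"
    have P: "pre (fobj E X) \<in> Obj C" "fobj E X \<in> Obj D" "pre (fobj E Y) \<in> Obj C" "fobj E Y \<in> Obj D" using o by (simp_all add: cats)
    note q = quasi_inverse_map[OF P(2,4) functor_simps(2)[OF o f]]
    have "Cmp C (pre (fobj E X)) (pre (fobj E Y)) Y (a Y) (fmap quasi_inverse (fobj E X) (fobj E Y) (fmap E X Y f))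
      = Cmp C (pre (fobj E X)) X Y f (a X)"
      using o P q a[OF o(1)] a[OF o(2)] f by (intro faithful[of "pre (fobj E X)" Y]) (simp_all add: cats)
    then show "Cmp C (fobj (func_comp quasi_inverse E) X) (fobj (func_comp quasi_inverse E) Y) (fobj idf Y) (a Y) (fmap (func_comp quasi_inverse E) X Y f)
      = Cmp C (fobj (func_comp quasi_inverse E) X) (fobj idf X) (fobj idf Y) (fmap idf X Y f) (a X)"
      by (simp add: quasi_inverse_obj)
  qed (auto simp: quasi_inverse_obj a iso)
  moreover have "functor_between K C C (func_comp quasi_inverse E)" "functor_between K C C idf"
    by (auto intro!: functor_betweenI C.linear_category_axioms is_functor_comp[OF is_functor G.is_functor]) (auto simp: is_functor_def)
  ultimately have "nat_iso C B (func_comp F (func_comp quasi_inverse E)) (func_comp F idf) (\<lambda>X. fmap F (pre (fobj E X)) X (a X))"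
    using nat_iso_whisker_left[OF assms, of C "func_comp quasi_inverse E" idf a] by (simp add: quasi_inverse_obj)
  then show ?thesis unfolding nat_iso_def nat_trans_def by auto
qed

end

text \<open>Fullness rests on the faithfulness of the inverse \<open>G\<close>: conjugating
  \<open>G g\<close> by \<open>\<alpha>\<close> gives a candidate preimage of \<open>g\<close>, and
  \<open>G\<close> identifies its image under \<open>E\<close> with \<open>g\<close>.\<close>

lemma equivalence_linear_equivalence:
  fixes C :: "('o, 'm, 'k, 'y) lin_cat_scheme" and D :: "('p, 'n, 'k, 'z) lin_cat_scheme"
    and E :: "('o, 'm, 'p, 'n, 'x) func_scheme"
  assumes C: "linear_category K C" and D: "linear_category K D" and l: "linear_functor K C D E" and eq: "is_equivalence C D E"
  shows "linear_equivalence K C D E"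
proof -
  interpret E: linear_functor_between K C D E by (rule linear_functor_betweenI[OF C D l])
  obtain G :: "('p, 'n, 'o, 'm) func" and \<alpha> \<beta> where G: "is_functor D C G" and \<alpha>: "nat_iso C C idf (func_comp G E) \<alpha>" and \<beta>: "nat_iso D D (func_comp E G) idf \<beta>"
    using eq unfolding is_equivalence_def by blast
  interpret G: functor_between K D C G by (rule functor_betweenI[OF D C G])
  have ai: "is_iso C X (fobj G (fobj E X)) (\<alpha> X)" if "X \<in> Obj C" for X using \<alpha> that by (simp add: nat_iso_def)
  have an: "Cmp C X Y (fobj G (fobj E Y)) (\<alpha> Y) f = Cmp C X (fobj G (fobj E X)) (fobj G (fobj E Y)) (fmap G (fobj E X) (fobj E Y) (fmap E X Y f)) (\<alpha> X)"
    if "X \<in> Obj C" "Y \<in> Obj C" "f \<in> mor C X Y" for X Y f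
    using \<alpha> that by (auto simp: nat_iso_def nat_trans_def)
  have bi: "is_iso D (fobj E (fobj G X)) X (\<beta> X)" if "X \<in> Obj D" for X using \<beta> that by (simp add: nat_iso_def)
  have bn: "Cmp D (fobj E (fobj G X)) (fobj E (fobj G Y)) Y (\<beta> Y) (fmap E (fobj G X) (fobj G Y) (fmap G X Y f)) = Cmp D (fobj E (fobj G X)) X Y f (\<beta> X)"
    if "X \<in> Obj D" "Y \<in> Obj D" "f \<in> mor D X Y" for X Y f
    using \<beta> that by (auto simp: nat_iso_def nat_trans_def)
  have faith: "f = f'" if o: "X \<in> Obj C" "Y \<in> Obj C" and m: "f \<in> mor C X Y" "f' \<in> mor C X Y" "fmap E X Y f = fmap E X Y f'" for X Y f f'
  proof -
    note i = inv_mor[OF ai[OF o(2)]]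
    have "Cmp C X Y (fobj G (fobj E Y)) (\<alpha> Y) f = Cmp C X Y (fobj G (fobj E Y)) (\<alpha> Y) f'"
      using an[OF o m(1)] an[OF o m(2)] m(3) by simp
    then have "Cmp C X (fobj G (fobj E Y)) Y (inv_mor C Y (fobj G (fobj E Y)) (\<alpha> Y)) (Cmp C X Y (fobj G (fobj E Y)) (\<alpha> Y) f)
      = Cmp C X (fobj G (fobj E Y)) Y (inv_mor C Y (fobj G (fobj E Y)) (\<alpha> Y)) (Cmp C X Y (fobj G (fobj E Y)) (\<alpha> Y) f')" by simp
    then show ?thesis using o m(1,2) i by (simp add: cats)
  qed
  have faithG: "g = g'" if o: "X \<in> Obj D" "Y \<in> Obj D" and m: "g \<in> mor D X Y" "g' \<in> mor D X Y" "fmap G X Y g = fmap G X Y g'" for X Y g g'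
  proof -
    note i = inv_mor[OF bi[OF o(1)]]
    have "Cmp D (fobj E (fobj G X)) X Y g (\<beta> X) = Cmp D (fobj E (fobj G X)) X Y g' (\<beta> X)"
      using bn[OF o m(1)] bn[OF o m(2)] m(3) by simp
    then show ?thesis using E.D.iso_cancel(4)[OF bi[OF o(1)] _ o] o m(1,2) by (metis E.functor_simps(1) G.functor_simps(1))
  qed
  have full: "\<exists>f\<in>mor C X Y. fmap E X Y f = g" if o: "X \<in> Obj C" "Y \<in> Obj C" and g: "g \<in> mor D (fobj E X) (fobj E Y)" for X Y g
  proof -
    let ?X = "fobj G (fobj E X)" and ?Y = "fobj G (fobj E Y)"
    note iY = inv_mor[OF ai[OF o(2)]] and iX = inv_mor[OF ai[OF o(1)]]
    let ?f = "Cmp C X ?Y Y (inv_mor C Y ?Y (\<alpha> Y)) (Cmp C X ?X ?Y (fmap G (fobj E X) (fobj E Y) g) (\<alpha> X))"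
    have oo: "?X \<in> Obj C" "?Y \<in> Obj C" using o by (simp_all add: cats)
    have f: "?f \<in> mor C X Y" using o g iY iX by (simp add: cats)
    have Gg: "fmap G (fobj E X) (fobj E Y) g \<in> mor C ?X ?Y" using o g by (simp add: cats)
    have "Cmp C X Y ?Y (\<alpha> Y) ?f = Cmp C X ?X ?Y (fmap G (fobj E X) (fobj E Y) g) (\<alpha> X)"
      using o oo Gg iY iX by (simp add: cats)
    then have "Cmp C X ?X ?Y (fmap G (fobj E X) (fobj E Y) (fmap E X Y ?f)) (\<alpha> X) = Cmp C X ?X ?Y (fmap G (fobj E X) (fobj E Y) g) (\<alpha> X)"
      using an[OF o f] by simp
    then have "fmap G (fobj E X) (fobj E Y) (fmap E X Y ?f) = fmap G (fobj E X) (fobj E Y) g"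
      using E.C.iso_cancel(4)[OF ai[OF o(1)] o(1) oo] Gg f o by (metis E.functor_simps(1,2) G.functor_simps(2))
    then have "fmap E X Y ?f = g" using faithG o f g by (metis E.functor_simps(1,2))
    then show ?thesis using f by blast
  qed
  show ?thesis
  proof (intro linear_equivalence.intro linear_equivalence_axioms.intro)
    show "linear_functor_between K C D E" by (rule E.linear_functor_between_axioms)
    show "\<exists>U\<in>Obj C. \<exists>b. is_iso D (fobj E U) V b" if "V \<in> Obj D" for V
      using bi[OF that] G.functor_simps(1)[OF that] by blast
  qed (fact full, fact faith)
qed

section \<open>Triangulated categories\<close>

lemma func_comp_assoc: "func_comp (func_comp H G) F = func_comp H (func_comp G F)"
  by (simp add: func_comp_def)

text \<open>\<open>g f\<close> yields a left inverse of \<open>f\<close> and \<open>f g\<close> a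
  right inverse, and these coincide.\<close>

lemma (in linear_category) is_iso_two_sided:
  assumes o: "X \<in> Obj C" "Y \<in> Obj C" and m: "f \<in> mor C X Y" "g \<in> mor C Y X"
    and l: "is_iso C X X (Cmp C X Y X g f)" and r: "is_iso C Y Y (Cmp C Y X Y f g)"
  shows "is_iso C X Y f"
proof -
  let ?l = "Cmp C Y X X (inv_mor C X X (Cmp C X Y X g f)) g" and ?r = "Cmp C Y Y X g (inv_mor C Y Y (Cmp C Y X Y f g))"
  note il = inv_mor[OF l] and ir = inv_mor[OF r]
  have lf: "Cmp C X Y X ?l f = Idn C X" and fr: "Cmp C Y X Y f ?r = Idn C Y"
    using o m il ir Cmp_assoc[OF o(1,2,1,1) m il(2)] Cmp_assoc[OF o(2,2,1,2) ir(2) m(2,1)] by (simp_all add: cats)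
  have "?l = Cmp C Y Y X ?l (Cmp C Y X Y f ?r)" unfolding fr using o m il by (simp add: cats)
  also have "\<dots> = Cmp C Y X X (Cmp C X Y X ?l f) ?r" using o m il ir by (intro Cmp_assoc) (simp_all add: cats)
  also have "\<dots> = ?r" unfolding lf using o m ir by (simp add: cats)
  finally have "?l = ?r" .
  then show ?thesis using lf fr o m il ir unfolding is_iso_def by (auto intro!: bexI[of _ ?l] simp: cats)
qed

section \<open>Consequences of the axioms: weak cokernels and uniqueness of cones\<close>

context triangulated_category
begin

lemma Sus_between: "linear_functor_between K T T (Sus T)"
  by (rule linear_functor_betweenI[OF linear_category_axioms linear_category_axioms Sus_linear])

lemma is_zero_object_Sus:
  assumes "is_zero_object T Z"
  shows "is_zero_object T (sob T Z)"
proof -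
  interpret Sus: linear_functor_between K T T "Sus T" by (rule Sus_between)
  have Z: "Z \<in> Obj T" using assms by (simp add: is_zero_object_def)
  have "Idn T Z \<in> {\<zero>\<^bsub>Hom T Z Z\<^esub>}" using assms Idn_mor[OF Z] by (auto simp: is_zero_object_def)
  then have i: "Idn T (sob T Z) = \<zero>\<^bsub>Hom T (sob T Z) (sob T Z)\<^esub>"
    using Sus.functor_simps(3)[OF Z] Sus.linear_simps(3)[OF Z Z] by simp
  have "f = \<zero>\<^bsub>Hom T X (sob T Z)\<^esub>" if "X \<in> Obj T" "f \<in> mor T X (sob T Z)" for X f
    using that Z Cmp_Idn_left[of X "sob T Z" f] by (simp add: i cats)
  moreover have "f = \<zero>\<^bsub>Hom T (sob T Z) X\<^esub>" if "X \<in> Obj T" "f \<in> mor T (sob T Z) X" for X f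
    using that Z Cmp_Idn_right[of "sob T Z" X f] by (simp add: i cats)
  ultimately show ?thesis using Z unfolding is_zero_object_def by (auto simp: cats abgc)
qed

text \<open>The rotated triangle is compared with \<open>0 -> W = W -> 0\<close>: the vanishing of
  \<open>e g\<close> is the commutativity of the square from which \<open>Tri_fill\<close> produces
  \<open>k\<close>.\<close>

lemma weak_cokernel:
  assumes tri: "(X, Y, Z, f, g, h) \<in> Tri T" and W: "W \<in> Obj T" and e: "e \<in> mor T Z W" "Cmp T Y Z W e g = \<zero>\<^bsub>Hom T Y W\<^esub>"
  obtains k where "k \<in> mor T (sob T X) W" "e = Cmp T Z (sob T X) W k h"
proof -
  interpret Sus: linear_functor_between K T T "Sus T" by (rule Sus_between)
  note m = Tri_mor[OF tri]
  obtain O' where O': "is_zero_object T O'" using zero_object by blast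
  have O1: "O' \<in> Obj T" using O' by (simp add: is_zero_object_def)
  have rot: "(Y, Z, sob T X, g, h, \<ominus>\<^bsub>Hom T (sob T X) (sob T Y)\<^esub> (smap T X Y f)) \<in> Tri T"
    using Tri_rotate m tri by blast
  \<comment> \<open>To rotate \<open>W = W -> 0\<close> back to \<open>0 -> W = W\<close>, the zero
    object is taken to be the suspension of \<open>O'\<close>, and its zero morphism is written in
    the shape with the sign that \<open>Tri_rotate\<close> produces.\<close>
  have z: "\<zero>\<^bsub>Hom T (sob T O') (sob T W)\<^esub> = \<ominus>\<^bsub>Hom T (sob T O') (sob T W)\<^esub> (smap T O' W \<zero>\<^bsub>Hom T O' W\<^esub>)"
    using O1 W by (simp add: cats abgc)
  have "(W, W, sob T O', Idn T W, \<zero>\<^bsub>Hom T W (sob T O')\<^esub>, \<zero>\<^bsub>Hom T (sob T O') (sob T W)\<^esub>) \<in> Tri T"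
    using Tri_id[OF W is_zero_object_Sus[OF O']] .
  then have "(W, W, sob T O', Idn T W, \<zero>\<^bsub>Hom T W (sob T O')\<^esub>, \<ominus>\<^bsub>Hom T (sob T O') (sob T W)\<^esub> (smap T O' W \<zero>\<^bsub>Hom T O' W\<^esub>)) \<in> Tri T"
    by (simp only: z[symmetric])
  moreover have "\<zero>\<^bsub>Hom T O' W\<^esub> \<in> mor T O' W" "\<zero>\<^bsub>Hom T W (sob T O')\<^esub> \<in> mor T W (sob T O')"
    using O1 W by (simp_all add: cats abgc)
  ultimately have t2: "(O', W, W, \<zero>\<^bsub>Hom T O' W\<^esub>, Idn T W, \<zero>\<^bsub>Hom T W (sob T O')\<^esub>) \<in> Tri T"
    using Tri_rotate[OF O1 W W _ Idn_mor[OF W]] by blast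
  have eq: "Cmp T Y Z W e g = Cmp T Y O' W \<zero>\<^bsub>Hom T O' W\<^esub> \<zero>\<^bsub>Hom T Y O'\<^esub>"
    using e m O1 W by (simp add: cats abgc)
  have "\<zero>\<^bsub>Hom T Y O'\<^esub> \<in> mor T Y O'" using m O1 by (simp add: cats abgc)
  then obtain k where "k \<in> mor T (sob T X) W" "Cmp T Z (sob T X) W k h = Cmp T Z W W (Idn T W) e"
    using Tri_fill[OF rot t2 _ e(1) eq] by blast
  then show thesis using that e m W by (simp add: cats)
qed

text \<open>With \<open>e = c - 1\<close> one has \<open>e g = 0\<close> and \<open>h e = 0\<close>.
  Hence \<open>e\<close> factors through \<open>h\<close>, so \<open>e e = 0\<close>, and
  \<open>1 + e\<close> has the inverse \<open>1 - e\<close>, which is \<open>?d\<close>. This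
  argument takes the place of the five lemma.\<close>

lemma triangle_endo_iso:
  assumes tri: "(X, Y, Z, f, g, h) \<in> Tri T" and c: "c \<in> mor T Z Z" "Cmp T Y Z Z c g = g" "Cmp T Z Z (sob T X) h c = h"
  shows "is_iso T Z Z c"
proof -
  interpret Sus: linear_functor_between K T T "Sus T" by (rule Sus_between)
  note m = Tri_mor[OF tri]
  let ?M = "Hom T Z Z"
  let ?e = "c \<ominus>\<^bsub>?M\<^esub> Idn T Z"
  have e: "?e \<in> mor T Z Z" using m c by (simp add: cats abgc)
  have "Cmp T Y Z Z ?e g = \<zero>\<^bsub>Hom T Y Z\<^esub>" using m c by (simp add: cats abgc)
  then obtain k where k: "k \<in> mor T (sob T X) Z" "?e = Cmp T Z (sob T X) Z k h"
    using weak_cokernel[OF tri _ e] m by blast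
  have "Cmp T Z Z Z ?e ?e = Cmp T Z Z Z (Cmp T Z (sob T X) Z k h) ?e" using k by simp
  also have "\<dots> = Cmp T Z (sob T X) Z k (Cmp T Z Z (sob T X) h ?e)"
    using m k e by (intro Cmp_assoc[symmetric]) (simp_all add: cats)
  also have "Cmp T Z Z (sob T X) h ?e = \<zero>\<^bsub>Hom T Z (sob T X)\<^esub>" using m c by (simp add: cats abgc)
  finally have ee: "Cmp T Z Z Z ?e ?e = \<zero>\<^bsub>?M\<^esub>" using m k by (simp add: cats)
  have cc: "Cmp T Z Z Z c c \<in> mor T Z Z" using m c by (simp add: cats)
  have "Cmp T Z Z Z c c = Cmp T Z Z Z ?e ?e \<oplus>\<^bsub>?M\<^esub> ((c \<oplus>\<^bsub>?M\<^esub> c) \<ominus>\<^bsub>?M\<^esub> Idn T Z)"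
    by (rule abeqI) (use m c cc in \<open>simp add: cats abg\<close>)
  then have cc2: "Cmp T Z Z Z c c = (c \<oplus>\<^bsub>?M\<^esub> c) \<ominus>\<^bsub>?M\<^esub> Idn T Z" unfolding ee using m c by (simp add: cats abgc)
  let ?d = "(Idn T Z \<oplus>\<^bsub>?M\<^esub> Idn T Z) \<ominus>\<^bsub>?M\<^esub> c"
  have "Cmp T Z Z Z ?d c = (c \<oplus>\<^bsub>?M\<^esub> c) \<ominus>\<^bsub>?M\<^esub> Cmp T Z Z Z c c" "Cmp T Z Z Z c ?d = (c \<oplus>\<^bsub>?M\<^esub> c) \<ominus>\<^bsub>?M\<^esub> Cmp T Z Z Z c c"
    using m c by (simp_all add: cats abgc)
  moreover have "(c \<oplus>\<^bsub>?M\<^esub> c) \<ominus>\<^bsub>?M\<^esub> ((c \<oplus>\<^bsub>?M\<^esub> c) \<ominus>\<^bsub>?M\<^esub> Idn T Z) = Idn T Z"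
    by (rule abeqI) (use m c in \<open>simp add: cats abg\<close>)
  ultimately have "Cmp T Z Z Z ?d c = Idn T Z" "Cmp T Z Z Z c ?d = Idn T Z" unfolding cc2 by simp_all
  then show ?thesis using m c unfolding is_iso_def by (auto intro!: bexI[of _ ?d] simp: cats abgc)
qed

text \<open>The fill-ins for \<open>a\<close>, \<open>b\<close> and for their inverses compose in
  both orders to endomorphisms that fix the second and third morphisms of a triangle;
  \<open>triangle_endo_iso\<close> makes these invertible.\<close>

lemma cone_unique:
  assumes t1: "(X, Y, Z, f, g, h) \<in> Tri T" and t2: "(X', Y', Z', f', g', h') \<in> Tri T"
    and a: "is_iso T X X' a" and b: "is_iso T Y Y' b" and sq: "Cmp T X Y Y' b f = Cmp T X X' Y' f' a"
  obtains c where "is_iso T Z Z' c" "Cmp T Y Z Z' c g = Cmp T Y Y' Z' g' b"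
    "Cmp T Z (sob T X) (sob T X') (smap T X X' a) h = Cmp T Z Z' (sob T X') h' c"
proof -
  interpret Sus: linear_functor_between K T T "Sus T" by (rule Sus_between)
  note m1 = Tri_mor[OF t1] and m2 = Tri_mor[OF t2] and ia = inv_mor[OF a] and ib = inv_mor[OF b]
  let ?a = "inv_mor T X X' a" and ?b = "inv_mor T Y Y' b"
  obtain c where c: "c \<in> mor T Z Z'" "Cmp T Y Z Z' c g = Cmp T Y Y' Z' g' b"
    "Cmp T Z (sob T X) (sob T X') (smap T X X' a) h = Cmp T Z Z' (sob T X') h' c"
    using Tri_fill[OF t1 t2 ia(1) ib(1) sq] by blast
  have "Cmp T X' Y' Y ?b f' = Cmp T X' Y' Y ?b (Cmp T X' X Y' (Cmp T X X' Y' f' a) ?a)"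
    using m1 m2 ia ib iso_cancel(4)[OF a, of Y' f'] by simp
  also have "\<dots> = Cmp T X' X Y f ?a"
    unfolding sq[symmetric] using m1 m2 ia ib by (simp add: cats)
  finally obtain d where d: "d \<in> mor T Z' Z" "Cmp T Y' Z' Z d g' = Cmp T Y' Y Z g ?b"
    "Cmp T Z' (sob T X') (sob T X) (smap T X' X ?a) h' = Cmp T Z' Z (sob T X) h d"
    using Tri_fill[OF t2 t1 ia(2) ib(2)] by blast
  have Sa: "Cmp T (sob T X) (sob T X') (sob T X) (smap T X' X ?a) (smap T X X' a) = Idn T (sob T X)"
    "Cmp T (sob T X') (sob T X) (sob T X') (smap T X X' a) (smap T X' X ?a) = Idn T (sob T X')"
    using m1 m2 ia by (simp_all flip: Sus.functor_simps(3,4))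
  have "is_iso T Z Z (Cmp T Z Z' Z d c)"
  proof (rule triangle_endo_iso[OF t1])
    have "Cmp T Y Z Z (Cmp T Z Z' Z d c) g = Cmp T Y Z' Z d (Cmp T Y Z Z' c g)" using m1 m2 c(1) d(1) by (simp add: cats)
    also have "\<dots> = Cmp T Y Y' Z (Cmp T Y' Z' Z d g') b" unfolding c(2) using m1 m2 c(1) d(1) ib by (simp add: cats)
    also have "\<dots> = g" unfolding d(2) using m1 m2 ib iso_cancel(3)[OF b, of Z g] by simp
    finally show "Cmp T Y Z Z (Cmp T Z Z' Z d c) g = g" .
    have "Cmp T Z Z (sob T X) h (Cmp T Z Z' Z d c) = Cmp T Z Z' (sob T X) (Cmp T Z' Z (sob T X) h d) c" using m1 m2 c(1) d(1) by (simp add: cats)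
    also have "\<dots> = Cmp T Z (sob T X') (sob T X) (smap T X' X ?a) (Cmp T Z Z' (sob T X') h' c)"
      unfolding d(3)[symmetric] using m1 m2 c(1) ia by (simp add: cats)
    also have "\<dots> = Cmp T Z (sob T X) (sob T X) (Cmp T (sob T X) (sob T X') (sob T X) (smap T X' X ?a) (smap T X X' a)) h"
      unfolding c(3)[symmetric] using m1 m2 ia by (simp add: cats)
    also have "\<dots> = h" unfolding Sa using m1 by (simp add: cats)
    finally show "Cmp T Z Z (sob T X) h (Cmp T Z Z' Z d c) = h" .
  qed (use m1 m2 c d in \<open>simp add: cats\<close>)
  moreover have "is_iso T Z' Z' (Cmp T Z' Z Z' c d)"
  proof (rule triangle_endo_iso[OF t2])
    have "Cmp T Y' Z' Z' (Cmp T Z' Z Z' c d) g' = Cmp T Y' Z Z' c (Cmp T Y' Z' Z d g')" using m1 m2 c(1) d(1) by (simp add: cats)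
    also have "\<dots> = Cmp T Y' Y Z' (Cmp T Y Z Z' c g) ?b" unfolding d(2) using m1 m2 c(1) d(1) ib by (simp add: cats)
    also have "\<dots> = g'" unfolding c(2) using m1 m2 ib iso_cancel(4)[OF b, of Z' g'] by simp
    finally show "Cmp T Y' Z' Z' (Cmp T Z' Z Z' c d) g' = g'" .
    have "Cmp T Z' Z' (sob T X') h' (Cmp T Z' Z Z' c d) = Cmp T Z' Z (sob T X') (Cmp T Z Z' (sob T X') h' c) d" using m1 m2 c(1) d(1) by (simp add: cats)
    also have "\<dots> = Cmp T Z' (sob T X) (sob T X') (smap T X X' a) (Cmp T Z' Z (sob T X) h d)"
      unfolding c(3)[symmetric] using m1 m2 d(1) ia by (simp add: cats)
    also have "\<dots> = Cmp T Z' (sob T X') (sob T X') (Cmp T (sob T X') (sob T X) (sob T X') (smap T X X' a) (smap T X' X ?a)) h'"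
      unfolding d(3)[symmetric] using m1 m2 ia by (simp add: cats)
    also have "\<dots> = h'" unfolding Sa using m2 by (simp add: cats)
    finally show "Cmp T Z' Z' (sob T X') h' (Cmp T Z' Z Z' c d) = h'" .
  qed (use m1 m2 c d in \<open>simp add: cats\<close>)
  ultimately have "is_iso T Z Z' c"
    using m1 m2 c(1) d(1) by (intro is_iso_two_sided[of Z Z' c d]) simp_all
  then show thesis using that c by blast
qed

end

section \<open>Descent of triangle functors along an equivalence\<close>

text \<open>The categories enter through linearity, the suspensions as functors and, for
  \<open>A\<close>, the typing of triangles, because the lemma is applied to the categories
  \<open>H0\<close>, for which these facts are proved one by one.\<close>

lemma tcomp_triangle_functor:
  assumes A: "linear_category K A" and B: "linear_category K B" and C: "linear_category K C"
    and SA: "is_functor A A (Sus A)" and SB: "is_functor B B (Sus B)" and SC: "is_functor C C (Sus C)"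
    and F: "triangle_functor K A B F" and G: "triangle_functor K B C G"
    and TA: "\<And>X Y Z f g h. (X, Y, Z, f, g, h) \<in> Tri A \<Longrightarrow>
      X \<in> Obj A \<and> Y \<in> Obj A \<and> Z \<in> Obj A \<and> f \<in> mor A X Y \<and> g \<in> mor A Y Z \<and> h \<in> mor A Z (sob A X)"
  shows "triangle_functor K A C (tcomp A B C G F)"
proof -
  note F' = F[unfolded triangle_functor_def] and G' = G[unfolded triangle_functor_def]
  interpret F: linear_functor_between K A B F by (rule linear_functor_betweenI) (use A B F' in auto)
  interpret G: linear_functor_between K B C G by (rule linear_functor_betweenI) (use B C G' in auto)
  interpret SA: functor_between K A A "Sus A" by (rule functor_betweenI) (use A SA in auto)
  interpret SB: functor_between K B B "Sus B" by (rule functor_betweenI) (use B SB in auto)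
  interpret SC: functor_between K C C "Sus C" by (rule functor_betweenI) (use C SC in auto)
  have lin: "linear_functor K A C (tcomp A B C G F)"
    using linear_functor_comp[of K A B F C G] F' G' by (subst linear_functor_cong[of _ "func_comp G F"]) auto
  have cF: "is_iso B (fobj F (sob A X)) (sob B (fobj F X)) (Com F X)" if "X \<in> Obj A" for X
    using F' that by (simp add: nat_iso_def)
  have cG: "is_iso C (fobj G (sob B X)) (sob C (fobj G X)) (Com G X)" if "X \<in> Obj B" for X
    using G' that by (simp add: nat_iso_def)
  have n1: "nat_iso A C (func_comp G (func_comp F (Sus A))) (func_comp G (func_comp (Sus B) F)) (\<lambda>X. fmap G (fobj F (sob A X)) (sob B (fobj F X)) (Com F X))"
    using nat_iso_whisker_left[OF G.functor_between_axioms, of A "func_comp F (Sus A)" "func_comp (Sus B) F" "Com F"] F'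
      functor_betweenI[OF A B is_functor_comp[OF SA F.is_functor]] functor_betweenI[OF A B is_functor_comp[OF F.is_functor SB]] by simp
  have n2: "nat_iso A C (func_comp G (func_comp (Sus B) F)) (func_comp (Sus C) (func_comp G F)) (\<lambda>X. Com G (fobj F X))"
    using nat_iso_whisker_right[OF F.is_functor, of C "func_comp G (Sus B)" "func_comp (Sus C) G" "Com G"] G' by (simp add: func_comp_assoc)
  have "nat_iso A C (func_comp G (func_comp F (Sus A))) (func_comp (Sus C) (func_comp G F))
     (\<lambda>X. Cmp C (fobj G (fobj F (sob A X))) (fobj G (sob B (fobj F X))) (sob C (fobj G (fobj F X)))
        (Com G (fobj F X)) (fmap G (fobj F (sob A X)) (sob B (fobj F X)) (Com F X)))"
    using nat_iso_comp[OF _ _ _ n1 n2]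
      functor_betweenI[OF A C is_functor_comp[OF is_functor_comp[OF SA F.is_functor] G.is_functor]]
      functor_betweenI[OF A C is_functor_comp[OF is_functor_comp[OF F.is_functor SB] G.is_functor]]
      functor_betweenI[OF A C is_functor_comp[OF is_functor_comp[OF F.is_functor G.is_functor] SC]] by simp
  then have nat: "nat_iso A C (func_comp (tcomp A B C G F) (Sus A)) (func_comp (Sus C) (tcomp A B C G F)) (Com (tcomp A B C G F))"
    unfolding nat_iso_def nat_trans_def by (simp add: tcomp_def)
  show ?thesis
    unfolding triangle_functor_def
  proof (intro conjI lin nat allI impI)
    fix X Y Z f g h assume t: "(X, Y, Z, f, g, h) \<in> Tri A"
    note m = TA[OF t]
    have "(fobj F X, fobj F Y, fobj F Z, fmap F X Y f, fmap F Y Z g,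
          Cmp B (fobj F Z) (fobj F (sob A X)) (sob B (fobj F X)) (Com F X) (fmap F Z (sob A X) h)) \<in> Tri B"
      using F' t by blast
    then have "(fobj G (fobj F X), fobj G (fobj F Y), fobj G (fobj F Z), fmap G (fobj F X) (fobj F Y) (fmap F X Y f), fmap G (fobj F Y) (fobj F Z) (fmap F Y Z g),
          Cmp C (fobj G (fobj F Z)) (fobj G (sob B (fobj F X))) (sob C (fobj G (fobj F X))) (Com G (fobj F X))
           (fmap G (fobj F Z) (sob B (fobj F X)) (Cmp B (fobj F Z) (fobj F (sob A X)) (sob B (fobj F X)) (Com F X) (fmap F Z (sob A X) h)))) \<in> Tri C"
      using G' by blast
    moreover have "Cmp C (fobj G (fobj F Z)) (fobj G (sob B (fobj F X))) (sob C (fobj G (fobj F X))) (Com G (fobj F X))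
           (fmap G (fobj F Z) (sob B (fobj F X)) (Cmp B (fobj F Z) (fobj F (sob A X)) (sob B (fobj F X)) (Com F X) (fmap F Z (sob A X) h)))
       = Cmp C (fobj G (fobj F Z)) (fobj G (fobj F (sob A X))) (sob C (fobj G (fobj F X)))
          (Cmp C (fobj G (fobj F (sob A X))) (fobj G (sob B (fobj F X))) (sob C (fobj G (fobj F X))) (Com G (fobj F X))
            (fmap G (fobj F (sob A X)) (sob B (fobj F X)) (Com F X))) (fmap G (fobj F Z) (fobj F (sob A X)) (fmap F Z (sob A X) h))"
      using m cF[of X] cG[of "fobj F X"] inv_mor(1)[OF cF[of X]] inv_mor(1)[OF cG[of "fobj F X"]] by (simp add: cats)
    ultimately show "(fobj (tcomp A B C G F) X, fobj (tcomp A B C G F) Y, fobj (tcomp A B C G F) Z, fmap (tcomp A B C G F) X Y f, fmap (tcomp A B C G F) Y Z g,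
          Cmp C (fobj (tcomp A B C G F) Z) (fobj (tcomp A B C G F) (sob A X)) (sob C (fobj (tcomp A B C G F) X))
            (Com (tcomp A B C G F) X) (fmap (tcomp A B C G F) Z (sob A X) h)) \<in> Tri C"
      by (simp add: tcomp_def)
  qed
qed

text \<open>The assumptions on \<open>C\<close> are the part of a triangulated structure that
  descent uses: a suspension functor, well-typed triangles, and a triangle on every morphism.
  \<open>H0\<close> of a pretriangulated dg category provides them.\<close>

locale triangle_descent = linear_equivalence K C T E + T: triangulated_category K T
  for K :: "'k ring" and C :: "('o, 'm, 'k, 'y) tri_cat_scheme" and T :: "('p, 'n, 'k, 'z) tri_cat_scheme"
    and E :: "('o, 'm, 'p, 'n) tri_func" +
  fixes F :: "('o, 'm, 'p, 'n) tri_func"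
  assumes E: "triangle_functor K C T E" and F: "triangle_functor K C T F"
    and Sus_functor: "is_functor C C (Sus C)"
    and C_mor: "(U, V, W, f, g, h) \<in> Tri C \<Longrightarrow>
      U \<in> Obj C \<and> V \<in> Obj C \<and> W \<in> Obj C \<and> f \<in> mor C U V \<and> g \<in> mor C V W \<and> h \<in> mor C W (sob C U)"
    and C_cone: "\<lbrakk>U \<in> Obj C; V \<in> Obj C; f \<in> mor C U V\<rbrakk> \<Longrightarrow> \<exists>W g h. (U, V, W, f, g, h) \<in> Tri C"
begin

text \<open>The underlying functor is \<open>F\<close> after a quasi-inverse of \<open>E\<close>.
  Its suspension isomorphism is first defined on the image of \<open>E\<close> and then extended by
  \<open>extend_nat_trans\<close>. A triangle of \<open>T\<close> is isomorphic to the image under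
  \<open>E\<close> of one in \<open>C\<close>, so its image under \<open>t\<close> is isomorphic to
  the image under \<open>F\<close> of that triangle.\<close>

lemma descent:
  "\<exists>t \<zeta>. fobj t = fobj (func_comp F quasi_inverse) \<and> fmap t = fmap (func_comp F quasi_inverse) \<and>
    triangle_functor K T T t \<and> triangle_iso C T (tcomp C T T t E) F \<zeta>"
proof -
  note E' = E[unfolded triangle_functor_def] and F' = F[unfolded triangle_functor_def]
  note lc = C.linear_category_axioms and lt = D.linear_category_axioms
  interpret TS: linear_functor_between K T T "Sus T" by (rule T.Sus_between)
  interpret F: linear_functor_between K C T F by (rule linear_functor_betweenI[OF lc lt]) (use F' in auto)
  interpret G: linear_functor_between K T C quasi_inverse by (rule linear_functor_betweenI[OF lt lc quasi_inverse_linear])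
  interpret SC: functor_between K C C "Sus C" by (rule functor_betweenI[OF lc lc Sus_functor])
  let ?t = "func_comp F quasi_inverse"
  interpret t: linear_functor_between K T T ?t
    by (rule linear_functor_betweenI[OF lt lt linear_functor_comp[OF quasi_inverse_linear]]) (use F' in auto)
  obtain \<zeta> where z: "nat_iso C T (func_comp ?t E) F \<zeta>" using factor_iso[OF F.functor_between_axioms] by blast
  have fb: "functor_between K C T (func_comp E (Sus C))" "functor_between K C T (func_comp (Sus T) E)"
    "functor_between K C T (func_comp F (Sus C))" "functor_between K C T (func_comp (Sus T) F)"
    "functor_between K C T (func_comp ?t E)" "functor_between K C T (func_comp ?t (func_comp (Sus T) E))"
    "functor_between K C T (func_comp ?t (func_comp E (Sus C)))" "functor_between K C T (func_comp (Sus T) (func_comp ?t E))"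
    "functor_between K T T (func_comp ?t (Sus T))" "functor_between K T T (func_comp (Sus T) ?t)"
    using functor_betweenI[OF lc lt is_functor_comp[OF Sus_functor is_functor]]
      functor_betweenI[OF lc lt is_functor_comp[OF is_functor TS.is_functor]]
      functor_betweenI[OF lc lt is_functor_comp[OF Sus_functor F.is_functor]]
      functor_betweenI[OF lc lt is_functor_comp[OF F.is_functor TS.is_functor]]
      functor_betweenI[OF lc lt is_functor_comp[OF is_functor t.is_functor]]
      functor_betweenI[OF lc lt is_functor_comp[OF is_functor_comp[OF is_functor TS.is_functor] t.is_functor]]
      functor_betweenI[OF lc lt is_functor_comp[OF is_functor_comp[OF Sus_functor is_functor] t.is_functor]]
      functor_betweenI[OF lc lt is_functor_comp[OF is_functor_comp[OF is_functor t.is_functor] TS.is_functor]]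
      functor_betweenI[OF lt lt is_functor_comp[OF TS.is_functor t.is_functor]]
      functor_betweenI[OF lt lt is_functor_comp[OF t.is_functor TS.is_functor]] by auto
  have cE: "nat_iso C T (func_comp E (Sus C)) (func_comp (Sus T) E) (Com E)" and cF: "nat_iso C T (func_comp F (Sus C)) (func_comp (Sus T) F) (Com F)"
    using E' F' by auto
  let ?iE = "\<lambda>X. inv_mor T (fobj E (sob C X)) (sob T (fobj E X)) (Com E X)"
  let ?iz = "\<lambda>X. inv_mor T (fobj ?t (fobj E X)) (fobj F X) (\<zeta> X)"
  have n1: "nat_iso C T (func_comp ?t (func_comp (Sus T) E)) (func_comp ?t (func_comp E (Sus C)))
     (\<lambda>X. fmap ?t (sob T (fobj E X)) (fobj E (sob C X)) (?iE X))"
    using nat_iso_whisker_left[OF t.functor_between_axioms fb(2,1) nat_iso_inverse[OF fb(1,2) cE]] by simp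
  have n2: "nat_iso C T (func_comp ?t (func_comp E (Sus C))) (func_comp F (Sus C)) (\<lambda>X. \<zeta> (sob C X))"
    using nat_iso_whisker_right[OF Sus_functor z] by (simp add: func_comp_assoc)
  have n4: "nat_iso C T (func_comp (Sus T) F) (func_comp (Sus T) (func_comp ?t E)) (\<lambda>X. smap T (fobj F X) (fobj ?t (fobj E X)) (?iz X))"
    using nat_iso_whisker_left[OF TS.functor_between_axioms F.functor_between_axioms fb(5) nat_iso_inverse[OF fb(5) F.functor_between_axioms z]] by simp
  \<comment> \<open>Compatibility with \<open>\<zeta>\<close> dictates this formula: from
    \<open>t \<Sigma> E\<close> through \<open>t E \<Sigma>\<close>, \<open>F \<Sigma>\<close> and
    \<open>\<Sigma> F\<close> to \<open>\<Sigma> t E\<close>.\<close>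
  define \<xi> where "\<xi> X = Cmp T (fobj ?t (sob T (fobj E X))) (sob T (fobj F X)) (sob T (fobj ?t (fobj E X)))
      (smap T (fobj F X) (fobj ?t (fobj E X)) (?iz X))
      (Cmp T (fobj ?t (sob T (fobj E X))) (fobj F (sob C X)) (sob T (fobj F X)) (Com F X)
        (Cmp T (fobj ?t (sob T (fobj E X))) (fobj ?t (fobj E (sob C X))) (fobj F (sob C X)) (\<zeta> (sob C X))
          (fmap ?t (sob T (fobj E X)) (fobj E (sob C X)) (?iE X))))" for X
  have "nat_iso C T (func_comp ?t (func_comp (Sus T) E)) (func_comp (Sus T) (func_comp ?t E)) \<xi>"
    using nat_iso_comp[OF fb(6,4,8) nat_iso_comp[OF fb(6,3,4) nat_iso_comp[OF fb(6,7,3) n1 n2] cF] n4]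
    unfolding \<xi>_def[abs_def] by simp
  then have xi: "nat_iso C T (func_comp (func_comp ?t (Sus T)) E) (func_comp (func_comp (Sus T) ?t) E) \<xi>"
    by (simp add: func_comp_assoc)
  define \<xi>' where "\<xi>' Y = Cmp T (fobj (func_comp ?t (Sus T)) Y) (fobj (func_comp (Sus T) ?t) (fobj E (pre Y))) (fobj (func_comp (Sus T) ?t) Y)
      (fmap (func_comp (Sus T) ?t) (fobj E (pre Y)) Y (cmp Y))
     (Cmp T (fobj (func_comp ?t (Sus T)) Y) (fobj (func_comp ?t (Sus T)) (fobj E (pre Y))) (fobj (func_comp (Sus T) ?t) (fobj E (pre Y))) (\<xi> (pre Y))
        (fmap (func_comp ?t (Sus T)) Y (fobj E (pre Y)) (cmp' Y)))" for Y
  have xi': "nat_trans T T (func_comp ?t (Sus T)) (func_comp (Sus T) ?t) \<xi>'" "\<And>X. X \<in> Obj C \<Longrightarrow> \<xi>' (fobj E X) = \<xi> X"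
    using extend_nat_trans[OF fb(9,10), of \<xi>] xi unfolding \<xi>'_def[abs_def] nat_iso_def by auto
  have xiso: "is_iso T (fobj ?t (sob T Y)) (sob T (fobj ?t Y)) (\<xi>' Y)" if Y: "Y \<in> Obj T" for Y
  proof -
    have P: "pre Y \<in> Obj C" "fobj E (pre Y) \<in> Obj T" using Y by (simp_all add: cats)
    have b: "is_iso T (fobj E (pre Y)) Y (cmp Y)" "is_iso T Y (fobj E (pre Y)) (cmp' Y)" using pre_cmp[OF Y] is_iso_inv_mor by auto
    have "is_iso T (fobj ?t (sob T (fobj E (pre Y)))) (sob T (fobj ?t (fobj E (pre Y)))) (\<xi> (pre Y))"
      using xi P by (simp add: nat_iso_def)
    moreover have "is_iso T (fobj (func_comp (Sus T) ?t) (fobj E (pre Y))) (fobj (func_comp (Sus T) ?t) Y) (fmap (func_comp (Sus T) ?t) (fobj E (pre Y)) Y (cmp Y))"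
      by (rule functor_between.is_iso_fmap[OF fb(10) b(1) P(2) Y])
    moreover have "is_iso T (fobj (func_comp ?t (Sus T)) Y) (fobj (func_comp ?t (Sus T)) (fobj E (pre Y))) (fmap (func_comp ?t (Sus T)) Y (fobj E (pre Y)) (cmp' Y))"
      by (rule functor_between.is_iso_fmap[OF fb(9) b(2) Y P(2)])
    moreover have "fobj (func_comp (Sus T) ?t) Y \<in> Obj T" "fobj (func_comp (Sus T) ?t) (fobj E (pre Y)) \<in> Obj T"
      "fobj (func_comp ?t (Sus T)) Y \<in> Obj T" "fobj (func_comp ?t (Sus T)) (fobj E (pre Y)) \<in> Obj T"
      using functor_between.functor_simps(1)[OF fb(9)] functor_between.functor_simps(1)[OF fb(10)] Y P by auto
    ultimately show ?thesis unfolding \<xi>'_def using D.is_iso_Cmp by auto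
  qed
  define t where "t = \<lparr>fobj = fobj ?t, fmap = fmap ?t, Com = \<xi>'\<rparr>"
  have t_sel: "fobj t = fobj ?t" "fmap t = fmap ?t" "Com t = \<xi>'" by (auto simp: t_def)
  have zi: "is_iso T (fobj ?t (fobj E X)) (fobj F X) (\<zeta> X)" if "X \<in> Obj C" for X using z that by (simp add: nat_iso_def)
  have Ei: "is_iso T (fobj E (sob C X)) (sob T (fobj E X)) (Com E X)" if "X \<in> Obj C" for X using cE that by (simp add: nat_iso_def)
  have Fi: "is_iso T (fobj F (sob C X)) (sob T (fobj F X)) (Com F X)" if "X \<in> Obj C" for X using cF that by (simp add: nat_iso_def)
  have compat: "Cmp T (fobj ?t (fobj E (sob C X))) (fobj ?t (sob T (fobj E X))) (sob T (fobj ?t (fobj E X))) (\<xi>' (fobj E X)) (fmap ?t (fobj E (sob C X)) (sob T (fobj E X)) (Com E X))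
    = Cmp T (fobj ?t (fobj E (sob C X))) (sob T (fobj F X)) (sob T (fobj ?t (fobj E X))) (smap T (fobj F X) (fobj ?t (fobj E X)) (?iz X))
       (Cmp T (fobj ?t (fobj E (sob C X))) (fobj F (sob C X)) (sob T (fobj F X)) (Com F X) (\<zeta> (sob C X)))" if X: "X \<in> Obj C" for X
  proof -
    let ?ES = "fobj E (sob C X)" and ?SE = "sob T (fobj E X)"
    have o: "sob C X \<in> Obj C" "?ES \<in> Obj T" "?SE \<in> Obj T" using X by (simp_all add: cats)
    note iE = inv_mor[OF Ei[OF X]] and iz = inv_mor[OF zi[OF X]] and izS = inv_mor[OF zi[OF o(1)]] and iF = inv_mor[OF Fi[OF X]]
    have tE: "fmap ?t ?ES ?SE (Com E X) \<in> mor T (fobj ?t ?ES) (fobj ?t ?SE)" "fmap ?t ?SE ?ES (?iE X) \<in> mor T (fobj ?t ?SE) (fobj ?t ?ES)"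
      "Cmp T (fobj ?t ?ES) (fobj ?t ?SE) (fobj ?t ?ES) (fmap ?t ?SE ?ES (?iE X)) (fmap ?t ?ES ?SE (Com E X)) = Idn T (fobj ?t ?ES)"
      using t.functor_simps(2)[of ?ES ?SE] t.functor_simps(2)[of ?SE ?ES] t.functor_simps(4)[of ?ES ?SE ?ES "Com E X" "?iE X"] t.functor_simps(3)[of ?ES] iE o by auto
    have oo: "fobj ?t ?ES \<in> Obj T" "fobj ?t ?SE \<in> Obj T" "fobj ?t (fobj E X) \<in> Obj T" "fobj F X \<in> Obj T" "fobj F (sob C X) \<in> Obj T"
      using o X t.functor_simps(1) by (simp_all add: cats)
    have m: "smap T (fobj F X) (fobj ?t (fobj E X)) (?iz X) \<in> mor T (sob T (fobj F X)) (sob T (fobj ?t (fobj E X)))"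
       "Com F X \<in> mor T (fobj F (sob C X)) (sob T (fobj F X))" "\<zeta> (sob C X) \<in> mor T (fobj ?t ?ES) (fobj F (sob C X))"
      using oo iz iF izS by (auto simp: TS.functor_simps)
    have so: "sob T (fobj F X) \<in> Obj T" "sob T (fobj ?t (fobj E X)) \<in> Obj T" using oo by (simp_all add: cats)
    show ?thesis
      unfolding xi'(2)[OF X] \<xi>_def using oo so m tE D.Cmp_prefix[OF tE(3)]
      by (simp add: D.Cmp_left_assoc D.Cmp_simps(1) D.Cmp_Idn_right del: func_comp_simps)
  qed
  have tiso: "triangle_iso C T (tcomp C T T t E) F \<zeta>"
    unfolding triangle_iso_def
  proof (intro conjI ballI)
    show "nat_iso C T (tcomp C T T t E) F \<zeta>"
      using z unfolding nat_iso_def nat_trans_def by (simp add: t_sel)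
    fix X assume X: "X \<in> Obj C"
    have o: "sob C X \<in> Obj C" using X by (simp add: cats)
    have oo: "fobj ?t (fobj E (sob C X)) \<in> Obj T" "fobj ?t (fobj E X) \<in> Obj T" "fobj F X \<in> Obj T" "fobj F (sob C X) \<in> Obj T"
      using o X t.functor_simps(1) by (simp_all add: cats)
    note iz = inv_mor[OF zi[OF X]] and izS = inv_mor[OF zi[OF o(1)]] and iF = inv_mor[OF Fi[OF X]]
    have s: "Cmp T (sob T (fobj F X)) (sob T (fobj ?t (fobj E X))) (sob T (fobj F X)) (smap T (fobj ?t (fobj E X)) (fobj F X) (\<zeta> X)) (smap T (fobj F X) (fobj ?t (fobj E X)) (?iz X))
       = Idn T (sob T (fobj F X))"
      using oo iz by (simp flip: TS.functor_simps(3,4) del: func_comp_simps)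
    have m: "smap T (fobj F X) (fobj ?t (fobj E X)) (?iz X) \<in> mor T (sob T (fobj F X)) (sob T (fobj ?t (fobj E X)))"
      "smap T (fobj ?t (fobj E X)) (fobj F X) (\<zeta> X) \<in> mor T (sob T (fobj ?t (fobj E X))) (sob T (fobj F X))"
       "Com F X \<in> mor T (fobj F (sob C X)) (sob T (fobj F X))" "\<zeta> (sob C X) \<in> mor T (fobj ?t (fobj E (sob C X))) (fobj F (sob C X))"
      using oo iz iF izS by (auto simp: TS.functor_simps)
    have so: "sob T (fobj F X) \<in> Obj T" "sob T (fobj ?t (fobj E X)) \<in> Obj T" using oo by (simp_all add: cats)
    have "Com (tcomp C T T t E) X = Cmp T (fobj ?t (fobj E (sob C X))) (sob T (fobj F X)) (sob T (fobj ?t (fobj E X))) (smap T (fobj F X) (fobj ?t (fobj E X)) (?iz X))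
       (Cmp T (fobj ?t (fobj E (sob C X))) (fobj F (sob C X)) (sob T (fobj F X)) (Com F X) (\<zeta> (sob C X)))"
      using compat[OF X] by (simp add: tcomp_def t_sel)
    then show "Cmp T (fobj (tcomp C T T t E) (sob C X)) (sob T (fobj (tcomp C T T t E) X)) (sob T (fobj F X))
            (smap T (fobj (tcomp C T T t E) X) (fobj F X) (\<zeta> X)) (Com (tcomp C T T t E) X)
          = Cmp T (fobj (tcomp C T T t E) (sob C X)) (fobj F (sob C X)) (sob T (fobj F X)) (Com F X) (\<zeta> (sob C X))"
      using oo so m s D.Cmp_prefix[OF s]
      by (simp add: t_sel D.Cmp_left_assoc D.Cmp_simps(1) D.Cmp_Idn_left del: func_comp_simps)
  qed
  have lin: "linear_functor K T T t" using t.is_linear by (subst linear_functor_cong[of _ ?t]) (auto simp: t_sel)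
  have nat: "nat_iso T T (func_comp t (Sus T)) (func_comp (Sus T) t) (Com t)"
    using xi' xiso unfolding nat_iso_def nat_trans_def by (simp add: t_sel)
  have tri: "(fobj t X, fobj t Y, fobj t Z, fmap t X Y f, fmap t Y Z g, Cmp T (fobj t Z) (fobj t (sob T X)) (sob T (fobj t X)) (Com t X) (fmap t Z (sob T X) h)) \<in> Tri T"
    if tr: "(X, Y, Z, f, g, h) \<in> Tri T" for X Y Z f g h
  proof -
    note m = T.Tri_mor[OF tr]
    let ?P = "pre X" and ?Q = "pre Y"
    have P: "?P \<in> Obj C" "?Q \<in> Obj C" using m by (simp_all add: cats)
    \<comment> \<open>Only the first morphism is lifted to \<open>C\<close>. It is completed to a
      triangle there, and \<open>cone_unique\<close> compares the result with the given
      triangle.\<close>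
    define f' where "f' = fmap quasi_inverse X Y f"
    have f': "f' \<in> mor C ?P ?Q" "fmap E ?P ?Q f' = Cmp T (fobj E ?P) Y (fobj E ?Q) (cmp' Y) (Cmp T (fobj E ?P) X Y f (cmp X))"
      unfolding f'_def using quasi_inverse_map[of X Y f] m by auto
    obtain R g' h' where tc: "(?P, ?Q, R, f', g', h') \<in> Tri C" using C_cone[OF P f'(1)] by blast
    note mc = C_mor[OF tc]
    have tE: "(fobj E ?P, fobj E ?Q, fobj E R, fmap E ?P ?Q f', fmap E ?Q R g',
       Cmp T (fobj E R) (fobj E (sob C ?P)) (sob T (fobj E ?P)) (Com E ?P) (fmap E R (sob C ?P) h')) \<in> Tri T" using E' tc by blast
    have tF: "(fobj F ?P, fobj F ?Q, fobj F R, fmap F ?P ?Q f', fmap F ?Q R g',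
       Cmp T (fobj F R) (fobj F (sob C ?P)) (sob T (fobj F ?P)) (Com F ?P) (fmap F R (sob C ?P) h')) \<in> Tri T" using F' tc by blast
    have "Cmp T (fobj E ?P) (fobj E ?Q) Y (cmp Y) (fmap E ?P ?Q f') = Cmp T (fobj E ?P) X Y f (cmp X)"
      unfolding f'(2) using m by (simp add: cats)
    then obtain c where c: "is_iso T (fobj E R) Z c" "Cmp T (fobj E ?Q) (fobj E R) Z c (fmap E ?Q R g') = Cmp T (fobj E ?Q) Y Z g (cmp Y)"
      "Cmp T (fobj E R) (sob T (fobj E ?P)) (sob T X) (smap T (fobj E ?P) X (cmp X)) (Cmp T (fobj E R) (fobj E (sob C ?P)) (sob T (fobj E ?P)) (Com E ?P) (fmap E R (sob C ?P) h'))
        = Cmp T (fobj E R) Z (sob T X) h c"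
      using T.cone_unique[OF tE tr] pre_cmp m by blast
    note ic = inv_mor[OF c(1)] and izP = inv_mor[OF zi[OF P(1)]] and izQ = inv_mor[OF zi[OF P(2)]] and izR = inv_mor[of T _ _ "\<zeta> R", OF zi]
    have R: "R \<in> Obj C" "sob C ?P \<in> Obj C" using mc SC.functor_simps(1)[of ?P] by auto
    note izR = inv_mor[OF zi[OF R(1)]] and izS = inv_mor[OF zi[OF R(2)]] and iE = inv_mor[OF Ei[OF P(1)]] and iF = inv_mor[OF Fi[OF P(1)]]
    let ?EP = "fobj E ?P" and ?EQ = "fobj E ?Q" and ?ER = "fobj E R" and ?ES = "fobj E (sob C ?P)"
    let ?FP = "fobj F ?P" and ?FQ = "fobj F ?Q" and ?FR = "fobj F R" and ?FS = "fobj F (sob C ?P)" and ?SF = "sob T (fobj F ?P)"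
    let ?tX = "fobj t X" and ?tY = "fobj t Y" and ?tZ = "fobj t Z" and ?tP = "fobj t ?EP" and ?tQ = "fobj t ?EQ" and ?tR = "fobj t ?ER"
      and ?tS = "fobj t ?ES" and ?tSP = "fobj t (sob T ?EP)" and ?tSX = "fobj t (sob T X)" and ?StP = "sob T (fobj t ?EP)" and ?StX = "sob T (fobj t X)"
    have oE: "?EP \<in> Obj T" "?EQ \<in> Obj T" "?ER \<in> Obj T" "?ES \<in> Obj T" "sob T ?EP \<in> Obj T" using P R by (simp_all add: cats)
    have oT: "fobj t X \<in> Obj T" "fobj t Y \<in> Obj T" "fobj t Z \<in> Obj T" "fobj t ?EP \<in> Obj T" "fobj t ?EQ \<in> Obj T" "fobj t ?ER \<in> Obj T" "fobj t ?ES \<in> Obj T"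
      "fobj t (sob T ?EP) \<in> Obj T" "fobj t (sob T X) \<in> Obj T"
      using oE m t.functor_simps(1) by (simp_all add: t_sel TS.functor_simps)
    have oF: "fobj F ?P \<in> Obj T" "fobj F ?Q \<in> Obj T" "fobj F R \<in> Obj T" "fobj F (sob C ?P) \<in> Obj T" using P R by (simp_all add: cats)
    have oS: "sob T ?FP \<in> Obj T" "sob T ?tP \<in> Obj T" "sob T ?tX \<in> Obj T" "sob T X \<in> Obj T"
      using oF oT m by (simp_all add: TS.functor_simps)
    interpret t': functor_between K T T t
      by (rule functor_betweenI[OF lt lt]) (use lin in \<open>simp add: linear_functor_def\<close>)
    have zn: "Cmp T (fobj F V) (fobj F W) (fobj t (fobj E W)) (?iz W) (fmap F V W k) = Cmp T (fobj F V) (fobj t (fobj E V)) (fobj t (fobj E W)) (fmap t (fobj E V) (fobj E W) (fmap E V W k)) (?iz V)"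
      if "V \<in> Obj C" "W \<in> Obj C" "k \<in> mor C V W" for V W k
      using nat_iso_inverse[OF fb(5) F.functor_between_axioms z] that unfolding nat_iso_def nat_trans_def by (simp add: t_sel)
    have zz: "Cmp T (fobj t (fobj E V)) (fobj F V) (fobj F W) (fmap F V W k) (\<zeta> V) = Cmp T (fobj t (fobj E V)) (fobj t (fobj E W)) (fobj F W) (\<zeta> W) (fmap t (fobj E V) (fobj E W) (fmap E V W k))"
      if "V \<in> Obj C" "W \<in> Obj C" "k \<in> mor C V W" for V W k
      using z that unfolding nat_iso_def nat_trans_def by (simp add: t_sel)
    \<comment> \<open>The comparison of the two triangles: the inverse of \<open>\<zeta>\<close>
      followed by \<open>t\<close> applied to the isomorphisms \<open>cmp X\<close>,
      \<open>cmp Y\<close> and \<open>c\<close>.\<close>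
    let ?A = "Cmp T ?FP ?tP ?tX (fmap t ?EP X (cmp X)) (?iz ?P)"
    let ?B = "Cmp T ?FQ ?tQ ?tY (fmap t ?EQ Y (cmp Y)) (?iz ?Q)"
    let ?C = "Cmp T ?FR ?tR ?tZ (fmap t ?ER Z c) (?iz R)"
    have bX: "cmp X \<in> mor T ?EP X" "cmp Y \<in> mor T ?EQ Y" using m by (simp_all add: cats)
    have tm: "fmap t ?EP X (cmp X) \<in> mor T ?tP ?tX" "fmap t ?EQ Y (cmp Y) \<in> mor T ?tQ ?tY" "fmap t ?ER Z c \<in> mor T ?tR ?tZ"
      "fmap t X Y f \<in> mor T ?tX ?tY" "fmap t Y Z g \<in> mor T ?tY ?tZ" "fmap t Z (sob T X) h \<in> mor T ?tZ ?tSX"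
      using t'.functor_simps(2) oE m bX ic oS by auto
    have tEm: "fmap t ?EP ?EQ (fmap E ?P ?Q f') \<in> mor T ?tP ?tQ" "fmap t ?EQ ?ER (fmap E ?Q R g') \<in> mor T ?tQ ?tR"
      "fmap t ?ER ?ES (fmap E R (sob C ?P) h') \<in> mor T ?tR ?tS" "fmap t ?ES (sob T ?EP) (Com E ?P) \<in> mor T ?tS ?tSP"
      "fmap t (sob T ?EP) (sob T X) (smap T ?EP X (cmp X)) \<in> mor T ?tSP ?tSX"
      using t'.functor_simps(2) oE m bX iE oS functor_simps(2) P R mc TS.functor_simps(2) by auto
    have Fm: "fmap F ?P ?Q f' \<in> mor T ?FP ?FQ" "fmap F ?Q R g' \<in> mor T ?FQ ?FR" "fmap F R (sob C ?P) h' \<in> mor T ?FR ?FS"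
      using F.functor_simps(2) P R mc by auto
    have izm: "?iz ?P \<in> mor T ?FP ?tP" "?iz ?Q \<in> mor T ?FQ ?tQ" "?iz R \<in> mor T ?FR ?tR" "\<zeta> (sob C ?P) \<in> mor T ?tS ?FS"
       "\<zeta> R \<in> mor T ?tR ?FR"
      using izP izQ izR izS by (simp_all add: t_sel)
    have Cm: "Com F ?P \<in> mor T ?FS ?SF" "Com t X \<in> mor T ?tSX ?StX"
      "Com t ?EP \<in> mor T ?tSP ?StP"
      using iF xiso[THEN inv_mor(1)] m oE by (simp_all add: t_sel)
    have Sm: "smap T ?FP ?tP (?iz ?P) \<in> mor T ?SF ?StP"
      "smap T ?tP ?tX (fmap t ?EP X (cmp X)) \<in> mor T ?StP ?StX"
      using TS.functor_simps(2) oF oT izm tm by auto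
    note tps = oT oF oS oE tm tEm Fm izm Cm Sm
    show ?thesis
    proof (rule T.Tri_iso[OF tF])
      show "is_iso T ?FP ?tX ?A"
        using D.is_iso_Cmp[OF is_iso_inv_mor[OF zi[OF P(1)]] t.is_iso_fmap[of ?EP X "cmp X"]] pre_cmp[of X] m oE oF oT by (simp add: t_sel)
      show "is_iso T ?FQ ?tY ?B"
        using D.is_iso_Cmp[OF is_iso_inv_mor[OF zi[OF P(2)]] t.is_iso_fmap[of ?EQ Y "cmp Y"]] pre_cmp[of Y] m oE oF oT by (simp add: t_sel)
      show "is_iso T ?FR ?tZ ?C"
        using D.is_iso_Cmp[OF is_iso_inv_mor[OF zi[OF R(1)]] t.is_iso_fmap[of ?ER Z c]] c(1) m oE oF oT by (simp add: t_sel)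
      have "Cmp T ?FP ?FQ ?tY ?B (fmap F ?P ?Q f') = Cmp T ?FP ?tQ ?tY (fmap t ?EQ Y (cmp Y))
         (Cmp T ?FP ?FQ ?tQ (?iz ?Q) (fmap F ?P ?Q f'))"
        using tps by (simp add: D.Cmp_left_assoc D.Cmp_simps(1))
      also have "\<dots> = Cmp T ?FP ?tP ?tY (Cmp T ?tP ?tQ ?tY (fmap t ?EQ Y (cmp Y)) (fmap t ?EP ?EQ (fmap E ?P ?Q f'))) (?iz ?P)"
        unfolding zn[OF P f'(1)] using tps by (simp add: D.Cmp_left_assoc D.Cmp_simps(1))
      also have "Cmp T ?tP ?tQ ?tY (fmap t ?EQ Y (cmp Y)) (fmap t ?EP ?EQ (fmap E ?P ?Q f')) = fmap t ?EP Y (Cmp T ?EP ?EQ Y (cmp Y) (fmap E ?P ?Q f'))"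
        using oE m bX functor_simps(2) P f'(1) by (intro t'.functor_simps(4)[symmetric]) auto
      also have "Cmp T ?EP ?EQ Y (cmp Y) (fmap E ?P ?Q f') = Cmp T ?EP X Y f (cmp X)" by fact
      also have "fmap t ?EP Y (Cmp T ?EP X Y f (cmp X)) = Cmp T ?tP ?tX ?tY (fmap t X Y f) (fmap t ?EP X (cmp X))"
        using oE m bX by (intro t'.functor_simps(4)) auto
      finally show "Cmp T ?FP ?FQ ?tY ?B (fmap F ?P ?Q f') = Cmp T ?FP ?tX ?tY (fmap t X Y f) ?A"
        using tps by (simp add: D.Cmp_left_assoc)
      have "Cmp T ?FQ ?FR ?tZ ?C (fmap F ?Q R g') = Cmp T ?FQ ?tR ?tZ (fmap t ?ER Z c)
         (Cmp T ?FQ ?FR ?tR (?iz R) (fmap F ?Q R g'))"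
        using tps by (simp add: D.Cmp_left_assoc D.Cmp_simps(1))
      also have "\<dots> = Cmp T ?FQ ?tQ ?tZ (Cmp T ?tQ ?tR ?tZ (fmap t ?ER Z c) (fmap t ?EQ ?ER (fmap E ?Q R g'))) (?iz ?Q)"
        unfolding zn[OF P(2) R(1) mc[THEN conjunct2, THEN conjunct2, THEN conjunct2, THEN conjunct2, THEN conjunct1]] using tps by (simp add: D.Cmp_left_assoc D.Cmp_simps(1))
      also have "Cmp T ?tQ ?tR ?tZ (fmap t ?ER Z c) (fmap t ?EQ ?ER (fmap E ?Q R g')) = fmap t ?EQ Z (Cmp T ?EQ ?ER Z c (fmap E ?Q R g'))"
        using oE m ic functor_simps(2) P R mc by (intro t'.functor_simps(4)[symmetric]) auto
      also have "Cmp T ?EQ ?ER Z c (fmap E ?Q R g') = Cmp T ?EQ Y Z g (cmp Y)" by fact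
      also have "fmap t ?EQ Z (Cmp T ?EQ Y Z g (cmp Y)) = Cmp T ?tQ ?tY ?tZ (fmap t Y Z g) (fmap t ?EQ Y (cmp Y))"
        using oE m bX by (intro t'.functor_simps(4)) auto
      finally show "Cmp T ?FQ ?FR ?tZ ?C (fmap F ?Q R g') = Cmp T ?FQ ?tY ?tZ (fmap t Y Z g) ?B"
        using tps by (simp add: D.Cmp_left_assoc)
      let ?SA = "smap T ?tP ?tX (fmap t ?EP X (cmp X))" and ?Sz = "smap T ?FP ?tP (?iz ?P)"
      let ?th = "fmap t ?ER ?ES (fmap E R (sob C ?P) h')"
      have SA: "smap T ?FP ?tX ?A = Cmp T ?SF ?StP ?StX ?SA ?Sz"
        using tps by (intro TS.functor_simps(4)) auto
      have hR: "fmap E R (sob C ?P) h' \<in> mor T ?ER ?ES" using functor_simps(2) R mc by auto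
      have xn: "Cmp T ?tSP ?tSX ?StX (Com t X) (fmap t (sob T ?EP) (sob T X) (smap T ?EP X (cmp X)))
         = Cmp T ?tSP ?StP ?StX ?SA (Com t ?EP)"
        using nat_transD(2)[OF xi'(1) oE(1) m[THEN conjunct1] bX(1)] by (simp add: t_sel)
      have cmpt: "Cmp T ?tS ?tSP ?StP (Com t ?EP) (fmap t ?ES (sob T ?EP) (Com E ?P))
        = Cmp T ?tS ?SF ?StP ?Sz
          (Cmp T ?tS ?FS ?SF (Com F ?P) (\<zeta> (sob C ?P)))"
        using compat[OF P(1)] by (simp add: t_sel)
      have zc: "Cmp T ?FR ?tR ?FR (\<zeta> R) (?iz R) = Idn T ?FR" using izR by (simp add: t_sel)
      \<comment> \<open>The last square combines four facts: the third square of \<open>c\<close>,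
        naturality of \<open>Com t\<close>, its compatibility with \<open>Com E\<close>, and
        naturality of \<open>\<zeta>\<close>.\<close>
      have "Cmp T ?FR ?tZ ?StX (Cmp T ?tZ ?tSX ?StX (Com t X) (fmap t Z (sob T X) h)) ?C
        = Cmp T ?FR ?tR ?StX (Cmp T ?tR ?tSX ?StX (Com t X)
            (Cmp T ?tR ?tZ ?tSX (fmap t Z (sob T X) h) (fmap t ?ER Z c))) (?iz R)"
        using tps by (simp add: D.Cmp_left_assoc D.Cmp_simps(1))
      also have "Cmp T ?tR ?tZ ?tSX (fmap t Z (sob T X) h) (fmap t ?ER Z c) = fmap t ?ER (sob T X) (Cmp T ?ER Z (sob T X) h c)"
        using oE m ic oS by (intro t'.functor_simps(4)[symmetric]) auto
      also have "\<dots> = Cmp T ?tR ?tSP ?tSX (fmap t (sob T ?EP) (sob T X) (smap T ?EP X (cmp X)))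
           (Cmp T ?tR ?tS ?tSP (fmap t ?ES (sob T ?EP) (Com E ?P)) ?th)"
        unfolding c(3)[symmetric] using oE oS m bX iE hR TS.functor_simps(2)[of ?EP X "cmp X"]
        by (simp add: t'.functor_simps(4) D.Cmp_simps(1))
      also have "Cmp T ?tR ?tSX ?StX (Com t X) \<dots> =
          Cmp T ?tR ?tS ?StX (Cmp T ?tS ?tSP ?StX
            (Cmp T ?tSP ?tSX ?StX (Com t X) (fmap t (sob T ?EP) (sob T X) (smap T ?EP X (cmp X))))
            (fmap t ?ES (sob T ?EP) (Com E ?P))) ?th"
        using tps by (simp add: D.Cmp_left_assoc D.Cmp_simps(1))
      also have "\<dots> = Cmp T ?tR ?tS ?StX (Cmp T ?tS ?StP ?StX ?SA
            (Cmp T ?tS ?tSP ?StP (Com t ?EP) (fmap t ?ES (sob T ?EP) (Com E ?P)))) ?th"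
        unfolding xn using tps by (simp add: D.Cmp_left_assoc D.Cmp_simps(1))
      also have "\<dots> = Cmp T ?tR ?StP ?StX ?SA (Cmp T ?tR ?SF ?StP ?Sz
           (Cmp T ?tR ?FS ?SF (Com F ?P) (Cmp T ?tR ?tS ?FS (\<zeta> (sob C ?P)) ?th)))"
        unfolding cmpt using tps by (simp add: D.Cmp_left_assoc D.Cmp_simps(1))
      also have "Cmp T ?tR ?tS ?FS (\<zeta> (sob C ?P)) ?th = Cmp T ?tR ?FR ?FS (fmap F R (sob C ?P) h') (\<zeta> R)"
        using zz[of R "sob C ?P" h'] R mc by simp
      also have "Cmp T ?FR ?tR ?StX (Cmp T ?tR ?StP ?StX ?SA (Cmp T ?tR ?SF ?StP ?Sz
           (Cmp T ?tR ?FS ?SF (Com F ?P) (Cmp T ?tR ?FR ?FS (fmap F R (sob C ?P) h') (\<zeta> R))))) (?iz R)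
        = Cmp T ?FR ?SF ?StX (smap T ?FP ?tX ?A) (Cmp T ?FR ?FS ?SF (Com F ?P) (fmap F R (sob C ?P) h'))"
        unfolding SA using tps D.Cmp_prefix[OF zc] by (simp add: D.Cmp_left_assoc D.Cmp_simps(1) D.Cmp_Idn_right)
      finally show "Cmp T ?FR ?SF ?StX (smap T ?FP ?tX ?A) (Cmp T ?FR ?FS ?SF (Com F ?P) (fmap F R (sob C ?P) h'))
        = Cmp T ?FR ?tZ ?StX (Cmp T ?tZ ?tSX ?StX (Com t X) (fmap t Z (sob T X) h)) ?C" by simp
    qed (use tps in \<open>simp_all add: D.Cmp_simps(1)\<close>)
  qed
  have "triangle_functor K T T t" unfolding triangle_functor_def using lin nat tri by blast
  then show ?thesis using tiso t_sel by blast
qed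

end

lemma cohom_comp:
  assumes "complex_map K N L \<psi>"
  shows "cohom_surj M N \<phi> n \<Longrightarrow> cohom_surj N L \<psi> n \<Longrightarrow> cohom_surj M L (\<lambda>n x. \<psi> n (\<phi> n x)) n"
    and "complex_map K M N \<phi> \<Longrightarrow> cohom_inj M N \<phi> n \<Longrightarrow> cohom_inj N L \<psi> n \<Longrightarrow> cohom_inj M L (\<lambda>n x. \<psi> n (\<phi> n x)) n"
proof -
  interpret \<psi>: complex_map K N L \<psi> by fact
  show "cohom_surj M L (\<lambda>n x. \<psi> n (\<phi> n x)) n" if s: "cohom_surj M N \<phi> n" "cohom_surj N L \<psi> n"
    unfolding cohom_surj_def
  proof
    fix y assume "y \<in> cocycles L n"
    then obtain x z where x: "x \<in> cocycles N n" "z \<in> carrier (Mdl L (n - 1))" "\<psi> n x = y \<oplus>\<^bsub>Mdl L n\<^esub> Dif L (n - 1) z"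
      using s(2) unfolding cohom_surj_def by blast
    then obtain v u where v: "v \<in> cocycles M n" "u \<in> carrier (Mdl N (n - 1))" "\<phi> n v = x \<oplus>\<^bsub>Mdl N n\<^esub> Dif N (n - 1) u"
      using s(1) unfolding cohom_surj_def by blast
    have "\<psi> n (\<phi> n v) = \<psi> n x \<oplus>\<^bsub>Mdl L n\<^esub> Dif L (n - 1) (\<psi> (n - 1) u)"
      unfolding v(3) using x v by (simp add: cocycles_def \<psi>.phi_Dif)
    also have "\<dots> = y \<oplus>\<^bsub>Mdl L n\<^esub> Dif L (n - 1) (z \<oplus>\<^bsub>Mdl L (n - 1)\<^esub> \<psi> (n - 1) u)"
      unfolding x(3) using \<open>y \<in> cocycles L n\<close> x v by (simp add: cocycles_def abg)
    finally show "\<exists>x\<in>cocycles M n. \<exists>z\<in>carrier (Mdl L (n - 1)). \<psi> n (\<phi> n x) = y \<oplus>\<^bsub>Mdl L n\<^esub> Dif L (n - 1) z"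
      using x v by (intro bexI[of _ v] bexI[of _ "z \<oplus>\<^bsub>Mdl L (n - 1)\<^esub> \<psi> (n - 1) u"]) (simp_all add: abgc)
  qed
  show "cohom_inj M L (\<lambda>n x. \<psi> n (\<phi> n x)) n" if "complex_map K M N \<phi>" and s: "cohom_inj M N \<phi> n" "cohom_inj N L \<psi> n"
    using s complex_map.phi_cocycle[OF that(1)] unfolding cohom_inj_def by metis
qed

section \<open>The cone functor: from a coreflection in degree 0 to functorial triangles\<close>

section \<open>Shifting universal properties\<close>

context dg_functor_between
begin

context
  fixes X Y f
  assumes f: "X \<in> DObj A" "Y \<in> DObj B" "f \<in> dmor B (dobj F X) Y 0" "ddif B (dobj F X) Y 0 f = (dzero B (dobj F X) Y 1)"
begin

abbreviation (input) "post W \<equiv> \<lambda>n a. DCmp B (dobj F W) (dobj F X) Y 0 n f (dmap F W X n a)"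

text \<open>Composition with \<open>\<sigma>\<close> and \<open>\<sigma>'\<close> exhibits the map
  for \<open>W\<close> in degree \<open>n + d\<close> as a retract, up to homotopy, of the map for
  \<open>W'\<close> in degree \<open>n\<close>. Surjectivity and injectivity on cohomology pass to
  retracts.\<close>

lemma post_shift:
  assumes W: "W \<in> DObj A" "W' \<in> DObj A" and s: "\<sigma> \<in> dmor A W W' d" "\<sigma>' \<in> dmor A W' W (-d)"
    "ddif A W W' d \<sigma> = (dzero A W W' (d + 1))" "ddif A W' W (-d) \<sigma>' = (dzero A W' W (1 - d))"
    and k: "k \<in> dmor A W W (-1)" and ss: "DCmp A W W' W (-d) d \<sigma>' \<sigma> = DIdn A W \<oplus>\<^bsub>dM A W W 0\<^esub> ddif A W W (-1) k"
  shows "cohom_surj (DHom A W' X) (DHom B (dobj F W') Y) (post W') n \<Longrightarrow> cohom_surj (DHom A W X) (DHom B (dobj F W) Y) (post W) (n + d)"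
    and "cohom_inj (DHom A W' X) (DHom B (dobj F W') Y) (post W') n \<Longrightarrow> cohom_inj (DHom A W X) (DHom B (dobj F W) Y) (post W) (n + d)"
proof -
  let ?W = "dobj F W" and ?W' = "dobj F W'"
  have Fss: "DCmp B ?W ?W' ?W (-d) d (dmap F W' W (-d) \<sigma>') (dmap F W W' d \<sigma>) = DIdn B ?W \<oplus>\<^bsub>dM B ?W ?W 0\<^esub> dmap F W W 0 (ddif A W W (-1) k)"
    using arg_cong[OF ss, of "dmap F W W 0"] W s k by (simp add: dgs)
  note pre = A.DCmp_prefix[OF ss] B.DCmp_prefix[OF Fss]
  note data = W f s k
  show "cohom_surj (DHom A W X) (DHom B ?W Y) (post W) (n + d)" if surj: "cohom_surj (DHom A W' X) (DHom B ?W' Y) (post W') n"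
    unfolding cohom_surj_def
  proof
    fix y assume "y \<in> dcocyc B ?W Y (n + d)"
    then have y: "y \<in> dmor B ?W Y (n + d)" "ddif B ?W Y (n + d) y = (dzero B ?W Y (n + d + 1))" by (auto simp: dgs)
    have "DCmp B ?W' ?W Y (n + d) (-d) y (dmap F W' W (-d) \<sigma>') \<in> dcocyc B ?W' Y n"
      using y data by (cases "even (n + d)") (simp_all add: dgs abgc)
    then obtain x z where x: "x \<in> dcocyc A W' X n" "z \<in> dmor B ?W' Y (n - 1)"
      "post W' n x = DCmp B ?W' ?W Y (n + d) (-d) y (dmap F W' W (-d) \<sigma>') \<oplus>\<^bsub>dM B ?W' Y n\<^esub> ddif B ?W' Y (n - 1) z"
      using surj unfolding cohom_surj_def by blast
    have x': "x \<in> dmor A W' X n" "ddif A W' X n x = (dzero A W' X (n + 1))" using x by (auto simp: dgs)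
    let ?x = "DCmp A W W' X n d x \<sigma>"
    let ?z = "koszul (dM B ?W Y (n + d - 1)) (n + d) (DCmp B ?W ?W Y (n + d) (-1) y (dmap F W W (-1) k))
      \<oplus>\<^bsub>dM B ?W Y (n + d - 1)\<^esub> DCmp B ?W ?W' Y (n - 1) d z (dmap F W W' d \<sigma>)"
    note pre = pre B.DCmp_prefix[OF x(3)]
    have "?x \<in> dcocyc A W X (n + d)" using x' data by (cases "even n") (simp_all add: dgs abgc algebra_simps)
    moreover have "?z \<in> dmor B ?W Y (n + d - 1)" using x(2) y data by (cases "even (n + d)") (simp_all add: dgs abgc)
    moreover have "post W (n + d) ?x = y \<oplus>\<^bsub>dM B ?W Y (n + d)\<^esub> ddif B ?W Y (n + d - 1) ?z"
      by (cases "even n"; cases "even d"; rule abeqI) (use x(2,3) x' y data Fss in \<open>simp_all add: dgs abg pre algebra_simps\<close>)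
    ultimately show "\<exists>x\<in>dcocyc A W X (n + d). \<exists>z\<in>dmor B ?W Y (n + d - 1). post W (n + d) x = y \<oplus>\<^bsub>dM B ?W Y (n + d)\<^esub> ddif B ?W Y (n + d - 1) z"
      by blast
  qed
  show "cohom_inj (DHom A W X) (DHom B ?W Y) (post W) (n + d)" if inj: "cohom_inj (DHom A W' X) (DHom B ?W' Y) (post W') n"
    unfolding cohom_inj_def
  proof (intro ballI impI)
    fix x z assume "x \<in> dcocyc A W X (n + d)" and z: "z \<in> dmor B ?W Y (n + d - 1)" and eq: "post W (n + d) x = ddif B ?W Y (n + d - 1) z"
    then have x: "x \<in> dmor A W X (n + d)" "ddif A W X (n + d) x = (dzero A W X (n + d + 1))" by (auto simp: dgs)
    let ?x = "DCmp A W' W X (n + d) (-d) x \<sigma>'" and ?z = "DCmp B ?W' ?W Y (n + d - 1) (-d) z (dmap F W' W (-d) \<sigma>')"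
    have "?x \<in> dcocyc A W' X n" using x data by (cases "even (n + d)") (simp_all add: dgs abgc)
    moreover have "?z \<in> dmor B ?W' Y (n - 1)" using z data by (simp add: dgs)
    moreover have "post W' n ?x = ddif B ?W' Y (n - 1) ?z"
      by (cases "even (n + d - 1)"; rule abeqI) (use x z data eq in \<open>simp_all add: dgs abg B.DCmp_prefix[OF eq] algebra_simps\<close>)
    ultimately obtain w where w: "w \<in> dmor A W' X (n - 1)" "?x = ddif A W' X (n - 1) w"
      using inj unfolding cohom_inj_def by blast
    let ?y = "DCmp A W W' X (n - 1) d w \<sigma> \<ominus>\<^bsub>dM A W X (n + d - 1)\<^esub>
       koszul (dM A W X (n + d - 1)) (n + d) (DCmp A W W X (n + d) (-1) x k)"
    have "?y \<in> dmor A W X (n + d - 1)" using w(1) x data by (cases "even (n + d)") (simp_all add: dgs abgc)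
    moreover have "x = ddif A W X (n + d - 1) ?y"
    proof -
      have "DCmp A W W' X n d ?x \<sigma> = x \<oplus>\<^bsub>dM A W X (n + d)\<^esub> DCmp A W W X (n + d) 0 x (ddif A W W (-1) k)"
        using x data by (simp add: dgs pre)
      then have wx: "DCmp A W W' X n d (ddif A W' X (n - 1) w) \<sigma> = x \<oplus>\<^bsub>dM A W X (n + d)\<^esub> DCmp A W W X (n + d) 0 x (ddif A W W (-1) k)"
        unfolding w(2) .
      show ?thesis
        by (cases "even n"; cases "even d"; rule abeqI) (use w(1) x data wx in \<open>simp_all add: dgs abg algebra_simps\<close>)
    qed
    ultimately show "\<exists>y\<in>dmor A W X (n + d - 1). x = ddif A W X (n + d - 1) y" by blast
  qed
qed

text \<open>Degree \<open>-m\<close> at \<open>W\<close> is degree 0 at the \<open>m\<close>-fold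
  suspension of \<open>W\<close>, which stays in \<open>V\<close>. This is the half that an aisle
  provides.\<close>

lemma post_nonpositive:
  assumes V: "V \<subseteq> DObj A" "\<And>W. W \<in> V \<Longrightarrow> sus_obj A W \<in> V" and A: "pretriangulated_dg K A"
    and bij: "\<And>W. W \<in> V \<Longrightarrow> cohom_surj (DHom A W X) (DHom B (dobj F W) Y) (post W) 0 \<and> cohom_inj (DHom A W X) (DHom B (dobj F W) Y) (post W) 0"
    and W: "W \<in> V"
  shows "cohom_surj (DHom A W X) (DHom B (dobj F W) Y) (post W) (- int m) \<and> cohom_inj (DHom A W X) (DHom B (dobj F W) Y) (post W) (- int m)"
  using W
proof (induction m arbitrary: W)
  case 0
  then show ?case using bij by simp
next
  case (Suc m)
  interpret A': pretriangulated_dg K A by fact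
  have o: "W \<in> DObj A" "sus_obj A W \<in> DObj A" using Suc V by auto
  obtain k where k: "k \<in> dmor A W W (-1)"
    "DCmp A W (sus_obj A W) W 1 (-1) (sus_from A W) (sus_to A W) = DIdn A W \<oplus>\<^bsub>dM A W W 0\<^esub> ddif A W W (-1) k"
    using A'.sus_homotopy[OF o(1)] .
  have "- int m + -1 = - int (Suc m)" by simp
  then show ?case
    using post_shift[OF o, of "sus_to A W" "-1" "sus_from A W" k "- int m"] k A'.sus_simps[OF o(1)] Suc.IH[of "sus_obj A W"] Suc.prems V(2)
    by (simp add: algebra_simps)
qed

text \<open>Positive degrees use desuspensions of the test object, hence all of \<open>A\<close> as
  test objects.\<close>

lemma post_nonnegative:
  assumes A: "pretriangulated_dg K A"
    and bij: "\<And>W. W \<in> DObj A \<Longrightarrow> cohom_surj (DHom A W X) (DHom B (dobj F W) Y) (post W) 0 \<and> cohom_inj (DHom A W X) (DHom B (dobj F W) Y) (post W) 0"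
    and W: "W \<in> DObj A"
  shows "cohom_surj (DHom A W X) (DHom B (dobj F W) Y) (post W) (int m) \<and> cohom_inj (DHom A W X) (DHom B (dobj F W) Y) (post W) (int m)"
  using W
proof (induction m arbitrary: W)
  case 0
  then show ?case using bij by simp
next
  case (Suc m)
  interpret A': pretriangulated_dg K A by fact
  obtain W' \<sigma> \<sigma>' where "is_suspension A W' W \<sigma> \<sigma>'" using A'.pretri Suc.prems by (auto simp: pretriangulated_def)
  then obtain k where s: "W' \<in> DObj A" "\<sigma>' \<in> dmor A W W' 1" "\<sigma> \<in> dmor A W' W (-1)"
    "ddif A W' W (-1) \<sigma> = (dzero A W' W 0)" "ddif A W W' 1 \<sigma>' = (dzero A W W' 2)"
    "k \<in> dmor A W W (-1)" "DCmp A W W' W (-1) 1 \<sigma> \<sigma>' = DIdn A W \<oplus>\<^bsub>dM A W W 0\<^esub> ddif A W W (-1) k"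
    by (auto simp: A.is_suspension_iff)
  have "int m + 1 = int (Suc m)" by simp
  then show ?case using post_shift[OF Suc.prems s(1), of \<sigma>' 1 \<sigma> k "int m"] s Suc.IH[OF s(1)] by (simp add: algebra_simps)
qed

end

lemma H0func_bij:
  assumes "X \<in> DObj A" "Y \<in> DObj A" "cohom_surj (DHom A X Y) (DHom B (dobj F X) (dobj F Y)) (dmap F X Y) 0"
    "cohom_inj (DHom A X Y) (DHom B (dobj F X) (dobj F Y)) (dmap F X Y) 0"
  shows "bij_betw (fmap (H0func A B F) X Y) (mor (H0 K A) X Y) (mor (H0 K B) (dobj F X) (dobj F Y))"
  using complex_map.cohom_bij_iff[OF dmap_complex_map[OF assms(1,2)], of 0] assms by (simp add: H0func_def)

end

section \<open>The category of coreflection cones\<close>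

text \<open>
  The object \<open>p X\<close> below is the square with sides \<open>f X : F (c X) \<rightarrow> X\<close> and \<open>0 : F Nul \<rightarrow> Z X\<close>, where \<open>Nul\<close> is
  contractible; the square commutes up to the homotopy \<open>- j X\<close>.
\<close>

locale coreflection_cones = dg_functor_between K A B F + A: pretriangulated_dg K A + B: pretriangulated_dg K B
  for K :: "'k ring" and A :: "('o, 'm, 'k) dg_cat" and B :: "('p, 'n, 'k) dg_cat" and F +
  fixes V :: "'o set" and c :: "'p \<Rightarrow> 'o" and f :: "'p \<Rightarrow> 'n" and Z :: "'p \<Rightarrow> 'p" and i :: "'p \<Rightarrow> 'n" and j :: "'p \<Rightarrow> 'n"
    and Nul :: 'o and \<kappa> :: 'm
  assumes V: "V \<subseteq> DObj A" "\<And>W. W \<in> V \<Longrightarrow> sus_obj A W \<in> V"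
    and c: "X \<in> DObj B \<Longrightarrow> c X \<in> V"
    and cone: "X \<in> DObj B \<Longrightarrow> is_cone K B (dobj F (c X)) X (Z X) (f X) (i X) (j X)"
    and bij: "\<lbrakk>W \<in> V; X \<in> DObj B\<rbrakk> \<Longrightarrow>
      cohom_surj (DHom A W (c X)) (DHom B (dobj F W) X) (\<lambda>n a. DCmp B (dobj F W) (dobj F (c X)) X 0 n (f X) (dmap F W (c X) n a)) 0 \<and>
      cohom_inj (DHom A W (c X)) (DHom B (dobj F W) X) (\<lambda>n a. DCmp B (dobj F W) (dobj F (c X)) X 0 n (f X) (dmap F W (c X) n a)) 0"
    and Nul: "Nul \<in> DObj A" "\<kappa> \<in> dmor A Nul Nul (-1)" "ddif A Nul Nul (-1) \<kappa> = DIdn A Nul"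
begin

abbreviation "FX X \<equiv> dobj F (c X)"
abbreviation "FN \<equiv> dobj F Nul"

lemma cone_simps [dgs]:
  assumes "X \<in> DObj B"
  shows "c X \<in> DObj A" "Z X \<in> DObj B" "f X \<in> dmor B (FX X) X 0" "i X \<in> dmor B X (Z X) 0" "j X \<in> dmor B (FX X) (Z X) (-1)"
    "ddif B (FX X) X 0 (f X) = (dzero B (FX X) X 1)" "ddif B X (Z X) 0 (i X) = (dzero B X (Z X) 1)"
    "ddif B (FX X) (Z X) (-1) (j X) = DCmp B (FX X) X (Z X) 0 0 (i X) (f X)"
  using cone[OF assms] c[OF assms] V(1) unfolding B.is_cone_iff cone_data_def by auto

text \<open>Composing a cocycle with \<open>\<kappa>\<close>, or with its image under
  \<open>F\<close>, bounds it.\<close>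

lemma Nul_exact:
  assumes W: "W \<in> DObj A" "X \<in> DObj B"
  shows "a \<in> dmor A W Nul n \<Longrightarrow> ddif A W Nul n a = (dzero A W Nul (n + 1)) \<Longrightarrow> \<exists>b\<in>dmor A W Nul (n - 1). a = ddif A W Nul (n - 1) b"
    and "b \<in> dmor B FN X n \<Longrightarrow> ddif B FN X n b = (dzero B FN X (n + 1)) \<Longrightarrow> \<exists>a\<in>dmor B FN X (n - 1). b = ddif B FN X (n - 1) a"
proof -
  show "\<exists>b\<in>dmor A W Nul (n - 1). a = ddif A W Nul (n - 1) b"
    if "a \<in> dmor A W Nul n" "ddif A W Nul n a = (dzero A W Nul (n + 1))"
    by (rule bexI[of _ "DCmp A W Nul Nul (-1) n \<kappa> a"]) (use W Nul that in \<open>simp_all add: dgs abgc\<close>)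
  have k: "dmap F Nul Nul 0 (ddif A Nul Nul (-1) \<kappa>) = DIdn B FN" using Nul by (simp add: dgs)
  show "\<exists>a\<in>dmor B FN X (n - 1). b = ddif B FN X (n - 1) a"
    if "b \<in> dmor B FN X n" "ddif B FN X n b = (dzero B FN X (n + 1))"
    by (rule bexI[of _ "koszul (dM B FN X (n - 1)) n (DCmp B FN FN X n (-1) b (dmap F Nul Nul (-1) \<kappa>))"])
      (cases "even n"; use W Nul(1,2) k that in \<open>simp_all add: dgs abgc algebra_simps\<close>)+
qed

abbreviation "idG \<equiv> \<lparr>dobj = (\<lambda>X. X), dmap = (\<lambda>X Y n f. f)\<rparr>"
abbreviation "G \<equiv> arrow_cat A B F"
abbreviation "GG \<equiv> arrow_cat G G idG"
abbreviation "g X \<equiv> (c X, X, f X)"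
abbreviation "g' X \<equiv> (Nul, Z X, (dzero B FN (Z X) 0))"
abbreviation "\<nu> X \<equiv> ((dzero A (c X) Nul 0), i X, \<ominus>\<^bsub>dM B (FX X) (Z X) (-1)\<^esub> j X)"
abbreviation "p X \<equiv> (g X, g' X, \<nu> X)"

sublocale G: dg_functor_between K G G idG
  by (intro dg_functor_between.intro arrow_dg_category dg_functor_between_axioms.intro dg_functor_idf)

lemma g_obj: "X \<in> DObj B \<Longrightarrow> g X \<in> DObj G" "X \<in> DObj B \<Longrightarrow> g' X \<in> DObj G"
  using Nul(1) by (simp_all add: dgs abgc)

text \<open>Closedness of \<open>\<nu> X\<close> in \<open>G\<close> asks its third component to
  bound \<open>0 - i f\<close>, the zero being the structure morphism of \<open>g' X\<close>. Since
  \<open>d j = i f\<close>, that component is \<open>- j\<close>.\<close>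

lemma p_obj: "X \<in> DObj B \<Longrightarrow> p X \<in> DObj GG"
  using g_obj[of X] Nul(1) unfolding G.arrow_obj by (simp, simp add: dgs abgc)

text \<open>A full subcategory of \<open>GG\<close>, reindexed by \<open>X\<close> itself.
  \<open>base\<close> is then the identity on objects, which gives the injectivity required for
  small models and the surjectivity required for reflecting pretriangulated structures.\<close>

definition cones :: "('p, ('m \<times> 'n \<times> 'n) \<times> ('m \<times> 'n \<times> 'n) \<times> ('m \<times> 'n \<times> 'n), 'k) dg_cat" where
  "cones = \<lparr>DObj = DObj B, DHom = (\<lambda>X Y. DHom GG (p X) (p Y)), DCmp = (\<lambda>X Y Z. DCmp GG (p X) (p Y) (p Z)), DIdn = (\<lambda>X. DIdn GG (p X))\<rparr>"

lemma cones_sel [simp]: "DObj cones = DObj B" "DHom cones X Y = DHom GG (p X) (p Y)" "DCmp cones X Y W = DCmp GG (p X) (p Y) (p W)"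
  "DIdn cones X = DIdn GG (p X)"
  by (simp_all add: cones_def)

definition cones_incl :: "('p, ('m \<times> 'n \<times> 'n) \<times> ('m \<times> 'n \<times> 'n) \<times> ('m \<times> 'n \<times> 'n), _, _) dg_func" where
  "cones_incl = \<lparr>dobj = p, dmap = (\<lambda>X Y n h. h)\<rparr>"

lemma cones_incl_dg_functor: "dg_functor_between K cones GG cones_incl"
proof -
  interpret GG: dg_category K GG by (rule G.arrow_dg_category)
  show ?thesis
    by (rule dg_category_pullback[OF G.arrow_dg_category])
      (simp_all add: cones_incl_def p_obj del: G.arrow_mor G.arrow_dif,
       simp_all add: p_obj GG.dmor_group GG.dmor_smult GG.ddif_simps GG.DCmp_simps GG.DIdn_mor abgc)
qed

definition base :: "('p, ('m \<times> 'n \<times> 'n) \<times> ('m \<times> 'n \<times> 'n) \<times> ('m \<times> 'n \<times> 'n), 'p, 'n) dg_func" where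
  "base = dg_comp arrow_tgt (dg_comp arrow_src cones_incl)"

definition apex :: "('p, ('m \<times> 'n \<times> 'n) \<times> ('m \<times> 'n \<times> 'n) \<times> ('m \<times> 'n \<times> 'n), 'p, 'n) dg_func" where
  "apex = dg_comp arrow_tgt (dg_comp arrow_tgt cones_incl)"

lemma base_dg_functor: "dg_functor_between K cones B base"
  unfolding base_def by (intro dg_functor_comp[OF _ arrow_tgt_dg_functor] dg_functor_comp[OF cones_incl_dg_functor G.arrow_src_dg_functor])

lemma apex_dg_functor: "dg_functor_between K cones B apex"
  unfolding apex_def by (intro dg_functor_comp[OF _ arrow_tgt_dg_functor] dg_functor_comp[OF cones_incl_dg_functor G.arrow_tgt_dg_functor])

lemma base_apex_sel [simp]:
  "dobj base X = X" "dmap base X Y n ((a, x, r), U', W) = x" "dobj apex X = Z X" "dmap apex X Y n (U, (b, z, r'), W) = z"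
  by (simp_all add: base_def apex_def dg_comp_def cones_incl_def arrow_src_def arrow_tgt_def)

text \<open>Up to contractible parts, a morphism from \<open>g X\<close> to \<open>g' Y\<close> is a
  morphism \<open>x\<close> from \<open>X\<close> to \<open>Z Y\<close> with a null-homotopy of
  \<open>x f\<close>. Such a pair extends over the cone \<open>Z X\<close> by
  \<open>contravariant_surj\<close>, in every degree.\<close>

lemma pull_surj:
  assumes X: "X \<in> DObj B" "Y \<in> DObj B"
  shows "cohom_surj (DHom G (g' X) (g' Y)) (DHom G (g X) (g' Y)) (\<lambda>n v. DCmp G (g X) (g' X) (g' Y) n 0 v (\<nu> X)) n"
  unfolding cohom_surj_def
proof
  fix y assume "y \<in> dcocyc G (g X) (g' Y) n"
  moreover obtain a x m where y: "y = (a, x, m)" by (cases y)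
  ultimately have d: "a \<in> dmor A (c X) Nul n" "x \<in> dmor B X (Z Y) n" "m \<in> dmor B (FX X) (Z Y) (n - 1)"
    and "ddif G (g X) (g' Y) n (a, x, m) = (dzero G (g X) (g' Y) (n + 1))"
    by (auto simp: cocycles_def arrow_mor)
  then have e: "ddif A (c X) Nul n a = (dzero A (c X) Nul (n + 1))" "ddif B X (Z Y) n x = (dzero B X (Z Y) (n + 1))"
    and r: "(DCmp B (FX X) FN (Z Y) 0 n (dzero B FN (Z Y) 0) (dmap F (c X) Nul n a)
            \<ominus>\<^bsub>dM B (FX X) (Z Y) n\<^esub> DCmp B (FX X) X (Z Y) n 0 x (f X))
            \<ominus>\<^bsub>dM B (FX X) (Z Y) n\<^esub> ddif B (FX X) (Z Y) (n - 1) m = (dzero B (FX X) (Z Y) n)"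
    unfolding arrow_dif arrow_zero by simp_all
  have dm: "ddif B (FX X) (Z Y) (n - 1) m = \<ominus>\<^bsub>dM B (FX X) (Z Y) n\<^esub> DCmp B (FX X) X (Z Y) n 0 x (f X)"
    using r d X Nul(1) by (simp add: dgs abgc abge)
  \<comment> \<open>The component into \<open>Nul\<close> is a boundary and is removed; what remains
    is \<open>x\<close> and the null-homotopy \<open>m\<close>.\<close>
  obtain a' where a': "a' \<in> dmor A (c X) Nul (n - 1)" "a = ddif A (c X) Nul (n - 1) a'"
    using Nul_exact(1)[OF cone_simps(1)[OF X(1)] X(1) d(1) e(1)] by blast
  interpret B: pretriangulated_dg K B by (rule B.pretriangulated_dg_axioms)
  obtain \<alpha> \<beta> \<gamma> a1 b1 c1 a0 b0 c0 where "cone_contraction K B (FX X) X (Z X) (f X) (i X) (j X) \<alpha> \<beta> \<gamma> a1 b1 c1 a0 b0 c0"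
    using B.is_cone_contraction[OF cone[OF X(1)]] by blast
  then interpret k: cone_contraction K B "FX X" X "Z X" "f X" "i X" "j X" \<alpha> \<beta> \<gamma> a1 b1 c1 a0 b0 c0 .
  \<comment> \<open>\<open>m\<close> bounds \<open>- x f\<close>, whereas
    \<open>contravariant_surj\<close> expects a cochain bounding \<open>(-1)^n x f\<close>.\<close>
  let ?w = "\<ominus>\<^bsub>dM B (FX X) (Z Y) (n - 1)\<^esub> koszul (dM B (FX X) (Z Y) (n - 1)) n m"
  have w: "?w \<in> dmor B (FX X) (Z Y) (n - 1)" "ddif B (FX X) (Z Y) (n - 1) ?w = koszul (dM B (FX X) (Z Y) n) n (DCmp B (FX X) X (Z Y) n 0 x (f X))"
    by (cases "even n"; use d dm X in \<open>simp_all add: dgs abgc\<close>)+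
  obtain z v' w' where z: "z \<in> dmor B (Z X) (Z Y) n" "v' \<in> dmor B X (Z Y) (n - 1)" "w' \<in> dmor B (FX X) (Z Y) (n - 2)"
    "ddif B (Z X) (Z Y) n z = (dzero B (Z X) (Z Y) (n + 1))"
    "DCmp B X (Z X) (Z Y) n 0 z (i X) = x \<oplus>\<^bsub>dM B X (Z Y) n\<^esub> ddif B X (Z Y) (n - 1) v'"
    "DCmp B (FX X) (Z X) (Z Y) n (-1) z (j X) = ?w \<oplus>\<^bsub>dM B (FX X) (Z Y) (n - 1)\<^esub>
      (koszul (dM B (FX X) (Z Y) (n - 1)) n (DCmp B (FX X) X (Z Y) (n - 1) 0 v' (f X))
        \<oplus>\<^bsub>dM B (FX X) (Z Y) (n - 1)\<^esub> ddif B (FX X) (Z Y) (n - 2) w')"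
    using k.contravariant_surj[OF cone_simps(2)[OF X(2)] d(2) w(1) e(2) w(2)] by blast
  let ?z = "((dzero A Nul Nul n), z, (dzero B FN (Z Y) (n - 1)))"
  let ?t = "(\<ominus>\<^bsub>dM A (c X) Nul (n - 1)\<^esub> a', v', koszul (dM B (FX X) (Z Y) (n - 2)) n w')"
  show "\<exists>z\<in>dcocyc G (g' X) (g' Y) n. \<exists>t\<in>dmor G (g X) (g' Y) (n - 1).
      DCmp G (g X) (g' X) (g' Y) n 0 z (\<nu> X) = y \<oplus>\<^bsub>dM G (g X) (g' Y) n\<^esub> ddif G (g X) (g' Y) (n - 1) t"
  proof (intro bexI)
    show "?z \<in> dcocyc G (g' X) (g' Y) n" using z X Nul(1) by (simp add: cocycles_def arrow_mor arrow_dif arrow_zero dgs abgc)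
    show "?t \<in> dmor G (g X) (g' Y) (n - 1)" using z a' X Nul(1) by (cases "even n") (simp_all add: arrow_mor dgs abgc)
    show "DCmp G (g X) (g' X) (g' Y) n 0 ?z (\<nu> X) = y \<oplus>\<^bsub>dM G (g X) (g' Y) n\<^esub> ddif G (g X) (g' Y) (n - 1) ?t"
      unfolding y arrow_cmp arrow_dif arrow_add prod.inject
    proof (intro conjI)
      show "DCmp A (c X) Nul Nul n 0 (dzero A Nul Nul n) (dzero A (c X) Nul 0) =
        a \<oplus>\<^bsub>dM A (c X) Nul n\<^esub> ddif A (c X) Nul (n - 1) (\<ominus>\<^bsub>dM A (c X) Nul (n - 1)\<^esub> a')"
        unfolding a'(2) by (rule abeqI) (use a'(1) X Nul(1) in \<open>simp add: dgs abg\<close>)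
      show "DCmp B X (Z X) (Z Y) n 0 z (i X) = x \<oplus>\<^bsub>dM B X (Z Y) n\<^esub> ddif B X (Z Y) (n - 1) v'" by (rule z)
    qed (cases "even n"; rule abeqI; use z(1-3,6) d a'(1) X Nul(1) in \<open>simp add: dgs abg algebra_simps\<close>)
  qed
qed

text \<open>\<open>contravariant_inj\<close> bounds the component \<open>z\<close> on the cone; the
  two components that involve \<open>Nul\<close> are bounded through its contraction.\<close>

lemma pull_inj:
  assumes X: "X \<in> DObj B" "Y \<in> DObj B"
  shows "cohom_inj (DHom G (g' X) (g' Y)) (DHom G (g X) (g' Y)) (\<lambda>n v. DCmp G (g X) (g' X) (g' Y) n 0 v (\<nu> X)) n"
  unfolding cohom_inj_def
proof (intro ballI impI)
  fix y t assume y: "y \<in> dcocyc G (g' X) (g' Y) n" and t: "t \<in> dmor G (g X) (g' Y) (n - 1)"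
    and eq: "DCmp G (g X) (g' X) (g' Y) n 0 y (\<nu> X) = ddif G (g X) (g' Y) (n - 1) t"
  obtain b z r where [simp]: "y = (b, z, r)" by (cases y)
  obtain a v m where [simp]: "t = (a, v, m)" by (cases t)
  have d: "b \<in> dmor A Nul Nul n" "z \<in> dmor B (Z X) (Z Y) n" "r \<in> dmor B FN (Z Y) (n - 1)"
    "a \<in> dmor A (c X) Nul (n - 1)" "v \<in> dmor B X (Z Y) (n - 1)" "m \<in> dmor B (FX X) (Z Y) (n - 2)"
    and "ddif G (g' X) (g' Y) n (b, z, r) = (dzero G (g' X) (g' Y) (n + 1))"
    using y t by (auto simp: cocycles_def arrow_mor)
  then have e: "ddif A Nul Nul n b = (dzero A Nul Nul (n + 1))" "ddif B (Z X) (Z Y) n z = (dzero B (Z X) (Z Y) (n + 1))"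
    and r: "(DCmp B FN FN (Z Y) 0 n (dzero B FN (Z Y) 0) (dmap F Nul Nul n b)
            \<ominus>\<^bsub>dM B FN (Z Y) n\<^esub> DCmp B FN (Z X) (Z Y) n 0 z (dzero B FN (Z X) 0))
            \<ominus>\<^bsub>dM B FN (Z Y) n\<^esub> ddif B FN (Z Y) (n - 1) r = (dzero B FN (Z Y) n)"
    unfolding arrow_dif arrow_zero by simp_all
  have dr: "ddif B FN (Z Y) (n - 1) r = (dzero B FN (Z Y) (n - 1 + 1))"
  proof -
    have "\<ominus>\<^bsub>dM B FN (Z Y) n\<^esub> ddif B FN (Z Y) (n - 1) r = (dzero B FN (Z Y) n)"
      using r d X Nul(1) by (simp add: dgs abgc abge)
    then have "\<ominus>\<^bsub>dM B FN (Z Y) n\<^esub> (\<ominus>\<^bsub>dM B FN (Z Y) n\<^esub> ddif B FN (Z Y) (n - 1) r)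
       = \<ominus>\<^bsub>dM B FN (Z Y) n\<^esub> (dzero B FN (Z Y) n)" by simp
    then show ?thesis using d X Nul(1) by (simp add: dgs abgc)
  qed
  obtain b' where b': "b' \<in> dmor A Nul Nul (n - 1)" "b = ddif A Nul Nul (n - 1) b'"
    using Nul_exact(1)[OF Nul(1) X(1) d(1) e(1)] by blast
  obtain r' where r': "r' \<in> dmor B FN (Z Y) (n - 1 - 1)" "r = ddif B FN (Z Y) (n - 1 - 1) r'"
    using Nul_exact(2)[OF Nul(1) cone_simps(2)[OF X(2)] d(3) dr] by blast
  have i: "DCmp B X (Z X) (Z Y) n 0 z (i X) = ddif B X (Z Y) (n - 1) v"
    and j0: "koszul (dM B (FX X) (Z Y) (n + 0 - 1)) n (DCmp B (FX X) (Z X) (Z Y) n (0 - 1) z (\<ominus>\<^bsub>dM B (FX X) (Z X) (-1)\<^esub> j X))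
          \<oplus>\<^bsub>dM B (FX X) (Z Y) (n + 0 - 1)\<^esub>
          DCmp B (FX X) FN (Z Y) (n - 1) 0 r (dmap F (c X) Nul 0 (dzero A (c X) Nul 0))
       = (DCmp B (FX X) FN (Z Y) 0 (n - 1) (dzero B FN (Z Y) 0) (dmap F (c X) Nul (n - 1) a)
            \<ominus>\<^bsub>dM B (FX X) (Z Y) (n - 1)\<^esub> DCmp B (FX X) X (Z Y) (n - 1) 0 v (f X))
            \<ominus>\<^bsub>dM B (FX X) (Z Y) (n - 1)\<^esub> ddif B (FX X) (Z Y) (n - 1 - 1) m"
    using eq by (simp_all only: \<open>y = (b, z, r)\<close> \<open>t = (a, v, m)\<close> arrow_cmp arrow_dif prod.inject)
  let ?M = "dM B (FX X) (Z Y) (n - 1)"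
  let ?j = "DCmp B (FX X) (Z X) (Z Y) n (-1) z (j X)" and ?vf = "DCmp B (FX X) X (Z Y) (n - 1) 0 v (f X)"
    and ?dm = "ddif B (FX X) (Z Y) (n - 2) m"
  have cl: "?j \<in> carrier ?M" "?vf \<in> carrier ?M" "?dm \<in> carrier ?M" "abelian_group ?M" using d X Nul(1) by (simp_all add: dgs)
  have "koszul ?M n (\<ominus>\<^bsub>?M\<^esub> ?j) = \<ominus>\<^bsub>?M\<^esub> ?vf \<ominus>\<^bsub>?M\<^esub> ?dm"
    using j0 d X Nul(1) by (simp add: dgs abgc)
  then have j: "?j = koszul ?M n ?vf \<oplus>\<^bsub>?M\<^esub> koszul ?M n ?dm"
  proof (cases "even n")
    case True
    then have "\<ominus>\<^bsub>?M\<^esub> (\<ominus>\<^bsub>?M\<^esub> ?j) = \<ominus>\<^bsub>?M\<^esub> (\<ominus>\<^bsub>?M\<^esub> ?vf \<ominus>\<^bsub>?M\<^esub> ?dm)"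
      using \<open>koszul ?M n (\<ominus>\<^bsub>?M\<^esub> ?j) = _\<close> by (simp add: koszul_def)
    also have "\<dots> = ?vf \<oplus>\<^bsub>?M\<^esub> ?dm" by (rule abeqI) (use cl in \<open>simp add: abg\<close>)
    finally show ?thesis using True cl by (simp add: koszul_def abgc)
  next
    case False
    then have "?j = \<ominus>\<^bsub>?M\<^esub> ?vf \<ominus>\<^bsub>?M\<^esub> ?dm"
      using \<open>koszul ?M n (\<ominus>\<^bsub>?M\<^esub> ?j) = _\<close> cl by (simp add: koszul_def abgc)
    also have "\<dots> = \<ominus>\<^bsub>?M\<^esub> ?vf \<oplus>\<^bsub>?M\<^esub> \<ominus>\<^bsub>?M\<^esub> ?dm" by (rule abeqI) (use cl in \<open>simp add: abg\<close>)
    finally show ?thesis using False by (simp add: koszul_def)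
  qed
  obtain \<alpha> \<beta> \<gamma> a1 b1 c1 a0 b0 c0 where "cone_contraction K B (FX X) X (Z X) (f X) (i X) (j X) \<alpha> \<beta> \<gamma> a1 b1 c1 a0 b0 c0"
    using B.is_cone_contraction[OF cone[OF X(1)]] by blast
  then interpret k: cone_contraction K B "FX X" X "Z X" "f X" "i X" "j X" \<alpha> \<beta> \<gamma> a1 b1 c1 a0 b0 c0 .
  have "koszul (dM B (FX X) (Z Y) (n - 2)) n m \<in> dmor B (FX X) (Z Y) (n - 2)"
    "ddif B (FX X) (Z Y) (n - 2) (koszul (dM B (FX X) (Z Y) (n - 2)) n m) = koszul ?M n ?dm"
    by (cases "even n"; use d X in \<open>simp_all add: dgs abgc\<close>)+
  then obtain y' where y': "y' \<in> dmor B (Z X) (Z Y) (n - 1)" "z = ddif B (Z X) (Z Y) (n - 1) y'"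
    using k.contravariant_inj[OF cone_simps(2)[OF X(2)] d(2,5) _ e(2) i] j by metis
  show "\<exists>y'\<in>dmor G (g' X) (g' Y) (n - 1). y = ddif G (g' X) (g' Y) (n - 1) y'"
  proof (rule bexI[of _ "(b', y', \<ominus>\<^bsub>dM B FN (Z Y) (n - 1 - 1)\<^esub> r')"])
    show "(b', y', \<ominus>\<^bsub>dM B FN (Z Y) (n - 1 - 1)\<^esub> r') \<in> dmor G (g' X) (g' Y) (n - 1)"
      using b' y' r' X Nul(1) by (simp add: arrow_mor dgs abgc)
    show "y = ddif G (g' X) (g' Y) (n - 1) (b', y', \<ominus>\<^bsub>dM B FN (Z Y) (n - 1 - 1)\<^esub> r')"
      using b'(1) y'(1) r'(1) X Nul(1) by (simp add: arrow_dif b'(2) y'(2) r'(2) dgs abgc)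
  qed
qed

text \<open>\<open>base\<close> is the composite of two projections. The one that forgets the cone
  is bijective in all degrees by \<open>pull_surj\<close> and \<open>pull_inj\<close>; the one that
  forgets the lift is so in degree \<open>n\<close> once \<open>?post\<close> is in the degrees
  \<open>n\<close> and \<open>n - 1\<close>. For \<open>n = 0\<close> both are nonpositive.\<close>

lemma base_quasi:
  assumes X: "X \<in> DObj B" "Y \<in> DObj B" and n: "n = 0 \<or> V = DObj A"
  shows "cohom_surj (DHom cones X Y) (DHom B X Y) (dmap base X Y) n" "cohom_inj (DHom cones X Y) (DHom B X Y) (dmap base X Y) n"
proof -
  interpret src: dg_functor_between K GG G arrow_src by (rule G.arrow_src_dg_functor)
  interpret tgt: dg_functor_between K G B arrow_tgt by (rule arrow_tgt_dg_functor)
  have cX: "c X \<in> V" using c X by simp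
  let ?post = "\<lambda>n a. DCmp B (FX X) (FX Y) Y 0 n (f Y) (dmap F (c X) (c Y) n a)"
  note cY = cone_simps(1)[OF X(2)] X(2) cone_simps(3,6)[OF X(2)]
  have np: "cohom_surj (DHom A (c X) (c Y)) (DHom B (FX X) Y) ?post (- int m) \<and>
     cohom_inj (DHom A (c X) (c Y)) (DHom B (FX X) Y) ?post (- int m)" for m
    using post_nonpositive[OF cY V A.pretriangulated_dg_axioms bij[OF _ X(2)] cX] .
  have nn: "cohom_surj (DHom A (c X) (c Y)) (DHom B (FX X) Y) ?post (int m) \<and>
     cohom_inj (DHom A (c X) (c Y)) (DHom B (FX X) Y) ?post (int m)" if "V = DObj A" for m
    using post_nonnegative[OF cY A.pretriangulated_dg_axioms bij[OF _ X(2)]] that cX by simp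
  have all: "cohom_surj (DHom A (c X) (c Y)) (DHom B (FX X) Y) ?post m \<and>
     cohom_inj (DHom A (c X) (c Y)) (DHom B (FX X) Y) ?post m" if "m \<le> 0 \<or> V = DObj A" for m
  proof (cases "m \<le> 0")
    case True
    then show ?thesis using np[of "nat (- m)"] by simp
  next
    case False
    then show ?thesis using nn[of "nat m"] that by simp
  qed
  have t: "cohom_surj (DHom G (g X) (g Y)) (DHom B X Y) (dmap arrow_tgt (g X) (g Y)) n" "cohom_inj (DHom G (g X) (g Y)) (DHom B X Y) (dmap arrow_tgt (g X) (g Y)) n"
    using arrow_tgt_surj[OF g_obj(1)[OF X(1)] g_obj(1)[OF X(2)]] arrow_tgt_inj[OF g_obj(1)[OF X(1)] g_obj(1)[OF X(2)]] all[of n] all[of "n - 1"] n by auto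
  have s: "cohom_surj (DHom GG (p X) (p Y)) (DHom G (g X) (g Y)) (dmap arrow_src (p X) (p Y)) n" "cohom_inj (DHom GG (p X) (p Y)) (DHom G (g X) (g Y)) (dmap arrow_src (p X) (p Y)) n"
    using G.arrow_src_surj[OF p_obj[OF X(1)] p_obj[OF X(2)]] G.arrow_src_inj[OF p_obj[OF X(1)] p_obj[OF X(2)]] pull_surj[OF X] pull_inj[OF X] by simp_all
  have sel: "dobj arrow_src (p U) = g U" "dobj arrow_tgt (g U) = U" for U by (simp_all add: arrow_src_def arrow_tgt_def)
  have b: "dmap base X Y = (\<lambda>n x. dmap arrow_tgt (g X) (g Y) n (dmap arrow_src (p X) (p Y) n x))"
    by (intro ext) (simp add: base_def dg_comp_def cones_incl_def sel)
  show "cohom_surj (DHom cones X Y) (DHom B X Y) (dmap base X Y) n" "cohom_inj (DHom cones X Y) (DHom B X Y) (dmap base X Y) n"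
    unfolding b cones_sel
    using cohom_comp[OF tgt.dmap_complex_map[OF g_obj(1)[OF X(1)] g_obj(1)[OF X(2)], unfolded sel]] s t
      src.dmap_complex_map[OF p_obj[OF X(1)] p_obj[OF X(2)], unfolded sel] by auto
qed

text \<open>Of the nine components of \<open>h\<close>, the components \<open>b\<close>,
  \<open>r'\<close>, \<open>w\<close> belong to \<open>Nul\<close> and disappear from the equations.
  The rest is a morphism of cones in the sense of \<open>connecting_natural\<close>:
  \<open>a\<close>, \<open>x\<close>, \<open>z\<close> on the three vertices, \<open>r\<close> and
  \<open>q\<close> for the two squares, \<open>m\<close> for their compatibility.\<close>

lemma cones_morphism:
  assumes X: "X \<in> DObj B" "Y \<in> DObj B" and h: "h \<in> dcocyc cones X Y 0"
    and hX: "B.connecting (FX X) X (Z X) (f X) (i X) (j X) hX" and hY: "B.connecting (FX Y) Y (Z Y) (f Y) (i Y) (j Y) hY"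
  obtains a where "a \<in> dcocyc A (c X) (c Y) 0"
    "dcls B (FX X) Y (DCmp B (FX X) (FX Y) Y 0 0 (f Y) (dmap F (c X) (c Y) 0 a))
      = dcls B (FX X) Y (DCmp B (FX X) X Y 0 0 (dmap base X Y 0 h) (f X))"
    "dcls B X (Z Y) (DCmp B X (Z X) (Z Y) 0 0 (dmap apex X Y 0 h) (i X)) = dcls B X (Z Y) (DCmp B X Y (Z Y) 0 0 (i Y) (dmap base X Y 0 h))"
    "dcls B (Z X) (sus_obj B (FX Y)) (DCmp B (Z X) (Z Y) (sus_obj B (FX Y)) 0 0 hY (dmap apex X Y 0 h))
      = dcls B (Z X) (sus_obj B (FX Y)) (DCmp B (Z X) (sus_obj B (FX X)) (sus_obj B (FX Y)) 0 0
          (B.sus_mor (FX X) (FX Y) (dmap F (c X) (c Y) 0 a)) hX)"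
proof -
  obtain a x r b z r' w q m where hh: "h = ((a, x, r), (b, z, r'), (w, q, m))" by (metis prod_cases3)
  have "h \<in> dmor GG (p X) (p Y) 0" "ddif GG (p X) (p Y) 0 h = (dzero GG (p X) (p Y) 1)"
    using h by (simp_all add: cocycles_def)
  then have mm: "(a, x, r) \<in> dmor G (g X) (g Y) 0" "(b, z, r') \<in> dmor G (g' X) (g' Y) 0" "(w, q, m) \<in> dmor G (g X) (g' Y) (0 - 1)"
    and dd: "ddif G (g X) (g Y) 0 (a, x, r) = (dzero G (g X) (g Y) 1)" "ddif G (g' X) (g' Y) 0 (b, z, r') = (dzero G (g' X) (g' Y) 1)"
      "(DCmp G (g X) (g Y) (g' Y) 0 0 (\<nu> Y) (a, x, r) \<ominus>\<^bsub>dM G (g X) (g' Y) 0\<^esub> DCmp G (g X) (g' X) (g' Y) 0 0 (b, z, r') (\<nu> X))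
        \<ominus>\<^bsub>dM G (g X) (g' Y) 0\<^esub> ddif G (g X) (g' Y) (0 - 1) (w, q, m) = (dzero G (g X) (g' Y) 0)"
    unfolding hh G.arrow_mor G.arrow_dif G.arrow_zero prod.inject by auto
  have m: "a \<in> dmor A (c X) (c Y) 0" "x \<in> dmor B X Y 0" "r \<in> dmor B (FX X) Y (-1)" "b \<in> dmor A Nul Nul 0"
    "z \<in> dmor B (Z X) (Z Y) 0" "r' \<in> dmor B FN (Z Y) (-1)" "w \<in> dmor A (c X) Nul (-1)" "q \<in> dmor B X (Z Y) (-1)" "m \<in> dmor B (FX X) (Z Y) (-2)"
    using mm unfolding arrow_mor by auto
  have d: "ddif A (c X) (c Y) 0 a = (dzero A (c X) (c Y) 1)" "ddif B X Y 0 x = (dzero B X Y 1)"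
    "ddif B (Z X) (Z Y) 0 z = (dzero B (Z X) (Z Y) 1)"
    and dr: "(DCmp B (FX X) (FX Y) Y 0 0 (f Y) (dmap F (c X) (c Y) 0 a) \<ominus>\<^bsub>dM B (FX X) Y 0\<^esub> DCmp B (FX X) X Y 0 0 x (f X))
       \<ominus>\<^bsub>dM B (FX X) Y 0\<^esub> ddif B (FX X) Y (-1) r = (dzero B (FX X) Y 0)"
    using dd(1,2) unfolding arrow_dif arrow_zero prod.inject by auto
  let ?FX = "FX X" and ?FY = "FX Y"
  have o: "?FX \<in> DObj B" "?FY \<in> DObj B" using X by (simp_all add: dgs)
  have dr': "ddif B ?FX Y (-1) r = DCmp B ?FX ?FY Y 0 0 (f Y) (dmap F (c X) (c Y) 0 a) \<ominus>\<^bsub>dM B ?FX Y 0\<^esub> DCmp B ?FX X Y 0 0 x (f X)"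
    using dr m X by (simp add: dgs abgc abge)
  note dd3 = dd(3)[unfolded arrow_cmp arrow_dif]
  have cl: "DCmp A (c X) (c Y) Nul 0 0 (dzero A (c Y) Nul 0) a = (dzero A (c X) Nul 0)"
    "DCmp A (c X) Nul Nul 0 0 b (dzero A (c X) Nul 0) = (dzero A (c X) Nul 0)"
    using m X Nul(1) by (simp_all add: dgs)
  have sub: "(u1, v1, w1) \<ominus>\<^bsub>dM G (g X) (g' Y) 0\<^esub> (u2, v2, w2) = (u1 \<ominus>\<^bsub>dM A (c X) Nul 0\<^esub> u2, v1 \<ominus>\<^bsub>dM B X (Z Y) 0\<^esub> v2, w1 \<ominus>\<^bsub>dM B ?FX (Z Y) (-1)\<^esub> w2)"
    if "u2 \<in> dmor A (c X) Nul 0" "v2 \<in> dmor B X (Z Y) 0" "w2 \<in> dmor B ?FX (Z Y) (-1)" for u1 v1 w1 u2 v2 w2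
    using arrow_minus[OF g_obj(1)[OF X(1)] g_obj(2)[OF X(2)]] that by (simp add: a_minus_def arrow_add)
  have e: "DCmp B X Y (Z Y) 0 0 (i Y) x \<ominus>\<^bsub>dM B X (Z Y) 0\<^esub> DCmp B X (Z X) (Z Y) 0 0 z (i X) \<ominus>\<^bsub>dM B X (Z Y) 0\<^esub> ddif B X (Z Y) (-1) q = (dzero B X (Z Y) 0)"
    "((DCmp B ?FX Y (Z Y) 0 (-1) (i Y) r \<ominus>\<^bsub>dM B ?FX (Z Y) (-1)\<^esub> DCmp B ?FX ?FY (Z Y) (-1) 0 (j Y) (dmap F (c X) (c Y) 0 a))
      \<oplus>\<^bsub>dM B ?FX (Z Y) (-1)\<^esub> DCmp B ?FX (Z X) (Z Y) 0 (-1) z (j X))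
      \<ominus>\<^bsub>dM B ?FX (Z Y) (-1)\<^esub> (\<ominus>\<^bsub>dM B ?FX (Z Y) (-1)\<^esub> DCmp B ?FX X (Z Y) (-1) 0 q (f X) \<ominus>\<^bsub>dM B ?FX (Z Y) (-1)\<^esub> ddif B ?FX (Z Y) (-2) m)
      = (dzero B ?FX (Z Y) (-1))"
    using dd3 m d X Nul(1) by (simp_all add: sub arrow_zero dgs abgc) (simp_all add: abg dgs)
  have dq: "ddif B X (Z Y) (-1) q = DCmp B X Y (Z Y) 0 0 (i Y) x \<ominus>\<^bsub>dM B X (Z Y) 0\<^esub> DCmp B X (Z X) (Z Y) 0 0 z (i X)"
    using e(1) m X by (simp add: dgs abgc abge)
  have dm: "ddif B ?FX (Z Y) (-2) m = DCmp B ?FX ?FY (Z Y) (-1) 0 (j Y) (dmap F (c X) (c Y) 0 a) \<ominus>\<^bsub>dM B ?FX (Z Y) (-1)\<^esub>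
        (DCmp B ?FX X (Z Y) (-1) 0 q (f X) \<oplus>\<^bsub>dM B ?FX (Z Y) (-1)\<^esub> (DCmp B ?FX Y (Z Y) 0 (-1) (i Y) r
          \<oplus>\<^bsub>dM B ?FX (Z Y) (-1)\<^esub> DCmp B ?FX (Z X) (Z Y) 0 (-1) z (j X)))" (is "?dm = ?R")
  proof -
    let ?M = "dM B ?FX (Z Y) (-1)"
    have "?dm = ?R \<oplus>\<^bsub>?M\<^esub> (((DCmp B ?FX Y (Z Y) 0 (-1) (i Y) r \<ominus>\<^bsub>dM B ?FX (Z Y) (-1)\<^esub> DCmp B ?FX ?FY (Z Y) (-1) 0 (j Y) (dmap F (c X) (c Y) 0 a))
      \<oplus>\<^bsub>dM B ?FX (Z Y) (-1)\<^esub> DCmp B ?FX (Z X) (Z Y) 0 (-1) z (j X))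
      \<ominus>\<^bsub>dM B ?FX (Z Y) (-1)\<^esub> (\<ominus>\<^bsub>dM B ?FX (Z Y) (-1)\<^esub> DCmp B ?FX X (Z Y) (-1) 0 q (f X) \<ominus>\<^bsub>dM B ?FX (Z Y) (-1)\<^esub> ddif B ?FX (Z Y) (-2) m))"
      by (rule abeqI) (use m X Nul(1) in \<open>simp add: dgs abg\<close>)
    then show ?thesis unfolding e(2) using m X by (simp add: dgs abgc)
  qed
  show thesis
  proof (rule that)
    show a: "a \<in> dcocyc A (c X) (c Y) 0" using m d by (simp add: cocycles_def)
    show "dcls B ?FX Y (DCmp B ?FX ?FY Y 0 0 (f Y) (dmap F (c X) (c Y) 0 a)) = dcls B ?FX Y (DCmp B ?FX X Y 0 0 (dmap base X Y 0 h) (f X))"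
      unfolding hh base_apex_sel
    proof (rule B.dcls_eqI[of _ _ _ r])
      show "DCmp B ?FX ?FY Y 0 0 (f Y) (dmap F (c X) (c Y) 0 a) = DCmp B ?FX X Y 0 0 x (f X) \<oplus>\<^bsub>dM B ?FX Y 0\<^esub> ddif B ?FX Y (-1) r"
        unfolding dr' by (rule abeqI) (use m X in \<open>simp add: dgs abg\<close>)
    qed (use m X in \<open>simp_all add: dgs\<close>)
    show "dcls B X (Z Y) (DCmp B X (Z X) (Z Y) 0 0 (dmap apex X Y 0 h) (i X)) = dcls B X (Z Y) (DCmp B X Y (Z Y) 0 0 (i Y) (dmap base X Y 0 h))"
      unfolding hh base_apex_sel
    proof (rule B.dcls_eqI[of _ _ _ q, symmetric])
      show "DCmp B X Y (Z Y) 0 0 (i Y) x = DCmp B X (Z X) (Z Y) 0 0 z (i X) \<oplus>\<^bsub>dM B X (Z Y) 0\<^esub> ddif B X (Z Y) (-1) q"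
        unfolding dq by (rule abeqI) (use m X in \<open>simp add: dgs abg\<close>)
    qed (use m X in \<open>simp_all add: dgs\<close>)
    show "dcls B (Z X) (sus_obj B ?FY) (DCmp B (Z X) (Z Y) (sus_obj B ?FY) 0 0 hY (dmap apex X Y 0 h))
      = dcls B (Z X) (sus_obj B ?FY) (DCmp B (Z X) (sus_obj B ?FX) (sus_obj B ?FY) 0 0 (B.sus_mor ?FX ?FY (dmap F (c X) (c Y) 0 a)) hX)"
      unfolding hh base_apex_sel
      by (rule B.connecting_natural[OF cone[OF X(1)] hX cone[OF X(2)] hY _ _ _ _ _ _ dr' dq dm])
        (use m d X in \<open>simp_all add: cocycles_def dgs\<close>)
  qed
qed

end

section \<open>Descent of functorial triangles\<close>

text \<open>The first two functors already live on \<open>T\<close>; only the third is transported.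
  Conjugating \<open>\<beta>\<close> and \<open>\<gamma>\<close> with \<open>cmp\<close> makes each
  new triangle isomorphic to the given one at the chosen preimage, with the identity on its third
  vertex.\<close>

lemma functorial_triangle_descent:
  fixes T :: "('p, 'n, 'k, 'z) tri_cat_scheme"
  assumes "linear_equivalence K C T E" and "triangulated_category K T"
    and F: "linear_functor K C T F" and G: "is_functor T T G" and e: "nat_trans T T G idf e"
    and \<beta>: "nat_trans C T E F \<beta>" and \<gamma>: "nat_trans C T F (func_comp (Sus T) (func_comp G E)) \<gamma>"
    and tri: "\<And>X. X \<in> Obj C \<Longrightarrow> (fobj G (fobj E X), fobj E X, fobj F X, e (fobj E X), \<beta> X, \<gamma> X) \<in> Tri T"
    and t: "fobj t = fobj (func_comp F (linear_equivalence.quasi_inverse C T E))" "fmap t = fmap (func_comp F (linear_equivalence.quasi_inverse C T E))"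
  shows "\<exists>\<beta>' \<gamma>'. functorial_triangle T T G idf t e \<beta>' \<gamma>'"
proof -
  interpret E: linear_equivalence K C T E by fact
  interpret T: triangulated_category K T by fact
  interpret TS: linear_functor_between K T T "Sus T" by (rule T.Sus_between)
  interpret F: linear_functor_between K C T F by (rule linear_functor_betweenI[OF E.C.linear_category_axioms E.D.linear_category_axioms F])
  interpret G: functor_between K T T G by (rule functor_betweenI[OF E.D.linear_category_axioms E.D.linear_category_axioms G])
  let ?p = "E.pre" and ?E = "\<lambda>Y. fobj E (E.pre Y)"
  have to: "fobj t Y = fobj F (?p Y)" for Y by (simp add: t E.quasi_inverse_obj)
  define y' where "y' Y Z y = fmap E.quasi_inverse Y Z y" for Y Z y
  have tm: "fmap t Y Z y = fmap F (?p Y) (?p Z) (y' Y Z y)" for Y Z y by (simp add: t E.quasi_inverse_obj y'_def)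
  have y'm: "y' Y Z y \<in> mor C (?p Y) (?p Z)" "fmap E (?p Y) (?p Z) (y' Y Z y) = Cmp T (?E Y) Z (?E Z) (E.cmp' Z) (Cmp T (?E Y) Y Z y (E.cmp Y))"
    if "Y \<in> Obj T" "Z \<in> Obj T" "y \<in> mor T Y Z" for Y Z y
    using E.quasi_inverse_map[OF that] by (simp_all add: y'_def)
  have o: "?p Y \<in> Obj C" "?E Y \<in> Obj T" "fobj F (?p Y) \<in> Obj T" "fobj G Y \<in> Obj T" "fobj G (?E Y) \<in> Obj T"
    "sob T (fobj G Y) \<in> Obj T" "sob T (fobj G (?E Y)) \<in> Obj T" if "Y \<in> Obj T" for Y
    using that by (simp_all add: cats)
  have m: "\<beta> (?p Y) \<in> mor T (?E Y) (fobj F (?p Y))" "\<gamma> (?p Y) \<in> mor T (fobj F (?p Y)) (sob T (fobj G (?E Y)))" "e Y \<in> mor T (fobj G Y) Y" "e (?E Y) \<in> mor T (fobj G (?E Y)) (?E Y)"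
    "smap T (fobj G (?E Y)) (fobj G Y) (fmap G (?E Y) Y (E.cmp Y)) \<in> mor T (sob T (fobj G (?E Y))) (sob T (fobj G Y))"
    if "Y \<in> Obj T" for Y
    using nat_transD(1)[OF \<beta> o(1)[OF that]] nat_transD(1)[OF \<gamma> o(1)[OF that]] nat_transD(1)[OF e] that by (simp_all add: cats)
  define \<beta>' where "\<beta>' Y = Cmp T Y (?E Y) (fobj F (?p Y)) (\<beta> (?p Y)) (E.cmp' Y)" for Y
  define \<gamma>' where "\<gamma>' Y = Cmp T (fobj F (?p Y)) (sob T (fobj G (?E Y))) (sob T (fobj G Y)) (smap T (fobj G (?E Y)) (fobj G Y) (fmap G (?E Y) Y (E.cmp Y))) (\<gamma> (?p Y))" for Y
  have cc: "Cmp T (?E Y) Y (?E Y) (E.cmp' Y) (E.cmp Y) = Idn T (?E Y)" "Cmp T Y (?E Y) Y (E.cmp Y) (E.cmp' Y) = Idn T Y" if "Y \<in> Obj T" for Y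
    using inv_mor[OF conjunct2[OF E.pre_cmp[OF that]]] by auto
  have "nat_trans T T idf t \<beta>'"
    unfolding nat_trans_def
  proof (intro conjI ballI)
    fix Y assume Y: "Y \<in> Obj T"
    then show "\<beta>' Y \<in> mor T (fobj idf Y) (fobj t Y)" using o[OF Y] m[OF Y] by (simp add: \<beta>'_def to cats)
    fix W y assume W: "W \<in> Obj T" and y: "y \<in> mor T Y W"
    note oo = o[OF Y] o[OF W] Y W and mm = m[OF Y] m[OF W] y E.cmp_simps[OF Y] E.cmp_simps[OF W] y'm(1)[OF Y W y]
    have "Cmp T Y (fobj F (?p Y)) (fobj F (?p W)) (fmap F (?p Y) (?p W) (y' Y W y)) (\<beta>' Y)
      = Cmp T Y (?E Y) (fobj F (?p W)) (Cmp T (?E Y) (fobj F (?p Y)) (fobj F (?p W)) (fmap F (?p Y) (?p W) (y' Y W y)) (\<beta> (?p Y))) (E.cmp' Y)"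
      unfolding \<beta>'_def using oo mm by (simp add: cats)
    also have "\<dots> = Cmp T Y (?E Y) (fobj F (?p W)) (Cmp T (?E Y) (?E W) (fobj F (?p W)) (\<beta> (?p W)) (fmap E (?p Y) (?p W) (y' Y W y))) (E.cmp' Y)"
      using nat_transD(2)[OF \<beta> o(1)[OF Y] o(1)[OF W] y'm(1)[OF Y W y]] by simp
    also have "\<dots> = Cmp T Y W (fobj F (?p W)) (\<beta>' W) y"
      unfolding y'm(2)[OF Y W y] \<beta>'_def using oo mm E.D.Cmp_prefix[OF cc(2)[OF Y]] by (simp add: cats)
    finally show "Cmp T (fobj idf Y) (fobj idf W) (fobj t W) (\<beta>' W) (fmap idf Y W y) = Cmp T (fobj idf Y) (fobj t Y) (fobj t W) (fmap t Y W y) (\<beta>' Y)"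
      by (simp add: to tm)
  qed
  moreover have "nat_trans T T t (func_comp (Sus T) G) \<gamma>'"
    unfolding nat_trans_def
  proof (intro conjI ballI)
    fix Y assume Y: "Y \<in> Obj T"
    then show "\<gamma>' Y \<in> mor T (fobj t Y) (fobj (func_comp (Sus T) G) Y)" using o[OF Y] m[OF Y] by (simp add: \<gamma>'_def to cats)
    fix W y assume W: "W \<in> Obj T" and y: "y \<in> mor T Y W"
    note oo = o[OF Y] o[OF W] Y W and mm = m[OF Y] m[OF W] y E.cmp_simps[OF Y] E.cmp_simps[OF W] y'm(1)[OF Y W y]
    let ?SG = "\<lambda>A B x. smap T (fobj G A) (fobj G B) (fmap G A B x)"
    have SG: "?SG A C (Cmp T A B C v u) = Cmp T (sob T (fobj G A)) (sob T (fobj G B)) (sob T (fobj G C)) (?SG B C v) (?SG A B u)"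
      "?SG A B u \<in> mor T (sob T (fobj G A)) (sob T (fobj G B))"
      if "A \<in> Obj T" "B \<in> Obj T" "C \<in> Obj T" "u \<in> mor T A B" "v \<in> mor T B C" for A B C u v
      using that by (simp_all add: cats)
    have "Cmp T (fobj F (?p Y)) (fobj F (?p W)) (sob T (fobj G W)) (\<gamma>' W) (fmap F (?p Y) (?p W) (y' Y W y))
      = Cmp T (fobj F (?p Y)) (sob T (fobj G (?E W))) (sob T (fobj G W)) (?SG (?E W) W (E.cmp W))
         (Cmp T (fobj F (?p Y)) (fobj F (?p W)) (sob T (fobj G (?E W))) (\<gamma> (?p W)) (fmap F (?p Y) (?p W) (y' Y W y)))"
      unfolding \<gamma>'_def using oo mm by (simp add: cats)
    also have "\<dots> = Cmp T (fobj F (?p Y)) (sob T (fobj G (?E W))) (sob T (fobj G W)) (?SG (?E W) W (E.cmp W))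
         (Cmp T (fobj F (?p Y)) (sob T (fobj G (?E Y))) (sob T (fobj G (?E W))) (?SG (?E Y) (?E W) (fmap E (?p Y) (?p W) (y' Y W y))) (\<gamma> (?p Y)))"
      using nat_transD(2)[OF \<gamma> o(1)[OF Y] o(1)[OF W] y'm(1)[OF Y W y]] by simp
    also have "\<dots> = Cmp T (fobj F (?p Y)) (sob T (fobj G (?E Y))) (sob T (fobj G W)) (?SG (?E Y) W (Cmp T (?E Y) (?E W) W (E.cmp W) (fmap E (?p Y) (?p W) (y' Y W y)))) (\<gamma> (?p Y))"
      using oo mm by (simp add: SG(1)[of "?E Y" "?E W" W] cats)
    also have "Cmp T (?E Y) (?E W) W (E.cmp W) (fmap E (?p Y) (?p W) (y' Y W y)) = Cmp T (?E Y) Y W y (E.cmp Y)"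
      unfolding y'm(2)[OF Y W y] using oo mm cc(2)[OF W] E.D.Cmp_prefix[OF cc(2)[OF W]] by (simp add: cats)
    also have "Cmp T (fobj F (?p Y)) (sob T (fobj G (?E Y))) (sob T (fobj G W)) (?SG (?E Y) W (Cmp T (?E Y) Y W y (E.cmp Y))) (\<gamma> (?p Y))
      = Cmp T (fobj F (?p Y)) (sob T (fobj G Y)) (sob T (fobj G W)) (?SG Y W y) (\<gamma>' Y)"
      unfolding \<gamma>'_def using oo mm by (simp add: SG(1)[of "?E Y" Y W] SG(2) cats)
    finally show "Cmp T (fobj t Y) (fobj t W) (fobj (func_comp (Sus T) G) W) (\<gamma>' W) (fmap t Y W y)
      = Cmp T (fobj t Y) (fobj (func_comp (Sus T) G) Y) (fobj (func_comp (Sus T) G) W) (fmap (func_comp (Sus T) G) Y W y) (\<gamma>' Y)"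
      by (simp add: to tm)
  qed
  moreover have "(fobj G Y, Y, fobj t Y, e Y, \<beta>' Y, \<gamma>' Y) \<in> Tri T" if Y: "Y \<in> Obj T" for Y
  proof (rule T.Tri_iso[OF tri[OF o(1)[OF Y]]])
    note oo = o[OF Y] Y and mm = m[OF Y] E.cmp_simps[OF Y]
    show "is_iso T (fobj G (?E Y)) (fobj G Y) (fmap G (?E Y) Y (E.cmp Y))"
      using G.is_iso_fmap E.pre_cmp[OF Y] oo by simp
    show "is_iso T (?E Y) Y (E.cmp Y)" using E.pre_cmp[OF Y] by simp
    show "is_iso T (fobj F (?p Y)) (fobj t Y) (Idn T (fobj F (?p Y)))" using E.D.is_iso_Idn oo by (simp add: to)
    show "Cmp T (fobj G (?E Y)) (?E Y) Y (E.cmp Y) (e (?E Y)) = Cmp T (fobj G (?E Y)) (fobj G Y) Y (e Y) (fmap G (?E Y) Y (E.cmp Y))"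
      using nat_transD(2)[OF e o(2)[OF Y] Y] mm by simp
    show "Cmp T (?E Y) (fobj F (?p Y)) (fobj t Y) (Idn T (fobj F (?p Y))) (\<beta> (?p Y)) = Cmp T (?E Y) Y (fobj t Y) (\<beta>' Y) (E.cmp Y)"
      using oo mm E.D.Cmp_prefix[OF cc(1)[OF Y]] by (simp add: \<beta>'_def to cats)
    show "Cmp T (fobj F (?p Y)) (sob T (fobj G (?E Y))) (sob T (fobj G Y)) (smap T (fobj G (?E Y)) (fobj G Y) (fmap G (?E Y) Y (E.cmp Y))) (\<gamma> (?p Y))
      = Cmp T (fobj F (?p Y)) (fobj t Y) (sob T (fobj G Y)) (\<gamma>' Y) (Idn T (fobj F (?p Y)))"
      using oo mm by (simp add: \<gamma>'_def to cats)
  qed (use o[OF Y] m[OF Y] E.cmp_simps[OF Y] Y in \<open>simp_all add: \<beta>'_def \<gamma>'_def to cats\<close>)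
  ultimately show ?thesis using e unfolding functorial_triangle_def by auto
qed

section \<open>The triangulated structure of the homotopy category\<close>

context pretriangulated_dg
begin

text \<open>Conjugation by the suspension data respects identities because
  \<open>sus_to sus_from\<close> is homotopic to 1, and composites because
  \<open>sus_from sus_to\<close> is.\<close>

lemma H0_Sus_functor: "is_functor (H0 K A) (H0 K A) (Sus (H0 K A))"
  unfolding is_functor_def
proof (intro conjI ballI)
  show "sob (H0 K A) \<in> Obj (H0 K A) \<rightarrow> Obj (H0 K A)" by (simp add: dgs)
  fix X assume X: "X \<in> Obj (H0 K A)"
  have o: "X \<in> DObj A" using X by simp
  have sX: "sus_mor X X (DIdn A X) = DCmp A (sus_obj A X) X (sus_obj A X) (-1) 1 (sus_to A X) (sus_from A X)"
    using o by (simp add: dgs)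
  obtain l where "l \<in> dmor A (sus_obj A X) (sus_obj A X) (-1)"
    "DCmp A (sus_obj A X) X (sus_obj A X) (-1) 1 (sus_to A X) (sus_from A X)
      = DIdn A (sus_obj A X) \<oplus>\<^bsub>dM A (sus_obj A X) (sus_obj A X) 0\<^esub> ddif A (sus_obj A X) (sus_obj A X) (-1) l"
    using sus_homotopy'[OF o] .
  then show "smap (H0 K A) X X (Idn (H0 K A) X) = Idn (H0 K A) (sob (H0 K A) X)"
    using o unfolding H0_sel H0_Sus_map[OF o o dcocyc_DIdn[OF o]] sX by (intro dcls_eqI) (simp_all add: dgs)
  fix Y assume "Y \<in> Obj (H0 K A)"
  then have o2: "Y \<in> DObj A" by simp
  show "smap (H0 K A) X Y \<in> mor (H0 K A) X Y \<rightarrow> mor (H0 K A) (sob (H0 K A) X) (sob (H0 K A) Y)"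
    using H0_Sus_map[OF o o2] sus_mor_dcocyc[OF o o2] by (auto simp: H0_mor)
  fix Z f g assume "Z \<in> Obj (H0 K A)" "f \<in> mor (H0 K A) X Y" "g \<in> mor (H0 K A) Y Z"
  then obtain f' g' where o3: "Z \<in> DObj A" and f: "f = dcls A X Y f'" "f' \<in> dcocyc A X Y 0" and g: "g = dcls A Y Z g'" "g' \<in> dcocyc A Y Z 0"
    by (auto simp: H0_mor)
  have f': "f' \<in> dmor A X Y 0" "ddif A X Y 0 f' = (dzero A X Y 1)" and g': "g' \<in> dmor A Y Z 0" "ddif A Y Z 0 g' = (dzero A Y Z 1)"
    using f g by (auto simp: dgs)
  let ?SX = "sus_obj A X" and ?SY = "sus_obj A Y" and ?SZ = "sus_obj A Z"
  obtain k where k: "k \<in> dmor A Y Y (-1)" and ss: "DCmp A Y ?SY Y 1 (-1) (sus_from A Y) (sus_to A Y) = DIdn A Y \<oplus>\<^bsub>dM A Y Y 0\<^esub> ddif A Y Y (-1) k"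
    using sus_homotopy[OF o2] .
  let ?h = "\<ominus>\<^bsub>dM A ?SX ?SZ (-1)\<^esub> DCmp A ?SX Y ?SZ (-2) 1 (DCmp A Y Y ?SZ (-1) (-1) (DCmp A Y Z ?SZ (-1) 0 (sus_to A Z) g') k)
      (DCmp A ?SX X Y 0 1 f' (sus_from A X))"
  have "dcls A ?SX ?SZ (DCmp A ?SX ?SY ?SZ 0 0 (sus_mor Y Z g') (sus_mor X Y f')) = dcls A ?SX ?SZ (sus_mor X Z (DCmp A X Y Z 0 0 g' f'))"
  proof (rule dcls_eqI[of _ _ _ ?h])
    show "DCmp A ?SX ?SY ?SZ 0 0 (sus_mor Y Z g') (sus_mor X Y f') = sus_mor X Z (DCmp A X Y Z 0 0 g' f') \<oplus>\<^bsub>dM A ?SX ?SZ 0\<^esub> ddif A ?SX ?SZ (-1) ?h"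
      by (rule abeqI) (use o o2 o3 f' g' k ss in \<open>simp add: dgs abg DCmp_prefix[OF ss]\<close>)
  qed (use o o2 o3 f' g' k in \<open>simp_all add: dgs abgc\<close>)
  then show "smap (H0 K A) X Z (Cmp (H0 K A) X Y Z g f) = Cmp (H0 K A) (sob (H0 K A) X) (sob (H0 K A) Y) (sob (H0 K A) Z) (smap (H0 K A) Y Z g) (smap (H0 K A) X Y f)"
    unfolding f(1) g(1) using o o2 o3 f(2) g(2) sus_mor_dcocyc dcocyc_DCmp[OF o o2 o3 f(2) g(2), of 0] sus_simps(1)
    by (simp add: H0_Cmp H0_Sus_map del: dcocyc_iff)
qed

lemma H0_Tri_mor:
  assumes "(X, Y, Z, f, g, h) \<in> Tri (H0 K A)"
  shows "X \<in> Obj (H0 K A) \<and> Y \<in> Obj (H0 K A) \<and> Z \<in> Obj (H0 K A) \<and> f \<in> mor (H0 K A) X Y \<and> g \<in> mor (H0 K A) Y Z \<and> h \<in> mor (H0 K A) Z (sob (H0 K A) X)"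
  using assms unfolding H0_Tri_iff is_cone_iff cone_data_def connecting_def by (auto simp: H0_mor dcocyc_iff)

lemma H0_cone:
  assumes "X \<in> Obj (H0 K A)" "Y \<in> Obj (H0 K A)" "f \<in> mor (H0 K A) X Y"
  shows "\<exists>Z g h. (X, Y, Z, f, g, h) \<in> Tri (H0 K A)"
proof -
  obtain f' where f: "f = dcls A X Y f'" "f' \<in> dcocyc A X Y 0" using assms by (auto simp: H0_mor)
  moreover have "\<forall>X\<in>DObj A. \<forall>Y\<in>DObj A. \<forall>f\<in>dcocyc A X Y 0. \<exists>Z i j. is_cone K A X Y Z f i j"
    using pretri by (simp add: pretriangulated_def)
  ultimately obtain Z i j where c: "is_cone K A X Y Z f' i j" using assms by (metis H0_sel(1))
  then show ?thesis using connecting_exists[OF c] f unfolding H0_Tri_iff by blast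
qed

end

section \<open>Enhancements\<close>

locale enhancement = A: pretriangulated_dg K A + T: triangulated_category K T + linear_equivalence K "H0 K A" T E
  for K :: "'k ring" and A :: "('o, 'm, 'k) dg_cat" and T :: "('p, 'n, 'k) tri_cat" and E :: "('o, 'm set, 'p, 'n) tri_func" +
  assumes triangle: "triangle_functor K (H0 K A) T E"
begin

lemma E_obj [cats]: "X \<in> DObj A \<Longrightarrow> fobj E X \<in> Obj T"
  using functor_simps(1) by simp

abbreviation cls :: "'o \<Rightarrow> 'o \<Rightarrow> 'm \<Rightarrow> 'n" where
  "cls X Y f \<equiv> fmap E X Y (dcls A X Y f)"

lemma E_mor: "\<lbrakk>X \<in> DObj A; Y \<in> DObj A; f \<in> dcocyc A X Y 0\<rbrakk> \<Longrightarrow> cls X Y f \<in> mor T (fobj E X) (fobj E Y)"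
  using functor_simps(2)[of X Y "dcls A X Y f"] by (simp add: A.H0_mor)

lemma E_full: "\<lbrakk>X \<in> DObj A; Y \<in> DObj A; g \<in> mor T (fobj E X) (fobj E Y)\<rbrakk> \<Longrightarrow> \<exists>f\<in>dcocyc A X Y 0. cls X Y f = g"
  using full[of X Y g] by (auto simp: A.H0_mor)

lemma E_faithful: "\<lbrakk>X \<in> DObj A; Y \<in> DObj A; f \<in> dcocyc A X Y 0; g \<in> dcocyc A X Y 0; cls X Y f = cls X Y g\<rbrakk> \<Longrightarrow> dcls A X Y f = dcls A X Y g"
  using faithful[of X Y "dcls A X Y f" "dcls A X Y g"] by (simp add: A.H0_mor)

lemma E_Cmp: "\<lbrakk>X \<in> DObj A; Y \<in> DObj A; Z \<in> DObj A; f \<in> dcocyc A X Y 0; g \<in> dcocyc A Y Z 0\<rbrakk> \<Longrightarrow>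
    cls X Z (DCmp A X Y Z 0 0 g f) = Cmp T (fobj E X) (fobj E Y) (fobj E Z) (cls Y Z g) (cls X Y f)"
  using functor_simps(4)[of X Y Z "dcls A X Y f" "dcls A Y Z g"] by (simp add: A.H0_mor A.H0_Cmp)

lemma Com_iso: "X \<in> DObj A \<Longrightarrow> is_iso T (fobj E (sus_obj A X)) (sob T (fobj E X)) (Com E X)"
  using triangle by (simp add: triangle_functor_def nat_iso_def)

lemma Com_natural: "\<lbrakk>X \<in> DObj A; Y \<in> DObj A; f \<in> dcocyc A X Y 0\<rbrakk> \<Longrightarrow>
    Cmp T (fobj E (sus_obj A X)) (fobj E (sus_obj A Y)) (sob T (fobj E Y)) (Com E Y) (cls (sus_obj A X) (sus_obj A Y) (A.sus_mor X Y f))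
     = Cmp T (fobj E (sus_obj A X)) (sob T (fobj E X)) (sob T (fobj E Y)) (smap T (fobj E X) (fobj E Y) (cls X Y f)) (Com E X)"
  using triangle unfolding triangle_functor_def nat_iso_def nat_trans_def by (auto simp: A.H0_mor A.H0_Sus_map)

lemma cone_triangle:
  assumes "is_cone K A X Y Z f i j" "A.connecting X Y Z f i j h"
  shows "(fobj E X, fobj E Y, fobj E Z, cls X Y f, cls Y Z i,
    Cmp T (fobj E Z) (fobj E (sus_obj A X)) (sob T (fobj E X)) (Com E X) (cls Z (sus_obj A X) h)) \<in> Tri T"
proof -
  have "(X, Y, Z, dcls A X Y f, dcls A Y Z i, dcls A Z (sus_obj A X) h) \<in> Tri (H0 K A)"
    unfolding A.H0_Tri_iff using assms by blast
  then show ?thesis using triangle unfolding triangle_functor_def by fastforce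
qed

end

lemma enhancementI:
  assumes "dg_enhancement K T A E" "triangulated_category K T"
  shows "enhancement K A T E"
proof -
  interpret T: triangulated_category K T by fact
  have A: "dg_category K A" using assms by (simp add: dg_enhancement_def pretriangulated_def)
  interpret A: pretriangulated_dg K A
    using A assms by (intro pretriangulated_dg.intro pretriangulated_dg_axioms.intro) (simp_all add: dg_enhancement_def)
  interpret linear_equivalence K "H0 K A" T E
    using assms by (intro equivalence_linear_equivalence A.H0_linear_category T.linear_category_axioms)
      (simp_all add: dg_enhancement_def triangle_functor_def)
  show ?thesis using assms by unfold_locales (simp add: dg_enhancement_def)
qed

section \<open>Coreflections between enhanced triangulated categories\<close>

text \<open>The common setting of both parts of the theorem. \<open>\<rho>\<close> is
  \<open>r\<close> with \<open>U\<close> all objects, or the truncation of \<open>r\<close> with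
  \<open>U\<close> the left aisle; \<open>universal\<close> says that \<open>e\<close> is universal
  among morphisms to \<open>X\<close> from \<open>s\<close> of objects of \<open>U\<close>.\<close>

locale enhanced_coreflection = dg_functor_between K A B F + ES: enhancement K A S ES + ET: enhancement K B T ET
  for K :: "'k ring" and A :: "('o, 'm, 'k) dg_cat" and B :: "('p, 'n, 'k) dg_cat" and F
    and S :: "('so, 'sm, 'k) tri_cat" and T :: "('to, 'tm, 'k) tri_cat" and ES and ET +
  fixes s :: "('so, 'sm, 'to, 'tm) tri_func" and \<alpha> :: "'o \<Rightarrow> 'tm" and \<rho> :: "('to, 'tm, 'so, 'sm) func" and e :: "'to \<Rightarrow> 'tm" and U :: "'so set"
  assumes s: "is_functor S T s"
    and \<alpha>: "nat_iso (H0 K A) T (func_comp s ES) (func_comp ET (H0func A B F)) \<alpha>"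
    and \<rho>: "is_functor T S \<rho>" and e: "nat_trans T T (func_comp s \<rho>) idf e"
    and U: "U \<subseteq> Obj S" "\<And>X Y f. X \<in> U \<Longrightarrow> Y \<in> Obj S \<Longrightarrow> is_iso S X Y f \<Longrightarrow> Y \<in> U" "\<And>X. X \<in> U \<Longrightarrow> sob S X \<in> U"
      "\<And>X. X \<in> Obj T \<Longrightarrow> fobj \<rho> X \<in> U"
    and universal: "\<And>W X g. W \<in> U \<Longrightarrow> X \<in> Obj T \<Longrightarrow> g \<in> mor T (fobj s W) X \<Longrightarrow>
      \<exists>!a. a \<in> mor S W (fobj \<rho> X) \<and> Cmp T (fobj s W) (fobj s (fobj \<rho> X)) X (e X) (fmap s W (fobj \<rho> X) a) = g"
begin

sublocale s: functor_between K S T s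
  by (rule functor_betweenI[OF ES.T.linear_category_axioms ET.T.linear_category_axioms s])

sublocale \<rho>: functor_between K T S \<rho>
  by (rule functor_betweenI[OF ET.T.linear_category_axioms ES.T.linear_category_axioms \<rho>])

abbreviation "sE W \<equiv> fobj s (fobj ES W)"
abbreviation "TF W \<equiv> fobj ET (dobj F W)"
abbreviation "sr X \<equiv> fobj s (fobj \<rho> X)"

lemma obj [cats]: "W \<in> DObj A \<Longrightarrow> sE W \<in> Obj T" "W \<in> DObj A \<Longrightarrow> TF W \<in> Obj T" "X \<in> Obj T \<Longrightarrow> sr X \<in> Obj T"
  by (simp_all add: cats dgs)

lemma \<alpha>_iso: "W \<in> DObj A \<Longrightarrow> is_iso T (sE W) (TF W) (\<alpha> W)"
  using \<alpha> by (simp add: nat_iso_def)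

lemma \<alpha>_natural: "\<lbrakk>W \<in> DObj A; W' \<in> DObj A; a \<in> dcocyc A W W' 0\<rbrakk> \<Longrightarrow>
    Cmp T (sE W) (TF W) (TF W') (ET.cls (dobj F W) (dobj F W') (dmap F W W' 0 a)) (\<alpha> W)
      = Cmp T (sE W) (sE W') (TF W') (\<alpha> W') (fmap s (fobj ES W) (fobj ES W') (ES.cls W W' a))"
  using \<alpha> unfolding nat_iso_def nat_trans_def by (auto simp: A.H0_mor H0func_map)

lemma e_mor [cats]: "X \<in> Obj T \<Longrightarrow> e X \<in> mor T (sr X) X"
  using nat_transD(1)[OF e] by simp

definition V :: "'o set" where
  "V = {W \<in> DObj A. fobj ES W \<in> U}"

lemma V_sus: "W \<in> V \<Longrightarrow> sus_obj A W \<in> V"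
  using U(2)[OF U(3) _ is_iso_inv_mor[OF ES.Com_iso]] by (auto simp: V_def cats dgs)

definition cor :: "'p \<Rightarrow> 'o" where
  "cor X = (SOME W. W \<in> DObj A \<and> (\<exists>\<phi>. is_iso S (fobj ES W) (fobj \<rho> (fobj ET X)) \<phi>))"

definition \<phi> :: "'p \<Rightarrow> 'sm" where
  "\<phi> X = (SOME \<phi>. is_iso S (fobj ES (cor X)) (fobj \<rho> (fobj ET X)) \<phi>)"

abbreviation "Fc X \<equiv> dobj F (cor X)"
abbreviation "Ec X \<equiv> fobj ES (cor X)"
abbreviation "rT X \<equiv> fobj \<rho> (fobj ET X)"
abbreviation "rE X \<equiv> fobj s (rT X)"

lemma cor:
  assumes X: "X \<in> DObj B"
  shows "cor X \<in> DObj A" "is_iso S (Ec X) (rT X) (\<phi> X)" "cor X \<in> V"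
proof -
  have r: "rT X \<in> Obj S" using X by (simp add: cats)
  have "\<exists>W. W \<in> DObj A \<and> (\<exists>\<phi>. is_iso S (fobj ES W) (rT X) \<phi>)"
    using ES.ess_surj[OF r] by auto
  from someI_ex[OF this] have *: "cor X \<in> DObj A" "\<exists>\<phi>. is_iso S (Ec X) (rT X) \<phi>"
    unfolding cor_def by auto
  show "cor X \<in> DObj A" by fact
  show i: "is_iso S (Ec X) (rT X) (\<phi> X)" unfolding \<phi>_def using *(2) by (rule someI_ex)
  show "cor X \<in> V" using U(2)[OF U(4) _ is_iso_inv_mor[OF i]] * X by (simp add: V_def cats)
qed

text \<open>\<open>cor X\<close> represents \<open>\<rho> X\<close> only up to isomorphism, and
  \<open>F\<close> induces \<open>s\<close> only up to \<open>\<alpha>\<close>. Both are collected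
  in \<open>\<theta>\<close>, along which cone triangles become triangles on
  \<open>s \<rho> X\<close>.\<close>

definition \<theta> :: "'p \<Rightarrow> 'tm" where
  "\<theta> X = Cmp T (TF (cor X)) (sE (cor X)) (rE X) (fmap s (Ec X) (rT X) (\<phi> X))
    (inv_mor T (sE (cor X)) (TF (cor X)) (\<alpha> (cor X)))"

lemma \<phi>_mor [cats]: "X \<in> DObj B \<Longrightarrow> \<phi> X \<in> mor S (Ec X) (rT X)"
  using inv_mor(1)[OF cor(2)] .

lemma \<theta>:
  assumes "X \<in> DObj B"
  shows "is_iso T (TF (cor X)) (rE X) (\<theta> X)" "\<theta> X \<in> mor T (TF (cor X)) (rE X)"
    "Cmp T (sE (cor X)) (TF (cor X)) (rE X) (\<theta> X) (\<alpha> (cor X)) = fmap s (Ec X) (rT X) (\<phi> X)"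
proof -
  note c = cor[OF assms]
  have o: "Ec X \<in> Obj S" "rT X \<in> Obj S" "sE (cor X) \<in> Obj T" "TF (cor X) \<in> Obj T" "rE X \<in> Obj T"
    using c assms by (simp_all add: cats)
  have i: "is_iso T (sE (cor X)) (rE X) (fmap s (Ec X) (rT X) (\<phi> X))"
    by (rule s.is_iso_fmap[OF c(2) o(1,2)])
  show *: "is_iso T (TF (cor X)) (rE X) (\<theta> X)"
    unfolding \<theta>_def using ET.T.is_iso_Cmp[OF is_iso_inv_mor[OF \<alpha>_iso[OF c(1)]] i] o by simp
  show "\<theta> X \<in> mor T (TF (cor X)) (rE X)" using inv_mor(1)[OF *] .
  show "Cmp T (sE (cor X)) (TF (cor X)) (rE X) (\<theta> X) (\<alpha> (cor X)) = fmap s (Ec X) (rT X) (\<phi> X)"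
    unfolding \<theta>_def using ET.T.iso_cancel(3)[OF \<alpha>_iso[OF c(1)] o(3,4,5) inv_mor(1)[OF i]] .
qed

definition counit :: "'p \<Rightarrow> 'n" where
  "counit X = (SOME f. f \<in> dcocyc B (Fc X) X 0 \<and>
     ET.cls (Fc X) X f = Cmp T (TF (cor X)) (rE X) (fobj ET X) (e (fobj ET X)) (\<theta> X))"

lemma counit:
  assumes X: "X \<in> DObj B"
  shows "counit X \<in> dcocyc B (Fc X) X 0"
    "ET.cls (Fc X) X (counit X) = Cmp T (TF (cor X)) (rE X) (fobj ET X) (e (fobj ET X)) (\<theta> X)"
proof -
  have "Cmp T (TF (cor X)) (rE X) (fobj ET X) (e (fobj ET X)) (\<theta> X) \<in> mor T (TF (cor X)) (fobj ET X)"
    using X \<theta>[OF X] cor[OF X] by (simp add: cats)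
  then have "\<exists>f. f \<in> dcocyc B (Fc X) X 0 \<and>
     ET.cls (Fc X) X f = Cmp T (TF (cor X)) (rE X) (fobj ET X) (e (fobj ET X)) (\<theta> X)"
    using ET.E_full[OF dobj_closed[OF cor(1)[OF X]] X] by blast
  from someI_ex[OF this] show "counit X \<in> dcocyc B (Fc X) X 0"
    "ET.cls (Fc X) X (counit X) = Cmp T (TF (cor X)) (rE X) (fobj ET X) (e (fobj ET X)) (\<theta> X)"
    unfolding counit_def by auto
qed

text \<open>Translation of the dg operation "apply \<open>F\<close>, then compose with
  \<open>counit X\<close>" into the operation of \<open>universal\<close>: \<open>\<alpha>\<close>
  moves \<open>F\<close> to \<open>s\<close>, and \<open>\<phi>\<close> moves \<open>cor X\<close>
  to \<open>\<rho> X\<close>.\<close>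

lemma counit_post:
  assumes X: "X \<in> DObj B" and W: "W \<in> DObj A" and a: "a \<in> dcocyc A W (cor X) 0"
  shows "Cmp T (sE W) (TF W) (fobj ET X) (ET.cls (dobj F W) X (DCmp B (dobj F W) (Fc X) X 0 0 (counit X) (dmap F W (cor X) 0 a))) (\<alpha> W)
     = Cmp T (sE W) (rE X) (fobj ET X) (e (fobj ET X)) (fmap s (fobj ES W) (rT X) (Cmp S (fobj ES W) (Ec X) (rT X) (\<phi> X) (ES.cls W (cor X) a)))"
proof -
  note c = cor[OF X] and t = \<theta>[OF X] and f = counit[OF X]
  have Fa: "dmap F W (cor X) 0 a \<in> dcocyc B (dobj F W) (Fc X) 0" by (rule dmap_dcocyc[OF W c(1) a])
  have m: "ET.cls (dobj F W) (Fc X) (dmap F W (cor X) 0 a) \<in> mor T (TF W) (TF (cor X))" "ES.cls W (cor X) a \<in> mor S (fobj ES W) (Ec X)"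
    "\<alpha> W \<in> mor T (sE W) (TF W)" "\<alpha> (cor X) \<in> mor T (sE (cor X)) (TF (cor X))"
    using ET.E_mor[OF _ _ Fa] ES.E_mor[OF W c(1) a] inv_mor(1)[OF \<alpha>_iso[OF W]] inv_mor(1)[OF \<alpha>_iso[OF c(1)]] W c by (simp_all add: dgs)
  have o: "fobj ES W \<in> Obj S" "Ec X \<in> Obj S" "rT X \<in> Obj S" "sE W \<in> Obj T" "sE (cor X) \<in> Obj T" "TF W \<in> Obj T" "TF (cor X) \<in> Obj T"
    "rE X \<in> Obj T" "fobj ET X \<in> Obj T"
    using W X c by (simp_all add: cats)
  have "Cmp T (sE W) (TF W) (fobj ET X) (ET.cls (dobj F W) X (DCmp B (dobj F W) (Fc X) X 0 0 (counit X) (dmap F W (cor X) 0 a))) (\<alpha> W)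
    = Cmp T (sE W) (TF W) (fobj ET X) (Cmp T (TF W) (TF (cor X)) (fobj ET X) (Cmp T (TF (cor X)) (rE X) (fobj ET X) (e (fobj ET X)) (\<theta> X))
       (ET.cls (dobj F W) (Fc X) (dmap F W (cor X) 0 a))) (\<alpha> W)"
    using ET.E_Cmp[OF _ _ X Fa f(1)] f(2) W c(1) by (simp add: dobj_closed)
  also have "\<dots> = Cmp T (sE W) (rE X) (fobj ET X) (e (fobj ET X)) (Cmp T (sE W) (TF (cor X)) (rE X) (\<theta> X)
       (Cmp T (sE W) (TF W) (TF (cor X)) (ET.cls (dobj F W) (Fc X) (dmap F W (cor X) 0 a)) (\<alpha> W)))"
    using o m t e_mor[OF o(9)] by (simp add: ET.T.Cmp_left_assoc ET.T.Cmp_simps(1))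
  also have "Cmp T (sE W) (TF W) (TF (cor X)) (ET.cls (dobj F W) (Fc X) (dmap F W (cor X) 0 a)) (\<alpha> W)
     = Cmp T (sE W) (sE (cor X)) (TF (cor X)) (\<alpha> (cor X)) (fmap s (fobj ES W) (Ec X) (ES.cls W (cor X) a))"
    by (rule \<alpha>_natural[OF W c(1) a])
  also have "Cmp T (sE W) (TF (cor X)) (rE X) (\<theta> X) \<dots>
     = Cmp T (sE W) (sE (cor X)) (rE X) (Cmp T (sE (cor X)) (TF (cor X)) (rE X) (\<theta> X) (\<alpha> (cor X))) (fmap s (fobj ES W) (Ec X) (ES.cls W (cor X) a))"
    using o m t s.functor_simps(2)[OF o(1,2) m(2)] by (simp add: ET.T.Cmp_left_assoc)
  also have "\<dots> = fmap s (fobj ES W) (rT X) (Cmp S (fobj ES W) (Ec X) (rT X) (\<phi> X) (ES.cls W (cor X) a))"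
    unfolding t(3) using s.functor_simps(4)[OF o(1,2,3) m(2) \<phi>_mor[OF X]] by simp
  finally show ?thesis .
qed

text \<open>\<open>universal\<close> is a statement about morphisms in the triangulated categories,
  hence about H^0 only; existence gives surjectivity and uniqueness gives injectivity. The other
  degrees are left to the shifting lemmas.\<close>

lemma counit_bij:
  assumes W: "W \<in> V" and X: "X \<in> DObj B"
  shows "cohom_surj (DHom A W (cor X)) (DHom B (dobj F W) X) (\<lambda>n a. DCmp B (dobj F W) (Fc X) X 0 n (counit X) (dmap F W (cor X) n a)) 0"
    "cohom_inj (DHom A W (cor X)) (DHom B (dobj F W) X) (\<lambda>n a. DCmp B (dobj F W) (Fc X) X 0 n (counit X) (dmap F W (cor X) n a)) 0"
proof -
  note c = cor[OF X] and t = \<theta>[OF X] and f = counit[OF X]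
  have W': "W \<in> DObj A" "fobj ES W \<in> U" using W by (auto simp: V_def)
  have o: "fobj ES W \<in> Obj S" "Ec X \<in> Obj S" "rT X \<in> Obj S" "sE W \<in> Obj T" "TF W \<in> Obj T" "fobj ET X \<in> Obj T" "dobj F W \<in> DObj B"
    using W' X c by (simp_all add: cats dgs)
  let ?f = "\<lambda>a. DCmp B (dobj F W) (Fc X) X 0 0 (counit X) (dmap F W (cor X) 0 a)"
  have fa: "?f a \<in> dcocyc B (dobj F W) X 0" if "a \<in> dcocyc A W (cor X) 0" for a
    using B.dcocyc_DCmp[OF o(7) dobj_closed[OF c(1)] X dmap_dcocyc[OF W'(1) c(1) that] f(1)] by simp
  note ia = \<alpha>_iso[OF W'(1)]
  have canc: "x = y" if "x \<in> mor T (TF W) (fobj ET X)" "y \<in> mor T (TF W) (fobj ET X)" "Cmp T (sE W) (TF W) (fobj ET X) x (\<alpha> W) = Cmp T (sE W) (TF W) (fobj ET X) y (\<alpha> W)" for x y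
    using ET.T.iso_cancel(4)[OF ia o(4,5,6) that(1)] ET.T.iso_cancel(4)[OF ia o(4,5,6) that(2)] that(3) by metis
  show "cohom_surj (DHom A W (cor X)) (DHom B (dobj F W) X) (\<lambda>n a. DCmp B (dobj F W) (Fc X) X 0 n (counit X) (dmap F W (cor X) n a)) 0"
    unfolding cohom_surj_def
  proof
    fix y assume y: "y \<in> dcocyc B (dobj F W) X 0"
    let ?g = "Cmp T (sE W) (TF W) (fobj ET X) (ET.cls (dobj F W) X y) (\<alpha> W)"
    have ym: "ET.cls (dobj F W) X y \<in> mor T (TF W) (fobj ET X)" by (rule ET.E_mor[OF o(7) X y])
    then have "?g \<in> mor T (sE W) (fobj ET X)" using o inv_mor(1)[OF ia] by (simp add: ET.T.Cmp_simps(1))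
    then obtain b where b: "b \<in> mor S (fobj ES W) (rT X)" "Cmp T (sE W) (rE X) (fobj ET X) (e (fobj ET X)) (fmap s (fobj ES W) (rT X) b) = ?g"
      using universal[OF W'(2) o(6)] by blast
    \<comment> \<open>\<open>b\<close> ends in \<open>\<rho> X\<close>; the inverse of
      \<open>\<phi> X\<close> brings it to \<open>cor X\<close>, where fullness of the enhancement
      gives a cocycle.\<close>
    let ?b = "Cmp S (fobj ES W) (rT X) (Ec X) (inv_mor S (Ec X) (rT X) (\<phi> X)) b"
    note i\<phi> = inv_mor[OF c(2)]
    have "?b \<in> mor S (fobj ES W) (Ec X)" using o b i\<phi> by (simp add: ES.T.Cmp_simps(1))
    then obtain a where a: "a \<in> dcocyc A W (cor X) 0" "ES.cls W (cor X) a = ?b" using ES.E_full[OF W'(1) c(1)] by blast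
    have "Cmp S (fobj ES W) (Ec X) (rT X) (\<phi> X) ?b = b"
      using o b i\<phi> by (simp add: ES.T.Cmp_left_assoc ES.T.Cmp_Idn_left)
    then have "Cmp T (sE W) (TF W) (fobj ET X) (ET.cls (dobj F W) X (?f a)) (\<alpha> W) = ?g"
      unfolding counit_post[OF X W'(1) a(1)] a(2) by (simp add: b(2))
    then have "dcls B (dobj F W) X (?f a) = dcls B (dobj F W) X y"
      using ET.E_faithful[OF o(7) X fa[OF a(1)] y] canc ET.E_mor[OF o(7) X fa[OF a(1)]] ym by blast
    moreover have "?f a \<in> dmor B (dobj F W) X 0" "y \<in> dmor B (dobj F W) X 0" using fa[OF a(1)] y by (auto simp: cocycles_def)
    ultimately obtain z where "z \<in> dmor B (dobj F W) X (-1)" "?f a = y \<oplus>\<^bsub>dM B (dobj F W) X 0\<^esub> ddif B (dobj F W) X (-1) z"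
      using B.dcls_eqE[OF o(7) X] by blast
    then show "\<exists>a\<in>dcocyc A W (cor X) 0. \<exists>z\<in>dmor B (dobj F W) X (0 - 1). ?f a = y \<oplus>\<^bsub>dM B (dobj F W) X 0\<^esub> ddif B (dobj F W) X (0 - 1) z"
      using a(1) by auto
  qed
  show "cohom_inj (DHom A W (cor X)) (DHom B (dobj F W) X) (\<lambda>n a. DCmp B (dobj F W) (Fc X) X 0 n (counit X) (dmap F W (cor X) n a)) 0"
    unfolding cohom_inj_def
  proof (intro ballI impI)
    fix a z assume a: "a \<in> dcocyc A W (cor X) 0" and z: "z \<in> dmor B (dobj F W) X (0 - 1)" "?f a = ddif B (dobj F W) X (0 - 1) z"
    let ?n = "(dzero A W (cor X) 0)"
    have 0: "?n \<in> dcocyc A W (cor X) 0" using W' c by (simp add: dgs abgc)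
    have f0: "?f ?n = (dzero B (dobj F W) X 0)" using W' c X f(1) by (simp add: dgs)
    have "dcls B (dobj F W) X (?f a) = dcls B (dobj F W) X (?f ?n)"
      unfolding f0 by (rule B.dcls_eqI[of _ _ _ z]) (use o X z in \<open>simp_all add: dgs abgc\<close>)
    then have eq: "Cmp T (sE W) (rE X) (fobj ET X) (e (fobj ET X)) (fmap s (fobj ES W) (rT X) (Cmp S (fobj ES W) (Ec X) (rT X) (\<phi> X) (ES.cls W (cor X) a)))
      = Cmp T (sE W) (rE X) (fobj ET X) (e (fobj ET X)) (fmap s (fobj ES W) (rT X) (Cmp S (fobj ES W) (Ec X) (rT X) (\<phi> X) (ES.cls W (cor X) ?n)))"
      unfolding counit_post[OF X W'(1) a, symmetric] counit_post[OF X W'(1) 0, symmetric] by simp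
    have m: "ES.cls W (cor X) a \<in> mor S (fobj ES W) (Ec X)" "ES.cls W (cor X) ?n \<in> mor S (fobj ES W) (Ec X)"
      using ES.E_mor[OF W'(1) c(1)] a 0 by auto
    let ?p = "\<lambda>x. Cmp S (fobj ES W) (Ec X) (rT X) (\<phi> X) x"
    have pm: "?p (ES.cls W (cor X) a) \<in> mor S (fobj ES W) (rT X)" "?p (ES.cls W (cor X) ?n) \<in> mor S (fobj ES W) (rT X)"
      using m o \<phi>_mor[OF X] by (simp_all add: ES.T.Cmp_simps(1))
    have "Cmp T (sE W) (rE X) (fobj ET X) (e (fobj ET X)) (fmap s (fobj ES W) (rT X) (?p (ES.cls W (cor X) a))) \<in> mor T (sE W) (fobj ET X)"
      using pm o s.functor_simps(2)[OF o(1,3) pm(1)] e_mor[OF o(6)] by (simp add: ET.T.Cmp_simps(1) obj)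
    from universal[OF W'(2) o(6) this] have "?p (ES.cls W (cor X) a) = ?p (ES.cls W (cor X) ?n)"
      using pm eq by metis
    then have "Cmp S (fobj ES W) (rT X) (Ec X) (inv_mor S (Ec X) (rT X) (\<phi> X)) (?p (ES.cls W (cor X) a))
       = Cmp S (fobj ES W) (rT X) (Ec X) (inv_mor S (Ec X) (rT X) (\<phi> X)) (?p (ES.cls W (cor X) ?n))" by simp
    then have "ES.cls W (cor X) a = ES.cls W (cor X) ?n"
      using o m inv_mor[OF c(2)] by (simp add: ES.T.Cmp_left_assoc ES.T.Cmp_Idn_left)
    then have "dcls A W (cor X) a = dcls A W (cor X) ?n" using ES.E_faithful[OF W'(1) c(1) a 0] by blast
    moreover have "a \<in> dmor A W (cor X) 0" "?n \<in> dmor A W (cor X) 0" using a 0 by (auto simp: cocycles_def)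
    ultimately obtain k where "k \<in> dmor A W (cor X) (-1)" "a = ?n \<oplus>\<^bsub>dM A W (cor X) 0\<^esub> ddif A W (cor X) (-1) k"
      using A.dcls_eqE[OF W'(1) c(1)] by blast
    then show "\<exists>y\<in>dmor A W (cor X) (0 - 1). a = ddif A W (cor X) (0 - 1) y"
      using W' c by (intro bexI[of _ k]) (simp_all add: dgs abgc)
  qed
qed

text \<open>The lift \<open>a\<close> is related to \<open>x\<close> only by a homotopy over the
  counits. Uniqueness in \<open>universal\<close> nevertheless forces its class to be
  \<open>\<rho>\<close> of the class of \<open>x\<close>, up to \<open>\<phi>\<close>.\<close>

lemma \<theta>_natural:
  assumes X: "X \<in> DObj B" "Y \<in> DObj B" and a: "a \<in> dcocyc A (cor X) (cor Y) 0" and x: "x \<in> dcocyc B X Y 0"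
    and eq: "dcls B (Fc X) Y (DCmp B (Fc X) (Fc Y) Y 0 0 (counit Y) (dmap F (cor X) (cor Y) 0 a))
      = dcls B (Fc X) Y (DCmp B (Fc X) X Y 0 0 x (counit X))"
  shows "Cmp T (TF (cor X)) (TF (cor Y)) (rE Y) (\<theta> Y) (ET.cls (Fc X) (Fc Y) (dmap F (cor X) (cor Y) 0 a))
    = Cmp T (TF (cor X)) (rE X) (rE Y) (fmap s (rT X) (rT Y) (fmap \<rho> (fobj ET X) (fobj ET Y) (ET.cls X Y x))) (\<theta> X)"
proof -
  note cX = cor[OF X(1)] and cY = cor[OF X(2)] and tX = \<theta>[OF X(1)] and tY = \<theta>[OF X(2)]
  let ?rX = "rT X" and ?rY = "rT Y" and ?EX = "fobj ET X" and ?EY = "fobj ET Y"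
  let ?Fa = "ET.cls (Fc X) (Fc Y) (dmap F (cor X) (cor Y) 0 a)" and ?a = "ES.cls (cor X) (cor Y) a" and ?x = "ET.cls X Y x"
  have o: "Ec X \<in> Obj S" "Ec Y \<in> Obj S" "?rX \<in> Obj S" "?rY \<in> Obj S" "?EX \<in> Obj T" "?EY \<in> Obj T"
    "sE (cor X) \<in> Obj T" "sE (cor Y) \<in> Obj T" "TF (cor X) \<in> Obj T" "TF (cor Y) \<in> Obj T" "sr ?EX \<in> Obj T" "sr ?EY \<in> Obj T"
    using X cX cY by (simp_all add: cats)
  have Fa: "dmap F (cor X) (cor Y) 0 a \<in> dcocyc B (Fc X) (Fc Y) 0" by (rule dmap_dcocyc[OF cX(1) cY(1) a])
  have m: "?Fa \<in> mor T (TF (cor X)) (TF (cor Y))" "?a \<in> mor S (Ec X) (Ec Y)" "?x \<in> mor T ?EX ?EY"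
    "\<alpha> (cor X) \<in> mor T (sE (cor X)) (TF (cor X))" "\<alpha> (cor Y) \<in> mor T (sE (cor Y)) (TF (cor Y))"
    using ET.E_mor[OF _ _ Fa] ES.E_mor[OF cX(1) cY(1) a] ET.E_mor[OF X x] inv_mor(1)[OF \<alpha>_iso[OF cX(1)]] inv_mor(1)[OF \<alpha>_iso[OF cY(1)]] cX cY by (simp_all add: dobj_closed)
  have rm: "fmap \<rho> ?EX ?EY ?x \<in> mor S ?rX ?rY" using \<rho>.functor_simps(2) o m by simp
  have sm: "fmap s (Ec X) ?rX (\<phi> X) \<in> mor T (sE (cor X)) (sr ?EX)" "fmap s (Ec Y) ?rY (\<phi> Y) \<in> mor T (sE (cor Y)) (sr ?EY)"
    "fmap s ?rX ?rY (fmap \<rho> ?EX ?EY ?x) \<in> mor T (sr ?EX) (sr ?EY)" "fmap s (Ec X) (Ec Y) ?a \<in> mor T (sE (cor X)) (sE (cor Y))"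
    using s.functor_simps(2) o m rm \<phi>_mor X by simp_all
  \<comment> \<open>\<open>?u\<close> and \<open>?v\<close> are the two ways around the square of
    \<open>\<phi>\<close>; they agree after composition with the counit, and the source
    \<open>Ec X\<close> lies in \<open>U\<close>, so \<open>universal\<close> makes them
    equal.\<close>
  let ?u = "Cmp S (Ec X) (Ec Y) ?rY (\<phi> Y) ?a" and ?v = "Cmp S (Ec X) ?rX ?rY (fmap \<rho> ?EX ?EY ?x) (\<phi> X)"
  have uv: "?u \<in> mor S (Ec X) ?rY" "?v \<in> mor S (Ec X) ?rY"
    using o m rm \<phi>_mor X by (simp_all add: ES.T.Cmp_simps(1))
  have "Cmp T (sE (cor X)) (sr ?EY) ?EY (e ?EY) (fmap s (Ec X) ?rY ?u)
     = Cmp T (sE (cor X)) (TF (cor X)) ?EY (ET.cls (Fc X) Y (DCmp B (Fc X) X Y 0 0 x (counit X))) (\<alpha> (cor X))"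
    unfolding counit_post[OF X(2) cX(1) a, symmetric] eq ..
  also have "\<dots> = Cmp T (sE (cor X)) (TF (cor X)) ?EY (Cmp T (TF (cor X)) ?EX ?EY ?x (Cmp T (TF (cor X)) (sr ?EX) ?EX (e ?EX) (\<theta> X))) (\<alpha> (cor X))"
    using ET.E_Cmp[OF dobj_closed[OF cX(1)] X counit(1)[OF X(1)] x] counit(2)[OF X(1)] by simp
  also have "\<dots> = Cmp T (sE (cor X)) (sr ?EX) ?EY (Cmp T (sr ?EX) ?EX ?EY ?x (e ?EX)) (Cmp T (sE (cor X)) (TF (cor X)) (sr ?EX) (\<theta> X) (\<alpha> (cor X)))"
    using o m tX(2) e_mor by (simp add: ET.T.Cmp_left_assoc ET.T.Cmp_simps(1))
  also have "Cmp T (sr ?EX) ?EX ?EY ?x (e ?EX) = Cmp T (sr ?EX) (sr ?EY) ?EY (e ?EY) (fmap s ?rX ?rY (fmap \<rho> ?EX ?EY ?x))"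
    using nat_transD(2)[OF e o(5,6) m(3)] by simp
  also have "Cmp T (sE (cor X)) (sr ?EX) ?EY \<dots> (Cmp T (sE (cor X)) (TF (cor X)) (sr ?EX) (\<theta> X) (\<alpha> (cor X)))
     = Cmp T (sE (cor X)) (sr ?EY) ?EY (e ?EY) (fmap s (Ec X) ?rY ?v)"
    unfolding tX(3) s.functor_simps(4)[OF o(1,3,4) \<phi>_mor[OF X(1)] rm] using o sm e_mor by (simp add: ET.T.Cmp_left_assoc)
  finally have "Cmp T (sE (cor X)) (sr ?EY) ?EY (e ?EY) (fmap s (Ec X) ?rY ?u) = Cmp T (sE (cor X)) (sr ?EY) ?EY (e ?EY) (fmap s (Ec X) ?rY ?v)" .
  moreover have "Cmp T (sE (cor X)) (sr ?EY) ?EY (e ?EY) (fmap s (Ec X) ?rY ?u) \<in> mor T (sE (cor X)) ?EY"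
    using o s.functor_simps(2)[OF o(1,4) uv(1)] e_mor by (simp add: ET.T.Cmp_simps(1))
  moreover have "Ec X \<in> U" using cX(3) by (simp add: V_def)
  ultimately have "?u = ?v" using universal[of "Ec X" ?EY] o(6) uv by metis
  then have su: "Cmp T (sE (cor X)) (sE (cor Y)) (sr ?EY) (fmap s (Ec Y) ?rY (\<phi> Y)) (fmap s (Ec X) (Ec Y) ?a)
     = Cmp T (sE (cor X)) (sr ?EX) (sr ?EY) (fmap s ?rX ?rY (fmap \<rho> ?EX ?EY ?x)) (fmap s (Ec X) ?rX (\<phi> X))"
    using s.functor_simps(4)[OF o(1,3,4) \<phi>_mor[OF X(1)] rm] s.functor_simps(4)[OF o(1,2,4) m(2) \<phi>_mor[OF X(2)]] by simp
  let ?l = "Cmp T (TF (cor X)) (TF (cor Y)) (sr ?EY) (\<theta> Y) ?Fa" and ?r = "Cmp T (TF (cor X)) (sr ?EX) (sr ?EY) (fmap s ?rX ?rY (fmap \<rho> ?EX ?EY ?x)) (\<theta> X)"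
  have lr: "?l \<in> mor T (TF (cor X)) (sr ?EY)" "?r \<in> mor T (TF (cor X)) (sr ?EY)" using o m tX tY sm by (simp_all add: ET.T.Cmp_simps(1))
  have "Cmp T (sE (cor X)) (TF (cor X)) (sr ?EY) ?l (\<alpha> (cor X)) = Cmp T (sE (cor X)) (TF (cor Y)) (sr ?EY) (\<theta> Y) (Cmp T (sE (cor X)) (TF (cor X)) (TF (cor Y)) ?Fa (\<alpha> (cor X)))"
    using o m tY by (simp add: ET.T.Cmp_left_assoc)
  also have "\<dots> = Cmp T (sE (cor X)) (sE (cor Y)) (sr ?EY) (Cmp T (sE (cor Y)) (TF (cor Y)) (sr ?EY) (\<theta> Y) (\<alpha> (cor Y))) (fmap s (Ec X) (Ec Y) ?a)"
    unfolding \<alpha>_natural[OF cX(1) cY(1) a] using o m tY sm by (simp add: ET.T.Cmp_left_assoc)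
  also have "\<dots> = Cmp T (sE (cor X)) (TF (cor X)) (sr ?EY) ?r (\<alpha> (cor X))"
    unfolding tY(3) su unfolding tX(3)[symmetric] using o m tX(2) sm by (simp add: ET.T.Cmp_left_assoc)
  finally show ?thesis
    using ET.T.iso_cancel(4)[OF \<alpha>_iso[OF cX(1)] o(7,9,12) lr(1)] ET.T.iso_cancel(4)[OF \<alpha>_iso[OF cX(1)] o(7,9,12) lr(2)] by metis
qed

end

section \<open>Cone triangles of the counits and their naturality\<close>

context enhanced_coreflection
begin

definition cone_of :: "'p \<Rightarrow> 'p \<times> 'n \<times> 'n" where
  "cone_of X = (SOME (Z, i, j). is_cone K B (Fc X) X Z (counit X) i j)"

definition apx :: "'p \<Rightarrow> 'p" where "apx X = fst (cone_of X)"
definition inc :: "'p \<Rightarrow> 'n" where "inc X = fst (snd (cone_of X))"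
definition htp :: "'p \<Rightarrow> 'n" where "htp X = snd (snd (cone_of X))"

lemma cone_of:
  assumes X: "X \<in> DObj B"
  shows "is_cone K B (Fc X) X (apx X) (counit X) (inc X) (htp X)"
proof -
  have "\<forall>X\<in>DObj B. \<forall>Y\<in>DObj B. \<forall>f\<in>dcocyc B X Y 0. \<exists>Z i j. is_cone K B X Y Z f i j"
    using ET.A.pretri by (simp add: pretriangulated_def)
  then obtain Z i j where "is_cone K B (Fc X) X Z (counit X) i j"
    using dobj_closed[OF cor(1)[OF X]] X counit(1)[OF X] by blast
  then have "\<exists>d. case d of (Z, i, j) \<Rightarrow> is_cone K B (Fc X) X Z (counit X) i j" by auto
  then have "case cone_of X of (Z, i, j) \<Rightarrow> is_cone K B (Fc X) X Z (counit X) i j"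
    unfolding cone_of_def by (rule someI_ex)
  then show ?thesis by (auto simp: apx_def inc_def htp_def split: prod.splits)
qed

definition nul :: "'o \<times> 'm" where
  "nul = (SOME (N, \<kappa>). N \<in> DObj A \<and> \<kappa> \<in> dmor A N N (-1) \<and> ddif A N N (-1) \<kappa> = DIdn A N)"

lemma nul: "fst nul \<in> DObj A \<and> snd nul \<in> dmor A (fst nul) (fst nul) (-1) \<and> ddif A (fst nul) (fst nul) (-1) (snd nul) = DIdn A (fst nul)"
proof -
  obtain N where N: "N \<in> DObj A" "DIdn A N \<in> dcob A N N 0" using ES.A.pretri by (auto simp: pretriangulated_def)
  then obtain k where "k \<in> dmor A N N (-1)" "ddif A N N (-1) k = DIdn A N" by (auto simp: coboundaries_def)
  with N(1) have "\<exists>d. case d of (N, \<kappa>) \<Rightarrow> N \<in> DObj A \<and> \<kappa> \<in> dmor A N N (-1) \<and> ddif A N N (-1) \<kappa> = DIdn A N" by blast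
  then have "case nul of (N, \<kappa>) \<Rightarrow> N \<in> DObj A \<and> \<kappa> \<in> dmor A N N (-1) \<and> ddif A N N (-1) \<kappa> = DIdn A N"
    unfolding nul_def by (rule someI_ex)
  then show ?thesis by (auto split: prod.splits)
qed

sublocale P: coreflection_cones K A B F V cor counit apx inc htp "fst nul" "snd nul"
proof (intro coreflection_cones.intro coreflection_cones_axioms.intro)
  show "V \<subseteq> DObj A" by (auto simp: V_def)
qed (use nul counit_bij V_sus cor cone_of in \<open>auto intro: dg_functor_between_axioms ES.A.pretriangulated_dg_axioms ET.A.pretriangulated_dg_axioms\<close>)

definition hom :: "'p \<Rightarrow> 'n" where
  "hom X = (SOME h. B.connecting (Fc X) X (apx X) (counit X) (inc X) (htp X) h)"

lemma hom: "X \<in> DObj B \<Longrightarrow> B.connecting (Fc X) X (apx X) (counit X) (inc X) (htp X) (hom X)"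
  unfolding hom_def by (rule someI_ex[OF ET.A.connecting_exists[OF cone_of]])

definition \<beta> :: "'p \<Rightarrow> 'tm" where
  "\<beta> X = ET.cls X (apx X) (inc X)"

text \<open>The class of the connecting morphism ends at the image of the suspension chosen in
  \<open>B\<close>; \<open>Com ET\<close> and the suspension of \<open>\<theta>\<close> carry it on
  to the suspension of \<open>s \<rho> X\<close>.\<close>

definition \<gamma> :: "'p \<Rightarrow> 'tm" where
  "\<gamma> X = Cmp T (fobj ET (apx X)) (sob T (TF (cor X))) (sob T (rE X)) (smap T (TF (cor X)) (rE X) (\<theta> X))
    (Cmp T (fobj ET (apx X)) (fobj ET (sus_obj B (Fc X))) (sob T (TF (cor X))) (Com ET (Fc X))
      (ET.cls (apx X) (sus_obj B (Fc X)) (hom X)))"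

lemma cone_data_closed:
  assumes X: "X \<in> DObj B"
  shows "Fc X \<in> DObj B" "apx X \<in> DObj B" "sus_obj B (Fc X) \<in> DObj B" "inc X \<in> dcocyc B X (apx X) 0"
    "hom X \<in> dcocyc B (apx X) (sus_obj B (Fc X)) 0"
  using dobj_closed[OF cor(1)[OF X]] cone_of[OF X] hom[OF X] ET.A.sus_simps(1)[OF dobj_closed[OF cor(1)[OF X]]]
  unfolding B.is_cone_iff cone_data_def B.connecting_def by (auto simp: dgs)

lemma cone_objects:
  assumes X: "X \<in> DObj B"
  shows "fobj ET X \<in> Obj T" "TF (cor X) \<in> Obj T" "fobj ET (apx X) \<in> Obj T" "fobj ET (sus_obj B (Fc X)) \<in> Obj T" "rE X \<in> Obj T"
    "sob T (TF (cor X)) \<in> Obj T" "sob T (rE X) \<in> Obj T"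
proof -
  interpret TS: linear_functor_between K T T "Sus T" by (rule ET.T.Sus_between)
  show "fobj ET X \<in> Obj T" "TF (cor X) \<in> Obj T" "fobj ET (apx X) \<in> Obj T" "fobj ET (sus_obj B (Fc X)) \<in> Obj T" "rE X \<in> Obj T"
    "sob T (TF (cor X)) \<in> Obj T" "sob T (rE X) \<in> Obj T"
    using X cone_data_closed[OF X] cor[OF X] by (simp_all add: cats)
qed

lemma cone_morphisms:
  assumes X: "X \<in> DObj B"
  shows "smap T (TF (cor X)) (rE X) (\<theta> X) \<in> mor T (sob T (TF (cor X))) (sob T (rE X))"
    "Com ET (Fc X) \<in> mor T (fobj ET (sus_obj B (Fc X))) (sob T (TF (cor X)))"
    "ET.cls (apx X) (sus_obj B (Fc X)) (hom X) \<in> mor T (fobj ET (apx X)) (fobj ET (sus_obj B (Fc X)))"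
    "\<beta> X \<in> mor T (fobj ET X) (fobj ET (apx X))" "\<gamma> X \<in> mor T (fobj ET (apx X)) (sob T (rE X))"
proof -
  interpret TS: linear_functor_between K T T "Sus T" by (rule ET.T.Sus_between)
  note f = cone_data_closed[OF X] and o = cone_objects[OF X]
  show *: "smap T (TF (cor X)) (rE X) (\<theta> X) \<in> mor T (sob T (TF (cor X))) (sob T (rE X))"
    "Com ET (Fc X) \<in> mor T (fobj ET (sus_obj B (Fc X))) (sob T (TF (cor X)))"
    "ET.cls (apx X) (sus_obj B (Fc X)) (hom X) \<in> mor T (fobj ET (apx X)) (fobj ET (sus_obj B (Fc X)))"
    "\<beta> X \<in> mor T (fobj ET X) (fobj ET (apx X))"
    using TS.functor_simps(2)[OF o(2,5) \<theta>(2)[OF X]] inv_mor(1)[OF ET.Com_iso[OF f(1)]] ET.E_mor[OF f(2,3,5)] ET.E_mor[OF X f(2,4)]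
    by (simp_all add: \<beta>_def)
  show "\<gamma> X \<in> mor T (fobj ET (apx X)) (sob T (rE X))"
    unfolding \<gamma>_def using * o by (simp add: ET.T.Cmp_simps(1))
qed

text \<open>The isomorphism from the cone triangle of \<open>counit X\<close> is
  \<open>\<theta> X\<close> on the first vertex and the identity on the other two.\<close>

lemma coreflection_triangle:
  assumes X: "X \<in> DObj B"
  shows "(rE X, fobj ET X, fobj ET (apx X), e (fobj ET X), \<beta> X, \<gamma> X) \<in> Tri T"
proof (rule ET.T.Tri_iso[OF ET.cone_triangle[OF cone_of[OF X] hom[OF X]]])
  note o = cone_objects[OF X] and m = cone_morphisms[OF X]
  show "is_iso T (TF (cor X)) (rE X) (\<theta> X)" by (rule \<theta>(1)[OF X])
  show "is_iso T (fobj ET X) (fobj ET X) (Idn T (fobj ET X))" "is_iso T (fobj ET (apx X)) (fobj ET (apx X)) (Idn T (fobj ET (apx X)))"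
    using ET.T.is_iso_Idn o by auto
  show "Cmp T (TF (cor X)) (fobj ET X) (fobj ET X) (Idn T (fobj ET X)) (ET.cls (Fc X) X (counit X))
     = Cmp T (TF (cor X)) (rE X) (fobj ET X) (e (fobj ET X)) (\<theta> X)"
    unfolding counit(2)[OF X] using o \<theta>(2)[OF X] e_mor[OF o(1)] by (simp add: ET.T.Cmp_Idn_left ET.T.Cmp_simps(1))
  show "Cmp T (fobj ET X) (fobj ET (apx X)) (fobj ET (apx X)) (Idn T (fobj ET (apx X))) (ET.cls X (apx X) (inc X))
     = Cmp T (fobj ET X) (fobj ET X) (fobj ET (apx X)) (\<beta> X) (Idn T (fobj ET X))"
    using o m(4) by (simp add: \<beta>_def ET.T.Cmp_Idn_left ET.T.Cmp_Idn_right)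
  show "Cmp T (fobj ET (apx X)) (sob T (TF (cor X))) (sob T (rE X)) (smap T (TF (cor X)) (rE X) (\<theta> X))
      (Cmp T (fobj ET (apx X)) (fobj ET (sus_obj B (Fc X))) (sob T (TF (cor X))) (Com ET (Fc X)) (ET.cls (apx X) (sus_obj B (Fc X)) (hom X)))
    = Cmp T (fobj ET (apx X)) (fobj ET (apx X)) (sob T (rE X)) (\<gamma> X) (Idn T (fobj ET (apx X)))"
    using o m(5) unfolding \<gamma>_def[symmetric] by (simp add: ET.T.Cmp_Idn_right)
qed (use cone_objects[OF X] cone_morphisms[OF X] e_mor in simp_all)

text \<open>Naturality is obtained for morphisms of cones, whose homotopies supply what a morphism
  of \<open>X\<close> alone lacks. It becomes naturality on \<open>T\<close> once
  \<open>base\<close> is inverted on H^0.\<close>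

lemma coreflection_natural:
  assumes X: "X \<in> DObj B" "Y \<in> DObj B" and h: "h \<in> dcocyc P.cones X Y 0"
  shows "Cmp T (fobj ET X) (fobj ET (apx X)) (fobj ET (apx Y)) (ET.cls (apx X) (apx Y) (dmap P.apex X Y 0 h)) (\<beta> X)
      = Cmp T (fobj ET X) (fobj ET Y) (fobj ET (apx Y)) (\<beta> Y) (ET.cls X Y (dmap P.base X Y 0 h))"
    and "Cmp T (fobj ET (apx X)) (fobj ET (apx Y)) (sob T (rE Y)) (\<gamma> Y) (ET.cls (apx X) (apx Y) (dmap P.apex X Y 0 h))
      = Cmp T (fobj ET (apx X)) (sob T (rE X)) (sob T (rE Y))
          (smap T (rE X) (rE Y) (fmap s (rT X) (rT Y) (fmap \<rho> (fobj ET X) (fobj ET Y) (ET.cls X Y (dmap P.base X Y 0 h))))) (\<gamma> X)"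
proof -
  interpret TS: linear_functor_between K T T "Sus T" by (rule ET.T.Sus_between)
  note fX = cone_data_closed[OF X(1)] and fY = cone_data_closed[OF X(2)] and oX = cone_objects[OF X(1)] and oY = cone_objects[OF X(2)] and mX = cone_morphisms[OF X(1)] and mY = cone_morphisms[OF X(2)]
    and cX = cor[OF X(1)] and cY = cor[OF X(2)]
  let ?FX = "Fc X" and ?FY = "Fc Y" and ?SX = "sus_obj B (Fc X)" and ?SY = "sus_obj B (Fc Y)"
  define x where "x = dmap P.base X Y 0 h"
  define z where "z = dmap P.apex X Y 0 h"
  obtain a where a: "a \<in> dcocyc A (cor X) (cor Y) 0"
    and eq1: "dcls B ?FX Y (DCmp B ?FX ?FY Y 0 0 (counit Y) (dmap F (cor X) (cor Y) 0 a)) = dcls B ?FX Y (DCmp B ?FX X Y 0 0 x (counit X))"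
    and eq2: "dcls B X (apx Y) (DCmp B X (apx X) (apx Y) 0 0 z (inc X)) = dcls B X (apx Y) (DCmp B X Y (apx Y) 0 0 (inc Y) x)"
    and eq3: "dcls B (apx X) ?SY (DCmp B (apx X) (apx Y) ?SY 0 0 (hom Y) z)
      = dcls B (apx X) ?SY (DCmp B (apx X) ?SX ?SY 0 0 (ET.A.sus_mor ?FX ?FY (dmap F (cor X) (cor Y) 0 a)) (hom X))"
    using P.cones_morphism[OF X h hom[OF X(1)] hom[OF X(2)]] unfolding x_def z_def by blast
  have x: "x \<in> dcocyc B X Y 0" and z: "z \<in> dcocyc B (apx X) (apx Y) 0"
    using dg_functor_between.dmap_dcocyc[OF P.base_dg_functor _ _ h] dg_functor_between.dmap_dcocyc[OF P.apex_dg_functor _ _ h] X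
    unfolding x_def z_def by simp_all
  have Fa: "dmap F (cor X) (cor Y) 0 a \<in> dcocyc B ?FX ?FY 0" by (rule dmap_dcocyc[OF cX(1) cY(1) a])
  let ?sa = "ET.A.sus_mor ?FX ?FY (dmap F (cor X) (cor Y) 0 a)"
  have sa: "?sa \<in> dcocyc B ?SX ?SY 0" by (rule ET.A.sus_mor_dcocyc[OF fX(1) fY(1) Fa])
  have m: "ET.cls X Y x \<in> mor T (fobj ET X) (fobj ET Y)" "ET.cls (apx X) (apx Y) z \<in> mor T (fobj ET (apx X)) (fobj ET (apx Y))"
    "ET.cls ?FX ?FY (dmap F (cor X) (cor Y) 0 a) \<in> mor T (TF (cor X)) (TF (cor Y))" "ET.cls ?SX ?SY ?sa \<in> mor T (fobj ET ?SX) (fobj ET ?SY)"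
    using ET.E_mor[OF X x] ET.E_mor[OF fX(2) fY(2) z] ET.E_mor[OF fX(1) fY(1) Fa] ET.E_mor[OF fX(3) fY(3) sa] by auto
  have "Cmp T (fobj ET X) (fobj ET (apx X)) (fobj ET (apx Y)) (ET.cls (apx X) (apx Y) z) (\<beta> X) = Cmp T (fobj ET X) (fobj ET Y) (fobj ET (apx Y)) (\<beta> Y) (ET.cls X Y x)"
    unfolding \<beta>_def ET.E_Cmp[OF X(1) fX(2) fY(2) fX(4) z, symmetric] ET.E_Cmp[OF X fY(2) x fY(4), symmetric] eq2 ..
  then show "Cmp T (fobj ET X) (fobj ET (apx X)) (fobj ET (apx Y)) (ET.cls (apx X) (apx Y) (dmap P.apex X Y 0 h)) (\<beta> X)
      = Cmp T (fobj ET X) (fobj ET Y) (fobj ET (apx Y)) (\<beta> Y) (ET.cls X Y (dmap P.base X Y 0 h))"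
    unfolding x_def z_def .
  let ?rx = "fmap s (rT X) (rT Y) (fmap \<rho> (fobj ET X) (fobj ET Y) (ET.cls X Y x))"
  have rx: "?rx \<in> mor T (rE X) (rE Y)"
    using s.functor_simps(2) \<rho>.functor_simps m(1) oX oY by simp
  have Sm: "smap T (TF (cor X)) (TF (cor Y)) (ET.cls ?FX ?FY (dmap F (cor X) (cor Y) 0 a)) \<in> mor T (sob T (TF (cor X))) (sob T (TF (cor Y)))"
    "smap T (rE X) (rE Y) ?rx \<in> mor T (sob T (rE X)) (sob T (rE Y))"
    using TS.functor_simps(2) oX oY m rx by simp_all
  note ty = oX oY mX mY m Sm
  have "Cmp T (fobj ET (apx X)) (fobj ET (apx Y)) (sob T (rE Y)) (\<gamma> Y) (ET.cls (apx X) (apx Y) z)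
     = Cmp T (fobj ET (apx X)) (sob T (TF (cor Y))) (sob T (rE Y)) (smap T (TF (cor Y)) (rE Y) (\<theta> Y))
       (Cmp T (fobj ET (apx X)) (fobj ET ?SY) (sob T (TF (cor Y))) (Com ET ?FY)
         (Cmp T (fobj ET (apx X)) (fobj ET (apx Y)) (fobj ET ?SY) (ET.cls (apx Y) ?SY (hom Y)) (ET.cls (apx X) (apx Y) z)))"
    unfolding \<gamma>_def using ty by (simp add: ET.T.Cmp_left_assoc ET.T.Cmp_simps(1))
  also have "Cmp T (fobj ET (apx X)) (fobj ET (apx Y)) (fobj ET ?SY) (ET.cls (apx Y) ?SY (hom Y)) (ET.cls (apx X) (apx Y) z)
     = Cmp T (fobj ET (apx X)) (fobj ET ?SX) (fobj ET ?SY) (ET.cls ?SX ?SY ?sa) (ET.cls (apx X) ?SX (hom X))"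
    unfolding ET.E_Cmp[OF fX(2) fY(2,3) z fY(5), symmetric] eq3 ET.E_Cmp[OF fX(2,3) fY(3) fX(5) sa] ..
  also have "Cmp T (fobj ET (apx X)) (fobj ET ?SY) (sob T (TF (cor Y))) (Com ET ?FY) \<dots>
     = Cmp T (fobj ET (apx X)) (fobj ET ?SX) (sob T (TF (cor Y))) (Cmp T (fobj ET ?SX) (fobj ET ?SY) (sob T (TF (cor Y))) (Com ET ?FY) (ET.cls ?SX ?SY ?sa)) (ET.cls (apx X) ?SX (hom X))"
    using ty by (simp add: ET.T.Cmp_left_assoc)
  also have "\<dots> = Cmp T (fobj ET (apx X)) (sob T (TF (cor X))) (sob T (TF (cor Y))) (smap T (TF (cor X)) (TF (cor Y)) (ET.cls ?FX ?FY (dmap F (cor X) (cor Y) 0 a)))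
       (Cmp T (fobj ET (apx X)) (fobj ET ?SX) (sob T (TF (cor X))) (Com ET ?FX) (ET.cls (apx X) ?SX (hom X)))"
    unfolding ET.Com_natural[OF fX(1) fY(1) Fa] using ty by (simp add: ET.T.Cmp_left_assoc)
  also have "Cmp T (fobj ET (apx X)) (sob T (TF (cor Y))) (sob T (rE Y)) (smap T (TF (cor Y)) (rE Y) (\<theta> Y)) \<dots>
     = Cmp T (fobj ET (apx X)) (sob T (TF (cor X))) (sob T (rE Y)) (Cmp T (sob T (TF (cor X))) (sob T (TF (cor Y))) (sob T (rE Y)) (smap T (TF (cor Y)) (rE Y) (\<theta> Y))
        (smap T (TF (cor X)) (TF (cor Y)) (ET.cls ?FX ?FY (dmap F (cor X) (cor Y) 0 a))))
       (Cmp T (fobj ET (apx X)) (fobj ET ?SX) (sob T (TF (cor X))) (Com ET ?FX) (ET.cls (apx X) ?SX (hom X)))"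
    using ty by (simp add: ET.T.Cmp_left_assoc ET.T.Cmp_simps(1))
  also have "Cmp T (sob T (TF (cor X))) (sob T (TF (cor Y))) (sob T (rE Y)) (smap T (TF (cor Y)) (rE Y) (\<theta> Y))
        (smap T (TF (cor X)) (TF (cor Y)) (ET.cls ?FX ?FY (dmap F (cor X) (cor Y) 0 a)))
     = smap T (TF (cor X)) (rE Y) (Cmp T (TF (cor X)) (TF (cor Y)) (rE Y) (\<theta> Y) (ET.cls ?FX ?FY (dmap F (cor X) (cor Y) 0 a)))"
    by (rule TS.functor_simps(4)[OF oX(2) oY(2,5) m(3) \<theta>(2)[OF X(2)], symmetric])
  also have "\<dots> = Cmp T (sob T (TF (cor X))) (sob T (rE X)) (sob T (rE Y)) (smap T (rE X) (rE Y) ?rx) (smap T (TF (cor X)) (rE X) (\<theta> X))"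
    unfolding \<theta>_natural[OF X a x eq1] by (rule TS.functor_simps(4)[OF oX(2,5) oY(5) \<theta>(2)[OF X(1)] rx])
  also have "Cmp T (fobj ET (apx X)) (sob T (TF (cor X))) (sob T (rE Y)) \<dots>
       (Cmp T (fobj ET (apx X)) (fobj ET ?SX) (sob T (TF (cor X))) (Com ET ?FX) (ET.cls (apx X) ?SX (hom X)))
     = Cmp T (fobj ET (apx X)) (sob T (rE X)) (sob T (rE Y)) (smap T (rE X) (rE Y) ?rx) (\<gamma> X)"
    unfolding \<gamma>_def using ty by (simp add: ET.T.Cmp_left_assoc ET.T.Cmp_simps(1))
  finally show "Cmp T (fobj ET (apx X)) (fobj ET (apx Y)) (sob T (rE Y)) (\<gamma> Y) (ET.cls (apx X) (apx Y) (dmap P.apex X Y 0 h))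
      = Cmp T (fobj ET (apx X)) (sob T (rE X)) (sob T (rE Y))
          (smap T (rE X) (rE Y) (fmap s (rT X) (rT Y) (fmap \<rho> (fobj ET X) (fobj ET Y) (ET.cls X Y (dmap P.base X Y 0 h))))) (\<gamma> X)"
    unfolding x_def z_def .
qed

end

section \<open>The functors on \<open>T\<close> and their functorial triangles\<close>

context enhanced_coreflection
begin

text \<open>\<open>Q\<close> and \<open>J\<close> are parameters because \<open>Q\<close> will be
  the category of cones itself in the linear case and its small model in the enhanced case.\<close>

lemma base_equivalence:
  assumes J: "dg_functor_between K Q P.cones J" "DObj B \<subseteq> dobj J ` DObj Q"
    and bij: "\<And>p q. p \<in> DObj Q \<Longrightarrow> q \<in> DObj Q \<Longrightarrow>
      cohom_surj (DHom Q p q) (DHom B (dobj J p) (dobj J q)) (dmap (dg_comp P.base J) p q) 0 \<and>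
      cohom_inj (DHom Q p q) (DHom B (dobj J p) (dobj J q)) (dmap (dg_comp P.base J) p q) 0"
    and E: "fobj E = fobj (func_comp ET (H0func Q B (dg_comp P.base J)))" "fmap E = fmap (func_comp ET (H0func Q B (dg_comp P.base J)))"
  shows "linear_equivalence K (H0 K Q) T E"
proof -
  let ?w = "dg_comp P.base J"
  interpret w: dg_functor_between K Q B ?w by (rule dg_functor_comp[OF J(1) P.base_dg_functor])
  have wo: "dobj ?w p = dobj J p" for p by (simp add: dg_comp_def)
  have b: "bij_betw (fmap (H0func Q B ?w) p q) (mor (H0 K Q) p q) (mor (H0 K B) (dobj J p) (dobj J q))"
    if "p \<in> DObj Q" "q \<in> DObj Q" for p q
    using w.H0func_bij[OF that] bij[OF that] by (simp add: wo)
  have lin: "linear_functor K (H0 K Q) T E"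
    using linear_functor_comp[OF w.H0func_linear ET.is_linear] E by (subst linear_functor_cong[of _ "func_comp ET (H0func Q B ?w)"]) auto
  have Eo: "fobj E p = fobj ET (dobj J p)" for p by (simp add: E wo)
  have Em: "fmap E p q c = fmap ET (dobj J p) (dobj J q) (fmap (H0func Q B ?w) p q c)" for p q c by (simp add: E wo)
  have Jo: "dobj J p \<in> DObj B" if "p \<in> DObj Q" for p using w.dobj_closed[OF that] by (simp add: wo)
  interpret E: linear_functor_between K "H0 K Q" T E
    by (rule linear_functor_betweenI[OF w.A.H0_linear_category ET.T.linear_category_axioms lin])
  show ?thesis
  proof
    fix p q g assume p: "p \<in> Obj (H0 K Q)" "q \<in> Obj (H0 K Q)" and g: "g \<in> mor T (fobj E p) (fobj E q)"
    obtain d where d: "d \<in> mor (H0 K B) (dobj J p) (dobj J q)" "fmap ET (dobj J p) (dobj J q) d = g"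
      using ET.full[of "dobj J p" "dobj J q" g] p g Jo by (auto simp: Eo)
    have pQ: "p \<in> DObj Q" "q \<in> DObj Q" using p by simp_all
    have "d \<in> fmap (H0func Q B ?w) p q ` mor (H0 K Q) p q"
      by (subst bij_betw_imp_surj_on[OF b[OF pQ]]) (rule d(1))
    then obtain c where "c \<in> mor (H0 K Q) p q" "fmap (H0func Q B ?w) p q c = d" by blast
    then show "\<exists>f\<in>mor (H0 K Q) p q. fmap E p q f = g" using d by (auto simp: Em)
  next
    fix p q f f' assume p: "p \<in> Obj (H0 K Q)" "q \<in> Obj (H0 K Q)" and f: "f \<in> mor (H0 K Q) p q" "f' \<in> mor (H0 K Q) p q"
      and eq: "fmap E p q f = fmap E p q f'"
    have b': "bij_betw (fmap (H0func Q B ?w) p q) (mor (H0 K Q) p q) (mor (H0 K B) (dobj J p) (dobj J q))" using b p by simp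
    have "fmap (H0func Q B ?w) p q f = fmap (H0func Q B ?w) p q f'"
      using ET.faithful[of "dobj J p" "dobj J q"] eq p Jo bij_betwE[OF b'] f by (simp add: Em)
    then show "f = f'" using b' f unfolding bij_betw_def inj_on_def by blast
  next
    fix X assume "X \<in> Obj T"
    then obtain Y b where Y: "Y \<in> DObj B" "is_iso T (fobj ET Y) X b" using ET.ess_surj[of X] by auto
    then obtain p where "p \<in> DObj Q" "Y = dobj J p" using J(2) by blast
    then show "\<exists>p\<in>Obj (H0 K Q). \<exists>b. is_iso T (fobj E p) X b" using Y by (auto simp: Eo)
  qed
qed

text \<open>The functors are fixed only through \<open>fobj\<close> and \<open>fmap\<close>, so the
  lemma serves plain functors and triangle functors with their additional field \<open>Com\<close>
  alike.\<close>

lemma coreflection_functorial: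
  assumes J: "dg_functor_between K Q P.cones J"
    and lE: "linear_equivalence K (H0 K Q) T E"
    and E: "fobj E = fobj (func_comp ET (H0func Q B (dg_comp P.base J)))" "fmap E = fmap (func_comp ET (H0func Q B (dg_comp P.base J)))"
    and H: "fobj H = fobj (func_comp ET (H0func Q B (dg_comp P.apex J)))" "fmap H = fmap (func_comp ET (H0func Q B (dg_comp P.apex J)))"
    and t: "fobj t = fobj (func_comp H (linear_equivalence.quasi_inverse (H0 K Q) T E))" "fmap t = fmap (func_comp H (linear_equivalence.quasi_inverse (H0 K Q) T E))"
  shows "\<exists>\<beta> \<gamma>. functorial_triangle T T (func_comp s \<rho>) idf t e \<beta> \<gamma>"
proof -
  interpret J: dg_functor_between K Q P.cones J by fact
  interpret w: dg_functor_between K Q B "dg_comp P.base J" by (rule dg_functor_comp[OF J P.base_dg_functor])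
  interpret u: dg_functor_between K Q B "dg_comp P.apex J" by (rule dg_functor_comp[OF J P.apex_dg_functor])
  have o: "dobj (dg_comp P.base J) p = dobj J p" "dobj (dg_comp P.apex J) p = apx (dobj J p)" for p by (simp_all add: dg_comp_def)
  have Eo: "fobj E p = fobj ET (dobj J p)" "fobj H p = fobj ET (apx (dobj J p))" for p by (simp_all add: E H o)
  have Em: "fmap E p q (dcls Q p q h) = ET.cls (dobj J p) (dobj J q) (dmap P.base (dobj J p) (dobj J q) 0 (dmap J p q 0 h))"
    "fmap H p q (dcls Q p q h) = ET.cls (apx (dobj J p)) (apx (dobj J q)) (dmap P.apex (dobj J p) (dobj J q) 0 (dmap J p q 0 h))"
    if "p \<in> DObj Q" "q \<in> DObj Q" "h \<in> dcocyc Q p q 0" for p q h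
    using w.H0func_map[OF that] u.H0func_map[OF that] by (simp_all add: E H o) (simp_all add: dg_comp_def)
  have Jo: "dobj J p \<in> DObj B" if "p \<in> DObj Q" for p using w.dobj_closed[OF that] by (simp add: o)
  have Jh: "dmap J p q 0 h \<in> dcocyc P.cones (dobj J p) (dobj J q) 0" if "p \<in> DObj Q" "q \<in> DObj Q" "h \<in> dcocyc Q p q 0" for p q h
    by (rule J.dmap_dcocyc[OF that])
  have lin: "linear_functor K (H0 K Q) T H"
    using linear_functor_comp[OF u.H0func_linear ET.is_linear] H by (subst linear_functor_cong[of _ "func_comp ET (H0func Q B (dg_comp P.apex J))"]) auto
  show ?thesis
  proof (rule functorial_triangle_descent[OF lE ET.T.triangulated_category_axioms lin is_functor_comp[OF \<rho> s] e _ _ _ t])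
    show "nat_trans (H0 K Q) T E H (\<lambda>p. \<beta> (dobj J p))"
      unfolding nat_trans_def using cone_morphisms(4)[OF Jo] coreflection_natural(1)[OF Jo Jo Jh]
      by (auto simp: Eo Em J.A.H0_mor simp del: J.A.dcocyc_iff)
    show "nat_trans (H0 K Q) T H (func_comp (Sus T) (func_comp (func_comp s \<rho>) E)) (\<lambda>p. \<gamma> (dobj J p))"
      unfolding nat_trans_def using cone_morphisms(5)[OF Jo] coreflection_natural(2)[OF Jo Jo Jh]
      by (auto simp: Eo Em J.A.H0_mor simp del: J.A.dcocyc_iff)
    show "(fobj (func_comp s \<rho>) (fobj E p), fobj E p, fobj H p, e (fobj E p), \<beta> (dobj J p), \<gamma> (dobj J p)) \<in> Tri T" if "p \<in> Obj (H0 K Q)" for p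
      using coreflection_triangle[OF Jo] that by (simp add: Eo)
  qed
qed

text \<open>Bijectivity of \<open>base\<close> on H^0 is enough to invert it, so closure of
  \<open>U\<close> under suspension suffices. No roof is claimed here, and \<open>J\<close> is the
  identity.\<close>

lemma linear_cone_functor:
  "\<exists>(t :: ('to, 'tm, 'to, 'tm) func) \<beta> \<gamma>. linear_functor K T T t \<and> functorial_triangle T T (func_comp s \<rho>) idf t e \<beta> \<gamma>"
proof -
  let ?J = "\<lparr>dobj = (\<lambda>X. X), dmap = (\<lambda>X Y n f. f)\<rparr>"
  let ?w = "dg_comp P.base ?J" and ?u = "dg_comp P.apex ?J"
  let ?E = "func_comp ET (H0func P.cones B ?w)" and ?H = "func_comp ET (H0func P.cones B ?u)"
  interpret c: dg_functor_between K P.cones B P.base by (rule P.base_dg_functor)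
  have J: "dg_functor_between K P.cones P.cones ?J"
    by (intro dg_functor_between.intro c.A.dg_category_axioms dg_functor_between_axioms.intro dg_functor_idf)
  have w: "dmap ?w = dmap P.base" by (intro ext) (simp add: dg_comp_def)
  have lE: "linear_equivalence K (H0 K P.cones) T ?E"
    by (rule base_equivalence[OF J]) (simp_all add: w P.base_quasi[unfolded P.cones_sel])
  interpret E: linear_equivalence K "H0 K P.cones" T ?E by (rule lE)
  interpret u: dg_functor_between K P.cones B ?u by (rule dg_functor_comp[OF J P.apex_dg_functor])
  let ?t = "func_comp ?H E.quasi_inverse"
  have "linear_functor K T T ?t"
    by (intro linear_functor_comp[OF E.quasi_inverse_linear] linear_functor_comp[OF u.H0func_linear ET.is_linear])
  moreover have "\<exists>\<beta> \<gamma>. functorial_triangle T T (func_comp s \<rho>) idf ?t e \<beta> \<gamma>"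
    by (rule coreflection_functorial[OF J lE refl refl refl refl refl refl])
  ultimately show ?thesis by blast
qed

text \<open>The roof consists of \<open>base\<close> and \<open>apex\<close> restricted to
  \<open>Q\<close>. Pretriangulatedness of \<open>Q\<close> is reflected from \<open>B\<close>, both
  legs induce triangle functors on \<open>H0\<close>, and descent along the left leg yields
  \<open>t\<close> with the isomorphism that \<open>induced_by\<close> demands.\<close>

lemma triangle_cone_functor_model:
  fixes Q :: "(('k, 'p, 'n) roomy, ('k, 'p, 'n) roomy, 'k) dg_cat"
  assumes J: "dg_functor_between K Q P.cones J" and Jo: "dobj J ` DObj Q = DObj B"
    and q: "\<And>p q n. p \<in> DObj Q \<Longrightarrow> q \<in> DObj Q \<Longrightarrow>
      cohom_surj (DHom Q p q) (DHom B (dobj J p) (dobj J q)) (dmap (dg_comp P.base J) p q) n \<and>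
      cohom_inj (DHom Q p q) (DHom B (dobj J p) (dobj J q)) (dmap (dg_comp P.base J) p q) n"
  shows "\<exists>(t :: ('to, 'tm, 'to, 'tm) tri_func) \<beta> \<gamma>. triangle_functor K T T t \<and> admits_dg_enhancement K T T B ET B ET t \<and>
    functorial_triangle T T (func_comp s \<rho>) idf t e \<beta> \<gamma>"
proof -
  let ?w = "dg_comp P.base J" and ?u = "dg_comp P.apex J"
  have wo: "dobj ?w p = dobj J p" for p by (simp add: dg_comp_def)
  interpret w: dg_functor_between K Q B ?w by (rule dg_functor_comp[OF J P.base_dg_functor])
  interpret u: dg_functor_between K Q B ?u by (rule dg_functor_comp[OF J P.apex_dg_functor])
  interpret w: surjective_quasi_equivalence K Q B ?w
  proof (intro surjective_quasi_equivalence.intro surjective_quasi_equivalence_axioms.intro w.dg_functor_between_axioms)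
    fix p q' n assume "p \<in> DObj Q" "q' \<in> DObj Q"
    then show "cohom_surj (DHom Q p q') (DHom B (dobj ?w p) (dobj ?w q')) (dmap ?w p q') n \<and> cohom_inj (DHom Q p q') (DHom B (dobj ?w p) (dobj ?w q')) (dmap ?w p q') n"
      unfolding wo by (rule q)
  next
    fix Y assume "Y \<in> DObj B"
    then obtain p where "p \<in> DObj Q" "Y = dobj J p" unfolding Jo[symmetric] by (rule imageE)
    then show "\<exists>p\<in>DObj Q. dobj ?w p = Y" by (auto simp: wo)
  qed
  \<comment> \<open>\<open>Q\<close> receives no cones by construction; they are lifted from
    \<open>B\<close> along the left leg.\<close>
  have pQ: "pretriangulated K Q" by (rule w.reflects_pretriangulated[OF ET.A.pretri])
  interpret Q: pretriangulated_dg K Q by unfold_locales (rule pQ)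
  interpret w: pretriangulated_dg_functor K Q B ?w
    by (intro pretriangulated_dg_functor.intro w.dg_functor_between_axioms Q.pretriangulated_dg_axioms ET.A.pretriangulated_dg_axioms)
  interpret u: pretriangulated_dg_functor K Q B ?u
    by (intro pretriangulated_dg_functor.intro u.dg_functor_between_axioms Q.pretriangulated_dg_axioms ET.A.pretriangulated_dg_axioms)
  define E where "E = tcomp (H0 K Q) (H0 K B) T ET (H0func Q B ?w)"
  define H where "H = tcomp (H0 K Q) (H0 K B) T ET (H0func Q B ?u)"
  have sel: "fobj E = fobj (func_comp ET (H0func Q B ?w))" "fmap E = fmap (func_comp ET (H0func Q B ?w))"
    "fobj H = fobj (func_comp ET (H0func Q B ?u))" "fmap H = fmap (func_comp ET (H0func Q B ?u))"
    by (simp_all add: tcomp_def E_def H_def)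
  have lE: "linear_equivalence K (H0 K Q) T E"
    by (rule base_equivalence[OF J equalityD2[OF Jo] q sel(1,2)])
  interpret E: linear_equivalence K "H0 K Q" T E by (rule lE)
  have tE: "triangle_functor K (H0 K Q) T E" and tH: "triangle_functor K (H0 K Q) T H"
    using tcomp_triangle_functor[OF w.A.H0_linear_category B.H0_linear_category ET.T.linear_category_axioms Q.H0_Sus_functor ET.A.H0_Sus_functor
      functor_between.is_functor[OF linear_functor_between.axioms(1)[OF ET.T.Sus_between]] _ ET.triangle Q.H0_Tri_mor]
      w.H0func_triangle u.H0func_triangle unfolding E_def H_def by blast+
  interpret D: triangle_descent K "H0 K Q" T E H
    by (intro triangle_descent.intro triangle_descent_axioms.intro lE ET.T.triangulated_category_axioms tE tH Q.H0_Sus_functor Q.H0_Tri_mor Q.H0_cone)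
  obtain t \<zeta> where t: "fobj t = fobj (func_comp H E.quasi_inverse)" "fmap t = fmap (func_comp H E.quasi_inverse)"
    "triangle_functor K T T t" "triangle_iso (H0 K Q) T (tcomp (H0 K Q) T T t E) H \<zeta>"
    using D.descent by blast
  have "\<exists>\<beta> \<gamma>. functorial_triangle T T (func_comp s \<rho>) idf t e \<beta> \<gamma>"
    by (rule coreflection_functorial[OF J lE sel t(1,2)])
  moreover have "admits_dg_enhancement K T T B ET B ET t"
    unfolding admits_dg_enhancement_def
  proof (intro exI conjI)
    show "pretriangulated K Q" by (rule pQ)
    show "quasi_equivalence K Q B ?w"
      unfolding quasi_equivalence_def
    proof (intro conjI ballI)
      show "dg_functor K Q B ?w" by (rule w.dg_functor)
      show "quasi_iso K (DHom Q p q) (DHom B (dobj ?w p) (dobj ?w q)) (dmap ?w p q)" if "p \<in> DObj Q" "q \<in> DObj Q" for p q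
        using complex_map.quasi_iso_iff[OF w.dmap_complex_map[OF that]] q[OF that] by (simp add: wo)
      show "\<exists>p\<in>DObj Q. \<exists>c. is_iso (H0cat B) (dobj ?w p) Y c" if Y: "Y \<in> DObj B" for Y
      proof -
        interpret H: linear_category K "H0cat B" by (rule B.H0cat_linear_category)
        obtain p where p: "Y = dobj J p" "p \<in> DObj Q" using Y unfolding Jo[symmetric] by (rule imageE)
        have "is_iso (H0cat B) Y Y (Idn (H0cat B) Y)" using Y by (intro H.is_iso_Idn) simp
        then show ?thesis using p unfolding wo by blast
      qed
    qed
    show "induced_by K T T Q (tcomp (H0 K Q) (H0 K B) T ET (H0func Q B ?w)) B ET t ?u"
      unfolding induced_by_def using u.dg_functor t(4) unfolding E_def H_def by blast
  qed
  ultimately show ?thesis using t(3) by blast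
qed

text \<open>Morphisms of cones contain morphisms of \<open>A\<close>, whose type does not occur in
  \<open>roomy\<close> over \<open>B\<close>. The left leg \<open>base\<close> is injective on
  objects and quasi-fully faithful, which is what the small model requires.\<close>

lemma triangle_cone_functor:
  assumes all: "U = Obj S"
  shows "\<exists>(t :: ('to, 'tm, 'to, 'tm) tri_func) \<beta> \<gamma>. triangle_functor K T T t \<and> admits_dg_enhancement K T T B ET B ET t \<and>
    functorial_triangle T T (func_comp s \<rho>) idf t e \<beta> \<gamma>"
proof -
  \<comment> \<open>All objects of \<open>A\<close> are now admissible test objects, which opens all
    degrees in \<open>base_quasi\<close>.\<close>
  have V: "V = DObj A" using ES.E_obj all V_def by blast
  interpret c: dg_functor_between K P.cones B P.base by (rule P.base_dg_functor)
  interpret c: injective_dg_functor K P.cones B P.base by unfold_locales (simp add: inj_on_def)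
  let ?Q = "c.small_model" and ?J = "c.small_model_incl"
  let ?w = "dg_comp P.base ?J"
  have J: "dg_functor_between K ?Q P.cones ?J" by (rule c.small_model_incl_dg_functor)
  have Jo: "dobj ?J ` DObj ?Q = DObj B" using c.small_model_incl_obj by simp
  have wo: "dobj ?w p = dobj ?J p" for p by (simp add: dg_comp_def)
  have q: "cohom_surj (DHom ?Q p q) (DHom B (dobj ?J p) (dobj ?J q)) (dmap ?w p q) n \<and> cohom_inj (DHom ?Q p q) (DHom B (dobj ?J p) (dobj ?J q)) (dmap ?w p q) n"
    if "p \<in> DObj ?Q" "q \<in> DObj ?Q" for p q n
    using c.small_model_quasi[OF _ that, of n] P.base_quasi[unfolded P.cones_sel] V by (simp add: wo)
  show ?thesis by (rule triangle_cone_functor_model[OF J Jo q])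
qed

end

section \<open>Adjunctions\<close>

text \<open>Existence is the transpose of \<open>g\<close>, uniqueness the second triangle identity.
  In this form the adjunction can be composed with the truncation and restricted to test objects in
  an aisle.\<close>

lemma adjunction_universal:
  assumes "linear_category K C" "linear_category K D" and adj: "adjunction C D F G \<eta> \<epsilon>"
    and o: "A \<in> Obj C" "X \<in> Obj D" and g: "g \<in> mor D (fobj F A) X"
  shows "\<exists>!a. a \<in> mor C A (fobj G X) \<and> Cmp D (fobj F A) (fobj F (fobj G X)) X (\<epsilon> X) (fmap F A (fobj G X) a) = g"
proof -
  note adj = adj[unfolded adjunction_def Let_def]
  interpret F: functor_between K C D F by (rule functor_betweenI) (use assms adj in auto)
  interpret G: functor_between K D C G by (rule functor_betweenI) (use assms adj in auto)
  have \<eta>: "nat_trans C C idf (func_comp G F) \<eta>" and \<epsilon>: "nat_trans D D (func_comp F G) idf \<epsilon>" using adj by auto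
  have t1: "Cmp D (fobj F A) (fobj F (fobj G (fobj F A))) (fobj F A) (\<epsilon> (fobj F A)) (fmap F A (fobj G (fobj F A)) (\<eta> A)) = Idn D (fobj F A)"
    and t2: "Cmp C (fobj G X) (fobj G (fobj F (fobj G X))) (fobj G X) (fmap G (fobj F (fobj G X)) X (\<epsilon> X)) (\<eta> (fobj G X)) = Idn C (fobj G X)"
    using adj o by auto
  let ?FA = "fobj F A" and ?GFA = "fobj G (fobj F A)" and ?GX = "fobj G X" and ?FGX = "fobj F (fobj G X)" and ?FGFA = "fobj F (fobj G (fobj F A))" and ?GFGX = "fobj G (fobj F (fobj G X))"
  have oo: "?FA \<in> Obj D" "?GFA \<in> Obj C" "?GX \<in> Obj C" "?FGX \<in> Obj D" "?FGFA \<in> Obj D" "?GFGX \<in> Obj C" using o by (simp_all add: cats)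
  have m: "\<eta> A \<in> mor C A ?GFA" "\<epsilon> X \<in> mor D ?FGX X" "\<eta> ?GX \<in> mor C ?GX ?GFGX" "\<epsilon> ?FA \<in> mor D ?FGFA ?FA"
    using nat_transD(1)[OF \<eta>] nat_transD(1)[OF \<epsilon>] o oo by auto
  have Gm: "fmap G ?FA X g \<in> mor C ?GFA ?GX" "fmap G ?FGX X (\<epsilon> X) \<in> mor C ?GFGX ?GX" "fmap F A ?GFA (\<eta> A) \<in> mor D ?FA ?FGFA"
    using G.functor_simps(2) F.functor_simps(2) o oo m g by simp_all
  have FGm: "fmap F ?GFA ?GX (fmap G ?FA X g) \<in> mor D ?FGFA ?FGX" using F.functor_simps(2) oo Gm by simp
  show ?thesis
  proof (rule ex1I[of _ "Cmp C A ?GFA ?GX (fmap G ?FA X g) (\<eta> A)"], intro conjI)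
    show "Cmp C A ?GFA ?GX (fmap G ?FA X g) (\<eta> A) \<in> mor C A ?GX" using o oo m Gm by (simp add: F.C.Cmp_simps(1))
    have "Cmp D ?FA ?FGX X (\<epsilon> X) (fmap F A ?GX (Cmp C A ?GFA ?GX (fmap G ?FA X g) (\<eta> A)))
      = Cmp D ?FA ?FGFA X (Cmp D ?FGFA ?FGX X (\<epsilon> X) (fmap F ?GFA ?GX (fmap G ?FA X g))) (fmap F A ?GFA (\<eta> A))"
      using o oo m Gm FGm by (simp add: F.functor_simps(4) F.D.Cmp_left_assoc)
    also have "Cmp D ?FGFA ?FGX X (\<epsilon> X) (fmap F ?GFA ?GX (fmap G ?FA X g)) = Cmp D ?FGFA ?FA X g (\<epsilon> ?FA)"
      using nat_transD(2)[OF \<epsilon> oo(1) o(2) g] by simp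
    also have "Cmp D ?FA ?FGFA X \<dots> (fmap F A ?GFA (\<eta> A)) = Cmp D ?FA ?FA X g (Cmp D ?FA ?FGFA ?FA (\<epsilon> ?FA) (fmap F A ?GFA (\<eta> A)))"
      using o oo m Gm g by (simp add: F.D.Cmp_left_assoc)
    finally show "Cmp D ?FA ?FGX X (\<epsilon> X) (fmap F A ?GX (Cmp C A ?GFA ?GX (fmap G ?FA X g) (\<eta> A))) = g"
      unfolding t1 using o oo g by (simp add: F.D.Cmp_Idn_right)
    fix a assume a: "a \<in> mor C A ?GX \<and> Cmp D ?FA ?FGX X (\<epsilon> X) (fmap F A ?GX a) = g"
    have Fa: "fmap F A ?GX a \<in> mor D ?FA ?FGX" "fmap G ?FA ?FGX (fmap F A ?GX a) \<in> mor C ?GFA ?GFGX"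
      using F.functor_simps(2)[OF o(1) oo(3)] G.functor_simps(2)[OF oo(1,4)] a by simp_all
    have "a = Cmp C A ?GX ?GX (Cmp C ?GX ?GFGX ?GX (fmap G ?FGX X (\<epsilon> X)) (\<eta> ?GX)) a"
      unfolding t2 using o oo a by (simp add: F.C.Cmp_Idn_left)
    also have "\<dots> = Cmp C A ?GFGX ?GX (fmap G ?FGX X (\<epsilon> X)) (Cmp C A ?GX ?GFGX (\<eta> ?GX) a)"
      using o oo a m Gm by (simp add: F.C.Cmp_left_assoc)
    also have "Cmp C A ?GX ?GFGX (\<eta> ?GX) a = Cmp C A ?GFA ?GFGX (fmap G ?FA ?FGX (fmap F A ?GX a)) (\<eta> A)"
      using nat_transD(2)[OF \<eta> o(1) oo(3), of a] a by simp
    also have "Cmp C A ?GFGX ?GX (fmap G ?FGX X (\<epsilon> X)) \<dots> = Cmp C A ?GFA ?GX (fmap G ?FA X (Cmp D ?FA ?FGX X (\<epsilon> X) (fmap F A ?GX a))) (\<eta> A)"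
      using o oo m Gm Fa by (simp add: G.functor_simps(4) F.C.Cmp_left_assoc)
    finally show "a = Cmp C A ?GFA ?GX (fmap G ?FA X g) (\<eta> A)" using a by simp
  qed
qed

lemma full_subcat_sel [simp]:
  "Obj (full_subcat C L) = L" "Hom (full_subcat C L) = Hom C" "Cmp (full_subcat C L) = Cmp C" "Idn (full_subcat C L) = Idn C"
  by (simp_all add: full_subcat_def)

lemma full_subcat_linear:
  assumes "linear_category K C" "L \<subseteq> Obj C"
  shows "linear_category K (full_subcat C L)"
proof -
  interpret C: linear_category K C by fact
  show ?thesis
    by (intro linear_category.intro linear_category_axioms.intro C.cring_axioms;
      unfold full_subcat_sel; (rule C.Hom_module C.Cmp_linear_right C.Cmp_linear_left C.Cmp_assoc C.Idn_mor C.Cmp_Idn_left C.Cmp_Idn_right;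
        use assms(2) in blast))
qed

theorem propositionA1:
  fixes K :: "'k ring"
    and S :: "('so, 'sm, 'k) tri_cat" and T :: "('to, 'tm, 'k) tri_cat"
    and Sdg :: "('sdo, 'sdm, 'k) dg_cat" and Tdg :: "('tdo, 'tdm, 'k) dg_cat"
    and ES :: "('sdo, 'sdm set, 'so, 'sm) tri_func"
    and ET :: "('tdo, 'tdm set, 'to, 'tm) tri_func"
    and s :: "('so, 'sm, 'to, 'tm) tri_func"
    and sdg :: "('sdo, 'sdm, 'tdo, 'tdm) dg_func"
    and r :: "('to, 'tm, 'so, 'sm) func"
    and \<eta> :: "'so \<Rightarrow> 'sm" and \<epsilon> :: "'to \<Rightarrow> 'tm"
    and L R :: "'so set"
    and \<tau> :: "('so, 'sm, 'so, 'sm) func"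
    and \<theta> \<kappa> :: "'so \<Rightarrow> 'sm"
  assumes "cring K"
    and "triangulated_category K S"
    and "triangulated_category K T"
    and "dg_enhancement K S Sdg ES"
    and "dg_enhancement K T Tdg ET"
    and "triangle_functor K S T s"
    and "induced_by K S T Sdg ES Tdg ET s sdg"
    and r_adjoint: "adjunction S T s r \<eta> \<epsilon>"
    and "t_structure S L R"
    and truncation: "adjunction (full_subcat S L) S idf \<tau> \<theta> \<kappa>"
  shows "(\<exists>(t :: ('to, 'tm, 'to, 'tm) tri_func) \<beta> \<gamma>.
            triangle_functor K T T t \<and>
            admits_dg_enhancement K T T Tdg ET Tdg ET t \<and>
            functorial_triangle T T (func_comp s r) idf t \<epsilon> \<beta> \<gamma>) \<and>
         (\<exists>(t0 :: ('to, 'tm, 'to, 'tm) func) \<beta> \<gamma>.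
            linear_functor K T T t0 \<and>
            functorial_triangle T T (func_comp s (func_comp \<tau> r)) idf t0
              (\<lambda>X. Cmp T (fobj s (fobj \<tau> (fobj r X))) (fobj s (fobj r X)) X
                     (\<epsilon> X) (fmap s (fobj \<tau> (fobj r X)) (fobj r X) (\<kappa> (fobj r X))))
              \<beta> \<gamma>)"
proof -
  let ?t = "\<lambda>X. fobj \<tau> (fobj r X)"
  let ?P = "\<lambda>X. fobj s (?t X)" and ?Q = "\<lambda>X. fobj s (fobj r X)"
  note ass = assms
  interpret S: triangulated_category K S by fact
  interpret T: triangulated_category K T by fact
  have eS: "enhancement K Sdg S ES" by (rule enhancementI) fact+
  have eT: "enhancement K Tdg T ET" by (rule enhancementI) fact+
  interpret ES: enhancement K Sdg S ES by (rule eS)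
  interpret ET: enhancement K Tdg T ET by (rule eT)
  have sf: "is_functor S T s" using ass(6) by (simp add: triangle_functor_def linear_functor_def)
  interpret s: functor_between K S T s by (rule functor_betweenI[OF S.linear_category_axioms T.linear_category_axioms sf])
  have dg: "dg_functor K Sdg Tdg sdg" using ass(7) by (simp add: induced_by_def)
  interpret F: dg_functor_between K Sdg Tdg sdg
    by (intro dg_functor_between.intro ES.A.dg_category_axioms ET.A.dg_category_axioms dg_functor_between_axioms.intro dg)
  obtain \<alpha> where "triangle_iso (H0 K Sdg) T (tcomp (H0 K Sdg) S T s ES) (tcomp (H0 K Sdg) (H0 K Tdg) T ET (H0func Sdg Tdg sdg)) \<alpha>"
    using ass(7) unfolding induced_by_def by blast
  then have \<alpha>: "nat_iso (H0 K Sdg) T (func_comp s ES) (func_comp ET (H0func Sdg Tdg sdg)) \<alpha>"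
    unfolding triangle_iso_def nat_iso_def nat_trans_def by simp
  have rf: "is_functor T S r" and \<epsilon>: "nat_trans T T (func_comp s r) idf \<epsilon>"
    using r_adjoint by (simp_all add: adjunction_def)
  interpret r: functor_between K T S r by (rule functor_betweenI[OF T.linear_category_axioms S.linear_category_axioms rf])
  have runi: "\<exists>!a. a \<in> mor S W (fobj r X) \<and> Cmp T (fobj s W) (?Q X) X (\<epsilon> X) (fmap s W (fobj r X) a) = g"
    if "W \<in> Obj S" "X \<in> Obj T" "g \<in> mor T (fobj s W) X" for W X g
    by (rule adjunction_universal[OF S.linear_category_axioms T.linear_category_axioms r_adjoint that])
  \<comment> \<open>The enhanced case: every object of \<open>S\<close> is a test object, and
    \<open>universal\<close> is the adjunction itself.\<close>
  interpret a: enhanced_coreflection K Sdg Tdg sdg S T ES ET s \<alpha> r \<epsilon> "Obj S"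
  proof (intro enhanced_coreflection.intro enhanced_coreflection_axioms.intro F.dg_functor_between_axioms eS eT sf \<alpha> rf \<epsilon> subset_refl)
    show "sob S X \<in> Obj S" if "X \<in> Obj S" for X
      using that functor_between.functor_simps(1)[OF linear_functor_between.axioms(1)[OF S.Sus_between]] by simp
  qed (use runi r.functor_simps(1) in auto)

  note tL = \<open>t_structure S L R\<close>[unfolded t_structure_def]
  have L: "L \<subseteq> Obj S" using tL by blast
  have lL: "linear_category K (full_subcat S L)" by (rule full_subcat_linear[OF S.linear_category_axioms L])
  have \<tau>': "is_functor S (full_subcat S L) \<tau>" and \<kappa>: "nat_trans S S (func_comp idf \<tau>) idf \<kappa>"
    using truncation by (simp_all add: adjunction_def)
  interpret \<tau>: functor_between K S "full_subcat S L" \<tau> by (rule functor_betweenI[OF S.linear_category_axioms lL \<tau>'])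
  have \<tau>L: "fobj \<tau> X \<in> L" if "X \<in> Obj S" for X using \<tau>.functor_simps(1)[OF that] by simp
  \<comment> \<open>The truncation has values in the aisle; since a full subcategory keeps its
    morphisms, it is also an endofunctor of \<open>S\<close>.\<close>
  have \<tau>f: "is_functor S S \<tau>" using \<tau>' L unfolding is_functor_def by auto
  interpret \<tau>S: functor_between K S S \<tau> by (rule functor_betweenI[OF S.linear_category_axioms S.linear_category_axioms \<tau>f])
  have \<kappa>m: "\<kappa> X \<in> mor S (fobj \<tau> X) X" if "X \<in> Obj S" for X using nat_transD(1)[OF \<kappa> that] by simp
  have \<tau>uni: "\<exists>!a. a \<in> mor S W (fobj \<tau> X) \<and> Cmp S W (fobj \<tau> X) X (\<kappa> X) a = g"
    if "W \<in> L" "X \<in> Obj S" "g \<in> mor S W X" for W X g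
    using adjunction_universal[OF lL S.linear_category_axioms truncation, of W X g] that by simp
  let ?\<rho> = "func_comp \<tau> r"
  let ?e = "\<lambda>X. Cmp T (?P X) (?Q X) X (\<epsilon> X) (fmap s (?t X) (fobj r X) (\<kappa> (fobj r X)))"
  have \<epsilon>m: "\<epsilon> X \<in> mor T (?Q X) X" if "X \<in> Obj T" for X using nat_transD(1)[OF \<epsilon> that] by simp
  have ob: "fobj r X \<in> Obj S" "fobj \<tau> (fobj r X) \<in> Obj S" "fobj s (fobj r X) \<in> Obj T" "fobj s (?t X) \<in> Obj T"
    if "X \<in> Obj T" for X
    using that r.functor_simps(1) \<tau>S.functor_simps(1) s.functor_simps(1) by simp_all
  have s\<kappa>: "fmap s (?t X) (fobj r X) (\<kappa> (fobj r X)) \<in> mor T (?P X) (?Q X)" if "X \<in> Obj T" for X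
    using s.functor_simps(2) ob[OF that] \<kappa>m by simp
  have e: "nat_trans T T (func_comp s ?\<rho>) idf ?e"
    unfolding nat_trans_def
  proof (intro conjI ballI)
    show "?e X \<in> mor T (fobj (func_comp s ?\<rho>) X) (fobj idf X)" if "X \<in> Obj T" for X
      using ob[OF that] s\<kappa>[OF that] \<epsilon>m[OF that] that by (simp add: T.Cmp_simps(1))
    fix X Y f assume X: "X \<in> Obj T" and Y: "Y \<in> Obj T" and f: "f \<in> mor T X Y"
    note oX = ob[OF X] and oY = ob[OF Y]
    let ?rf = "fmap r X Y f" and ?trf = "fmap \<tau> (fobj r X) (fobj r Y) (fmap r X Y f)"
    have rm: "?rf \<in> mor S (fobj r X) (fobj r Y)" "?trf \<in> mor S (?t X) (?t Y)"
      using r.functor_simps(2)[OF X Y f] \<tau>S.functor_simps(2)[OF oX(1) oY(1)] by simp_all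
    have sm: "fmap s (fobj r X) (fobj r Y) ?rf \<in> mor T (?Q X) (?Q Y)"
      "fmap s (?t X) (?t Y) ?trf \<in> mor T (?P X) (?P Y)"
      using s.functor_simps(2)[OF oX(1) oY(1) rm(1)] s.functor_simps(2)[OF oX(2) oY(2) rm(2)] by auto
    note ty = oX oY X Y f s\<kappa>[OF X] s\<kappa>[OF Y] \<epsilon>m[OF X] \<epsilon>m[OF Y] sm
    have "Cmp T (?P X) (?P Y) (?Q Y) (fmap s (?t Y) (fobj r Y) (\<kappa> (fobj r Y))) (fmap s (?t X) (?t Y) ?trf)
      = fmap s (?t X) (fobj r Y) (Cmp S (?t X) (?t Y) (fobj r Y) (\<kappa> (fobj r Y)) ?trf)"
      by (rule s.functor_simps(4)[OF oX(2) oY(2,1) rm(2) \<kappa>m[OF oY(1)], symmetric])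
    also have "Cmp S (?t X) (?t Y) (fobj r Y) (\<kappa> (fobj r Y)) ?trf = Cmp S (?t X) (fobj r X) (fobj r Y) ?rf (\<kappa> (fobj r X))"
      using nat_transD(2)[OF \<kappa> oX(1) oY(1) rm(1)] by simp
    also have "fmap s (?t X) (fobj r Y) \<dots>
      = Cmp T (?P X) (?Q X) (?Q Y) (fmap s (fobj r X) (fobj r Y) ?rf) (fmap s (?t X) (fobj r X) (\<kappa> (fobj r X)))"
      by (rule s.functor_simps(4)[OF oX(2,1) oY(1) \<kappa>m[OF oX(1)] rm(1)])
    finally have k: "Cmp T (?P X) (?P Y) (?Q Y) (fmap s (?t Y) (fobj r Y) (\<kappa> (fobj r Y))) (fmap s (?t X) (?t Y) ?trf)
      = Cmp T (?P X) (?Q X) (?Q Y) (fmap s (fobj r X) (fobj r Y) ?rf) (fmap s (?t X) (fobj r X) (\<kappa> (fobj r X)))" .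
    have "Cmp T (?P X) (?P Y) Y (?e Y) (fmap s (?t X) (?t Y) ?trf)
      = Cmp T (?P X) (?Q X) Y (Cmp T (?Q X) (?Q Y) Y (\<epsilon> Y) (fmap s (fobj r X) (fobj r Y) ?rf)) (fmap s (?t X) (fobj r X) (\<kappa> (fobj r X)))"
      using ty T.Cmp_prefix[OF k] by (simp add: T.Cmp_left_assoc)
    also have "Cmp T (?Q X) (?Q Y) Y (\<epsilon> Y) (fmap s (fobj r X) (fobj r Y) ?rf) = Cmp T (?Q X) X Y f (\<epsilon> X)"
      using nat_transD(2)[OF \<epsilon> X Y f] by simp
    also have "Cmp T (?P X) (?Q X) Y \<dots> (fmap s (?t X) (fobj r X) (\<kappa> (fobj r X))) = Cmp T (?P X) X Y f (?e X)"
      using ty by (simp add: T.Cmp_left_assoc)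
    finally show "Cmp T (fobj (func_comp s ?\<rho>) X) (fobj (func_comp s ?\<rho>) Y) (fobj idf Y) (?e Y) (fmap (func_comp s ?\<rho>) X Y f)
      = Cmp T (fobj (func_comp s ?\<rho>) X) (fobj idf X) (fobj idf Y) (fmap idf X Y f) (?e X)" by simp
  qed
  \<comment> \<open>Two universal properties in succession: \<open>g\<close> factors through
    \<open>b\<close> by the adjunction, and \<open>b\<close> through \<open>a\<close> by the
    truncation, which is available for sources in \<open>L\<close>. Uniqueness is traced back the
    same way.\<close>
  have uni: "\<exists>!a. a \<in> mor S W (fobj ?\<rho> X) \<and> Cmp T (fobj s W) (fobj s (fobj ?\<rho> X)) X (?e X) (fmap s W (fobj ?\<rho> X) a) = g"
    if W: "W \<in> L" and X: "X \<in> Obj T" and g: "g \<in> mor T (fobj s W) X" for W X g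
  proof -
    note o = ob[OF X]
    have W': "W \<in> Obj S" "fobj s W \<in> Obj T" using W L s.functor_simps(1) by auto
    have eq: "Cmp T (fobj s W) (?P X) X (?e X) (fmap s W (?t X) a)
        = Cmp T (fobj s W) (?Q X) X (\<epsilon> X) (fmap s W (fobj r X) (Cmp S W (?t X) (fobj r X) (\<kappa> (fobj r X)) a))"
      if a: "a \<in> mor S W (?t X)" for a
      unfolding s.functor_simps(4)[OF W'(1) o(2,1) a \<kappa>m[OF o(1)]]
      using o W' X s\<kappa>[OF X] \<epsilon>m[OF X] s.functor_simps(2)[OF W'(1) o(2) a] by (simp add: T.Cmp_left_assoc)
    have \<kappa>a: "Cmp S W (?t X) (fobj r X) (\<kappa> (fobj r X)) a \<in> mor S W (fobj r X)" if "a \<in> mor S W (?t X)" for a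
      using that o W' \<kappa>m[OF o(1)] by (simp add: S.Cmp_simps(1))
    obtain b where b: "b \<in> mor S W (fobj r X)" "Cmp T (fobj s W) (?Q X) X (\<epsilon> X) (fmap s W (fobj r X) b) = g"
      using runi[OF W'(1) X g] by blast
    obtain a where a: "a \<in> mor S W (?t X)" "Cmp S W (?t X) (fobj r X) (\<kappa> (fobj r X)) a = b"
      using \<tau>uni[OF W o(1) b(1)] by blast
    show ?thesis
    proof (rule ex1I[of _ a])
      show "a \<in> mor S W (fobj ?\<rho> X) \<and> Cmp T (fobj s W) (fobj s (fobj ?\<rho> X)) X (?e X) (fmap s W (fobj ?\<rho> X) a) = g"
        using a b eq[OF a(1)] by simp
      fix a' assume "a' \<in> mor S W (fobj ?\<rho> X) \<and> Cmp T (fobj s W) (fobj s (fobj ?\<rho> X)) X (?e X) (fmap s W (fobj ?\<rho> X) a') = g"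
      then have a': "a' \<in> mor S W (?t X)" "Cmp T (fobj s W) (?P X) X (?e X) (fmap s W (?t X) a') = g"
        by simp_all
      have "Cmp S W (?t X) (fobj r X) (\<kappa> (fobj r X)) a' = b"
        using runi[OF W'(1) X g] b \<kappa>a[OF a'(1)] a'(2) eq[OF a'(1)] by metis
      then show "a' = a" using \<tau>uni[OF W o(1) b(1)] a a'(1) by metis
    qed
  qed
  \<comment> \<open>The truncated case: a left aisle is closed under isomorphisms and suspension,
    which are the closure conditions on \<open>U\<close>.\<close>
  interpret b: enhanced_coreflection K Sdg Tdg sdg S T ES ET s \<alpha> ?\<rho> ?e L
  proof (intro enhanced_coreflection.intro enhanced_coreflection_axioms.intro F.dg_functor_between_axioms eS eT sf \<alpha> e L uni)
    show "is_functor T S ?\<rho>" by (rule is_functor_comp[OF rf \<tau>f])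
    show "Y \<in> L" if "X \<in> L" "Y \<in> Obj S" "is_iso S X Y f" for X Y f using tL that by blast
    show "sob S X \<in> L" if "X \<in> L" for X using tL that by blast
    show "fobj ?\<rho> X \<in> L" if "X \<in> Obj T" for X using \<tau>L r.functor_simps(1)[OF that] by simp
  qed
  show ?thesis
    using a.triangle_cone_functor[OF refl] b.linear_cone_functor by blast
qed

end
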